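(* Let $n\ge2$, let $I\subset\mathbb{R}$ be an interval with $|I|=1$, and let $1\le p<n$. Then the mixed norm space $\mathcal{R}(L^{p(n-1)/(n-p),p},L^\infty)$ is the smallest space of the form $\mathcal{R}(X,L^\infty)$, with $X(I^{n-1})$ an r.i. space, satisfying $$W^1L^p(I^n)\hookrightarrow\mathcal{R}(L^{p(n-1)/(n-p),p},L^\infty).$$ That is, this embedding holds, and whenever $X(I^{n-1})$ is an r.i. space with $W^1L^p(I^n)\hookrightarrow\mathcal{R}(X,L^\infty)$, one has $\mathcal{R}(L^{p(n-1)/(n-p),p},L^\infty)\hookrightarrow\mathcal{R}(X,L^\infty)$.
   Context: Rearrangements: for a measurable real function $f$ on $I^m$ ($m\ge1$, $|I|=1$), $\lambda_f(t)=|\{x:|f(x)|>t\}|$ and $f^*(t)=\inf\{s\ge 0:\lambda_f(s)\le t\}$. R.i. spaces: a Banach function norm is a map $\rho$ from non-negative measurable functions on $I^m$ to $[0,\infty]$ with: $\rho(f)=0$ iff $f=0$ a.e., $\rho(f+g)\le\rho(f)+\rho(g)$, $\rho(\alpha f)=\alpha\rho(f)$ for $\alpha\ge0$; $0\le g\le f$ a.e. implies $\rho(g)\le\rho(f)$; $0\le f_j\uparrow f$ a.e. implies $\rho(f_j)\uparrow\rho(f)$; $\rho(\chi_{I^m})<\infty$; $\int_{I^m}f\,dx\le C\rho(f)$ for a constant $C$. The space $X(I^m)=\{f \text{ measurable}:\|f\|_{X(I^m)}:=\rho(|f|)<\infty\}$ is rearrangement invariant (r.i.) if $\|f\|_{X(I^m)}=\|g\|_{X(I^m)}$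 whenever $\lambda_f=\lambda_g$. Lorentz spaces: for $p=q=1$, or $p=q=\infty$, or $1<p<\infty$ and $1\le q\le\infty$, $L^{p,q}(I^m)$ is the space of measurable $f$ with $\|f\|_{L^{p,q}(I^m)}=\|t^{1/p-1/q}f^*(t)\|_{L^q(0,1)}<\infty$. In $\mathcal{R}(L^{p(n-1)/(n-p),p},L^\infty)$ the first space is taken on $I^{n-1}$ and $L^\infty$ on $I$. Sobolev space: for an r.i. space $Z(I^n)$, $W^1Z(I^n)=\{u\in Z(I^n):|\nabla u|\in Z(I^n)\}$ ($\nabla u$ the distributional gradient, $|\cdot|$ Euclidean length), with norm $\|u\|_{W^1Z(I^n)}=\|u\|_{Z(I^n)}+\||\nabla u|\|_{Z(I^n)}$. Mixed norm spaces: for $x\in I^n$ and $k\in\{1,\dots,n\}$ let $\widehat{x}_k\in I^{n-1}$ be $x$ with its $k$th coordinate removed. For r.i. spaces $X(I^{n-1})$, $Y(I)$, let $\psi_k(f,Y)(\widehat{x}_k)=\|f(\widehat{x}_k,\cdot)\|_{Y(I)}$ (norm in the $k$th variable), $\|f\|_{\mathcal{R}_k(X,Y)}=\|\psi_k(f,Y)\|_{X(I^{n-1})}$, $\mathcal{R}_k(X,Y)=\{f:\|f\|_{\mathcal{R}_k(X,Y)}<\infty\}$, and $\mathcal{R}(X,Y)=\bigcap_{k=1}^n\mathcal{R}_k(X,Y)$ with norm $\|f\|_{\mathcal{R}(X,Y)}=\sum_{k=1}^n\|f\|_{\mathcal{R}_k(X,Y)}$. $A\hookrightarrow B$ denotes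 a continuous embedding: $A\subset B$ and $\|f\|_B\le C\|f\|_A$ for all $f\in A$. *)

theory Defs
  imports "HOL-Probability.Probability"
begin

text \<open>Conventions. Points of \<open>I\<^sup>m\<close> are functions in \<open>{..<m} \<rightarrow>\<^sub>E I\<close>, so coordinates are numbered from 0.
  Function norms act on \<open>[0,\<infinity>]\<close>-valued functions; a real function \<open>f\<close> enters through \<open>|f|\<close>.
  Functions are not identified when they agree almost everywhere.\<close>

section \<open>Cubes\<close>

text \<open>The completion makes this the Lebesgue (rather than Borel) measure space on \<open>I\<^sup>m\<close>.\<close>

definition cube :: "real set \<Rightarrow> nat \<Rightarrow> (nat \<Rightarrow> real) measure" where
  "cube I m = completion (PiM {..<m} (\<lambda>_. restrict_space lborel I))"

section \<open>Normed function spaces and embeddings\<close>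

text \<open>A function space together with its norm.\<close>

type_synonym 'a fspace = "('a \<Rightarrow> real) set \<times> (('a \<Rightarrow> real) \<Rightarrow> ennreal)"

definition embeds :: "'a fspace \<Rightarrow> 'a fspace \<Rightarrow> bool" (infix \<open>\<hookrightarrow>\<close> 50) where
  "A \<hookrightarrow> B \<longleftrightarrow> fst A \<subseteq> fst B \<and> (\<exists>C\<ge>0. \<forall>f\<in>fst A. snd B f \<le> ennreal C * snd A f)"

section \<open>Rearrangements and rearrangement invariant norms\<close>

definition distr_fun :: "'a measure \<Rightarrow> ('a \<Rightarrow> ennreal) \<Rightarrow> ennreal \<Rightarrow> ennreal" where
  "distr_fun M h t = emeasure M {x \<in> space M. h x > t}"

definition rearrangement :: "'a measure \<Rightarrow> ('a \<Rightarrow> ennreal) \<Rightarrow> real \<Rightarrow> ennreal" where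
  "rearrangement M h t = Inf {s. distr_fun M h s \<le> ennreal t}"

definition fnorm :: "(('a \<Rightarrow> ennreal) \<Rightarrow> ennreal) \<Rightarrow> ('a \<Rightarrow> real) \<Rightarrow> ennreal" where
  "fnorm \<rho> f = \<rho> (\<lambda>x. ennreal \<bar>f x\<bar>)"

definition fspace_of :: "'a measure \<Rightarrow> (('a \<Rightarrow> ennreal) \<Rightarrow> ennreal) \<Rightarrow> 'a fspace" where
  "fspace_of M \<rho> = ({f \<in> borel_measurable M. fnorm \<rho> f < \<infinity>}, fnorm \<rho>)"

definition banach_function_norm :: "'a measure \<Rightarrow> (('a \<Rightarrow> ennreal) \<Rightarrow> ennreal) \<Rightarrow> bool" where
  "banach_function_norm M \<rho> \<longleftrightarrow>
     (\<forall>f \<in> borel_measurable M. \<rho> f = 0 \<longleftrightarrow> (AE x in M. f x = 0)) \<and>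
     (\<forall>f \<in> borel_measurable M. \<forall>g \<in> borel_measurable M. \<rho> (\<lambda>x. f x + g x) \<le> \<rho> f + \<rho> g) \<and>
     (\<forall>f \<in> borel_measurable M. \<forall>\<alpha>::real. \<alpha> \<ge> 0 \<longrightarrow> \<rho> (\<lambda>x. ennreal \<alpha> * f x) = ennreal \<alpha> * \<rho> f) \<and>
     (\<forall>f \<in> borel_measurable M. \<forall>g \<in> borel_measurable M. (AE x in M. g x \<le> f x) \<longrightarrow> \<rho> g \<le> \<rho> f) \<and>
     (\<forall>F f. (\<forall>j::nat. F j \<in> borel_measurable M) \<and> f \<in> borel_measurable M \<and>
        (AE x in M. incseq (\<lambda>j. F j x) \<and> (\<lambda>j. F j x) \<longlonglongrightarrow> f x) \<longrightarrow>
        incseq (\<lambda>j. \<rho> (F j)) \<and> (\<lambda>j. \<rho> (F j)) \<longlonglongrightarrow> \<rho> f) \<and>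
     \<rho> (\<lambda>_. 1) < \<infinity> \<and>
     (\<exists>C\<ge>0. \<forall>f \<in> borel_measurable M. (\<integral>\<^sup>+x. f x \<partial>M) \<le> ennreal C * \<rho> f)"

definition ri_norm :: "'a measure \<Rightarrow> (('a \<Rightarrow> ennreal) \<Rightarrow> ennreal) \<Rightarrow> bool" where
  "ri_norm M \<rho> \<longleftrightarrow> banach_function_norm M \<rho> \<and>
     (\<forall>f \<in> borel_measurable M. \<forall>g \<in> borel_measurable M.
        distr_fun M (\<lambda>x. ennreal \<bar>f x\<bar>) = distr_fun M (\<lambda>x. ennreal \<bar>g x\<bar>) \<longrightarrow> fnorm \<rho> f = fnorm \<rho> g)"

section \<open>Lebesgue and Lorentz norms\<close>

definition epowr :: "ennreal \<Rightarrow> real \<Rightarrow> ennreal" where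
  "epowr x a = (if x = \<infinity> then \<infinity> else ennreal (enn2real x powr a))"

definition Lnorm :: "'a measure \<Rightarrow> ennreal \<Rightarrow> ('a \<Rightarrow> ennreal) \<Rightarrow> ennreal" where
  "Lnorm M q h = (if q = \<infinity> then esssup M h
     else epowr (\<integral>\<^sup>+x. epowr (h x) (enn2real q) \<partial>M) (1 / enn2real q))"

text \<open>The exponent is \<open>1/p - 1/q\<close>, with \<open>1/\<infinity> = 0\<close>.\<close>

definition lorentz_norm :: "'a measure \<Rightarrow> ennreal \<Rightarrow> ennreal \<Rightarrow> ('a \<Rightarrow> ennreal) \<Rightarrow> ennreal" where
  "lorentz_norm M p q h =
     Lnorm (lebesgue_on {0<..<1}) q
       (\<lambda>t. ennreal (t powr (enn2real (1/p) - enn2real (1/q))) * rearrangement M h t)"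

section \<open>Distributional gradient and first order Sobolev spaces\<close>

definition partial :: "nat \<Rightarrow> ((nat \<Rightarrow> real) \<Rightarrow> real) \<Rightarrow> (nat \<Rightarrow> real) \<Rightarrow> real" where
  "partial i \<phi> x = deriv (\<lambda>t. \<phi> (x(i := t))) (x i)"

text \<open>\<open>C\<^sup>\<infinity>\<close> on \<open>\<real>\<^sup>n\<close>: all iterated partial derivatives exist and are continuous. \<open>\<real>\<^sup>n\<close> is the set
  \<open>{..<n} \<rightarrow>\<^sub>E UNIV\<close>, on which the topology of pointwise convergence is the Euclidean one.\<close>

definition smooth_fun :: "nat \<Rightarrow> ((nat \<Rightarrow> real) \<Rightarrow> real) \<Rightarrow> bool" where
  "smooth_fun n \<phi> \<longleftrightarrow> (\<forall>js \<in> lists {..<n}.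
     continuous_on ({..<n} \<rightarrow>\<^sub>E UNIV) (foldr partial js \<phi>) \<and>
     (\<forall>i<n. \<forall>x \<in> {..<n} \<rightarrow>\<^sub>E UNIV.
        (\<lambda>t. foldr partial js \<phi> (x(i := t))) differentiable (at (x i))))"

text \<open>Compact subsets of the open cube are those contained in some closed subcube \<open>[a,b]\<^sup>n\<close>.\<close>

definition test_fun :: "real set \<Rightarrow> nat \<Rightarrow> ((nat \<Rightarrow> real) \<Rightarrow> real) \<Rightarrow> bool" where
  "test_fun I n \<phi> \<longleftrightarrow> smooth_fun n \<phi> \<and>
     (\<exists>a b. {a..b} \<subseteq> interior I \<and>
        (\<forall>x \<in> ({..<n} \<rightarrow>\<^sub>E UNIV) - ({..<n} \<rightarrow>\<^sub>E {a..b}). \<phi> x = 0))"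

definition locally_integrable :: "real set \<Rightarrow> nat \<Rightarrow> ((nat \<Rightarrow> real) \<Rightarrow> real) \<Rightarrow> bool" where
  "locally_integrable I n u \<longleftrightarrow> u \<in> borel_measurable (cube I n) \<and>
     (\<forall>a b. {a..b} \<subseteq> interior I \<longrightarrow> set_integrable (cube I n) ({..<n} \<rightarrow>\<^sub>E {a..b}) u)"

definition is_weak_gradient ::
  "real set \<Rightarrow> nat \<Rightarrow> ((nat \<Rightarrow> real) \<Rightarrow> real) \<Rightarrow> (nat \<Rightarrow> (nat \<Rightarrow> real) \<Rightarrow> real) \<Rightarrow> bool" where
  "is_weak_gradient I n u G \<longleftrightarrow> locally_integrable I n u \<and>
     (\<forall>i<n. locally_integrable I n (G i) \<and>
        (\<forall>\<phi>. test_fun I n \<phi> \<longrightarrow>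
           (LINT x|cube I n. u x * partial i \<phi> x) = - (LINT x|cube I n. G i x * \<phi> x)))"

text \<open>Weak gradients are unique up to null sets, so the choice does not affect norms.\<close>

definition weak_gradient ::
  "real set \<Rightarrow> nat \<Rightarrow> ((nat \<Rightarrow> real) \<Rightarrow> real) \<Rightarrow> nat \<Rightarrow> (nat \<Rightarrow> real) \<Rightarrow> real" where
  "weak_gradient I n u = (SOME G. is_weak_gradient I n u G)"

definition grad_length ::
  "real set \<Rightarrow> nat \<Rightarrow> ((nat \<Rightarrow> real) \<Rightarrow> real) \<Rightarrow> (nat \<Rightarrow> real) \<Rightarrow> real" where
  "grad_length I n u x = sqrt (\<Sum>i<n. (weak_gradient I n u i x)\<^sup>2)"

definition sobolev_W1 ::
  "real set \<Rightarrow> nat \<Rightarrow> (((nat \<Rightarrow> real) \<Rightarrow> ennreal) \<Rightarrow> ennreal) \<Rightarrow> (nat \<Rightarrow> real) fspace" where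
  "sobolev_W1 I n \<rho> =
     ({u \<in> fst (fspace_of (cube I n) \<rho>).
         (\<exists>G. is_weak_gradient I n u G) \<and> grad_length I n u \<in> fst (fspace_of (cube I n) \<rho>)},
      \<lambda>u. fnorm \<rho> u + fnorm \<rho> (grad_length I n u))"

section \<open>Mixed norm spaces\<close>

text \<open>The point \<open>x \<in> I\<^sup>n\<close> with \<open>x\<^sub>k = t\<close> from which deleting the \<open>k\<close>th coordinate leaves \<open>y \<in> I\<^bsup>n-1\<^esup>\<close>.\<close>

definition insert_coord :: "nat \<Rightarrow> nat \<Rightarrow> (nat \<Rightarrow> real) \<Rightarrow> real \<Rightarrow> nat \<Rightarrow> real" where
  "insert_coord n k y t =
     (\<lambda>i\<in>{..<n}. if i < k then y i else if i = k then t else y (i - 1))"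

definition mixed_psi ::
  "nat \<Rightarrow> ((real \<Rightarrow> ennreal) \<Rightarrow> ennreal) \<Rightarrow> nat \<Rightarrow> ((nat \<Rightarrow> real) \<Rightarrow> real) \<Rightarrow> (nat \<Rightarrow> real) \<Rightarrow> ennreal" where
  "mixed_psi n \<rho>Y k f y = fnorm \<rho>Y (\<lambda>t. f (insert_coord n k y t))"

definition mixed_space_k ::
  "real set \<Rightarrow> nat \<Rightarrow> (((nat \<Rightarrow> real) \<Rightarrow> ennreal) \<Rightarrow> ennreal) \<Rightarrow> ((real \<Rightarrow> ennreal) \<Rightarrow> ennreal) \<Rightarrow>
   nat \<Rightarrow> (nat \<Rightarrow> real) fspace" where
  "mixed_space_k I n \<rho>X \<rho>Y k =
     ({f \<in> borel_measurable (cube I n). \<rho>X (mixed_psi n \<rho>Y k f) < \<infinity>},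
      \<lambda>f. \<rho>X (mixed_psi n \<rho>Y k f))"

definition mixed_space ::
  "real set \<Rightarrow> nat \<Rightarrow> (((nat \<Rightarrow> real) \<Rightarrow> ennreal) \<Rightarrow> ennreal) \<Rightarrow> ((real \<Rightarrow> ennreal) \<Rightarrow> ennreal) \<Rightarrow>
   (nat \<Rightarrow> real) fspace" where
  "mixed_space I n \<rho>X \<rho>Y =
     (\<Inter>k<n. fst (mixed_space_k I n \<rho>X \<rho>Y k), \<lambda>f. \<Sum>k<n. snd (mixed_space_k I n \<rho>X \<rho>Y k) f)"

end

theory Submission
  imports Defs "HOL-Real_Asymp.Real_Asymp"
begin

text \<open>Let \<open>r = p(n-1)/(n-p)\<close> and \<open>e = p/r = (n-p)/(n-1)\<close>. For \<open>u\<close> on the cube, \<open>\<psi>\<^sub>k(u, L\<^sup>\<infinity>)\<close> exceeds \<open>s\<close> exactly on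
  the projection of \<open>{|u| > s}\<close> along the \<open>k\<close>th axis, up to null sets. Let \<open>\<mu>(s)\<close> be the measure of this
  level set and \<open>a(s)\<close> the sum over \<open>k\<close> of the measures of its projections.

  \<^bold>\<open>The Lorentz norm is rearrangement invariant\<close> (\<open>ri_norm_lorentz\<close>). The only difficulty is the triangle
  inequality. Since \<open>p \<le> r\<close>, the weight \<open>t\<^bsup>e-1\<^esup>\<close> is decreasing, so the \<open>p\<close>-th power of the norm is a
  mixture of the functionals \<open>\<integral>\<^sub>0\<^sup>a (f\<^sup>*)\<^sup>p\<close>. Each of these is the minimum over \<open>c\<close> of
  \<open>a c + \<integral> (f\<^sup>p - c)\<^sup>+\<close>, hence convex (\<open>truncated_integral_convex\<close>), and a convex functional that is
  homogeneous of degree \<open>p\<close> has a subadditive \<open>p\<close>-th root (\<open>lorentz_int_subadditive\<close>).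

  \<^bold>\<open>The embedding\<close> (\<open>sobolev_embedding\<close>). By the layer cake formula (\<open>lorentz_int_layer_cake\<close>) it says
  that \<open>\<integral> s\<^bsup>p-1\<^esup> a(s)\<^sup>e ds\<close> is bounded by the \<open>p\<close>-th power of the Sobolev norm. A weakly differentiable
  function is absolutely continuous on almost all lines parallel to the axes
  (\<open>weak_gradient_line_representation\<close>). On such a line it either stays above the level \<open>s\<close> or has to
  climb from \<open>s\<close> to \<open>2s\<close> before it exceeds \<open>2s\<close>; summed over all lines and directions,
  \<open>s a(2s) \<le> \<integral>\<^bsub>s < |u| \<le> 2s\<^esub> \<Sum>\<^sub>k |\<partial>\<^sub>k u| + n s \<mu>(s)\<close> (\<open>projection_level_estimate\<close>). The Loomis--Whitney
  inequality gives \<open>\<mu>(s)\<^bsup>n-1\<^esup> \<le> a(s)\<^sup>n\<close>. Bounding \<open>|\<partial>\<^sub>k u|\<close> by \<open>\<tau>\<^bsup>1-p\<^esup> |\<partial>\<^sub>k u|\<^sup>p + \<tau>\<close> with a threshold \<open>\<tau>\<close> adapted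
  to the level turns this into a recursion: \<open>s\<^sup>p a(2s)\<^sup>e\<close> is at most a multiple of the energy in the
  shell \<open>s < |u| \<le> 2s\<close> and of \<open>s\<^sup>p \<mu>(s)\<close>, plus a small multiple of \<open>s\<^sup>p a(s)\<^sup>e\<close> (\<open>proj_sum_recursion\<close>).
  Integrated against \<open>ds/s\<close>, the shells add up to the total energy and the small term is absorbed
  (\<open>proj_sum_integral\<close>).

  \<^bold>\<open>Optimality\<close> (\<open>lorentz_optimal\<close>). Let \<open>W\<^sup>1L\<^sup>p\<close> be embedded in \<open>\<R>(X, L\<^sup>\<infinity>)\<close>, and let \<open>f\<close> be a function on
  \<open>I\<^bsup>n-1\<^esup>\<close> with finite Lorentz norm. Put \<open>h(s) = f\<^sup>*(s\<^bsup>n-1\<^esup>)\<close> and consider the function of \<open>x\<close> that is the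
  logarithmic average of \<open>h\<close> at the distance of \<open>x\<close> from a corner of the cube in the maximum norm. Its
  Sobolev norm is bounded by the Lorentz norm of \<open>f\<close> (\<open>corner_fun_sobolev\<close>). Its supremum on lines is at
  least \<open>h\<close> of the corner distance in \<open>I\<^bsup>n-1\<^esup>\<close> (\<open>profile_le_mixed_psi\<close>), and the latter function is
  equimeasurable with \<open>f\<close> (\<open>distr_fun_corner\<close>). Rearrangement invariance of \<open>X\<close> therefore bounds the norm
  of \<open>f\<close> in \<open>X\<close> by its Lorentz norm (\<open>ri_norm_le_lorentz\<close>), and applying this to \<open>\<psi>\<^sub>k(u, L\<^sup>\<infinity>)\<close> gives the
  embedding of the mixed norm spaces.\<close>

section \<open>Replacing and deleting a coordinate\<close>

context prob_space begin

lemma product_sigma_finite_const: "product_sigma_finite (\<lambda>_. M)"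
  by (simp add: product_sigma_finite_def sigma_finite_measure_axioms)

lemma prob_space_PiM_const: "prob_space (PiM J (\<lambda>_. M))"
  by (simp add: prob_space_PiM prob_space_axioms)

lemma emeasure_PiM_box:
  "finite J \<Longrightarrow> (\<And>i. i \<in> J \<Longrightarrow> A i \<in> sets M) \<Longrightarrow>
     emeasure (PiM J (\<lambda>_. M)) (Pi\<^sub>E J A) = (\<Prod>i\<in>J. emeasure M (A i))"
  by (rule product_sigma_finite.emeasure_PiM[OF product_sigma_finite_const])

lemma measurable_update [measurable]:
  assumes "k \<in> J"
  shows "(\<lambda>(x, t). x(k := t)) \<in> PiM J (\<lambda>_. M) \<Otimes>\<^sub>M M \<rightarrow>\<^sub>M PiM J (\<lambda>_. M)"
  using assms by (simp add: insert_absorb measurable_fun_upd[where J="J" and i=k] split_beta')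

text \<open>Since the factor \<open>M\<close> has mass one, resampling a coordinate preserves the product measure.\<close>

lemma distr_update:
  assumes J: "finite J" "k \<in> J"
  shows "distr (PiM J (\<lambda>_. M) \<Otimes>\<^sub>M M) (PiM J (\<lambda>_. M)) (\<lambda>(x, t). x(k := t)) = PiM J (\<lambda>_. M)"
proof (rule product_sigma_finite.PiM_eqI[OF product_sigma_finite_const J(1)])
  fix A assume A: "\<And>i. i \<in> J \<Longrightarrow> A i \<in> sets M"
  interpret J: prob_space "PiM J (\<lambda>_. M)" by (rule prob_space_PiM_const)
  have "emeasure (distr (PiM J (\<lambda>_. M) \<Otimes>\<^sub>M M) (PiM J (\<lambda>_. M)) (\<lambda>(x, t). x(k := t))) (Pi\<^sub>E J A)
      = emeasure (PiM J (\<lambda>_. M) \<Otimes>\<^sub>M M) ((\<lambda>(x, t). x(k := t)) -` (Pi\<^sub>E J A) \<inter> space (PiM J (\<lambda>_. M) \<Otimes>\<^sub>M M))"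
    using J A by (intro emeasure_distr measurable_update) (auto intro!: sets_PiM_I_finite)
  also have "(\<lambda>(x, t). x(k := t)) -` (Pi\<^sub>E J A) \<inter> space (PiM J (\<lambda>_. M) \<Otimes>\<^sub>M M)
      = (Pi\<^sub>E J (A(k := space M))) \<times> A k" (is "?L = ?R")
  proof -
    have sub: "A i \<subseteq> space M" if "i \<in> J" for i using A[OF that] sets.sets_into_space by blast
    show ?thesis
    proof (intro set_eqI iffI; clarsimp simp: space_pair_measure space_PiM)
      fix x t assume "x(k := t) \<in> Pi\<^sub>E J A" "x \<in> J \<rightarrow>\<^sub>E space M" "t \<in> space M"
      then show "x \<in> Pi\<^sub>E J (A(k := space M)) \<and> t \<in> A k"
        using J(2) by (auto simp: PiE_iff split: if_splits)
    next
      fix x t assume x: "x \<in> Pi\<^sub>E J (A(k := space M))" and t: "t \<in> A k"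
      have "x(k := t) \<in> Pi\<^sub>E J A"
        using x t J(2) by (auto simp: PiE_iff extensional_def split: if_splits)
      moreover have "x i \<in> space M" if "i \<in> J" for i
        using x sub[OF that] that by (cases "i = k") (auto simp: PiE_iff dest!: bspec[of _ _ i])
      then have "x \<in> J \<rightarrow>\<^sub>E space M" using x by (simp add: PiE_iff)
      ultimately show "x(k := t) \<in> Pi\<^sub>E J A \<and> x \<in> J \<rightarrow>\<^sub>E space M \<and> t \<in> space M"
        using sub[OF J(2)] t by auto
    qed
  qed
  also have "emeasure (PiM J (\<lambda>_. M) \<Otimes>\<^sub>M M) ?R
      = emeasure (PiM J (\<lambda>_. M)) (Pi\<^sub>E J (A(k := space M))) * emeasure M (A k)"
    using J A by (intro emeasure_pair_measure_Times) (auto intro!: sets_PiM_I_finite)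
  also have "emeasure (PiM J (\<lambda>_. M)) (Pi\<^sub>E J (A(k := space M))) = (\<Prod>i\<in>J. emeasure M ((A(k := space M)) i))"
    using J A by (intro emeasure_PiM_box) auto
  also have "\<dots> = emeasure M (space M) * (\<Prod>i\<in>J - {k}. emeasure M (A i))"
    using J by (subst prod.remove[of _ k]) auto
  also have "\<dots> * emeasure M (A k) = (\<Prod>i\<in>J. emeasure M (A i))"
    using J by (subst (2) prod.remove[of _ k]) (auto simp: emeasure_space_1 mult.commute)
  finally show "emeasure (distr (PiM J (\<lambda>_. M) \<Otimes>\<^sub>M M) (PiM J (\<lambda>_. M)) (\<lambda>(x, t). x(k := t))) (Pi\<^sub>E J A)
      = (\<Prod>i\<in>J. emeasure M (A i))" .
qed simp

lemma nn_integral_update: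
  assumes J: "finite J" "k \<in> J" and [measurable]: "f \<in> borel_measurable (PiM J (\<lambda>_. M))"
  shows "(\<integral>\<^sup>+x. \<integral>\<^sup>+t. f (x(k := t)) \<partial>M \<partial>PiM J (\<lambda>_. M)) = (\<integral>\<^sup>+x. f x \<partial>PiM J (\<lambda>_. M))"
proof -
  note [measurable] = measurable_update[OF J(2)]
  have "(\<integral>\<^sup>+x. f x \<partial>PiM J (\<lambda>_. M))
      = (\<integral>\<^sup>+x. f x \<partial>distr (PiM J (\<lambda>_. M) \<Otimes>\<^sub>M M) (PiM J (\<lambda>_. M)) (\<lambda>(x, t). x(k := t)))"
    by (simp add: distr_update[OF J])
  also have "\<dots> = (\<integral>\<^sup>+z. f ((\<lambda>(x, t). x(k := t)) z) \<partial>(PiM J (\<lambda>_. M) \<Otimes>\<^sub>M M))"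
    by (subst nn_integral_distr) auto
  also have "\<dots> = (\<integral>\<^sup>+x. \<integral>\<^sup>+t. f (x(k := t)) \<partial>M \<partial>PiM J (\<lambda>_. M))"
    by (subst nn_integral_fst[symmetric]) (auto simp: split_beta')
  finally show ?thesis by simp
qed

lemma AE_update:
  assumes J: "finite J" "k \<in> J" and AE: "AE x in PiM J (\<lambda>_. M). P x"
  shows "AE x in PiM J (\<lambda>_. M). AE t in M. P (x(k := t))"
proof -
  interpret J: prob_space "PiM J (\<lambda>_. M)" by (rule prob_space_PiM_const)
  interpret JM: pair_sigma_finite "PiM J (\<lambda>_. M)" M by unfold_locales
  from AE obtain N where N: "{x \<in> space (PiM J (\<lambda>_. M)). \<not> P x} \<subseteq> N" "N \<in> null_sets (PiM J (\<lambda>_. M))"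
    by (auto elim!: AE_E simp: null_sets_def)
  have "AE x in distr (PiM J (\<lambda>_. M) \<Otimes>\<^sub>M M) (PiM J (\<lambda>_. M)) (\<lambda>(x, t). x(k := t)). x \<notin> N"
    unfolding distr_update[OF J] by (rule AE_not_in[OF N(2)])
  then have "AE z in (PiM J (\<lambda>_. M) \<Otimes>\<^sub>M M). (\<lambda>(x, t). x(k := t)) z \<notin> N"
    using N(2) by (subst (asm) AE_distr_iff[OF measurable_update[OF J(2)]]) (auto simp: null_sets_def)
  then have "AE x in PiM J (\<lambda>_. M). AE t in M. x(k := t) \<notin> N"
    by (auto dest!: JM.AE_pair)
  then show ?thesis using AE_space
  proof eventually_elim
    case (elim x)
    show ?case using elim(1) AE_space
    proof eventually_elim
      case (elim t)
      have "x(k := t) \<in> space (PiM J (\<lambda>_. M))"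
        using \<open>x \<in> space _\<close> elim J(2) by (auto simp: space_PiM PiE_iff extensional_def)
      with N(1) elim show "P (x(k := t))" by blast
    qed
  qed
qed

lemma
  fixes f :: "_ \<Rightarrow> real"
  assumes J: "finite J" "k \<in> J" and f: "integrable (PiM J (\<lambda>_. M)) f"
  shows integrable_update: "AE x in PiM J (\<lambda>_. M). integrable M (\<lambda>t. f (x(k := t)))"
    and integrable_integral_update: "integrable (PiM J (\<lambda>_. M)) (\<lambda>x. \<integral>t. f (x(k := t)) \<partial>M)"
    and integral_update: "(\<integral>x. \<integral>t. f (x(k := t)) \<partial>M \<partial>PiM J (\<lambda>_. M)) = (\<integral>x. f x \<partial>PiM J (\<lambda>_. M))"
proof -
  interpret J: prob_space "PiM J (\<lambda>_. M)" by (rule prob_space_PiM_const)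
  interpret JM: pair_sigma_finite "PiM J (\<lambda>_. M)" M by unfold_locales
  note [measurable] = measurable_update[OF J(2)]
  have [measurable]: "f \<in> borel_measurable (PiM J (\<lambda>_. M))" using f by simp
  have int: "integrable (PiM J (\<lambda>_. M) \<Otimes>\<^sub>M M) (\<lambda>z. f ((\<lambda>(x, t). x(k := t)) z))"
    using f by (subst integrable_distr_eq[symmetric, where N="PiM J (\<lambda>_. M)"]) (auto simp: distr_update[OF J])
  then have int': "integrable (PiM J (\<lambda>_. M) \<Otimes>\<^sub>M M) (case_prod (\<lambda>x t. f (x(k := t))))"
    by (simp add: split_beta')
  show "AE x in PiM J (\<lambda>_. M). integrable M (\<lambda>t. f (x(k := t)))" using JM.AE_integrable_fst[OF int'] by simp
  show "integrable (PiM J (\<lambda>_. M)) (\<lambda>x. \<integral>t. f (x(k := t)) \<partial>M)" using JM.integrable_fst[OF int'] by simp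
  have "(\<integral>x. f x \<partial>PiM J (\<lambda>_. M))
      = (\<integral>x. f x \<partial>distr (PiM J (\<lambda>_. M) \<Otimes>\<^sub>M M) (PiM J (\<lambda>_. M)) (\<lambda>(x, t). x(k := t)))"
    by (simp add: distr_update[OF J])
  also have "\<dots> = (\<integral>z. f ((\<lambda>(x, t). x(k := t)) z) \<partial>(PiM J (\<lambda>_. M) \<Otimes>\<^sub>M M))"
    by (subst integral_distr) auto
  also have "\<dots> = (\<integral>z. (case z of (x, t) \<Rightarrow> f (x(k := t))) \<partial>(PiM J (\<lambda>_. M) \<Otimes>\<^sub>M M))"
    by (simp add: split_beta')
  also have "\<dots> = (\<integral>x. \<integral>t. f (x(k := t)) \<partial>M \<partial>PiM J (\<lambda>_. M))"
    using JM.integral_fst[OF int'] by simp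
  finally show "(\<integral>x. \<integral>t. f (x(k := t)) \<partial>M \<partial>PiM J (\<lambda>_. M)) = (\<integral>x. f x \<partial>PiM J (\<lambda>_. M))" by simp
qed

end

definition delete_coord :: "nat \<Rightarrow> nat \<Rightarrow> (nat \<Rightarrow> real) \<Rightarrow> nat \<Rightarrow> real" where
  "delete_coord n k x = (\<lambda>i\<in>{..<n - 1}. if i < k then x i else x (Suc i))"

lemma insert_delete_coord:
  assumes "k < n" "x \<in> extensional {..<n}"
  shows "insert_coord n k (delete_coord n k x) t = x(k := t)"
proof
  fix i
  show "insert_coord n k (delete_coord n k x) t i = (x(k := t)) i"
  proof (cases "i < n")
    case True
    then show ?thesis using assms(1)
      by (cases i) (auto simp: insert_coord_def delete_coord_def)
  next
    case False
    then show ?thesis using assms by (auto simp: insert_coord_def extensional_def)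
  qed
qed

context
  fixes M :: "real measure" and n k :: nat
  assumes prob: "prob_space M" and k: "k < n"
begin

interpretation M: prob_space M by (rule prob)

lemma measurable_delete_coord [measurable]:
  "delete_coord n k \<in> PiM {..<n} (\<lambda>_. M) \<rightarrow>\<^sub>M PiM {..<n - 1} (\<lambda>_. M)"
  unfolding delete_coord_def using k by measurable auto

lemma measurable_insert_coord [measurable]:
  "(\<lambda>(y, t). insert_coord n k y t) \<in> PiM {..<n - 1} (\<lambda>_. M) \<Otimes>\<^sub>M M \<rightarrow>\<^sub>M PiM {..<n} (\<lambda>_. M)"
proof -
  have "(\<lambda>z. \<lambda>i\<in>{..<n}. if i < k then fst z i else if i = k then snd z else fst z (i - 1))
      \<in> PiM {..<n - 1} (\<lambda>_. M) \<Otimes>\<^sub>M M \<rightarrow>\<^sub>M PiM {..<n} (\<lambda>_. M)"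
  proof (rule measurable_restrict)
    fix i assume i: "i \<in> {..<n}"
    consider "i < k" | "i = k" | "i > k" by linarith
    then show "(\<lambda>z. if i < k then fst z i else if i = k then snd z else fst z (i - 1))
        \<in> PiM {..<n - 1} (\<lambda>_. M) \<Otimes>\<^sub>M M \<rightarrow>\<^sub>M M"
    proof cases
      case 1
      then  have i': "i \<in> {..<n - 1}" using k by auto
      have [measurable]: "(\<lambda>x. x i) \<in> PiM {..<n - 1} (\<lambda>_. M) \<rightarrow>\<^sub>M M"
        by (rule measurable_component_singleton[OF i'])
      have "(\<lambda>z. fst z i) \<in> PiM {..<n - 1} (\<lambda>_. M) \<Otimes>\<^sub>M M \<rightarrow>\<^sub>M M" by measurable
      then show ?thesis using 1 by simp
    next
      case 2 then show ?thesis by simp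
    next
      case 3
      then  have i': "i - 1 \<in> {..<n - 1}" using i by auto
      have [measurable]: "(\<lambda>x. x (i - 1)) \<in> PiM {..<n - 1} (\<lambda>_. M) \<rightarrow>\<^sub>M M"
        by (rule measurable_component_singleton[OF i'])
      have "(\<lambda>z. fst z (i - 1)) \<in> PiM {..<n - 1} (\<lambda>_. M) \<Otimes>\<^sub>M M \<rightarrow>\<^sub>M M" by measurable
      then show ?thesis using 3 by simp
    qed
  qed
  then show ?thesis by (simp add: insert_coord_def split_beta')
qed

lemma distr_delete_coord:
  "distr (PiM {..<n} (\<lambda>_. M)) (PiM {..<n - 1} (\<lambda>_. M)) (delete_coord n k) = PiM {..<n - 1} (\<lambda>_. M)"
proof (rule product_sigma_finite.PiM_eqI[OF M.product_sigma_finite_const])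
  fix A assume A: "\<And>i. i \<in> {..<n - 1} \<Longrightarrow> A i \<in> sets M"
  define B where "B = (\<lambda>i. if i < k then A i else if i = k then space M else A (i - 1))"
  have B: "B i \<in> sets M" if "i \<in> {..<n}" for i using A that k by (auto simp: B_def)
  have sub: "B i \<subseteq> space M" if "i \<in> {..<n}" for i using B[OF that] sets.sets_into_space by blast
  have "delete_coord n k -` Pi\<^sub>E {..<n - 1} A \<inter> space (PiM {..<n} (\<lambda>_. M)) = Pi\<^sub>E {..<n} B"
  proof (intro set_eqI iffI)
    fix x assume x: "x \<in> delete_coord n k -` Pi\<^sub>E {..<n - 1} A \<inter> space (PiM {..<n} (\<lambda>_. M))"
    then have *: "\<And>i. i < n - 1 \<Longrightarrow> (if i < k then x i else x (Suc i)) \<in> A i"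
      by (auto simp: delete_coord_def PiE_iff)
    have "x i \<in> B i" if "i < n" for i
    proof -
      consider "i < k" | "i = k" | "i > k" by linarith
      then show ?thesis
      proof cases
        case 1 then show ?thesis using *[of i] k by (auto simp: B_def)
      next
        case 2 then show ?thesis using x that by (auto simp: B_def space_PiM PiE_iff)
      next
        case 3
        then obtain j where j: "i = Suc j" by (cases i) auto
        then show ?thesis using *[of j] 3 that by (auto simp: B_def)
      qed
    qed
    then show "x \<in> Pi\<^sub>E {..<n} B" using x by (auto simp: space_PiM PiE_iff)
  next
    fix x assume x: "x \<in> Pi\<^sub>E {..<n} B"
    have "(if i < k then x i else x (Suc i)) \<in> A i" if "i < n - 1" for i
    proof -
      have "x i \<in> B i" "x (Suc i) \<in> B (Suc i)" using x that by (auto simp: PiE_iff)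
      then show ?thesis by (auto simp: B_def split: if_splits)
    qed
    moreover have "x \<in> space (PiM {..<n} (\<lambda>_. M))" using x sub by (fastforce simp: space_PiM PiE_iff)
    ultimately show "x \<in> delete_coord n k -` Pi\<^sub>E {..<n - 1} A \<inter> space (PiM {..<n} (\<lambda>_. M))"
      by (auto simp: delete_coord_def PiE_iff)
  qed
  then have "emeasure (distr (PiM {..<n} (\<lambda>_. M)) (PiM {..<n - 1} (\<lambda>_. M)) (delete_coord n k)) (Pi\<^sub>E {..<n - 1} A)
      = emeasure (PiM {..<n} (\<lambda>_. M)) (Pi\<^sub>E {..<n} B)"
    using A by (subst emeasure_distr) (auto intro!: sets_PiM_I_finite measurable_delete_coord[simplified])
  also have "\<dots> = (\<Prod>i\<in>{..<n}. emeasure M (B i))" using B by (intro M.emeasure_PiM_box) auto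
  also have "\<dots> = (\<Prod>i\<in>{..<n} - {k}. emeasure M (B i))"
    using k by (subst prod.remove[of _ k]) (auto simp: B_def M.emeasure_space_1)
  also have "\<dots> = (\<Prod>i\<in>{..<n - 1}. emeasure M (A i))"
    by (rule prod.reindex_bij_witness[where i="\<lambda>i. if i < k then i else Suc i" and j="\<lambda>i. if i < k then i else i - 1"])
       (use k in \<open>auto simp: B_def\<close>)
  finally show "emeasure (distr (PiM {..<n} (\<lambda>_. M)) (PiM {..<n - 1} (\<lambda>_. M)) (delete_coord n k)) (Pi\<^sub>E {..<n - 1} A)
      = (\<Prod>i\<in>{..<n - 1}. emeasure M (A i))" .
qed auto

end

section \<open>A Loomis--Whitney inequality\<close>

context prob_space begin

lemma emeasure_PiM_insert:
  assumes "finite J" "i \<notin> J" and [measurable]: "F \<in> sets (PiM (insert i J) (\<lambda>_. M))"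
  shows "emeasure (PiM (insert i J) (\<lambda>_. M)) F
    = (\<integral>\<^sup>+t. emeasure (PiM J (\<lambda>_. M)) {x \<in> space (PiM J (\<lambda>_. M)). x(i := t) \<in> F} \<partial>M)"
proof -
  interpret P: product_sigma_finite "\<lambda>_. M" by (rule product_sigma_finite_const)
  have "emeasure (PiM (insert i J) (\<lambda>_. M)) F = (\<integral>\<^sup>+x. indicator F x \<partial>PiM (insert i J) (\<lambda>_. M))" by simp
  also have "\<dots> = (\<integral>\<^sup>+t. \<integral>\<^sup>+x. indicator F (x(i := t)) \<partial>PiM J (\<lambda>_. M) \<partial>M)"
    using assms by (intro P.product_nn_integral_insert_rev) auto
  also have "\<dots> = (\<integral>\<^sup>+t. emeasure (PiM J (\<lambda>_. M)) {x \<in> space (PiM J (\<lambda>_. M)). x(i := t) \<in> F} \<partial>M)"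
  proof (rule nn_integral_cong)
    fix t assume t: "t \<in> space M"
    have [measurable]: "(\<lambda>x. x(i := t)) \<in> PiM J (\<lambda>_. M) \<rightarrow>\<^sub>M PiM (insert i J) (\<lambda>_. M)"
      using t by (intro measurable_fun_upd[where J=J]) auto
    have "(\<integral>\<^sup>+x. indicator F (x(i := t)) \<partial>PiM J (\<lambda>_. M))
        = (\<integral>\<^sup>+x. indicator {x \<in> space (PiM J (\<lambda>_. M)). x(i := t) \<in> F} x \<partial>PiM J (\<lambda>_. M))"
      by (rule nn_integral_cong) (auto simp: indicator_def)
    also have "\<dots> = emeasure (PiM J (\<lambda>_. M)) {x \<in> space (PiM J (\<lambda>_. M)). x(i := t) \<in> F}"
      by (rule nn_integral_indicator) measurable
    finally show "(\<integral>\<^sup>+x. indicator F (x(i := t)) \<partial>PiM J (\<lambda>_. M)) = \<dots>" .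
  qed
  finally show ?thesis .
qed

text \<open>The sets \<open>E j\<close> are cylinders in direction \<open>j\<close>. Slice at a new coordinate \<open>i\<close>: all slices of \<open>E i\<close> have
  the measure of \<open>E i\<close>, so a slice of \<open>F\<close> is bounded by \<open>|E i|\<close> and, by induction on the index set,
  through the slices of the other cylinders. The geometric mean of the two bounds is
  \<open>|F\<^sub>t| \<le> |E i|\<^bsup>1/N\<^esup> \<Sum>\<^sub>j |(E j)\<^sub>t|\<close> with \<open>N\<close> the old number of coordinates, and it can be integrated over
  \<open>t\<close>.\<close>

lemma loomis_whitney:
  assumes "finite J" "J \<noteq> {}" "F \<in> sets (PiM J (\<lambda>_. M))" "F \<noteq> {}"
    and "\<And>j. j \<in> J \<Longrightarrow> E j \<in> sets (PiM J (\<lambda>_. M))" "\<And>j. j \<in> J \<Longrightarrow> F \<subseteq> E j"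
    and "\<And>j x t. j \<in> J \<Longrightarrow> x \<in> space (PiM J (\<lambda>_. M)) \<Longrightarrow> t \<in> space M \<Longrightarrow> x \<in> E j \<longleftrightarrow> x(j := t) \<in> E j"
  shows "measure (PiM J (\<lambda>_. M)) F ^ (card J - 1) \<le> (\<Sum>j\<in>J. measure (PiM J (\<lambda>_. M)) (E j)) ^ card J"
  using assms
proof (induction J arbitrary: F E rule: finite_ne_induct)
  case (singleton i)
  interpret Q: prob_space "PiM {i} (\<lambda>_. M)" by (rule prob_space_PiM_const)
  have "E i = space (PiM {i} (\<lambda>_. M))"
  proof
    show "E i \<subseteq> space (PiM {i} (\<lambda>_. M))" using singleton(3) sets.sets_into_space by blast
    obtain z where z: "z \<in> E i" using singleton by blast
    then have zs: "z \<in> space (PiM {i} (\<lambda>_. M))" using singleton(3) sets.sets_into_space by blast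
    show "space (PiM {i} (\<lambda>_. M)) \<subseteq> E i"
    proof
      fix x assume x: "x \<in> space (PiM {i} (\<lambda>_. M))"
      have "x = z(i := x i)" using x zs by (auto simp: space_PiM PiE_iff extensional_def)
      moreover have "x i \<in> space M" using x by (auto simp: space_PiM PiE_iff)
      ultimately show "x \<in> E i" using singleton(5)[of i z "x i"] z zs by auto
    qed
  qed
  then show ?case by (simp add: Q.prob_space)
next
  case (insert i J)
  let ?Q = "PiM (insert i J) (\<lambda>_. M)" and ?P = "PiM J (\<lambda>_. M)"
  interpret Q: prob_space ?Q by (rule prob_space_PiM_const)
  interpret P: prob_space ?P by (rule prob_space_PiM_const)
  define N where "N = card J"
  have N: "N > 0" using insert by (auto simp: N_def card_gt_0_iff)
  define sl where "sl = (\<lambda>A t. {x \<in> space ?P. x(i := t) \<in> A})"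
  have upd: "(\<lambda>x. x(i := t)) \<in> ?P \<rightarrow>\<^sub>M ?Q" if "t \<in> space M" for t
    using that by (intro measurable_fun_upd[where J=J]) auto
  have sl_sets: "sl A t \<in> sets ?P" if "A \<in> sets ?Q" "t \<in> space M" for A t
    unfolding sl_def using upd[OF that(2)] that(1) by measurable
  have em: "emeasure ?Q A = (\<integral>\<^sup>+t. ennreal (measure ?P (sl A t)) \<partial>M)" if "A \<in> sets ?Q" for A
    using emeasure_PiM_insert[OF insert(1) insert(3) that] by (simp add: sl_def P.emeasure_eq_measure)
  obtain t0 where t0: "t0 \<in> space M" using not_empty by blast
  have Ei: "measure ?P (sl (E i) t) = measure ?Q (E i)" if "t \<in> space M" for t
  proof -
    have eq: "sl (E i) t' = sl (E i) t" if "t' \<in> space M" for t'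
    proof -
      have "x(i := t') \<in> E i \<longleftrightarrow> x(i := t) \<in> E i" if "x \<in> space ?P" for x
      proof -
        have "x(i := t') \<in> space ?Q" using measurable_space[OF upd[OF \<open>t' \<in> space M\<close>] that] .
        from insert(9)[OF insertI1 this \<open>t \<in> space M\<close>] show ?thesis by (simp only: fun_upd_upd)
      qed
      then show ?thesis by (auto simp: sl_def)
    qed
    have "emeasure ?Q (E i) = (\<integral>\<^sup>+t'. ennreal (measure ?P (sl (E i) t)) \<partial>M)"
      using em[OF insert(7)[of i]] eq by (simp cong: nn_integral_cong)
    then show ?thesis by (simp add: emeasure_space_1 Q.emeasure_eq_measure)
  qed
  define c where "c = root N (measure ?Q (E i))"
  have c: "c \<ge> 0" "c ^ N = measure ?Q (E i)" using N by (auto simp: c_def)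
  have slice: "measure ?P (sl F t) \<le> c * (\<Sum>j\<in>J. measure ?P (sl (E j) t))" if t: "t \<in> space M" for t
  proof (cases "sl F t = {}")
    case True then show ?thesis using c by (auto intro!: mult_nonneg_nonneg sum_nonneg)
  next
    case False
    have inv: "x \<in> sl (E j) t \<longleftrightarrow> x(j := s) \<in> sl (E j) t" if "j \<in> J" "x \<in> space ?P" "s \<in> space M" for j x s
    proof -
      have "x(i := t) \<in> space ?Q" using measurable_space[OF upd[OF t] that(2)] .
      note * = insert(9)[OF insertI2[OF that(1)] this that(3)]
      have "x(j := s) \<in> space ?P" using that by (auto simp: space_PiM PiE_iff extensional_def)
      moreover have "(x(i := t))(j := s) = (x(j := s))(i := t)" using that insert(3) by (auto intro: fun_upd_twist)
      ultimately show ?thesis using * that by (simp only: sl_def mem_Collect_eq)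
    qed
    have IH: "measure ?P (sl F t) ^ (N - 1) \<le> (\<Sum>j\<in>J. measure ?P (sl (E j) t)) ^ N"
      unfolding N_def
    proof (rule insert(4)[OF _ False])
      show "sl F t \<in> sets ?P" using sl_sets insert(5) t by auto
      show "sl (E j) t \<in> sets ?P" "sl F t \<subseteq> sl (E j) t" if "j \<in> J" for j
        using sl_sets insert(7)[of j] insert(8)[of j] t that by (auto simp: sl_def)
      show "x \<in> sl (E j) t \<longleftrightarrow> x(j := s) \<in> sl (E j) t" if "j \<in> J" "x \<in> space ?P" "s \<in> space M" for j x s
        using inv[OF that] .
    qed
    have "measure ?P (sl F t) \<le> measure ?P (sl (E i) t)"
      by (rule P.finite_measure_mono) (use insert(8)[of i] sl_sets insert(7)[of i] t in \<open>auto simp: sl_def\<close>)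
    also have "\<dots> = c ^ N" using Ei[OF t] c by simp
    finally have "measure ?P (sl F t) * measure ?P (sl F t) ^ (N - 1)
        \<le> c ^ N * (\<Sum>j\<in>J. measure ?P (sl (E j) t)) ^ N"
      using IH c(1) by (intro mult_mono) auto
    then have "measure ?P (sl F t) ^ N \<le> (c * (\<Sum>j\<in>J. measure ?P (sl (E j) t))) ^ N"
      using N by (cases N) (simp_all add: power_mult_distrib mult_ac)
    then show ?thesis using power_mono_iff[of "measure ?P (sl F t)" "c * (\<Sum>j\<in>J. measure ?P (sl (E j) t))" N] c(1) N
      by (simp add: sum_nonneg)
  qed
  have "ennreal (measure ?Q F) = (\<integral>\<^sup>+t. ennreal (measure ?P (sl F t)) \<partial>M)"
    using em[OF insert(5)] by (simp add: Q.emeasure_eq_measure)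
  also have "\<dots> \<le> (\<integral>\<^sup>+t. ennreal c * (\<Sum>j\<in>J. ennreal (measure ?P (sl (E j) t))) \<partial>M)"
    using slice c(1) by (intro nn_integral_mono)
      (simp add: sum_ennreal ennreal_mult[symmetric] ennreal_leI sum_nonneg)
  also have "\<dots> = ennreal c * (\<Sum>j\<in>J. \<integral>\<^sup>+t. ennreal (measure ?P (sl (E j) t)) \<partial>M)"
  proof -
    have meas: "(\<lambda>t. ennreal (measure ?P (sl (E j) t))) \<in> borel_measurable M" if "j \<in> J" for j
    proof -
      have [measurable]: "E j \<in> sets ?Q" using insert(7)[of j] that by auto
      have 1: "(\<lambda>(t, x). x(i := t)) \<in> M \<Otimes>\<^sub>M ?P \<rightarrow>\<^sub>M ?Q"
        using measurable_fun_upd[where I="insert i J" and J=J and i=i and f="snd" and N="M \<Otimes>\<^sub>M ?P" and M="\<lambda>_. M" and h=fst]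
        by (simp add: split_beta')
      have "(\<lambda>t. emeasure ?P (Pair t -` ((\<lambda>(t, x). x(i := t)) -` E j \<inter> space (M \<Otimes>\<^sub>M ?P)))) \<in> borel_measurable M"
        by (intro P.measurable_emeasure_Pair measurable_sets[OF 1]) simp
      moreover have "Pair t -` ((\<lambda>(t, x). x(i := t)) -` E j \<inter> space (M \<Otimes>\<^sub>M ?P)) = sl (E j) t" if "t \<in> space M" for t
        using that by (auto simp: sl_def space_pair_measure)
      ultimately show ?thesis by (simp add: P.emeasure_eq_measure cong: measurable_cong)
    qed
    have "(\<integral>\<^sup>+t. ennreal c * (\<Sum>j\<in>J. ennreal (measure ?P (sl (E j) t))) \<partial>M)
        = ennreal c * (\<integral>\<^sup>+t. (\<Sum>j\<in>J. ennreal (measure ?P (sl (E j) t))) \<partial>M)"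
      by (rule nn_integral_cmult) (rule borel_measurable_sum[OF meas])
    also have "(\<integral>\<^sup>+t. (\<Sum>j\<in>J. ennreal (measure ?P (sl (E j) t))) \<partial>M)
        = (\<Sum>j\<in>J. \<integral>\<^sup>+t. ennreal (measure ?P (sl (E j) t)) \<partial>M)"
      by (rule nn_integral_sum) (rule meas)
    finally show ?thesis .
  qed
  also have "\<dots> = ennreal c * (\<Sum>j\<in>J. ennreal (measure ?Q (E j)))"
    using em insert(7) by (simp add: Q.emeasure_eq_measure cong: sum.cong)
  also have "\<dots> = ennreal (c * (\<Sum>j\<in>J. measure ?Q (E j)))"
    using c by (simp add: ennreal_mult sum_nonneg)
  finally have "measure ?Q F \<le> c * (\<Sum>j\<in>J. measure ?Q (E j))"
    using c by (simp add: sum_nonneg)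
  then have "measure ?Q F ^ N \<le> (c * (\<Sum>j\<in>J. measure ?Q (E j))) ^ N"
    by (intro power_mono) auto
  also have "\<dots> = measure ?Q (E i) * (\<Sum>j\<in>J. measure ?Q (E j)) ^ N"
    by (simp add: power_mult_distrib c)
  also have "\<dots> \<le> (\<Sum>j\<in>insert i J. measure ?Q (E j)) * (\<Sum>j\<in>insert i J. measure ?Q (E j)) ^ N"
    using insert(1,3) by (intro mult_mono power_mono) (auto simp: sum_nonneg)
  finally show ?case using insert(1,3) by (simp add: N_def)
qed

end

section \<open>Variation along a line\<close>

lemma crossing_interval:
  fixes f :: "real \<Rightarrow> real"
  assumes cont: "continuous_on {a..b} f" and ab: "a \<le> b" and fa: "f a \<le> s" and fb: "S \<le> f b" and "s < S"
  obtains c d where "a \<le> c" "c \<le> d" "d \<le> b" "f c \<le> s" "S \<le> f d" "\<And>x. x \<in> {c<..<d} \<Longrightarrow> s < f x \<and> f x < S"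
proof -
  define A where "A = {x \<in> {a..b}. f x \<le> s}"
  have "closed A" unfolding A_def by (intro continuous_closed_preimage_constant continuous_on_closed_Collect_le cont) auto
  moreover have "bounded A" unfolding A_def by (rule bounded_subset[of "{a..b}"]) auto
  ultimately have "compact A" by (simp add: compact_eq_bounded_closed)
  moreover have "a \<in> A" using ab fa by (auto simp: A_def)
  ultimately obtain c where c: "c \<in> A" "\<And>x. x \<in> A \<Longrightarrow> x \<le> c" using compact_attains_sup[of A] by blast
  define B where "B = {x \<in> {c..b}. S \<le> f x}"
  have contB: "continuous_on {c..b} f" by (rule continuous_on_subset[OF cont]) (use c in \<open>auto simp: A_def\<close>)
  have "closed B" unfolding B_def by (intro continuous_on_closed_Collect_le contB) auto
  moreover have "bounded B" unfolding B_def by (rule bounded_subset[of "{c..b}"]) auto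
  ultimately have "compact B" by (simp add: compact_eq_bounded_closed)
  moreover have "b \<in> B" using c fb by (auto simp: A_def B_def)
  ultimately obtain d where d: "d \<in> B" "\<And>x. x \<in> B \<Longrightarrow> d \<le> x" using compact_attains_inf[of B] by blast
  show ?thesis
  proof (rule that[of c d])
    fix x assume x: "x \<in> {c<..<d}"
    have "x \<notin> A" using c(2)[of x] x by auto
    moreover have "x \<notin> B" using d(2)[of x] x by auto
    ultimately show "s < f x \<and> f x < S" using x c d by (auto simp: A_def B_def)
  qed (use c d in \<open>auto simp: A_def B_def\<close>)
qed

text \<open>The two points \<open>a\<close> and \<open>b\<close> come in either order; the second case is the first one reflected.\<close>

lemma crossing_interval':
  fixes f :: "real \<Rightarrow> real"
  assumes cont: "continuous_on UNIV f" and "f a \<le> s" and "S \<le> f b" and "s < S"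
  obtains c d where "min a b \<le> min c d" "max c d \<le> max a b" "f c \<le> s" "S \<le> f d"
    "\<And>x. x \<in> {min c d<..<max c d} \<Longrightarrow> s < f x \<and> f x < S"
proof (cases "a \<le> b")
  case True
  obtain c d where "a \<le> c" "c \<le> d" "d \<le> b" "f c \<le> s" "S \<le> f d" "\<And>x. x \<in> {c<..<d} \<Longrightarrow> s < f x \<and> f x < S"
    using crossing_interval[OF continuous_on_subset[OF cont] True assms(2-4)] by auto
  then show ?thesis using True by (intro that[of c d]) (auto simp: min_def max_def)
next
  case False
  have "continuous_on {- a..- b} (\<lambda>x. f (- x))"
    by (intro continuous_on_compose2[OF cont] continuous_intros) auto
  then obtain c d where cd: "- a \<le> c" "c \<le> d" "d \<le> - b" "f (- c) \<le> s" "S \<le> f (- d)"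
      "\<And>x. x \<in> {c<..<d} \<Longrightarrow> s < f (- x) \<and> f (- x) < S"
    using crossing_interval[of "- a" "- b" "\<lambda>x. f (- x)" s S] False assms(2-4) by auto
  show ?thesis
  proof (rule that[of "- c" "- d"])
    fix x assume "x \<in> {min (- c) (- d)<..<max (- c) (- d)}"
    then have "- x \<in> {c<..<d}" using cd(2) by (auto simp: min_def max_def split: if_splits)
    from cd(6)[OF this] show "s < f x \<and> f x < S" by simp
  qed (use cd False in \<open>auto simp: min_def max_def\<close>)
qed

text \<open>A function with integrable derivative that exceeds \<open>2s\<close> somewhere either stays above \<open>s\<close>
  or climbs from \<open>s\<close> to \<open>2s\<close>, which costs at least \<open>s\<close> of the integral of the derivative over the
  set where the values lie strictly between \<open>s\<close> and \<open>2s\<close>.\<close>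

lemma level_crossing_estimate:
  fixes v g :: "real \<Rightarrow> real" and I :: "real set" and m s :: real
  defines "R \<equiv> restrict_space lborel I"
  assumes I [measurable]: "I \<in> sets borel" "is_interval I" and R1: "emeasure lborel I = 1"
    and g: "integrable R g" and v [measurable]: "v \<in> borel_measurable R"
    and vg: "AE t in R. v t = m + (\<integral>x. indicator {..<t} x * g x \<partial>R)" and s: "s > 0"
    and pos: "emeasure R {t \<in> space R. \<bar>v t\<bar> > 2 * s} \<noteq> 0"
  shows "ennreal s \<le> (\<integral>\<^sup>+t. indicator {t. s < \<bar>v t\<bar> \<and> \<bar>v t\<bar> \<le> 2 * s} t * ennreal \<bar>g t\<bar> \<partial>R)
     + ennreal s * emeasure R {t \<in> space R. \<bar>v t\<bar> > s}"
proof -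
  have spR: "space R = I" by (simp add: R_def space_restrict_space)
  have [measurable]: "g \<in> borel_measurable R" using g by simp
  have [measurable_cong]: "sets R = sets (restrict_space borel I)"
    by (simp add: R_def sets_restrict_space)
  have meas[measurable]: "A \<inter> I \<in> sets R" if "A \<in> sets borel" for A
    using that by (auto simp: R_def sets_restrict_space_iff)
  have [measurable]: "(indicator {..<t} :: real \<Rightarrow> real) \<in> borel_measurable R" for t
    unfolding R_def by (intro measurable_restrict_space1) auto
  have prob: "prob_space R"
    by (rule prob_spaceI) (simp add: R_def space_restrict_space emeasure_restrict_space R1)
  interpret R: prob_space R by (rule prob)
  define W where "W = (\<lambda>t. m + (\<integral>x. indicator {..<t} x * g x \<partial>R))"
  have int: "integrable R (\<lambda>x. indicator {..<t} x * g x)" for t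
  proof (rule Bochner_Integration.integrable_bound[OF g])
    show "(\<lambda>x. indicator {..<t} x * g x) \<in> borel_measurable R" by measurable
  qed (auto simp: indicator_def)
  have contW: "continuous_on UNIV W"
    unfolding continuous_on_eq_continuous_at[OF open_UNIV] continuous_at_sequentially o_def
  proof (intro ballI allI impI)
    fix t :: real and X :: "nat \<Rightarrow> real" assume X: "X \<longlonglongrightarrow> t"
    have ae: "AE x in R. x \<noteq> t"
    proof -
      have "AE x in lborel. x \<noteq> t" by (rule AE_lborel_singleton)
      then show ?thesis unfolding R_def by (subst AE_restrict_space_iff) auto
    qed
    have "(\<lambda>i. \<integral>x. indicator {..<X i} x * g x \<partial>R) \<longlonglongrightarrow> (\<integral>x. indicator {..<t} x * g x \<partial>R)"
    proof (rule integral_dominated_convergence[where w="\<lambda>x. \<bar>g x\<bar>"])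
      show "AE x in R. (\<lambda>i. indicator {..<X i} x * g x) \<longlonglongrightarrow> indicator {..<t} x * g x"
        using ae
      proof eventually_elim
        case (elim x)
        have "\<forall>\<^sub>F i in sequentially. indicator {..<X i} x = (indicator {..<t} x :: real)"
        proof (cases "x < t")
          case True
          then show ?thesis using order_tendstoD(1)[OF X True] by (auto elim: eventually_mono)
        next
          case False
          then have "t < x" using elim by auto
          then show ?thesis using order_tendstoD(2)[OF X \<open>t < x\<close>] False
            by (auto elim!: eventually_mono simp: indicator_def)
        qed
        then show ?case by (intro tendsto_mult tendsto_eventually) (auto)
      qed
      show "(\<lambda>x. indicator {..<t} x * g x) \<in> borel_measurable R"
        "(\<lambda>x. indicator {..<X i} x * g x) \<in> borel_measurable R" for i by measurable
      show "integrable R (\<lambda>x. \<bar>g x\<bar>)" using g by simp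
    qed (auto simp: indicator_def)
    then show "(\<lambda>n. W (X n)) \<longlonglongrightarrow> W t" unfolding W_def by (intro tendsto_add) auto
  qed
  have [measurable]: "W \<in> borel_measurable borel" using contW by (rule borel_measurable_continuous_onI)
  have [measurable]: "W \<in> borel_measurable R" unfolding R_def by (intro measurable_restrict_space1) auto
  have vW: "AE t in R. v t = W t" using vg by (simp add: W_def)
  have "emeasure R {t \<in> space R. \<bar>W t\<bar> > 2 * s} \<noteq> 0"
  proof -
    have "emeasure R {t \<in> space R. \<bar>W t\<bar> > 2 * s} = emeasure R {t \<in> space R. \<bar>v t\<bar> > 2 * s}"
      by (rule emeasure_eq_AE) (use vW in auto)
    then show ?thesis using pos by simp
  qed
  then obtain t1 where t1: "t1 \<in> I" "\<bar>W t1\<bar> > 2 * s"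
    using spR by (metis (mono_tags, lifting) Collect_empty_eq emeasure_empty)
  \<comment> \<open>If \<open>|W|\<close> stays above \<open>s\<close>, the last term of the bound alone is \<open>s\<close>, as \<open>I\<close> has length one.\<close>
  show ?thesis
  proof (cases "\<exists>t0\<in>I. \<bar>W t0\<bar> \<le> s")
    case False
    have "AE t in R. \<bar>v t\<bar> > s"
      using vW AE_space by eventually_elim (use False in \<open>auto simp: spR not_le\<close>)
    then have "emeasure R {t \<in> space R. \<bar>v t\<bar> > s} = 1"
      by (subst R.emeasure_eq_1_AE) auto
    then show ?thesis by simp
  next
    case True
    then obtain t0 where t0: "t0 \<in> I" "\<bar>W t0\<bar> \<le> s" by auto
    have "continuous_on UNIV (\<lambda>t. \<bar>W t\<bar>)" using contW by (intro continuous_intros)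
    then obtain c d where cd: "min t0 t1 \<le> min c d" "max c d \<le> max t0 t1" "\<bar>W c\<bar> \<le> s" "2 * s \<le> \<bar>W d\<bar>"
      "\<And>x. x \<in> {min c d<..<max c d} \<Longrightarrow> s < \<bar>W x\<bar> \<and> \<bar>W x\<bar> < 2 * s"
      using crossing_interval'[of "\<lambda>t. \<bar>W t\<bar>" t0 s "2 * s" t1] t0 t1 s by auto
    have mono: "W y - W x = (\<integral>z. indicator {x..<y} z * g z \<partial>R)" if "x \<le> y" for x y
    proof -
      have "W y - W x = (\<integral>z. indicator {..<y} z * g z - indicator {..<x} z * g z \<partial>R)"
        unfolding W_def using int by simp
      also have "\<dots> = (\<integral>z. indicator {x..<y} z * g z \<partial>R)"
        by (rule Bochner_Integration.integral_cong) (use that in \<open>auto simp: indicator_def\<close>)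
      finally show ?thesis .
    qed
    define x y where "x = min c d" and "y = max c d"
    have xy: "x \<le> y" by (simp add: x_def y_def)
    have [measurable]: "(indicator {x..<y} :: real \<Rightarrow> real) \<in> borel_measurable R"
      unfolding R_def by (intro measurable_restrict_space1) auto
    have "s \<le> \<bar>W d\<bar> - \<bar>W c\<bar>" using cd by linarith
    also have "\<dots> \<le> \<bar>W y - W x\<bar>" unfolding x_def y_def by (auto simp: min_def max_def)
    also have "\<dots> = \<bar>\<integral>z. indicator {x..<y} z * g z \<partial>R\<bar>" using mono[OF xy] by simp
    also have "\<dots> \<le> (\<integral>z. \<bar>indicator {x..<y} z * g z\<bar> \<partial>R)" by (rule integral_abs_bound)
    finally have "ennreal s \<le> ennreal (\<integral>z. \<bar>indicator {x..<y} z * g z\<bar> \<partial>R)" by (rule ennreal_leI)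
    also have "\<dots> = (\<integral>\<^sup>+z. ennreal \<bar>indicator {x..<y} z * g z\<bar> \<partial>R)"
    proof (rule nn_integral_eq_integral[symmetric], rule integrable_abs, rule Bochner_Integration.integrable_bound[OF g])
      show "(\<lambda>z. indicator {x..<y} z * g z) \<in> borel_measurable R" by measurable
    qed (auto simp: indicator_def)
    also have "\<dots> \<le> (\<integral>\<^sup>+t. indicator {t. s < \<bar>v t\<bar> \<and> \<bar>v t\<bar> \<le> 2 * s} t * ennreal \<bar>g t\<bar> \<partial>R)"
    proof (rule nn_integral_mono_AE)
      have ae: "AE z in R. z \<noteq> x"
      proof -
        have "AE z in lborel. z \<noteq> x" by (rule AE_lborel_singleton)
        then show ?thesis unfolding R_def by (subst AE_restrict_space_iff) auto
      qed
      show "AE z in R. ennreal \<bar>indicator {x..<y} z * g z\<bar> \<le> indicator {t. s < \<bar>v t\<bar> \<and> \<bar>v t\<bar> \<le> 2 * s} z * ennreal \<bar>g z\<bar>"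
        using ae vW
      proof eventually_elim
        case (elim z)
        show ?case
        proof (cases "z \<in> {x..<y}")
          case True
          then have "z \<in> {min c d<..<max c d}" using elim by (auto simp: x_def y_def)
          then have "s < \<bar>W z\<bar> \<and> \<bar>W z\<bar> < 2 * s" by (rule cd(5))
          then show ?thesis using elim by (auto simp: indicator_def)
        qed simp
      qed
    qed
    finally show ?thesis by (rule order_trans) simp
  qed
qed

section \<open>Smooth functions of one variable\<close>

primrec smooth_upto :: "nat \<Rightarrow> (real \<Rightarrow> real) \<Rightarrow> bool" where
  "smooth_upto 0 f \<longleftrightarrow> True"
| "smooth_upto (Suc n) f \<longleftrightarrow> (\<exists>f'. (\<forall>t. (f has_real_derivative f' t) (at t)) \<and> smooth_upto n f')"

text \<open>Differentiability to all orders, in a form whose closure properties are proved by induction on the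
  order. It is the one-dimensional ingredient for product test functions.\<close>

definition smooth_real :: "(real \<Rightarrow> real) \<Rightarrow> bool" where
  "smooth_real f \<longleftrightarrow> (\<forall>n. smooth_upto n f)"

lemma smooth_upto_lower: "smooth_upto (Suc n) f \<Longrightarrow> smooth_upto n f"
proof (induction n arbitrary: f)
  case (Suc n)
  then show ?case by (metis smooth_upto.simps(2))
qed simp

lemma smooth_upto_const: "smooth_upto n (\<lambda>t. c)"
  by (induction n arbitrary: c) (auto intro!: exI[of _ "\<lambda>t. 0"] derivative_eq_intros)

lemma smooth_upto_add: "smooth_upto n f \<Longrightarrow> smooth_upto n g \<Longrightarrow> smooth_upto n (\<lambda>t. f t + g t)"
proof (induction n arbitrary: f g)
  case (Suc n)
  from Suc.prems obtain f' g' where "\<forall>t. (f has_real_derivative f' t) (at t)" "smooth_upto n f'"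
    "\<forall>t. (g has_real_derivative g' t) (at t)" "smooth_upto n g'" by auto
  then show ?case using Suc.IH[of f' g']
    by (auto intro!: exI[of _ "\<lambda>t. f' t + g' t"] derivative_intros)
qed simp

lemma smooth_upto_mult: "smooth_upto n f \<Longrightarrow> smooth_upto n g \<Longrightarrow> smooth_upto n (\<lambda>t. f t * g t)"
proof (induction n arbitrary: f g)
  case (Suc n)
  from Suc.prems obtain f' g' where *: "\<forall>t. (f has_real_derivative f' t) (at t)" "smooth_upto n f'"
    "\<forall>t. (g has_real_derivative g' t) (at t)" "smooth_upto n g'" by auto
  have "smooth_upto n (\<lambda>t. f' t * g t + f t * g' t)"
    by (intro smooth_upto_add Suc.IH *(2,4) smooth_upto_lower[OF Suc.prems(1)] smooth_upto_lower[OF Suc.prems(2)])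
  moreover have "((\<lambda>t. f t * g t) has_real_derivative f' t * g t + f t * g' t) (at t)" for t
    using * by (auto intro!: derivative_eq_intros)
  ultimately show ?case unfolding smooth_upto.simps by (intro exI[of _ "\<lambda>t. f' t * g t + f t * g' t"]) blast
qed simp

lemma smooth_upto_affine: "smooth_upto n f \<Longrightarrow> smooth_upto n (\<lambda>t. f (c * t + d))"
proof (induction n arbitrary: f)
  case (Suc n)
  from Suc.prems obtain f' where *: "\<And>t. (f has_real_derivative f' t) (at t)" "smooth_upto n f'" by auto
  have "smooth_upto n (\<lambda>t. f' (c * t + d) * c)"
    by (rule smooth_upto_mult[OF Suc.IH[OF *(2)] smooth_upto_const])
  moreover have "((\<lambda>t. f (c * t + d)) has_real_derivative f' (c * t + d) * c) (at t)" for t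
    by (rule DERIV_chain2[OF *(1)]) (auto intro!: derivative_eq_intros)
  ultimately show ?case unfolding smooth_upto.simps by (intro exI[of _ "\<lambda>t. f' (c * t + d) * c"]) blast
qed simp

lemma smooth_upto_exp: "smooth_upto n f \<Longrightarrow> smooth_upto n (\<lambda>t. exp (f t))"
proof (induction n arbitrary: f)
  case (Suc n)
  from Suc.prems obtain f' where *: "\<And>t. (f has_real_derivative f' t) (at t)" "smooth_upto n f'" by auto
  have "smooth_upto n (\<lambda>t. exp (f t) * f' t)"
    by (rule smooth_upto_mult[OF Suc.IH[OF smooth_upto_lower[OF Suc.prems]] *(2)])
  moreover have "((\<lambda>t. exp (f t)) has_real_derivative exp (f t) * f' t) (at t)" for t
    by (rule DERIV_chain2[OF DERIV_exp *(1)])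
  ultimately show ?case unfolding smooth_upto.simps by (intro exI[of _ "\<lambda>t. exp (f t) * f' t"]) blast
qed simp

lemma smooth_real_const: "smooth_real (\<lambda>t. c)"
  and smooth_real_add: "smooth_real f \<Longrightarrow> smooth_real g \<Longrightarrow> smooth_real (\<lambda>t. f t + g t)"
  and smooth_real_mult: "smooth_real f \<Longrightarrow> smooth_real g \<Longrightarrow> smooth_real (\<lambda>t. f t * g t)"
  and smooth_real_affine: "smooth_real f \<Longrightarrow> smooth_real (\<lambda>t. f (c * t + d))"
  and smooth_real_exp: "smooth_real f \<Longrightarrow> smooth_real (\<lambda>t. exp (f t))"
  by (simp_all add: smooth_real_def smooth_upto_const smooth_upto_add smooth_upto_mult smooth_upto_affine smooth_upto_exp)

lemma smooth_real_deriv: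
  assumes "smooth_real f"
  shows "(f has_real_derivative deriv f t) (at t)" "smooth_real (deriv f)"
proof -
  have ex: "\<exists>f'. (\<forall>t. (f has_real_derivative f' t) (at t)) \<and> smooth_upto n f'" for n
    using assms unfolding smooth_real_def by (metis smooth_upto.simps(2))
  then show "(f has_real_derivative deriv f t) (at t)" using DERIV_imp_deriv by metis
  have "smooth_upto n (deriv f)" for n
  proof -
    obtain f' where f': "\<forall>t. (f has_real_derivative f' t) (at t)" "smooth_upto n f'" using ex by blast
    then have "deriv f = f'" by (auto intro!: ext DERIV_imp_deriv)
    with f' show ?thesis by simp
  qed
  then show "smooth_real (deriv f)" by (simp add: smooth_real_def)
qed

lemma smooth_real_antiderivative:
  assumes "\<And>t. (F has_real_derivative f t) (at t)" "smooth_real f"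
  shows "smooth_real F"
  unfolding smooth_real_def
proof
  fix n show "smooth_upto n F" using assms by (cases n) (auto simp: smooth_real_def)
qed

lemma continuous_smooth_real: "smooth_real f \<Longrightarrow> continuous_on A f"
  using smooth_real_deriv(1) by (meson DERIV_isCont continuous_at_imp_continuous_on)

definition flat_exp :: "real poly \<Rightarrow> real \<Rightarrow> real" where
  "flat_exp p t = (if t > 0 then poly p (1 / t) * exp (- (1 / t)) else 0)"

lemma tendsto_poly_exp_minus: "((\<lambda>y. poly p y * exp (- y :: real)) \<longlongrightarrow> 0) at_top"
proof -
  have "((\<lambda>y. \<Sum>i\<le>degree p. coeff p i * (y ^ i / exp y)) \<longlongrightarrow> (\<Sum>i\<le>degree p. coeff p i * 0)) at_top"
    by (intro tendsto_intros tendsto_power_div_exp_0)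
  moreover have "(\<lambda>y. \<Sum>i\<le>degree p. coeff p i * (y ^ i / exp y)) = (\<lambda>y. poly p y * exp (- y))"
    by (auto simp: poly_altdef sum_distrib_right exp_minus divide_inverse mult.assoc)
  ultimately show ?thesis by simp
qed

text \<open>The functions \<open>p(1/t) exp(-1/t)\<close>, continued by zero to \<open>t \<le> 0\<close>, form a class closed under
  differentiation.\<close>

lemma flat_exp_has_derivative:
  "(flat_exp p has_real_derivative flat_exp ([:0, 0, 1:] * (p - pderiv p)) t) (at t)"
proof -
  consider "t > 0" | "t < 0" | "t = 0" by linarith
  then show ?thesis
  proof cases
    case 1
    have "((\<lambda>t. poly p (1 / t) * exp (- (1 / t))) has_real_derivative
        poly (pderiv p) (1 / t) * (- 1 / t\<^sup>2) * exp (- (1 / t)) + poly p (1 / t) * (exp (- (1 / t)) * (1 / t\<^sup>2))) (at t)"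
      using 1 by (auto intro!: derivative_eq_intros DERIV_chain2[OF poly_DERIV] simp: power2_eq_square)
    moreover have "\<forall>\<^sub>F s in nhds t. poly p (1 / s) * exp (- (1 / s)) = flat_exp p s"
      using eventually_nhds_in_open[of "{0<..}" t] 1 by (auto elim!: eventually_mono simp: flat_exp_def)
    ultimately show ?thesis
      using 1 by (subst DERIV_cong_ev[OF refl _ refl, symmetric])
        (auto simp: flat_exp_def field_simps power2_eq_square)
  next
    case 2
    have "\<forall>\<^sub>F s in nhds t. 0 = flat_exp p s"
      using eventually_nhds_in_open[of "{..<0}" t] 2 by (auto elim!: eventually_mono simp: flat_exp_def)
    then have "(flat_exp p has_real_derivative 0) (at t)"
      by (rule DERIV_cong_ev[OF refl _ refl, THEN iffD1]) auto
    then show ?thesis using 2 by (simp add: flat_exp_def)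
  next
    case 3
    have "((\<lambda>h. poly (pCons 0 p) (1 / h) * exp (- (1 / h))) \<longlongrightarrow> 0) (at_right 0)"
      by (rule filterlim_compose[OF tendsto_poly_exp_minus])
         (use filterlim_inverse_at_top_right in \<open>simp add: inverse_eq_divide\<close>)
    then have r: "((\<lambda>h. flat_exp p h / h) \<longlongrightarrow> 0) (at_right 0)"
      by (rule Lim_transform_eventually)
         (auto simp: flat_exp_def eventually_at_right_less eventually_at_filter)
    have l: "((\<lambda>h. flat_exp p h / h) \<longlongrightarrow> 0) (at_left 0)"
      by (rule Lim_transform_eventually[OF tendsto_const]) (auto simp: flat_exp_def eventually_at_filter)
    have "((\<lambda>h. flat_exp p h / h) \<longlongrightarrow> 0) (at 0)"
      using l r by (simp add: filterlim_split_at)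
    then show ?thesis using 3 by (simp add: DERIV_def flat_exp_def)
  qed
qed

lemma smooth_flat_exp: "smooth_real (flat_exp p)"
proof -
  have "smooth_upto n (flat_exp p)" for n
    by (induction n arbitrary: p) (auto intro: flat_exp_has_derivative)
  then show ?thesis by (simp add: smooth_real_def)
qed

definition bump :: "real \<Rightarrow> real \<Rightarrow> real \<Rightarrow> real" where
  "bump a b t = flat_exp 1 (t - a) * flat_exp 1 (b - t)"

lemma bump_nonneg: "0 \<le> bump a b t"
  and bump_pos: "a < t \<Longrightarrow> t < b \<Longrightarrow> 0 < bump a b t"
  and bump_zero: "t \<notin> {a<..<b} \<Longrightarrow> bump a b t = 0"
  by (auto simp: bump_def flat_exp_def)

lemma smooth_bump: "smooth_real (bump a b)"
proof -
  have "smooth_real (\<lambda>t. flat_exp 1 (1 * t + - a) * flat_exp 1 (- 1 * t + b))"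
    by (intro smooth_real_mult smooth_real_affine smooth_flat_exp)
  moreover have "(\<lambda>t. flat_exp 1 (1 * t + - a) * flat_exp 1 (- 1 * t + b)) = bump a b"
    by (auto simp: bump_def algebra_simps)
  ultimately show ?thesis by simp
qed

text \<open>Products of these functions stay in \<open>[0,1]\<close> and tend to indicators of boxes, so that integrals
  against smooth compactly supported products determine integrals over boxes.\<close>

definition plateau :: "real \<Rightarrow> real \<Rightarrow> nat \<Rightarrow> real \<Rightarrow> real" where
  "plateau a b k t = 1 - exp (- real k * bump a b t)"

lemma smooth_plateau: "smooth_real (plateau a b k)"
proof -
  have "smooth_real (\<lambda>t. 1 + (- 1) * exp ((- real k) * bump a b t))"
    by (intro smooth_real_add smooth_real_mult smooth_real_exp smooth_real_const smooth_bump)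
  moreover have "(\<lambda>t. 1 + (- 1) * exp ((- real k) * bump a b t)) = plateau a b k"
    by (auto simp: plateau_def)
  ultimately show ?thesis by simp
qed

lemma plateau_bounds: "0 \<le> plateau a b k t" "plateau a b k t \<le> 1"
  using bump_nonneg[of a b t] by (auto simp: plateau_def)

lemma plateau_zero: "t \<notin> {a<..<b} \<Longrightarrow> plateau a b k t = 0"
  by (simp add: plateau_def bump_zero)

lemma plateau_tendsto: "(\<lambda>k. plateau a b k t) \<longlonglongrightarrow> indicator {a<..<b} t"
proof (cases "t \<in> {a<..<b}")
  case True
  then have pos: "bump a b t > 0" using bump_pos by auto
  have "filterlim (\<lambda>k. real k * bump a b t) at_top sequentially"
    using pos by (intro filterlim_at_top_mult_tendsto_pos[OF tendsto_const]) (auto simp: filterlim_real_sequentially mult.commute)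
  then have "filterlim (\<lambda>k. - (real k * bump a b t)) at_bot sequentially"
    by (simp add: filterlim_uminus_at_bot)
  then have "(\<lambda>k. exp (- (real k * bump a b t))) \<longlonglongrightarrow> 0"
    by (rule filterlim_compose[OF exp_at_bot])
  then have "(\<lambda>k. 1 - exp (- (real k * bump a b t))) \<longlonglongrightarrow> 1 - 0" by (intro tendsto_intros)
  then show ?thesis using True by (simp add: plateau_def)
qed (simp add: plateau_zero)

section \<open>Products of functions of one variable\<close>

text \<open>Test functions of product form suffice throughout: their limits include the indicators of
  boxes, and differentiating them in one variable only affects one factor.\<close>

definition tensor :: "nat \<Rightarrow> (nat \<Rightarrow> real \<Rightarrow> real) \<Rightarrow> (nat \<Rightarrow> real) \<Rightarrow> real" where
  "tensor n \<alpha> x = (\<Prod>i<n. \<alpha> i (x i))"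

lemma tensor_upd:
  assumes "k < n"
  shows "tensor n (\<alpha>(k := \<gamma>)) (x(k := t)) = \<gamma> t * (\<Prod>i\<in>{..<n} - {k}. \<alpha> i (x i))"
  using assms by (simp add: tensor_def prod.remove[of "{..<n}" k])

lemma tensor_split:
  assumes "k < n"
  shows "tensor n \<alpha> x = \<alpha> k (x k) * (\<Prod>i\<in>{..<n} - {k}. \<alpha> i (x i))"
  using assms by (simp add: tensor_def prod.remove[of "{..<n}" k])

lemma
  assumes "k < n" "smooth_real (\<alpha> k)"
  shows tensor_has_partial: "((\<lambda>t. tensor n \<alpha> (x(k := t))) has_real_derivative
      deriv (\<alpha> k) t * (\<Prod>i\<in>{..<n} - {k}. \<alpha> i (x i))) (at t)"
    and partial_tensor: "partial k (tensor n \<alpha>) = tensor n (\<alpha>(k := deriv (\<alpha> k)))"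
proof -
  show *: "((\<lambda>t. tensor n \<alpha> (x(k := t))) has_real_derivative
      deriv (\<alpha> k) t * (\<Prod>i\<in>{..<n} - {k}. \<alpha> i (x i))) (at t)" for x t
  proof -
    have "(\<lambda>t. tensor n \<alpha> (x(k := t))) = (\<lambda>t. \<alpha> k t * (\<Prod>i\<in>{..<n} - {k}. \<alpha> i (x i)))"
      using tensor_upd[OF assms(1), of \<alpha> "\<alpha> k"] by simp
    then show ?thesis using smooth_real_deriv(1)[OF assms(2)] by (auto intro!: derivative_eq_intros)
  qed
  show "partial k (tensor n \<alpha>) = tensor n (\<alpha>(k := deriv (\<alpha> k)))"
  proof
    fix x show "partial k (tensor n \<alpha>) x = tensor n (\<alpha>(k := deriv (\<alpha> k))) x"
      using tensor_upd[OF assms(1), of \<alpha> "deriv (\<alpha> k)" x "x k"]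
      unfolding partial_def by (simp add: DERIV_imp_deriv[OF *])
  qed
qed

lemma smooth_fun_tensor:
  assumes "\<And>i. i < n \<Longrightarrow> smooth_real (\<alpha> i)"
  shows "smooth_fun n (tensor n \<alpha>)"
proof -
  have ex: "\<exists>\<beta>. (\<forall>i<n. smooth_real (\<beta> i)) \<and> foldr partial js (tensor n \<alpha>) = tensor n \<beta>"
    if "js \<in> lists {..<n}" for js
    using that
  proof (induction js)
    case Nil then show ?case using assms by auto
  next
    case (Cons k js)
    then obtain \<beta> where \<beta>: "\<And>i. i < n \<Longrightarrow> smooth_real (\<beta> i)" "foldr partial js (tensor n \<alpha>) = tensor n \<beta>" by auto
    have k: "k < n" using Cons by auto
    show ?case
      by (rule exI[of _ "\<beta>(k := deriv (\<beta> k))"])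
        (use \<beta> k smooth_real_deriv(2) in \<open>auto simp: partial_tensor fun_upd_def\<close>)
  qed
  show ?thesis unfolding smooth_fun_def
  proof (intro ballI conjI allI impI)
    fix js assume "js \<in> lists {..<n}"
    then obtain \<beta> where \<beta>: "\<And>i. i < n \<Longrightarrow> smooth_real (\<beta> i)" "foldr partial js (tensor n \<alpha>) = tensor n \<beta>"
      using ex by blast
    show "continuous_on ({..<n} \<rightarrow>\<^sub>E UNIV) (foldr partial js (tensor n \<alpha>))"
      unfolding \<beta>(2) tensor_def
      by (intro continuous_on_prod continuous_on_compose2[OF continuous_smooth_real[OF \<beta>(1), of _ UNIV]]
          continuous_on_subset[OF continuous_on_product_coordinates]) auto
    fix i x assume "i < n"
    then show "(\<lambda>t. foldr partial js (tensor n \<alpha>) (x(i := t))) differentiable (at (x i))"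
      using tensor_has_partial[of i n \<beta> x "x i"] \<beta> unfolding \<beta>(2)
      by (auto simp: real_differentiable_def)
  qed
qed

definition compactly_supported :: "real set \<Rightarrow> nat \<Rightarrow> (nat \<Rightarrow> real \<Rightarrow> real) \<Rightarrow> bool" where
  "compactly_supported I n \<alpha> \<longleftrightarrow> (\<exists>a b. {a..b} \<subseteq> interior I \<and> (\<forall>i<n. \<forall>t. t \<notin> {a..b} \<longrightarrow> \<alpha> i t = 0))"

lemma test_fun_tensor:
  assumes "\<And>i. i < n \<Longrightarrow> smooth_real (\<alpha> i)" "compactly_supported I n \<alpha>"
  shows "test_fun I n (tensor n \<alpha>)"
proof -
  obtain a b where ab: "{a..b} \<subseteq> interior I" "\<And>i t. i < n \<Longrightarrow> t \<notin> {a..b} \<Longrightarrow> \<alpha> i t = 0"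
    using assms(2) by (auto simp: compactly_supported_def)
  have "tensor n \<alpha> x = 0" if "x \<in> ({..<n} \<rightarrow>\<^sub>E UNIV) - ({..<n} \<rightarrow>\<^sub>E {a..b})" for x
  proof -
    have "\<exists>i<n. x i \<notin> {a..b}" using that by (force simp: PiE_iff)
    then obtain i where "i < n" "x i \<notin> {a..b}" by blast
    then have "i < n" "\<alpha> i (x i) = 0" using ab(2) by auto
    then show ?thesis unfolding tensor_def by (intro prod_zero) auto
  qed
  then have "\<forall>x \<in> ({..<n} \<rightarrow>\<^sub>E UNIV) - ({..<n} \<rightarrow>\<^sub>E {a..b}). tensor n \<alpha> x = 0" by simp
  then show ?thesis unfolding test_fun_def
    by (intro conjI smooth_fun_tensor[OF assms(1)] exI[of _ a] exI[of _ b] ab(1))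
qed

section \<open>Cubes over an interval of length one\<close>

locale unit_interval =
  fixes I :: "real set"
  assumes interval: "is_interval I" and unit: "emeasure lborel I = 1"
begin

text \<open>Whether \<open>I\<close> contains its end points never matters, since they form a null set; only the left end
  \<open>lo\<close> is needed to locate \<open>I\<close>.\<close>

definition lo :: real where "lo = Inf I"

abbreviation R :: "real measure" where "R \<equiv> restrict_space lborel I"

text \<open>\<open>cube I n\<close> is the completion of \<open>Q n\<close>. Products and line sections are only well behaved for Borel
  measurable functions, so the work is done in \<open>Q n\<close>, and a function on \<open>cube I n\<close> is first replaced by a
  Borel function that agrees with it almost everywhere.\<close>

abbreviation Q :: "nat \<Rightarrow> (nat \<Rightarrow> real) measure" where "Q n \<equiv> PiM {..<n} (\<lambda>_. R)"

lemma
  shows interval_lower: "{lo<..<lo + 1} \<subseteq> I" and interval_upper: "I \<subseteq> {lo..lo + 1}"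
proof -
  have ne: "I \<noteq> {}" using unit by auto
  have Isets: "I \<in> sets lborel" using unit emeasure_notin_sets[of I lborel] by (metis zero_neq_one)
  have len: "y - x \<le> 1" if "x \<in> I" "y \<in> I" for x y
  proof (rule ccontr)
    assume "\<not> y - x \<le> 1"
    define z where "z = min y (x + 2)"
    have "{x..z} \<subseteq> I"
    proof
      fix t assume "t \<in> {x..z}"
      then have "x \<le> t" "t \<le> y" by (auto simp: z_def)
      then show "t \<in> I" using interval that unfolding is_interval_1 by blast
    qed
    then have "emeasure lborel {x..z} \<le> emeasure lborel I"
      by (rule emeasure_mono) (rule Isets)
    moreover have z: "1 < z - x" using \<open>\<not> y - x \<le> 1\<close> unfolding z_def by linarith
    ultimately have "ennreal (z - x) \<le> 1" using unit by simp
    then have "z - x \<le> 1" by (simp only: ennreal_le_1)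
    with z show False by linarith
  qed
  obtain x0 where x0: "x0 \<in> I" using ne by auto
  have bdd: "bdd_below I" "bdd_above I"
    using len[OF x0] len[OF _ x0] by (auto intro!: bdd_belowI[of _ "x0 - 1"] bdd_aboveI[of _ "x0 + 1"] simp: algebra_simps)
  have 1: "{lo<..<Sup I} \<subseteq> I"
  proof
    fix t assume t: "t \<in> {lo<..<Sup I}"
    then obtain x y where "x \<in> I" "x < t" "y \<in> I" "t < y"
      using cInf_lessD[OF ne, of t] less_cSupD[OF ne, of t] by (auto simp: lo_def)
    then show "t \<in> I" using interval unfolding is_interval_1 by (meson less_imp_le)
  qed
  have 2: "I \<subseteq> {lo..Sup I}" using bdd by (auto simp: lo_def cInf_lower cSup_upper)
  have le: "lo \<le> Sup I" using 2 x0 by force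
  have "emeasure lborel {lo<..<Sup I} \<le> 1" using emeasure_mono[OF 1 Isets] unit by simp
  moreover have "1 \<le> emeasure lborel {lo..Sup I}" using emeasure_mono[OF 2, of lborel] unit by simp
  ultimately have "Sup I = lo + 1" using le by simp
  then show "{lo<..<lo + 1} \<subseteq> I" "I \<subseteq> {lo..lo + 1}" using 1 2 by auto
qed

lemma I_sets [measurable, simp]: "I \<in> sets borel"
proof -
  have "I \<in> sets lborel" using unit emeasure_notin_sets[of I lborel] by (metis zero_neq_one)
  then show ?thesis by simp
qed

lemma interior_I: "interior I = {lo<..<lo + 1}"
proof
  show "interior I \<subseteq> {lo<..<lo + 1}" using interior_mono[OF interval_upper] by simp
  show "{lo<..<lo + 1} \<subseteq> interior I" using interval_lower by (simp add: interior_maximal)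
qed

lemma space_R [simp]: "space R = I" by (simp add: space_restrict_space)

lemma sets_R [measurable_cong]: "sets R = sets (restrict_space borel I)"
  by (simp add: sets_restrict_space)

lemma measurable_R: "f \<in> borel_measurable borel \<Longrightarrow> f \<in> borel_measurable R"
  by (intro measurable_restrict_space1) simp

lemma prob_R: "prob_space R"
  by (rule prob_spaceI) (simp add: emeasure_restrict_space unit)

sublocale R: prob_space R by (rule prob_R)

lemma prob_Q: "prob_space (Q n)" by (rule R.prob_space_PiM_const)

lemma AE_R_neq: "AE t in R. t \<noteq> c"
  using AE_lborel_singleton[of c] by (subst AE_restrict_space_iff) auto

lemma AE_R_interior: "AE t in R. t \<in> {lo<..<lo + 1}"
  using AE_R_neq[of lo] AE_R_neq[of "lo + 1"] AE_space
  by eventually_elim (use interval_upper in force)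

lemma AE_Q_component: "i < n \<Longrightarrow> AE t in R. P t \<Longrightarrow> AE x in Q n. P (x i)"
  by (rule AE_PiM_component[OF prob_R]) auto

lemma AE_Q_interior: "AE x in Q n. \<forall>i<n. x i \<in> {lo<..<lo + 1}"
proof -
  have "AE x in Q n. \<forall>i\<in>{..<n}. x i \<in> {lo<..<lo + 1}"
    by (intro AE_finite_allI AE_Q_component AE_R_interior) auto
  then show ?thesis by eventually_elim simp
qed

lemma Q_update: "x \<in> space (Q n) \<Longrightarrow> k < n \<Longrightarrow> t \<in> I \<Longrightarrow> x(k := t) \<in> space (Q n)"
  by (auto simp: space_PiM PiE_iff extensional_def)

lemma Q_component: "x \<in> space (Q n) \<Longrightarrow> k < n \<Longrightarrow> x k \<in> I"
  by (auto simp: space_PiM PiE_iff)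

lemma measurable_Q_component [measurable]: "k < n \<Longrightarrow> (\<lambda>x. x k) \<in> borel_measurable (Q n)"
proof -
  assume "k < n"
  then have "(\<lambda>x. x k) \<in> Q n \<rightarrow>\<^sub>M R" by (intro measurable_component_singleton) auto
  then show ?thesis by (rule measurable_compose) (rule measurable_R, simp)
qed

lemma space_cube [simp]: "space (cube I n) = space (Q n)"
  by (simp add: cube_def)

lemma AE_cube: "(AE x in cube I n. P x) \<longleftrightarrow> (AE x in Q n. P x)"
  unfolding cube_def by (rule AE_completion_iff)

lemma nn_integral_cube: "(\<integral>\<^sup>+x. f x \<partial>cube I n) = (\<integral>\<^sup>+x. f x \<partial>Q n)"
  unfolding cube_def by (rule nn_integral_completion)

lemma measurable_cube: "f \<in> Q n \<rightarrow>\<^sub>M N \<Longrightarrow> f \<in> cube I n \<rightarrow>\<^sub>M N"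
  unfolding cube_def by (rule measurable_completion)

lemma cube_borel_version:
  fixes f :: "_ \<Rightarrow> real"
  assumes "f \<in> borel_measurable (cube I n)"
  obtains f' where "f' \<in> borel_measurable (Q n)" "AE x in Q n. f x = f' x"
  using completion_ex_borel_measurable_real[OF assms[unfolded cube_def]] that by blast

lemma integrable_cube:
  fixes f :: "_ \<Rightarrow> real"
  shows "f \<in> borel_measurable (Q n) \<Longrightarrow> integrable (cube I n) f \<longleftrightarrow> integrable (Q n) f"
  unfolding cube_def by (rule integrable_completion)

lemma integral_cube:
  fixes f :: "_ \<Rightarrow> real"
  shows "f \<in> borel_measurable (Q n) \<Longrightarrow> (LINT x|cube I n. f x) = (LINT x|Q n. f x)"
  unfolding cube_def by (rule integral_completion)

section \<open>The fundamental lemma of the calculus of variations\<close>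

text \<open>The boxes are closed under intersection and generate the product \<open>\<sigma>\<close>-algebra, so the measures with
  densities \<open>h\<^sup>+\<close> and \<open>h\<^sup>-\<close> coincide.\<close>

lemma AE_zero_if_box_integrals_zero:
  fixes h :: "(nat \<Rightarrow> real) \<Rightarrow> real"
  assumes h: "integrable (Q n) h"
    and zero: "\<And>c. (\<integral>x. h x * indicator (Pi\<^sub>E {..<n} (\<lambda>i. I \<inter> {c i<..})) x \<partial>Q n) = 0"
  shows "AE x in Q n. h x = 0"
proof -
  interpret Q: prob_space "Q n" by (rule prob_Q)
  have [measurable]: "h \<in> borel_measurable (Q n)" using h by simp
  define B where "B = (\<lambda>c :: nat \<Rightarrow> real. Pi\<^sub>E {..<n} (\<lambda>i. I \<inter> {c i<..}))"
  have Rray: "I \<inter> {c<..} \<in> sets R" for c by (simp add: sets_restrict_space_iff)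
  have B [measurable]: "B c \<in> sets (Q n)" for c
    unfolding B_def by (intro sets_PiM_I_finite Rray) auto
  define P N where "P = density (Q n) (\<lambda>x. ennreal (h x))" and "N = density (Q n) (\<lambda>x. ennreal (- h x))"
  have gen: "sets (Q n) = sigma_sets (space (Q n)) (range B)"
  proof
    show "sigma_sets (space (Q n)) (range B) \<subseteq> sets (Q n)"
      by (rule sets.sigma_sets_subset) auto
    have sub: "range B \<subseteq> Pow (space (Q n))" using B sets.sets_into_space by blast
    have comp: "(\<lambda>x. x i) \<in> sigma (space (Q n)) (range B) \<rightarrow>\<^sub>M R" if i: "i < n" for i
    proof (rule measurable_restrict_space2)
      show "(\<lambda>x. x i) \<in> space (sigma (space (Q n)) (range B)) \<rightarrow> I"
        using sub i by (auto simp: space_PiM PiE_iff)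
      have "(\<lambda>x. x i) \<in> borel_measurable (sigma (space (Q n)) (range B))"
        unfolding borel_measurable_iff_greater
      proof
        fix c
        have "{x \<in> space (sigma (space (Q n)) (range B)). c < x i}
            = (\<Union>k::nat. B (\<lambda>j. if j = i then c else - real k))" (is "?L = ?U")
        proof
          show "?U \<subseteq> ?L"
          proof
            fix x assume "x \<in> ?U"
            then obtain k where k: "x \<in> B (\<lambda>j. if j = i then c else - real k)" by blast
            then have "x \<in> space (Q n)" using sub by blast
            moreover have "c < x i" using k i by (auto simp: B_def PiE_iff dest: bspec[of _ _ i])
            ultimately show "x \<in> ?L" using sub by simp
          qed
          show "?L \<subseteq> ?U"
          proof
            fix x assume "x \<in> ?L"
            then have x: "x \<in> space (Q n)" "c < x i" using sub by auto
            obtain k :: nat where k: "real k > (\<Sum>j<n. \<bar>x j\<bar>)" using reals_Archimedean2 by blast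
            have "- real k < x j" if "j < n" for j
            proof -
              have "\<bar>x j\<bar> \<le> (\<Sum>j<n. \<bar>x j\<bar>)" by (rule member_le_sum) (use that in auto)
              then show ?thesis using k by linarith
            qed
            then have "x \<in> B (\<lambda>j. if j = i then c else - real k)"
              using x by (auto simp: B_def space_PiM PiE_iff)
            then show "x \<in> ?U" by blast
          qed
        qed
        also have "\<dots> \<in> sets (sigma (space (Q n)) (range B))"
          using sub by (intro sets.countable_UN) auto
        finally show "{x \<in> space (sigma (space (Q n)) (range B)). c < x i} \<in> sets (sigma (space (Q n)) (range B))" .
      qed
      then show "(\<lambda>x. x i) \<in> sigma (space (Q n)) (range B) \<rightarrow>\<^sub>M lborel" by simp
    qed
    have id: "(\<lambda>x. x) \<in> sigma (space (Q n)) (range B) \<rightarrow>\<^sub>M Q n"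
      by (rule measurable_PiM_single') (use comp sub in \<open>auto simp: space_PiM PiE_iff\<close>)
    show "sets (Q n) \<subseteq> sigma_sets (space (Q n)) (range B)"
    proof
      fix A assume A: "A \<in> sets (Q n)"
      have "(\<lambda>x. x) -` A \<inter> space (sigma (space (Q n)) (range B)) \<in> sets (sigma (space (Q n)) (range B))"
        by (rule measurable_sets[OF id A])
      moreover have "(\<lambda>x. x) -` A \<inter> space (sigma (space (Q n)) (range B)) = A"
        using sets.sets_into_space[OF A] sub by auto
      ultimately show "A \<in> sigma_sets (space (Q n)) (range B)" using sub by simp
    qed
  qed
  have fin: "emeasure P A \<noteq> \<infinity>" if "A \<in> sets (Q n)" for A
  proof -
    have "emeasure P A = (\<integral>\<^sup>+x. ennreal (h x) * indicator A x \<partial>Q n)"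
      unfolding P_def using that by (subst emeasure_density) auto
    also have "\<dots> \<le> (\<integral>\<^sup>+x. ennreal (norm (h x)) \<partial>Q n)"
      by (rule nn_integral_mono) (auto simp: indicator_def intro!: ennreal_leI)
    also have "\<dots> < \<infinity>" using h by (simp add: integrable_iff_bounded)
    finally show ?thesis by simp
  qed
  have "P = N"
  proof (rule measure_eqI_generator_eq[where E="range B" and \<Omega>="space (Q n)" and A="\<lambda>k. B (\<lambda>j. - real k)"])
    show "Int_stable (range B)"
    proof (rule Int_stableI_image)
      fix c d :: "nat \<Rightarrow> real"
      show "\<exists>e\<in>UNIV. B c \<inter> B d = B e"
      proof (rule bexI[of _ "\<lambda>i. max (c i) (d i)"])
        have "I \<inter> {c i<..} \<inter> (I \<inter> {d i<..}) = I \<inter> {max (c i) (d i)<..}" for i by auto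
        then show "B c \<inter> B d = B (\<lambda>i. max (c i) (d i))" by (simp add: B_def PiE_Int)
      qed simp
    qed
    show "range B \<subseteq> Pow (space (Q n))" using B sets.sets_into_space by blast
    show "sets P = sigma_sets (space (Q n)) (range B)" "sets N = sigma_sets (space (Q n)) (range B)"
      using gen by (simp_all add: P_def N_def)
    show "emeasure P (B (\<lambda>j. - real k)) \<noteq> \<infinity>" for k by (rule fin[OF B])
    show "(\<Union>k. B (\<lambda>j. - real k)) = space (Q n)"
    proof
      show "(\<Union>k. B (\<lambda>j. - real k)) \<subseteq> space (Q n)" by (intro UN_least sets.sets_into_space[OF B])
      show "space (Q n) \<subseteq> (\<Union>k. B (\<lambda>j. - real k))"
      proof
        fix x assume x: "x \<in> space (Q n)"
        obtain k :: nat where k: "real k > (\<Sum>j<n. \<bar>x j\<bar>)" using reals_Archimedean2 by blast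
        have "- real k < x j" if "j < n" for j
        proof -
          have "\<bar>x j\<bar> \<le> (\<Sum>j<n. \<bar>x j\<bar>)" by (rule member_le_sum) (use that in auto)
          then show ?thesis using k by linarith
        qed
        then have "x \<in> B (\<lambda>j. - real k)" using x by (auto simp: B_def space_PiM PiE_iff)
        then show "x \<in> (\<Union>k. B (\<lambda>j. - real k))" by (rule UN_I[OF UNIV_I])
      qed
    qed
    show "emeasure P X = emeasure N X" if XB: "X \<in> range B" for X
    proof -
      obtain c where X: "X = B c" using XB by auto
      have int: "integrable (Q n) (\<lambda>x. max 0 (h x) * indicator X x)" "integrable (Q n) (\<lambda>x. max 0 (- h x) * indicator X x)"
        using h by (auto simp: X intro!: integrable_real_mult_indicator)
      have "emeasure P X = (\<integral>\<^sup>+x. ennreal (max 0 (h x) * indicator X x) \<partial>Q n)"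
        unfolding P_def X by (subst emeasure_density) (auto intro!: nn_integral_cong simp: indicator_def max_def ennreal_neg)
      also have "\<dots> = ennreal (\<integral>x. max 0 (h x) * indicator X x \<partial>Q n)"
        by (rule nn_integral_eq_integral[OF int(1)]) auto
      also have "(\<integral>x. max 0 (h x) * indicator X x \<partial>Q n) - (\<integral>x. max 0 (- h x) * indicator X x \<partial>Q n)
          = (\<integral>x. h x * indicator X x \<partial>Q n)"
        by (subst Bochner_Integration.integral_diff[OF int, symmetric]) (auto intro!: Bochner_Integration.integral_cong simp: max_def algebra_simps)
      then have "(\<integral>x. max 0 (h x) * indicator X x \<partial>Q n) = (\<integral>x. max 0 (- h x) * indicator X x \<partial>Q n)"
        using zero[of c] by (simp add: X B_def)
      also have "ennreal (\<integral>x. max 0 (- h x) * indicator X x \<partial>Q n) = (\<integral>\<^sup>+x. ennreal (max 0 (- h x) * indicator X x) \<partial>Q n)"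
        by (rule nn_integral_eq_integral[symmetric, OF int(2)]) auto
      also have "\<dots> = emeasure N X"
        unfolding N_def X by (subst emeasure_density) (auto intro!: nn_integral_cong simp: indicator_def max_def ennreal_neg)
      finally show ?thesis .
    qed
  qed auto
  then have "AE x in Q n. ennreal (h x) = ennreal (- h x)"
    unfolding P_def N_def by (subst (asm) Q.density_unique_iff) auto
  then show ?thesis
  proof eventually_elim
    case (elim x)
    then show ?case by (cases "h x \<ge> 0") (auto simp: ennreal_neg)
  qed
qed

text \<open>Since \<open>h\<close> is only locally integrable, the open cube is exhausted by the cubes \<open>(a\<^sub>m, b\<^sub>m)\<^sup>n\<close>. Inside each
  of them indicators of boxes are limits of products of plateau functions, and the preceding lemma
  applies.\<close>

lemma fundamental_lemma:
  fixes h :: "(nat \<Rightarrow> real) \<Rightarrow> real"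
  assumes h [measurable]: "h \<in> borel_measurable (Q n)"
    and int: "\<And>a b. {a..b} \<subseteq> interior I \<Longrightarrow> integrable (Q n) (\<lambda>x. indicator (Pi\<^sub>E {..<n} (\<lambda>_. {a..b})) x * h x)"
    and zero: "\<And>\<alpha>. (\<And>i. i < n \<Longrightarrow> smooth_real (\<alpha> i)) \<Longrightarrow> compactly_supported I n \<alpha> \<Longrightarrow> (\<integral>x. h x * tensor n \<alpha> x \<partial>Q n) = 0"
  shows "AE x in Q n. h x = 0"
proof -
  define a b where "a = (\<lambda>m::nat. lo + 1 / (real m + 3))" and "b = (\<lambda>m::nat. lo + 1 - 1 / (real m + 3))"
  have ab: "lo < a m" "b m < lo + 1" for m by (auto simp: a_def b_def)
  have sub: "{a m..b m} \<subseteq> interior I" for m using ab[of m] unfolding interior_I by auto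
  have ae: "AE x in Q n. (\<forall>i<n. x i \<in> {a m<..<b m}) \<longrightarrow> h x = 0" for m
  proof -
    define V where "V = {x \<in> space (Q n). \<forall>i<n. x i \<in> {a m<..<b m}}"
    have [measurable]: "V \<in> sets (Q n)" unfolding V_def by measurable
    have VI: "indicator V x * h x = indicator V x * (indicator (Pi\<^sub>E {..<n} (\<lambda>_. {a m..b m})) x * h x)" for x
      by (auto simp: V_def indicator_def space_PiM PiE_iff intro: less_imp_le)
    have intV: "integrable (Q n) (\<lambda>x. indicator V x * h x)"
      unfolding VI using integrable_mult_indicator[OF _ int[OF sub], of V] by simp
    have "AE x in Q n. indicator V x * h x = 0"
    proof (rule AE_zero_if_box_integrals_zero[OF intV])
      fix c :: "nat \<Rightarrow> real"
      let ?B = "Pi\<^sub>E {..<n} (\<lambda>i. I \<inter> {c i<..})"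
      let ?\<alpha> = "\<lambda>k i. plateau (max (a m) (c i)) (b m) k"
      have tens0: "tensor n (?\<alpha> k) x = 0" if x: "x \<in> space (Q n)" "x \<notin> V" for k x
      proof -
        obtain i where "i < n" "x i \<notin> {a m<..<b m}" using x by (auto simp: V_def)
        then have "plateau (max (a m) (c i)) (b m) k (x i) = 0" by (intro plateau_zero) auto
        then show ?thesis using \<open>i < n\<close> unfolding tensor_def by (intro prod_zero) auto
      qed
      have tens01: "0 \<le> tensor n (?\<alpha> k) x" "tensor n (?\<alpha> k) x \<le> 1" for k x
        unfolding tensor_def by (auto intro!: prod_nonneg prod_le_1 simp: plateau_bounds)
      have meas_plateau [measurable]: "plateau u v k \<in> borel_measurable borel" for u v k
        by (rule borel_measurable_continuous_onI[OF continuous_smooth_real[OF smooth_plateau]])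
      have [measurable]: "tensor n (?\<alpha> k) \<in> borel_measurable (Q n)" for k
        unfolding tensor_def
        by (intro borel_measurable_prod measurable_compose[OF measurable_Q_component meas_plateau]) simp
      have "(\<lambda>k. \<integral>x. h x * tensor n (?\<alpha> k) x \<partial>Q n) \<longlonglongrightarrow> (\<integral>x. indicator V x * h x * indicator ?B x \<partial>Q n)"
      proof (rule integral_dominated_convergence[where w="\<lambda>x. \<bar>indicator V x * h x\<bar>"])
        have "?B \<in> sets (Q n)" by (intro sets_PiM_I_finite) (auto simp: sets_restrict_space_iff)
        then show "(\<lambda>x. indicator V x * h x * indicator ?B x) \<in> borel_measurable (Q n)" by measurable
        show "(\<lambda>x. h x * tensor n (?\<alpha> k) x) \<in> borel_measurable (Q n)" for k by measurable
        show "integrable (Q n) (\<lambda>x. \<bar>indicator V x * h x\<bar>)" using intV by simp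
        show "AE x in Q n. norm (h x * tensor n (?\<alpha> k) x) \<le> \<bar>indicator V x * h x\<bar>" for k
        proof (rule AE_I2)
          fix x assume x: "x \<in> space (Q n)"
          show "norm (h x * tensor n (?\<alpha> k) x) \<le> \<bar>indicator V x * h x\<bar>"
          proof (cases "x \<in> V")
            case True
            then show ?thesis using tens01[of k x] by (simp add: abs_mult mult_left_le)
          next
            case False then show ?thesis using tens0[OF x] by simp
          qed
        qed
        show "AE x in Q n. (\<lambda>k. h x * tensor n (?\<alpha> k) x) \<longlonglongrightarrow> indicator V x * h x * indicator ?B x"
        proof (rule AE_I2)
          fix x assume x: "x \<in> space (Q n)"
          have "(\<lambda>k. h x * tensor n (?\<alpha> k) x) \<longlonglongrightarrow> h x * (\<Prod>i<n. indicator {max (a m) (c i)<..<b m} (x i))"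
            unfolding tensor_def by (intro tendsto_intros plateau_tendsto)
          moreover have "(\<Prod>i<n. indicator {max (a m) (c i)<..<b m} (x i)) = indicator V x * (indicator ?B x :: real)"
          proof (cases "x \<in> V \<and> x \<in> ?B")
            case True
            then show ?thesis by (auto simp: V_def PiE_iff intro!: prod.neutral)
          next
            case False
            then obtain i where "i < n" "x i \<notin> {max (a m) (c i)<..<b m}"
              using x by (auto simp: V_def PiE_iff space_PiM)
            then have "i < n" "indicator {max (a m) (c i)<..<b m} (x i) = (0 :: real)" by auto
            then have "(\<Prod>i<n. indicator {max (a m) (c i)<..<b m} (x i)) = (0 :: real)"
              by (intro prod_zero) blast+
            moreover have "indicator V x * (indicator ?B x :: real) = 0"
              using False by (metis indicator_simps(2) mult_eq_0_iff)
            ultimately show ?thesis by (simp only:)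
          qed
          ultimately show "(\<lambda>k. h x * tensor n (?\<alpha> k) x) \<longlonglongrightarrow> indicator V x * h x * indicator ?B x"
            by (simp add: mult_ac)
        qed
      qed
      moreover have "(\<integral>x. h x * tensor n (?\<alpha> k) x \<partial>Q n) = 0" for k
      proof (rule zero)
        show "compactly_supported I n (?\<alpha> k)" unfolding compactly_supported_def
          by (rule exI[of _ "a m"], rule exI[of _ "b m"]) (use sub in \<open>auto intro!: plateau_zero\<close>)
      qed (rule smooth_plateau)
      ultimately show "(\<integral>x. indicator V x * h x * indicator ?B x \<partial>Q n) = 0"
        by (simp add: LIMSEQ_const_iff)
    qed
    then show ?thesis using AE_space by eventually_elim (auto simp: V_def)
  qed
  have "AE x in Q n. \<forall>m. (\<forall>i<n. x i \<in> {a m<..<b m}) \<longrightarrow> h x = 0"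
    unfolding AE_all_countable using ae by blast
  then show ?thesis using AE_Q_interior[of n]
  proof eventually_elim
    case (elim x)
    have "\<forall>\<^sub>F m in sequentially. \<forall>i\<in>{..<n}. x i \<in> {a m<..<b m}"
    proof (rule eventually_ball_finite)
      show "\<forall>i\<in>{..<n}. \<forall>\<^sub>F m in sequentially. x i \<in> {a m<..<b m}"
      proof
        fix i assume i: "i \<in> {..<n}"
        have "a \<longlonglongrightarrow> lo" "b \<longlonglongrightarrow> lo + 1" unfolding a_def b_def by real_asymp+
        then have "\<forall>\<^sub>F m in sequentially. a m < x i" "\<forall>\<^sub>F m in sequentially. x i < b m"
          using elim(2) i by (auto intro: order_tendstoD)
        then show "\<forall>\<^sub>F m in sequentially. x i \<in> {a m<..<b m}" by eventually_elim auto
      qed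
    qed simp
    then obtain m where "\<forall>i\<in>{..<n}. x i \<in> {a m<..<b m}"
      by (auto simp: eventually_sequentially)
    then show ?case using elim(1) by auto
  qed
qed

end

section \<open>Weak gradients along lines\<close>

context unit_interval begin

lemma integral_R: 
  fixes f :: "real \<Rightarrow> real"
  shows "(\<integral>t. f t \<partial>R) = (\<integral>t. indicator I t * f t \<partial>lborel)"
  by (subst integral_restrict_space) auto

lemma AE_lborel_interior: "AE t in lborel. t \<in> I \<longleftrightarrow> t \<in> {lo<..<lo + 1}"
  using AE_lborel_singleton[of lo] AE_lborel_singleton[of "lo + 1"]
  by eventually_elim (use interval_lower interval_upper in force)

lemma integral_deriv_R:
  fixes f f' :: "real \<Rightarrow> real"
  assumes deriv: "\<And>t. (f has_real_derivative f' t) (at t)" and cont: "continuous_on UNIV f'"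
    and zero: "f lo = 0" and t: "t \<in> {lo..lo + 1}"
  shows "(\<integral>s. indicator {..t} s * f' s \<partial>R) = f t"
proof -
  have [measurable]: "f' \<in> borel_measurable borel" by (rule borel_measurable_continuous_onI[OF cont])
  have "(\<integral>s. indicator {..t} s * f' s \<partial>R) = (\<integral>s. indicator I s * (indicator {..t} s * f' s) \<partial>lborel)"
    by (rule integral_R)
  also have "\<dots> = (\<integral>s. f' s * indicator {lo..t} s \<partial>lborel)"
  proof (rule integral_cong_AE)
    show "AE s in lborel. indicator I s * (indicator {..t} s * f' s) = f' s * indicator {lo..t} s"
      using AE_lborel_interior AE_lborel_singleton[of lo] AE_lborel_singleton[of "lo + 1"]
      by eventually_elim (use t in \<open>auto simp: indicator_def\<close>)
  qed auto
  also have "\<dots> = f t - f lo"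
    using t deriv cont by (intro integral_FTC_Icc_real) (auto simp: continuous_on_eq_continuous_at)
  finally show ?thesis using zero by simp
qed

text \<open>The primitive of a function supported in \<open>[a,b]\<close> vanishes to the right of \<open>b\<close> because the mean is
  zero; hence mean-zero test functions are exactly the derivatives of test functions.\<close>

lemma antiderivative_of_mean_zero:
  fixes \<gamma> :: "real \<Rightarrow> real"
  assumes smooth: "smooth_real \<gamma>" and ab: "{a..b} \<subseteq> interior I" "a \<le> b"
    and supp: "\<And>t. t \<notin> {a..b} \<Longrightarrow> \<gamma> t = 0" and mean: "(\<integral>t. \<gamma> t \<partial>R) = 0"
  obtains \<eta> where "smooth_real \<eta>" "deriv \<eta> = \<gamma>" "\<And>t. t \<notin> {a..b} \<Longrightarrow> \<eta> t = 0"
    "\<And>t. t \<in> I \<Longrightarrow> \<eta> t = (\<integral>s. indicator {..t} s * \<gamma> s \<partial>R)"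
proof -
  have cont: "continuous_on A \<gamma>" for A by (rule continuous_smooth_real[OF smooth])
  have [measurable]: "\<gamma> \<in> borel_measurable borel" by (rule borel_measurable_continuous_onI[OF cont])
  have lo_ab: "lo < a" "b < lo + 1" using ab unfolding interior_I by auto
  \<comment> \<open>Starting strictly to the left of \<open>I\<close> makes the primitive differentiable on all of \<open>I\<close>.\<close>
  define \<eta> where "\<eta> = (\<lambda>t. integral {lo - 1..t} \<gamma>)"
  have mid: "(\<eta> has_real_derivative \<gamma> t) (at t)" if "lo - 1 < t" "t < lo + 2" for t
    using integral_has_real_derivative[OF cont, of t "lo - 1" "lo + 2"] that
    by (simp add: \<eta>_def at_within_Icc_at)
  have left: "\<eta> t = 0" if "t < a" for t
  proof -
    have "integral {lo - 1..t} \<gamma> = integral {lo - 1..t} (\<lambda>_. 0)"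
      by (rule Henstock_Kurzweil_Integration.integral_cong) (use that supp in auto)
    then show ?thesis by (simp add: \<eta>_def)
  qed
  have right: "\<eta> t = 0" if "t > b" for t
  proof -
    have int: "set_integrable lborel {lo - 1..t} \<gamma>"
      by (rule borel_integrable_atLeastAtMost') (rule cont)
    have "\<eta> t = (\<integral>s\<in>{lo - 1..t}. \<gamma> s \<partial>lborel)"
      unfolding \<eta>_def using set_borel_integral_eq_integral(2)[OF int] by simp
    also have "\<dots> = (\<integral>s. indicator I s * \<gamma> s \<partial>lborel)"
      unfolding set_lebesgue_integral_def
    proof (rule Bochner_Integration.integral_cong)
      fix s show "indicator {lo - 1..t} s *\<^sub>R \<gamma> s = indicator I s * \<gamma> s"
        using supp[of s] that lo_ab ab(1) interior_subset[of I] by (cases "s \<in> {a..b}") (auto simp: indicator_def)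
    qed simp
    also have "\<dots> = 0" using mean by (simp add: integral_R)
    finally show ?thesis .
  qed
  have deriv: "(\<eta> has_real_derivative \<gamma> t) (at t)" for t
  proof -
    consider "lo - 1 < t" "t < lo + 2" | "t < a" | "t > b" using lo_ab ab(2) by linarith
    then show ?thesis
    proof cases
      case 1 then show ?thesis by (rule mid)
    next
      case 2
      have "\<forall>\<^sub>F s in nhds t. 0 = \<eta> s"
        using eventually_nhds_in_open[of "{..<a}" t] 2 by (auto elim!: eventually_mono simp: left)
      then have "(\<eta> has_real_derivative 0) (at t)"
        by (rule DERIV_cong_ev[OF refl _ refl, THEN iffD1]) auto
      then show ?thesis using supp[of t] 2 by simp
    next
      case 3
      have "\<forall>\<^sub>F s in nhds t. 0 = \<eta> s"
        using eventually_nhds_in_open[of "{b<..}" t] 3 by (auto elim!: eventually_mono simp: right)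
      then have "(\<eta> has_real_derivative 0) (at t)"
        by (rule DERIV_cong_ev[OF refl _ refl, THEN iffD1]) auto
      then show ?thesis using supp[of t] 3 by simp
    qed
  qed
  show ?thesis
  proof (rule that)
    show "smooth_real \<eta>" by (rule smooth_real_antiderivative[OF deriv smooth])
    show "deriv \<eta> = \<gamma>" using deriv by (auto intro!: ext DERIV_imp_deriv)
    show "\<eta> t = 0" if "t \<notin> {a..b}" for t using that left right by (cases "t < a") auto
    show "\<eta> t = (\<integral>s. indicator {..t} s * \<gamma> s \<partial>R)" if "t \<in> I" for t
      using that interval_upper lo_ab by (intro integral_deriv_R[symmetric] deriv cont left) auto
  qed
qed

lemma smooth_compact_support_bounded:
  assumes "smooth_real f" "\<And>t. t \<notin> {a..b::real} \<Longrightarrow> f t = 0"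
  obtains B where "\<And>t. \<bar>f t\<bar> \<le> B" "B \<ge> 0"
proof -
  have "compact (f ` {a..b})" by (intro compact_continuous_image continuous_smooth_real assms(1)) auto
  then have "\<exists>B. \<forall>x\<in>f ` {a..b}. norm x \<le> B" by (simp only: bounded_iff[symmetric] compact_imp_bounded)
  then obtain B where "\<forall>x\<in>f ` {a..b}. norm x \<le> B" by blast
  then have B: "\<bar>f t\<bar> \<le> B" if "t \<in> {a..b}" for t using that by auto
  show ?thesis
  proof (rule that[of "max B 0"])
    fix t show "\<bar>f t\<bar> \<le> max B 0" using B[of t] assms(2)[of t] by (cases "t \<in> {a..b}") auto
  qed auto
qed

lemma measurable_smooth_real: "smooth_real f \<Longrightarrow> f \<in> borel_measurable borel"
  by (rule borel_measurable_continuous_onI[OF continuous_smooth_real])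

lemma integrable_mult_tensor:
  fixes f :: "(nat \<Rightarrow> real) \<Rightarrow> real"
  assumes f: "integrable (Q n) f" and J: "J \<subseteq> {..<n}"
    and meas: "\<And>i. i < n \<Longrightarrow> \<alpha> i \<in> borel_measurable borel" and bdd: "\<And>i t. i < n \<Longrightarrow> \<bar>\<alpha> i t\<bar> \<le> B" 
  shows "integrable (Q n) (\<lambda>x. f x * (\<Prod>i\<in>J. \<alpha> i (x i)))"
proof (rule Bochner_Integration.integrable_bound)
  show "integrable (Q n) (\<lambda>x. B ^ card J * f x)" using f by simp
  have [measurable]: "(\<lambda>x. \<alpha> i (x i)) \<in> borel_measurable (Q n)" if "i \<in> J" for i
    using that J by (intro measurable_compose[OF measurable_Q_component meas]) auto
  have [measurable]: "f \<in> borel_measurable (Q n)" using f by simp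
  show "(\<lambda>x. f x * (\<Prod>i\<in>J. \<alpha> i (x i))) \<in> borel_measurable (Q n)" by measurable
  show "AE x in Q n. norm (f x * (\<Prod>i\<in>J. \<alpha> i (x i))) \<le> norm (B ^ card J * f x)"
  proof (rule AE_I2)
    fix x
    have "\<bar>\<Prod>i\<in>J. \<alpha> i (x i)\<bar> \<le> (\<Prod>i\<in>J. B)"
      unfolding abs_prod using J bdd by (intro prod_mono) auto
    also have "\<dots> \<le> \<bar>B ^ card J\<bar>" by simp
    finally show "norm (f x * (\<Prod>i\<in>J. \<alpha> i (x i))) \<le> norm (B ^ card J * f x)"
      by (simp add: abs_mult mult.commute mult_left_mono)
  qed
qed

lemma integral_update_tensor:
  fixes f :: "(nat \<Rightarrow> real) \<Rightarrow> real"
  assumes f: "integrable (Q n) f" and k: "k < n"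
    and meas: "\<And>i. i < n \<Longrightarrow> \<alpha> i \<in> borel_measurable borel" and bdd: "\<And>i t. i < n \<Longrightarrow> \<bar>\<alpha> i t\<bar> \<le> B" 
  shows "(\<integral>x. f x * tensor n \<alpha> x \<partial>Q n)
    = (\<integral>x. (\<integral>t. f (x(k := t)) * \<alpha> k t \<partial>R) * (\<Prod>i\<in>{..<n} - {k}. \<alpha> i (x i)) \<partial>Q n)"
proof -
  have "integrable (Q n) (\<lambda>x. f x * tensor n \<alpha> x)"
    unfolding tensor_def by (rule integrable_mult_tensor[OF f _ meas bdd]) auto
  then have "(\<integral>x. f x * tensor n \<alpha> x \<partial>Q n) = (\<integral>x. \<integral>t. f (x(k := t)) * tensor n \<alpha> (x(k := t)) \<partial>R \<partial>Q n)"
    using k by (intro R.integral_update[symmetric]) auto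
  also have "\<dots> = (\<integral>x. (\<integral>t. f (x(k := t)) * \<alpha> k t \<partial>R) * (\<Prod>i\<in>{..<n} - {k}. \<alpha> i (x i)) \<partial>Q n)"
  proof (rule Bochner_Integration.integral_cong[OF refl])
    fix x
    have "tensor n \<alpha> (x(k := t)) = \<alpha> k t * (\<Prod>i\<in>{..<n} - {k}. \<alpha> i (x i))" for t
      using tensor_upd[OF k, of \<alpha> "\<alpha> k" x t] by simp
    then show "(\<integral>t. f (x(k := t)) * tensor n \<alpha> (x(k := t)) \<partial>R)
        = (\<integral>t. f (x(k := t)) * \<alpha> k t \<partial>R) * (\<Prod>i\<in>{..<n} - {k}. \<alpha> i (x i))"
      by (simp add: mult.assoc[symmetric])
  qed
  finally show ?thesis .
qed

lemma bounded_tensor_factors: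
  assumes "\<And>i. i < n \<Longrightarrow> smooth_real (\<alpha> i)" "compactly_supported I n \<alpha>"
  shows "\<exists>B\<ge>0. \<forall>i<n. \<forall>t. \<bar>\<alpha> i t\<bar> \<le> B"
proof -
  obtain a b where ab: "\<forall>i<n. \<forall>t. t \<notin> {a..b} \<longrightarrow> \<alpha> i t = 0"
    using assms(2) unfolding compactly_supported_def by blast
  have "\<exists>B. \<forall>i\<in>{..<n}. (\<forall>t. \<bar>\<alpha> i t\<bar> \<le> B i) \<and> B i \<ge> 0"
  proof (rule bchoice, rule ballI)
    fix i assume i: "i \<in> {..<n}"
    obtain B where "\<And>t. \<bar>\<alpha> i t\<bar> \<le> B" "B \<ge> 0"
      by (rule smooth_compact_support_bounded[of "\<alpha> i" a b]) (use assms(1) ab i in auto)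
    then show "\<exists>B. (\<forall>t. \<bar>\<alpha> i t\<bar> \<le> B) \<and> B \<ge> 0" by blast
  qed
  then obtain B where B: "\<And>i t. i < n \<Longrightarrow> \<bar>\<alpha> i t\<bar> \<le> B i" "\<And>i. i < n \<Longrightarrow> B i \<ge> 0" by blast
  show ?thesis
  proof (intro exI[of _ "\<Sum>i<n. B i"] conjI allI impI)
    show "(\<Sum>i<n. B i) \<ge> 0" using B(2) by (intro sum_nonneg) auto
    fix i t assume i: "i < n"
    have "B i \<le> (\<Sum>i<n. B i)" by (rule member_le_sum) (use i B(2) in auto)
    then show "\<bar>\<alpha> i t\<bar> \<le> (\<Sum>i<n. B i)" using B(1)[OF i, of t] by linarith
  qed
qed

text \<open>Fubini on the triangle \<open>s \<le> t\<close>; since \<open>\<gamma>\<close> has mean zero, integrating \<open>g\<close> over \<open>t \<ge> s\<close> may be replaced by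
  minus the integral over \<open>t < s\<close>.\<close>

lemma integral_by_parts_R:
  fixes g \<gamma> \<eta> :: "real \<Rightarrow> real"
  assumes g: "integrable R g" and [measurable]: "\<gamma> \<in> borel_measurable borel" and bdd: "\<And>t. \<bar>\<gamma> t\<bar> \<le> B"
    and mean: "(\<integral>t. \<gamma> t \<partial>R) = 0"
    and \<eta>: "\<And>t. t \<in> I \<Longrightarrow> \<eta> t = (\<integral>s. indicator {..t} s * \<gamma> s \<partial>R)"
  shows "(\<integral>t. g t * \<eta> t \<partial>R) = - (\<integral>s. (\<integral>t. indicator {..<s} t * g t \<partial>R) * \<gamma> s \<partial>R)"
proof -
  interpret RR: pair_sigma_finite R R by unfold_locales
  have [measurable]: "g \<in> borel_measurable R" using g by simp
  have [measurable]: "\<gamma> \<in> borel_measurable R" by (rule measurable_R) simp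
  have [measurable]: "(\<lambda>t. t) \<in> borel_measurable R" by (rule measurable_R) simp
  have pred [measurable]: "Measurable.pred (R \<Otimes>\<^sub>M R) (\<lambda>(t, s). s \<le> t)"
  proof -
    have "fst \<in> borel_measurable (R \<Otimes>\<^sub>M R)" "snd \<in> borel_measurable (R \<Otimes>\<^sub>M R)"
      by (rule measurable_compose[OF measurable_fst], simp, rule measurable_compose[OF measurable_snd], simp)
    then show ?thesis by (simp add: split_beta')
  qed
  have B0: "B \<ge> 0" using bdd[of 0] by linarith
  have int1: "integrable R (\<lambda>t. B * \<bar>g t\<bar>)" using g by simp
  have int2: "integrable (R \<Otimes>\<^sub>M R) (\<lambda>(t, s). B * \<bar>g t\<bar>)"
  proof (rule RR.Fubini_integrable)
    have "(\<lambda>z. B * \<bar>g (fst z)\<bar>) \<in> borel_measurable (R \<Otimes>\<^sub>M R)" by measurable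
    then show "(\<lambda>(t, s). B * \<bar>g t\<bar>) \<in> borel_measurable (R \<Otimes>\<^sub>M R)" by (simp add: split_beta')
    show "integrable R (\<lambda>x. \<integral>y. norm (case (x, y) of (t, s) \<Rightarrow> B * \<bar>g t\<bar>) \<partial>R)"
      using int1 R.prob_space by (simp add: B0 abs_mult)
  qed simp
  have int: "integrable (R \<Otimes>\<^sub>M R) (\<lambda>(t, s). g t * (indicator {..t} s * \<gamma> s))"
  proof (rule Bochner_Integration.integrable_bound[OF int2])
    have "(\<lambda>z. g (fst z) * (of_bool ((\<lambda>(t, s). s \<le> t) z) * \<gamma> (snd z))) \<in> borel_measurable (R \<Otimes>\<^sub>M R)"
      by measurable
    moreover have "(\<lambda>z. g (fst z) * (of_bool ((\<lambda>(t, s). s \<le> t) z) * \<gamma> (snd z))) = (\<lambda>(t, s). g t * (indicator {..t} s * \<gamma> s))"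
      by (auto simp: fun_eq_iff indicator_def)
    ultimately show "(\<lambda>(t, s). g t * (indicator {..t} s * \<gamma> s)) \<in> borel_measurable (R \<Otimes>\<^sub>M R)" by simp
    show "AE z in R \<Otimes>\<^sub>M R. norm (case z of (t, s) \<Rightarrow> g t * (indicator {..t} s * \<gamma> s)) \<le> norm (case z of (t, s) \<Rightarrow> B * \<bar>g t\<bar>)"
      using bdd B0 by (intro AE_I2) (auto simp: abs_mult indicator_def mult.commute[of B] intro!: mult_left_mono mult_nonneg_nonneg)
  qed
  have g_int: "integrable R (\<lambda>t. indicator A t * g t)" if "A \<in> sets borel" for A
  proof (rule Bochner_Integration.integrable_bound[OF g])
    have "(indicator A :: real \<Rightarrow> real) \<in> borel_measurable R" using that by (intro measurable_R) simp
    then show "(\<lambda>t. indicator A t * g t) \<in> borel_measurable R" by measurable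
  qed (auto simp: indicator_def)
  have inner: "(\<integral>t. g t * (indicator {..t} s * \<gamma> s) \<partial>R) = (\<integral>t. g t \<partial>R) * \<gamma> s - (\<integral>t. indicator {..<s} t * g t \<partial>R) * \<gamma> s" for s
  proof -
    have "(\<integral>t. g t * (indicator {..t} s * \<gamma> s) \<partial>R) = (\<integral>t. (g t - indicator {..<s} t * g t) * \<gamma> s \<partial>R)"
      by (rule Bochner_Integration.integral_cong) (auto simp: indicator_def)
    also have "\<dots> = (\<integral>t. g t - indicator {..<s} t * g t \<partial>R) * \<gamma> s" by simp
    also have "\<dots> = ((\<integral>t. g t \<partial>R) - (\<integral>t. indicator {..<s} t * g t \<partial>R)) * \<gamma> s"
      using g g_int[of "{..<s}"] by simp
    finally show ?thesis
      by (simp add: left_diff_distrib)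
  qed
  have "(\<integral>t. g t * \<eta> t \<partial>R) = (\<integral>t. \<integral>s. g t * (indicator {..t} s * \<gamma> s) \<partial>R \<partial>R)"
    by (rule Bochner_Integration.integral_cong) (simp_all add: \<eta>)
  also have "\<dots> = (\<integral>s. \<integral>t. g t * (indicator {..t} s * \<gamma> s) \<partial>R \<partial>R)"
    by (rule RR.Fubini_integral[OF int, symmetric])
  also have "\<dots> = (\<integral>s. (\<integral>t. g t \<partial>R) * \<gamma> s - (\<integral>t. indicator {..<s} t * g t \<partial>R) * \<gamma> s \<partial>R)"
    by (simp only: inner)
  also have "\<dots> = (\<integral>s. (\<integral>t. g t \<partial>R) * \<gamma> s \<partial>R) - (\<integral>s. (\<integral>t. indicator {..<s} t * g t \<partial>R) * \<gamma> s \<partial>R)"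
  proof (rule Bochner_Integration.integral_diff)
    have "integrable R \<gamma>"
      by (rule R.integrable_const_bound[of _ B]) (use bdd in auto)
    then show i1: "integrable R (\<lambda>s. (\<integral>t. g t \<partial>R) * \<gamma> s)" by simp
    have "integrable R (\<lambda>s. \<integral>t. g t * (indicator {..t} s * \<gamma> s) \<partial>R)"
      using RR.integrable_snd[OF int] by simp
    then have "integrable R (\<lambda>s. (\<integral>t. g t \<partial>R) * \<gamma> s - (\<integral>t. indicator {..<s} t * g t \<partial>R) * \<gamma> s)"
      by (simp only: inner)
    then have "integrable R (\<lambda>s. (\<integral>t. g t \<partial>R) * \<gamma> s - ((\<integral>t. g t \<partial>R) * \<gamma> s - (\<integral>t. indicator {..<s} t * g t \<partial>R) * \<gamma> s))"
      by (rule Bochner_Integration.integrable_diff[OF i1])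
    then show "integrable R (\<lambda>s. (\<integral>t. indicator {..<s} t * g t \<partial>R) * \<gamma> s)"
      by simp
  qed
  finally show ?thesis using mean by simp
qed

end

context unit_interval begin

lemma compactly_supportedI:
  "{a..b} \<subseteq> interior I \<Longrightarrow> (\<And>i t. i < n \<Longrightarrow> t \<notin> {a..b} \<Longrightarrow> \<alpha> i t = 0) \<Longrightarrow> compactly_supported I n \<alpha>"
  unfolding compactly_supported_def by blast

lemma measurable_line_integral:
  fixes f :: "(nat \<Rightarrow> real) \<Rightarrow> real"
  assumes [measurable]: "f \<in> borel_measurable (Q n)" "\<beta> \<in> borel_measurable borel" and k: "k < n"
  shows "(\<lambda>x. \<integral>t. f (x(k := t)) * \<beta> t \<partial>R) \<in> borel_measurable (Q n)"
proof -
  have [measurable]: "(\<lambda>(x, t). x(k := t)) \<in> Q n \<Otimes>\<^sub>M R \<rightarrow>\<^sub>M Q n" using k by (intro R.measurable_update) auto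
  have [measurable]: "\<beta> \<in> borel_measurable R" by (rule measurable_R) simp
  have "(\<lambda>z. f ((\<lambda>(x, t). x(k := t)) z) * \<beta> (snd z)) \<in> borel_measurable (Q n \<Otimes>\<^sub>M R)" by measurable
  then have "(\<lambda>(x, t). f (x(k := t)) * \<beta> t) \<in> borel_measurable (Q n \<Otimes>\<^sub>M R)" by (simp add: split_beta')
  then show ?thesis by (rule R.borel_measurable_lebesgue_integral)
qed

definition primitive :: "nat \<Rightarrow> ((nat \<Rightarrow> real) \<Rightarrow> real) \<Rightarrow> (nat \<Rightarrow> real) \<Rightarrow> real" where
  "primitive k g x = (\<integral>t. indicator {..<x k} t * g (x(k := t)) \<partial>R)"

lemma primitive_update: "primitive k g (x(k := s)) = (\<integral>t. indicator {..<s} t * g (x(k := t)) \<partial>R)"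
  by (simp add: primitive_def)

lemma integrable_primitive:
  assumes g: "integrable (Q n) g" and k: "k < n"
  shows "integrable (Q n) (primitive k g)"
proof (rule Bochner_Integration.integrable_bound)
  have [measurable]: "g \<in> borel_measurable (Q n)" using g by simp
  have J: "finite {..<n}" "k \<in> {..<n}" using k by auto
  show "integrable (Q n) (\<lambda>x. \<integral>t. \<bar>g (x(k := t))\<bar> \<partial>R)"
    using g by (intro R.integrable_integral_update[OF J]) simp
  have [measurable]: "(\<lambda>(x, t). x(k := t)) \<in> Q n \<Otimes>\<^sub>M R \<rightarrow>\<^sub>M Q n" using k by (intro R.measurable_update) auto
  have [measurable]: "(\<lambda>x. x k) \<in> borel_measurable (Q n)" using k by (rule measurable_Q_component)
  have [measurable]: "(\<lambda>t. t) \<in> borel_measurable R" by (rule measurable_R) simp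
  have "(\<lambda>z. of_bool (snd z < (fst z) k) * g ((\<lambda>(x, t). x(k := t)) z)) \<in> borel_measurable (Q n \<Otimes>\<^sub>M R)"
  proof -
    have 1: "(\<lambda>z. fst z k) \<in> borel_measurable (Q n \<Otimes>\<^sub>M R)"
      by (rule measurable_compose[OF measurable_fst]) measurable
    have 2: "snd \<in> borel_measurable (Q n \<Otimes>\<^sub>M R)"
      using measurable_compose[OF measurable_snd measurable_R[of "\<lambda>t. t"]] by simp
    show ?thesis using 1 2 by measurable
  qed
  moreover have "(\<lambda>z. of_bool (snd z < (fst z) k) * g ((\<lambda>(x, t). x(k := t)) z))
      = (\<lambda>(x, t). indicator {..<x k} t * g (x(k := t)))" by (auto simp: fun_eq_iff indicator_def)
  ultimately have "(\<lambda>(x, t). indicator {..<x k} t * g (x(k := t))) \<in> borel_measurable (Q n \<Otimes>\<^sub>M R)" by simp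
  then show "primitive k g \<in> borel_measurable (Q n)"
    unfolding primitive_def by (rule R.borel_measurable_lebesgue_integral)
  show "AE x in Q n. norm (primitive k g x) \<le> norm (\<integral>t. \<bar>g (x(k := t))\<bar> \<partial>R)"
    using R.integrable_update[OF J g]
  proof eventually_elim
    case (elim x)
    have "\<bar>primitive k g x\<bar> \<le> (\<integral>t. \<bar>indicator {..<x k} t * g (x(k := t))\<bar> \<partial>R)"
      unfolding primitive_def by (rule integral_abs_bound)
    also have "\<dots> \<le> (\<integral>t. \<bar>g (x(k := t))\<bar> \<partial>R)"
    proof (rule integral_mono')
      show "integrable R (\<lambda>t. \<bar>g (x(k := t))\<bar>)" using elim by simp
    qed (auto simp: indicator_def)
    finally show ?case by simp
  qed
qed

text \<open>Testing against \<open>\<gamma>(x\<^sub>k) \<Prod>\<^sub>i \<alpha>\<^sub>i(x\<^sub>i)\<close>, where \<open>i\<close> ranges over the other coordinates and \<open>\<gamma>\<close> has mean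
  zero and is therefore the derivative of a test function, removes the weak derivative: \<open>u\<close> minus
  the primitive of \<open>g\<close> in direction \<open>k\<close> is orthogonal to all these products, hence does not depend on
  \<open>x\<^sub>k\<close>.\<close>

lemma weak_derivative_representation:
  fixes u g :: "(nat \<Rightarrow> real) \<Rightarrow> real"
  assumes u: "integrable (Q n) u" and g: "integrable (Q n) g" and k: "k < n"
    and weak: "\<And>\<alpha>. (\<And>i. i < n \<Longrightarrow> smooth_real (\<alpha> i)) \<Longrightarrow> compactly_supported I n \<alpha> \<Longrightarrow>
      (\<integral>x. u x * tensor n (\<alpha>(k := deriv (\<alpha> k))) x \<partial>Q n) = - (\<integral>x. g x * tensor n \<alpha> x \<partial>Q n)"
  obtains m where "\<And>x t. m (x(k := t)) = m x" "AE x in Q n. u x = m x + primitive k g x"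
proof -
  have J: "finite {..<n}" "k \<in> {..<n}" using k by auto
  define w where "w = (\<lambda>x. u x - primitive k g x)"
  have V: "integrable (Q n) (primitive k g)" by (rule integrable_primitive[OF g k])
  have w: "integrable (Q n) w" unfolding w_def using u V by simp
  have [measurable]: "u \<in> borel_measurable (Q n)" "g \<in> borel_measurable (Q n)" "w \<in> borel_measurable (Q n)"
    "primitive k g \<in> borel_measurable (Q n)" using u g w V by auto
  have orth: "(\<integral>x. w x * tensor n (\<alpha>(k := \<gamma>)) x \<partial>Q n) = 0"
    if \<alpha>: "\<And>i. i < n \<Longrightarrow> smooth_real (\<alpha> i)" and \<gamma>: "smooth_real \<gamma>" "(\<integral>t. \<gamma> t \<partial>R) = 0"
      and ab: "{a..b} \<subseteq> interior I" "a \<le> b" "\<And>i t. i < n \<Longrightarrow> t \<notin> {a..b} \<Longrightarrow> \<alpha> i t = 0" "\<And>t. t \<notin> {a..b} \<Longrightarrow> \<gamma> t = 0"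
    for \<alpha> \<gamma> a b
  proof -
    obtain \<eta> where \<eta>: "smooth_real \<eta>" "deriv \<eta> = \<gamma>" "\<And>t. t \<notin> {a..b} \<Longrightarrow> \<eta> t = 0"
      "\<And>t. t \<in> I \<Longrightarrow> \<eta> t = (\<integral>s. indicator {..t} s * \<gamma> s \<partial>R)"
      using antiderivative_of_mean_zero[OF \<gamma>(1) ab(1,2,4) \<gamma>(2)] by blast
    have s\<gamma>: "smooth_real ((\<alpha>(k := \<gamma>)) i)" and s\<eta>: "smooth_real ((\<alpha>(k := \<eta>)) i)" if "i < n" for i
      using \<alpha> \<gamma> \<eta> that by auto
    have c\<gamma>: "compactly_supported I n (\<alpha>(k := \<gamma>))" and c\<eta>: "compactly_supported I n (\<alpha>(k := \<eta>))"
      using ab(3,4) \<eta>(3) by (auto intro!: compactly_supportedI[OF ab(1)] simp del: atLeastAtMost_iff)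
    obtain B where "\<forall>i<n. \<forall>t. \<bar>(\<alpha>(k := \<gamma>)) i t\<bar> \<le> B"
      using bounded_tensor_factors[OF s\<gamma> c\<gamma>] by blast
    note B = this[rule_format]
    obtain B' where "\<forall>i<n. \<forall>t. \<bar>(\<alpha>(k := \<eta>)) i t\<bar> \<le> B'"
      using bounded_tensor_factors[OF s\<eta> c\<eta>] by blast
    note B' = this[rule_format]
    have m\<gamma>: "(\<alpha>(k := \<gamma>)) i \<in> borel_measurable borel" and m\<eta>: "(\<alpha>(k := \<eta>)) i \<in> borel_measurable borel" if "i < n" for i
      using s\<gamma>[OF that] s\<eta>[OF that] by (auto intro!: measurable_smooth_real simp del: fun_upd_apply)
    have m\<alpha>: "\<alpha> i \<in> borel_measurable borel" if "i < n" for i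
      using \<alpha>[OF that] by (rule measurable_smooth_real)
    have [measurable]: "\<gamma> \<in> borel_measurable borel" "\<eta> \<in> borel_measurable borel"
      using \<gamma>(1) \<eta>(1) by (auto intro: measurable_smooth_real)
    define \<zeta> where "\<zeta> = (\<lambda>x::nat \<Rightarrow> real. \<Prod>i\<in>{..<n} - {k}. \<alpha> i (x i))"
    have \<zeta>eq: "(\<Prod>i\<in>{..<n} - {k}. (\<alpha>(k := \<delta>)) i (x i)) = \<zeta> x" for x \<delta>
      unfolding \<zeta>_def by (rule prod.cong) auto
    have [measurable]: "\<zeta> \<in> borel_measurable (Q n)" unfolding \<zeta>_def
      by (intro borel_measurable_prod measurable_compose[OF measurable_Q_component m\<alpha>]) auto
    have "(\<integral>x. u x * tensor n (\<alpha>(k := \<gamma>)) x \<partial>Q n) = - (\<integral>x. g x * tensor n (\<alpha>(k := \<eta>)) x \<partial>Q n)"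
      using weak[OF s\<eta> c\<eta>] by (simp add: \<eta>(2))
    also have "(\<integral>x. g x * tensor n (\<alpha>(k := \<eta>)) x \<partial>Q n) = (\<integral>x. (\<integral>t. g (x(k := t)) * \<eta> t \<partial>R) * \<zeta> x \<partial>Q n)"
      using integral_update_tensor[where \<alpha>="\<alpha>(k := \<eta>)", OF g k m\<eta> B'] by (simp add: \<zeta>_def)
    also have "\<dots> = (\<integral>x. - ((\<integral>t. primitive k g (x(k := t)) * \<gamma> t \<partial>R) * \<zeta> x) \<partial>Q n)"
    proof (rule integral_cong_AE)
      show "(\<lambda>x. (\<integral>t. g (x(k := t)) * \<eta> t \<partial>R) * \<zeta> x) \<in> borel_measurable (Q n)"
        using k by (intro borel_measurable_times measurable_line_integral) measurable
      show "(\<lambda>x. - ((\<integral>t. primitive k g (x(k := t)) * \<gamma> t \<partial>R) * \<zeta> x)) \<in> borel_measurable (Q n)"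
        using k by (intro borel_measurable_uminus borel_measurable_times measurable_line_integral) measurable
      show "AE x in Q n. (\<integral>t. g (x(k := t)) * \<eta> t \<partial>R) * \<zeta> x = - ((\<integral>t. primitive k g (x(k := t)) * \<gamma> t \<partial>R) * \<zeta> x)"
        using R.integrable_update[OF J g]
      proof eventually_elim
        case (elim x)
        have "\<bar>\<gamma> t\<bar> \<le> B" for t using B[OF k] by simp
        then have "(\<integral>t. g (x(k := t)) * \<eta> t \<partial>R) = - (\<integral>s. (\<integral>t. indicator {..<s} t * g (x(k := t)) \<partial>R) * \<gamma> s \<partial>R)"
          by (intro integral_by_parts_R[where B=B] elim \<gamma>(2) \<eta>(4)) auto
        then show ?case by (simp add: primitive_update)
      qed
    qed
    also have "- \<dots> = (\<integral>x. (\<integral>t. primitive k g (x(k := t)) * \<gamma> t \<partial>R) * \<zeta> x \<partial>Q n)" by simp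
    also have "\<dots> = (\<integral>x. primitive k g x * tensor n (\<alpha>(k := \<gamma>)) x \<partial>Q n)"
      using integral_update_tensor[where \<alpha>="\<alpha>(k := \<gamma>)", OF V k m\<gamma> B] by (simp add: \<zeta>_def)
    finally have eq: "(\<integral>x. u x * tensor n (\<alpha>(k := \<gamma>)) x \<partial>Q n) = (\<integral>x. primitive k g x * tensor n (\<alpha>(k := \<gamma>)) x \<partial>Q n)" .
    have "integrable (Q n) (\<lambda>x. f x * tensor n (\<alpha>(k := \<gamma>)) x)" if "integrable (Q n) f" for f
      unfolding tensor_def by (rule integrable_mult_tensor[OF that _ m\<gamma> B]) auto
    then show ?thesis using eq u V by (simp add: w_def left_diff_distrib)
  qed
  \<comment> \<open>A fixed bump \<open>\<beta>\<close> of integral one turns any factor \<open>\<alpha>\<^sub>k\<close> into the mean-zero factor \<open>\<alpha>\<^sub>k - (\<integral>\<alpha>\<^sub>k) \<beta>\<close>, and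
  averaging against \<open>\<beta>\<close> in direction \<open>k\<close> yields the candidate for \<open>m\<close>.\<close>
  define a0 b0 where "a0 = lo + 1 / 3" and "b0 = lo + 2 / 3"
  have ab0: "{a0..b0} \<subseteq> interior I" "a0 < b0" by (auto simp: interior_I a0_def b0_def)
  have [measurable]: "bump a0 b0 \<in> borel_measurable borel" by (rule measurable_smooth_real[OF smooth_bump])
  have bump_int: "integrable R f" if f: "smooth_real f" and supp: "\<And>t. t \<notin> {a..b} \<Longrightarrow> f t = 0" for f a b
  proof -
    obtain B where "\<And>t. \<bar>f t\<bar> \<le> B"
      using smooth_compact_support_bounded[of f a b] f supp by blast
    then show ?thesis
      using measurable_R[OF measurable_smooth_real[OF f]] by (intro R.integrable_const_bound[of _ B]) auto
  qed
  have bump0: "bump a0 b0 t = 0" if "t \<notin> {a0..b0}" for t using that by (intro bump_zero) auto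
  define c0 where "c0 = (\<integral>t. bump a0 b0 t \<partial>R)"
  have ab0I: "{a0<..<b0} \<subseteq> I" using interval_lower by (force simp: a0_def b0_def)
  have "c0 \<noteq> 0"
  proof
    assume "c0 = 0"
    then have "AE t in R. bump a0 b0 t = 0"
      unfolding c0_def using bump_int[OF smooth_bump bump0] bump_nonneg
      by (subst (asm) integral_nonneg_eq_0_iff_AE) auto
    then have "AE t in R. t \<notin> {a0<..<b0}"
      by eventually_elim (use bump_pos in force)
    then have "emeasure R {a0<..<b0} = 0"
      using ab0I by (subst (asm) AE_iff_measurable[of "{a0<..<b0}"]) (auto simp: sets_restrict_space_iff)
    then show False
      using ab0 ab0I by (subst (asm) emeasure_restrict_space) auto
  qed
  define \<beta> where "\<beta> = (\<lambda>t. (1 / c0) * bump a0 b0 t)"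
  have \<beta>: "smooth_real \<beta>" unfolding \<beta>_def by (intro smooth_real_mult smooth_real_const smooth_bump)
  have \<beta>0: "\<beta> t = 0" if "t \<notin> {a0..b0}" for t using bump0[OF that] by (simp add: \<beta>_def)
  have \<beta>1: "(\<integral>t. \<beta> t \<partial>R) = 1" using \<open>c0 \<noteq> 0\<close> by (simp add: \<beta>_def c0_def[symmetric])
  have [measurable]: "\<beta> \<in> borel_measurable borel" by (rule measurable_smooth_real[OF \<beta>])
  define m where "m = (\<lambda>x. \<integral>t. w (x(k := t)) * \<beta> t \<partial>R)"
  have m_upd: "m (x(k := t)) = m x" for x t by (simp add: m_def)
  have m_int: "integrable (Q n) m"
  proof -
    obtain B where B: "\<And>t. \<bar>\<beta> t\<bar> \<le> B"
      using smooth_compact_support_bounded[of \<beta> a0 b0] \<beta> \<beta>0 by blast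
    have "integrable (Q n) (\<lambda>x. w x * (\<Prod>i\<in>{k}. (\<lambda>_. \<beta>) i (x i)))"
      by (rule integrable_mult_tensor[OF w, where B=B]) (use k B in auto)
    then have "integrable (Q n) (\<lambda>x. w x * \<beta> (x k))" by simp
    from R.integrable_integral_update[OF J this] show ?thesis by (simp add: m_def)
  qed
  have [measurable]: "m \<in> borel_measurable (Q n)" using m_int by simp
  have "AE x in Q n. w x - m x = 0"
  proof (rule fundamental_lemma)
    show "(\<lambda>x. w x - m x) \<in> borel_measurable (Q n)" by measurable
    fix a b :: real assume "{a..b} \<subseteq> interior I"
    then have "{a..b} \<subseteq> I" using interior_subset by blast
    then have "Pi\<^sub>E {..<n} (\<lambda>_. {a..b}) \<in> sets (Q n)"
      by (intro sets_PiM_I_finite) (auto simp: sets_restrict_space_iff)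
    then show "integrable (Q n) (\<lambda>x. indicator (Pi\<^sub>E {..<n} (\<lambda>_. {a..b})) x * (w x - m x))"
      using w m_int integrable_mult_indicator[of _ "Q n" "\<lambda>x. w x - m x"] by simp
  next
    fix \<alpha> :: "nat \<Rightarrow> real \<Rightarrow> real"
    assume \<alpha>: "\<And>i. i < n \<Longrightarrow> smooth_real (\<alpha> i)" and c\<alpha>: "compactly_supported I n \<alpha>"
    obtain a1 b1 where ab1: "{a1..b1} \<subseteq> interior I" "\<forall>i<n. \<forall>t. t \<notin> {a1..b1} \<longrightarrow> \<alpha> i t = 0"
      using c\<alpha> unfolding compactly_supported_def by blast
    define a b where "a = (if a1 \<le> b1 then min a1 a0 else a0)" and "b = (if a1 \<le> b1 then max b1 b0 else b0)"
    have ab: "{a..b} \<subseteq> interior I" "a \<le> b" "{a1..b1} \<subseteq> {a..b}" "{a0..b0} \<subseteq> {a..b}"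
    proof -
      have "lo < a0" "b0 < lo + 1" by (auto simp: a0_def b0_def)
      moreover have "lo < a1 \<and> b1 < lo + 1" if "a1 \<le> b1" using ab1(1) that unfolding interior_I by auto
      ultimately have "lo < a" "b < lo + 1" by (auto simp: a_def b_def)
      then show "{a..b} \<subseteq> interior I" unfolding interior_I by auto
    qed (use ab0(2) in \<open>auto simp: a_def b_def\<close>)
    define c where "c = (\<integral>t. \<alpha> k t \<partial>R)"
    define \<gamma> where "\<gamma> = (\<lambda>t. \<alpha> k t + (- c) * \<beta> t)"
    have s\<gamma>: "smooth_real \<gamma>" unfolding \<gamma>_def
      by (intro smooth_real_add smooth_real_mult smooth_real_const \<beta> \<alpha> k)
    have supp: "\<alpha> i t = 0" if "i < n" "t \<notin> {a..b}" for i t using ab1(2) ab(3) that by blast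
    have supp\<beta>: "\<beta> t = 0" if "t \<notin> {a..b}" for t using \<beta>0 ab(4) that by blast
    have i\<alpha>: "integrable R (\<alpha> k)" by (rule bump_int[OF \<alpha>[OF k], of a b]) (use supp k in auto)
    have i\<beta>: "integrable R \<beta>" by (rule bump_int[OF \<beta> \<beta>0])
    have mean: "(\<integral>t. \<gamma> t \<partial>R) = 0"
      unfolding \<gamma>_def using i\<alpha> i\<beta> \<beta>1 by (simp add: c_def)
    have 0: "(\<integral>x. w x * tensor n (\<alpha>(k := \<gamma>)) x \<partial>Q n) = 0"
      by (rule orth[OF \<alpha> s\<gamma> mean ab(1,2)]) (use supp supp\<beta> k in \<open>auto simp: \<gamma>_def\<close>)
    have s\<beta>: "smooth_real ((\<alpha>(k := \<beta>)) i)" if "i < n" for i using \<alpha> \<beta> that by auto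
    have c\<beta>: "compactly_supported I n (\<alpha>(k := \<beta>))"
      using supp supp\<beta> by (auto intro!: compactly_supportedI[OF ab(1)] simp del: atLeastAtMost_iff)
    obtain B where "\<forall>i<n. \<forall>t. \<bar>\<alpha> i t\<bar> \<le> B"
      using bounded_tensor_factors[OF \<alpha> c\<alpha>] by blast
    note B = this[rule_format]
    obtain B' where "\<forall>i<n. \<forall>t. \<bar>(\<alpha>(k := \<beta>)) i t\<bar> \<le> B'"
      using bounded_tensor_factors[OF s\<beta> c\<beta>] by blast
    note B' = this[rule_format]
    note m\<alpha> = measurable_smooth_real[OF \<alpha>] and m\<beta> = measurable_smooth_real[OF s\<beta>]
    define \<zeta> where "\<zeta> = (\<lambda>x::nat \<Rightarrow> real. \<Prod>i\<in>{..<n} - {k}. \<alpha> i (x i))"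
    have \<zeta>eq: "(\<Prod>i\<in>{..<n} - {k}. (\<alpha>(k := \<delta>)) i (x i)) = \<zeta> x" for x \<delta>
      unfolding \<zeta>_def by (rule prod.cong) auto
    have int: "integrable (Q n) (\<lambda>x. f x * tensor n \<alpha> x)" "integrable (Q n) (\<lambda>x. f x * tensor n (\<alpha>(k := \<beta>)) x)"
      if "integrable (Q n) f" for f
      unfolding tensor_def
      by (rule integrable_mult_tensor[OF that _ m\<alpha> B]; simp) (rule integrable_mult_tensor[OF that _ m\<beta> B']; simp)
    have "tensor n (\<alpha>(k := \<gamma>)) x = tensor n \<alpha> x - c * tensor n (\<alpha>(k := \<beta>)) x" for x
      unfolding tensor_split[OF k, of "\<alpha>(k := \<gamma>)"] tensor_split[OF k, of \<alpha>] tensor_split[OF k, of "\<alpha>(k := \<beta>)"] \<zeta>eq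
      by (simp add: \<gamma>_def \<zeta>_def left_diff_distrib mult.assoc)
    with 0 have "(\<integral>x. w x * tensor n \<alpha> x - c * (w x * tensor n (\<alpha>(k := \<beta>)) x) \<partial>Q n) = 0"
      by (simp add: right_diff_distrib mult_ac)
    then have "(\<integral>x. w x * tensor n \<alpha> x \<partial>Q n) = c * (\<integral>x. w x * tensor n (\<alpha>(k := \<beta>)) x \<partial>Q n)"
      using int[OF w] by simp
    also have "(\<integral>x. w x * tensor n (\<alpha>(k := \<beta>)) x \<partial>Q n) = (\<integral>x. m x * \<zeta> x \<partial>Q n)"
      using integral_update_tensor[where \<alpha>="\<alpha>(k := \<beta>)", OF w k m\<beta> B'] by (simp add: \<zeta>_def m_def)
    also have "c * (\<integral>x. m x * \<zeta> x \<partial>Q n) = (\<integral>x. (\<integral>t. m (x(k := t)) * \<alpha> k t \<partial>R) * \<zeta> x \<partial>Q n)"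
      by (simp add: m_upd c_def[symmetric] mult_ac)
    also have "\<dots> = (\<integral>x. m x * tensor n \<alpha> x \<partial>Q n)"
      using integral_update_tensor[where \<alpha>="\<alpha>", OF m_int k m\<alpha> B] by (simp add: \<zeta>_def)
    finally show "(\<integral>x. (w x - m x) * tensor n \<alpha> x \<partial>Q n) = 0"
      using int(1)[OF w] int(1)[OF m_int] by (simp add: left_diff_distrib)
  qed
  then have "AE x in Q n. u x = m x + primitive k g x"
    by eventually_elim (simp add: w_def)
  with m_upd show ?thesis by (rule that)
qed

lemma measurable_tensor:
  assumes "\<And>i. i < n \<Longrightarrow> smooth_real (\<alpha> i)"
  shows "tensor n \<alpha> \<in> borel_measurable (Q n)"
  unfolding tensor_def
  by (intro borel_measurable_prod measurable_compose[OF measurable_Q_component measurable_smooth_real[OF assms]]) auto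

lemma integral_cube_AE:
  fixes f f' :: "(nat \<Rightarrow> real) \<Rightarrow> real"
  assumes "f \<in> borel_measurable (cube I n)" "f' \<in> borel_measurable (Q n)" "AE x in Q n. f x = f' x"
  shows "(LINT x|cube I n. f x) = (LINT x|Q n. f' x)"
proof -
  have "(LINT x|cube I n. f x) = (LINT x|cube I n. f' x)"
    using assms by (intro integral_cong_AE) (auto simp: AE_cube intro: measurable_cube)
  also have "\<dots> = (LINT x|Q n. f' x)" by (rule integral_cube[OF assms(2)])
  finally show ?thesis .
qed

text \<open>In other words, \<open>u\<close> has a version that is absolutely continuous on almost every line parallel to an
  axis, with the weak derivative as its derivative there.\<close>

lemma weak_gradient_line_representation:
  assumes G: "is_weak_gradient I n u G" and k: "k < n"
    and u': "integrable (Q n) u'" "AE x in Q n. u x = u' x"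
    and g: "integrable (Q n) g" "AE x in Q n. G k x = g x"
  obtains m where "\<And>x t. m (x(k := t)) = m x" "AE x in Q n. u' x = m x + primitive k g x"
proof (rule weak_derivative_representation[OF u'(1) g(1) k _ that])
  have [measurable]: "u' \<in> borel_measurable (Q n)" "g \<in> borel_measurable (Q n)" using u' g by auto
  have mu: "u \<in> borel_measurable (cube I n)" "G k \<in> borel_measurable (cube I n)"
    using G k by (auto simp: is_weak_gradient_def locally_integrable_def)
  fix \<alpha> :: "nat \<Rightarrow> real \<Rightarrow> real"
  assume \<alpha>: "\<And>i. i < n \<Longrightarrow> smooth_real (\<alpha> i)" and c\<alpha>: "compactly_supported I n \<alpha>"
  have s: "smooth_real ((\<alpha>(k := deriv (\<alpha> k))) i)" if "i < n" for i using \<alpha> that smooth_real_deriv(2) by auto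
  note [measurable] = measurable_tensor[OF \<alpha>] measurable_tensor[OF s]
  have "(LINT x|cube I n. u x * partial k (tensor n \<alpha>) x) = - (LINT x|cube I n. G k x * tensor n \<alpha> x)"
    using G k test_fun_tensor[OF \<alpha> c\<alpha>] unfolding is_weak_gradient_def by blast
  moreover have "(LINT x|cube I n. u x * partial k (tensor n \<alpha>) x) = (LINT x|Q n. u' x * tensor n (\<alpha>(k := deriv (\<alpha> k))) x)"
  proof (rule integral_cube_AE)
    have "tensor n (\<alpha>(k := deriv (\<alpha> k))) \<in> borel_measurable (cube I n)"
      by (rule measurable_cube) (rule measurable_tensor[OF s])
    then show "(\<lambda>x. u x * partial k (tensor n \<alpha>) x) \<in> borel_measurable (cube I n)"
      using mu unfolding partial_tensor[of k n \<alpha>, OF k \<alpha>[OF k]] by (intro borel_measurable_times)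
    show "(\<lambda>x. u' x * tensor n (\<alpha>(k := deriv (\<alpha> k))) x) \<in> borel_measurable (Q n)"
      by (intro borel_measurable_times measurable_tensor[OF s]) simp_all
    show "AE x in Q n. u x * partial k (tensor n \<alpha>) x = u' x * tensor n (\<alpha>(k := deriv (\<alpha> k))) x"
      using u'(2) by eventually_elim (simp add: partial_tensor[of k n \<alpha>, OF k \<alpha>[OF k]])
  qed
  moreover have "(LINT x|cube I n. G k x * tensor n \<alpha> x) = (LINT x|Q n. g x * tensor n \<alpha> x)"
  proof (rule integral_cube_AE)
    have "tensor n \<alpha> \<in> borel_measurable (cube I n)"
      by (rule measurable_cube) (rule measurable_tensor[OF \<alpha>])
    then show "(\<lambda>x. G k x * tensor n \<alpha> x) \<in> borel_measurable (cube I n)"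
      using mu by (intro borel_measurable_times)
    show "(\<lambda>x. g x * tensor n \<alpha> x) \<in> borel_measurable (Q n)"
      by (intro borel_measurable_times measurable_tensor[OF \<alpha>]) simp_all
    show "AE x in Q n. G k x * tensor n \<alpha> x = g x * tensor n \<alpha> x"
      using g(2) by eventually_elim simp
  qed
  ultimately show "(LINT x|Q n. u' x * tensor n (\<alpha>(k := deriv (\<alpha> k))) x) = - (LINT x|Q n. g x * tensor n \<alpha> x)"
    by simp
qed

text \<open>The difference of two weak gradients is orthogonal to all product test functions, so the
  fundamental lemma applies. Hence estimates for one explicit weak gradient carry over to the one
  selected by \<open>weak_gradient\<close>.\<close>

lemma weak_gradient_unique:
  assumes G: "is_weak_gradient I n u G" and G': "is_weak_gradient I n u G'" and i: "i < n"
  shows "AE x in Q n. G i x = G' i x"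
proof -
  have mG: "G i \<in> borel_measurable (cube I n)" "G' i \<in> borel_measurable (cube I n)"
    using G G' i by (auto simp: is_weak_gradient_def locally_integrable_def)
  obtain g where g: "g \<in> borel_measurable (Q n)" "AE x in Q n. G i x = g x"
    using cube_borel_version[OF mG(1)] by blast
  obtain g' where g': "g' \<in> borel_measurable (Q n)" "AE x in Q n. G' i x = g' x"
    using cube_borel_version[OF mG(2)] by blast
  have int: "integrable (Q n) (\<lambda>x. indicator (Pi\<^sub>E {..<n} (\<lambda>_. {a..b})) x * f x)"
    if li: "locally_integrable I n F" and f: "f \<in> borel_measurable (Q n)" "AE x in Q n. F x = f x" and ab: "{a..b} \<subseteq> interior I"
    for F f a b
  proof -
    have "{a..b} \<subseteq> I" using ab interior_subset by blast
    then have S: "Pi\<^sub>E {..<n} (\<lambda>_. {a..b}) \<in> sets (Q n)"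
      by (intro sets_PiM_I_finite) (auto simp: sets_restrict_space_iff)
    have meas: "(\<lambda>x. indicator (Pi\<^sub>E {..<n} (\<lambda>_. {a..b})) x * f x) \<in> borel_measurable (Q n)"
      using S f(1) by measurable
    have int: "integrable (cube I n) (\<lambda>x. indicator (Pi\<^sub>E {..<n} (\<lambda>_. {a..b})) x * F x)"
      using li ab unfolding locally_integrable_def set_integrable_def by simp
    have "integrable (cube I n) (\<lambda>x. indicator (Pi\<^sub>E {..<n} (\<lambda>_. {a..b})) x * f x)"
    proof (rule integrable_cong_AE_imp[OF int measurable_cube[OF meas]])
      show "AE x in cube I n. indicator (Pi\<^sub>E {..<n} (\<lambda>_. {a..b})) x * F x = indicator (Pi\<^sub>E {..<n} (\<lambda>_. {a..b})) x * f x"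
        unfolding AE_cube using f(2) by eventually_elim simp
    qed
    then show ?thesis using integrable_cube[OF meas] by simp
  qed
  have li: "locally_integrable I n (G i)" "locally_integrable I n (G' i)"
    using G G' i by (auto simp: is_weak_gradient_def)
  have "AE x in Q n. g x - g' x = 0"
  proof (rule fundamental_lemma)
    show "(\<lambda>x. g x - g' x) \<in> borel_measurable (Q n)" using g g' by simp
    fix a b :: real assume ab: "{a..b} \<subseteq> interior I"
    show "integrable (Q n) (\<lambda>x. indicator (Pi\<^sub>E {..<n} (\<lambda>_. {a..b})) x * (g x - g' x))"
      using int[OF li(1) g ab] int[OF li(2) g' ab] by (simp add: right_diff_distrib)
  next
    fix \<alpha> :: "nat \<Rightarrow> real \<Rightarrow> real"
    assume \<alpha>: "\<And>i. i < n \<Longrightarrow> smooth_real (\<alpha> i)" and c\<alpha>: "compactly_supported I n \<alpha>"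
    obtain a b where ab: "{a..b} \<subseteq> interior I" "\<forall>i<n. \<forall>t. t \<notin> {a..b} \<longrightarrow> \<alpha> i t = 0"
      using c\<alpha> unfolding compactly_supported_def by blast
    obtain B where "\<forall>i<n. \<forall>t. \<bar>\<alpha> i t\<bar> \<le> B"
      using bounded_tensor_factors[OF \<alpha> c\<alpha>] by blast
    note B = this[rule_format]
    have mt: "tensor n \<alpha> \<in> borel_measurable (Q n)" by (rule measurable_tensor[OF \<alpha>])
    have int_t: "integrable (Q n) (\<lambda>x. f x * tensor n \<alpha> x)"
      and eq_t: "(LINT x|cube I n. F x * tensor n \<alpha> x) = (LINT x|Q n. f x * tensor n \<alpha> x)"
      if "locally_integrable I n F" and f: "f \<in> borel_measurable (Q n)" "AE x in Q n. F x = f x" for F f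
    proof -
      have "integrable (Q n) (\<lambda>x. (indicator (Pi\<^sub>E {..<n} (\<lambda>_. {a..b})) x * f x) * tensor n \<alpha> x)"
        unfolding tensor_def using int[OF that(1) f ab(1)]
        by (intro integrable_mult_tensor[OF _ _ measurable_smooth_real[OF \<alpha>] B]) auto
      moreover have "(indicator (Pi\<^sub>E {..<n} (\<lambda>_. {a..b})) x * f x) * tensor n \<alpha> x = f x * tensor n \<alpha> x"
        if "x \<in> space (Q n)" for x
      proof (cases "x \<in> Pi\<^sub>E {..<n} (\<lambda>_. {a..b})")
        case False
        then have "\<exists>j<n. x j \<notin> {a..b}" using that by (force simp: space_PiM PiE_iff)
        then obtain j where "j < n" "\<alpha> j (x j) = 0" using ab(2) by blast
        then have "tensor n \<alpha> x = 0" unfolding tensor_def by (intro prod_zero) auto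
        then show ?thesis by simp
      qed simp
      ultimately show "integrable (Q n) (\<lambda>x. f x * tensor n \<alpha> x)"
        by (simp cong: Bochner_Integration.integrable_cong)
      show "(LINT x|cube I n. F x * tensor n \<alpha> x) = (LINT x|Q n. f x * tensor n \<alpha> x)"
      proof (rule integral_cube_AE)
        show "(\<lambda>x. F x * tensor n \<alpha> x) \<in> borel_measurable (cube I n)"
          using that(1) measurable_cube[OF mt] unfolding locally_integrable_def by (intro borel_measurable_times) auto
        show "(\<lambda>x. f x * tensor n \<alpha> x) \<in> borel_measurable (Q n)" using f(1) mt by simp
        show "AE x in Q n. F x * tensor n \<alpha> x = f x * tensor n \<alpha> x" using f(2) by eventually_elim simp
      qed
    qed
    have "(LINT x|cube I n. G i x * tensor n \<alpha> x) = (LINT x|cube I n. G' i x * tensor n \<alpha> x)"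
      using G G' i test_fun_tensor[OF \<alpha> c\<alpha>] unfolding is_weak_gradient_def by (metis add.inverse_inverse)
    then show "(\<integral>x. (g x - g' x) * tensor n \<alpha> x \<partial>Q n) = 0"
      using eq_t[OF li(1) g] eq_t[OF li(2) g'] int_t[OF li(1) g] int_t[OF li(2) g']
      by (simp add: left_diff_distrib)
  qed
  with g(2) g'(2) show ?thesis by eventually_elim simp
qed

end

section \<open>Powers of extended nonnegative reals\<close>

lemma epowr_ennreal: "0 \<le> x \<Longrightarrow> epowr (ennreal x) a = ennreal (x powr a)"
  by (simp add: epowr_def)

lemma epowr_top [simp]: "epowr \<infinity> a = \<infinity>" "epowr top a = top"
  by (simp_all add: epowr_def)

lemma epowr_0 [simp]: "epowr 0 a = 0"
  by (simp add: epowr_def)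

lemma epowr_1 [simp]: "epowr x 1 = x"
  by (cases x) (simp_all add: epowr_ennreal)

lemma epowr_one [simp]: "epowr 1 a = 1"
  using epowr_ennreal[of 1 a] by simp

lemma epowr_mono: "x \<le> y \<Longrightarrow> 0 \<le> a \<Longrightarrow> epowr x a \<le> epowr y a"
proof (cases y)
  case (real r)
  assume *: "x \<le> y" "0 \<le> a"
  then obtain q where "x = ennreal q" "0 \<le> q" using real by (cases x) (auto simp: top_unique)
  then show ?thesis using * real by (auto simp: epowr_ennreal intro!: ennreal_leI powr_mono2)
qed simp

lemma epowr_epowr: "epowr (epowr x a) b = epowr x (a * b)"
  by (cases x) (auto simp: epowr_ennreal powr_powr)

lemma epowr_inverse: "0 < a \<Longrightarrow> epowr (epowr x a) (1 / a) = x"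
  by (simp add: epowr_epowr)

lemma epowr_inverse': "0 < a \<Longrightarrow> epowr (epowr x (1 / a)) a = x"
  by (simp add: epowr_epowr)

lemma epowr_mult:
  assumes "0 < a" shows "epowr (x * y) a = epowr x a * epowr y a"
proof (cases x; cases y)
  fix r q assume "x = ennreal r" "0 \<le> r" "y = ennreal q" "0 \<le> q"
  then show ?thesis by (simp add: ennreal_mult[symmetric] epowr_ennreal powr_mult)
next
  fix r assume "x = ennreal r" "0 \<le> r" "y = top"
  then show ?thesis using assms by (cases "r = 0") (auto simp: ennreal_mult_top epowr_ennreal)
next
  fix r assume "y = ennreal r" "0 \<le> r" "x = top"
  then show ?thesis using assms by (cases "r = 0") (auto simp: ennreal_top_mult epowr_ennreal)
qed (simp)

lemma epowr_eq_0_iff: "0 < a \<Longrightarrow> epowr x a = 0 \<longleftrightarrow> x = 0"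
  by (metis epowr_0 epowr_inverse)

lemma epowr_less_top_iff: "epowr x a < top \<longleftrightarrow> x < top"
  by (cases x) (auto simp: epowr_ennreal)

lemma epowr_SUP:
  assumes "0 < a" shows "epowr (SUP i\<in>A. f i) a = (SUP i\<in>A. epowr (f i) a)"
proof (rule antisym)
  let ?z = "SUP i\<in>A. epowr (f i) a"
  have "f i \<le> epowr ?z (1 / a)" if "i \<in> A" for i
  proof -
    have "epowr (f i) a \<le> ?z" by (rule SUP_upper[OF that])
    then have "epowr (epowr (f i) a) (1 / a) \<le> epowr ?z (1 / a)" using assms by (intro epowr_mono) auto
    then show ?thesis by (simp add: epowr_inverse[OF assms])
  qed
  then have "(SUP i\<in>A. f i) \<le> epowr ?z (1 / a)" by (rule SUP_least)
  then have "epowr (SUP i\<in>A. f i) a \<le> epowr (epowr ?z (1 / a)) a" using assms by (intro epowr_mono) auto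
  then show "epowr (SUP i\<in>A. f i) a \<le> ?z" by (simp add: epowr_inverse'[OF assms])
qed (use assms in \<open>auto intro!: SUP_least epowr_mono SUP_upper\<close>)

lemma measurable_epowr [measurable (raw)]:
  "f \<in> borel_measurable M \<Longrightarrow> (\<lambda>x. epowr (f x) a) \<in> borel_measurable M"
proof -
  assume [measurable]: "f \<in> borel_measurable M"
  have [measurable]: "(\<lambda>y. enn2real y powr a) \<in> borel_measurable borel" by measurable
  have "(\<lambda>y. if y \<in> {\<infinity>} then \<infinity> else ennreal (enn2real y powr a)) \<in> borel_measurable borel"
    by (intro measurable_If_set) auto
  then have "(\<lambda>y. epowr y a) \<in> borel_measurable borel" by (simp add: epowr_def cong: if_cong)
  then show ?thesis by measurable
qed

lemma convex_powr_nonneg: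
  fixes x y :: real
  assumes "0 \<le> x" "0 \<le> y" "0 < \<theta>" "\<theta> < 1" "1 \<le> p"
  shows "(\<theta> * x + (1 - \<theta>) * y) powr p \<le> \<theta> * x powr p + (1 - \<theta>) * y powr p"
proof -
  have small: "c powr p \<le> c" if "0 < c" "c < 1" for c :: real
    using powr_mono'[of 1 p c] that assms(5) by simp
  consider "x = 0" | "y = 0" | "x > 0" "y > 0" using assms by linarith
  then show ?thesis
  proof cases
    case 1
    then show ?thesis using assms small[of "1 - \<theta>"] by (simp add: powr_mult mult_right_mono)
  next
    case 2
    then show ?thesis using assms small[of "\<theta>"] by (simp add: powr_mult mult_right_mono)
  next
    case 3
    then show ?thesis
      using convex_onD[OF powr_convex[OF assms(5)], of "1 - \<theta>" x y] assms by (simp)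
  qed
qed

lemma epowr_convex:
  assumes "0 < \<theta>" "\<theta> < 1" "1 \<le> p"
  shows "epowr (ennreal \<theta> * x + ennreal (1 - \<theta>) * y) p
    \<le> ennreal \<theta> * epowr x p + ennreal (1 - \<theta>) * epowr y p"
proof (cases "x = top \<or> y = top")
  case True
  then have "ennreal \<theta> * epowr x p + ennreal (1 - \<theta>) * epowr y p = top"
    using assms by (auto simp: ennreal_mult_top)
  then show ?thesis by (simp only: top_greatest)
next
  case False
  then obtain q r where "x = ennreal q" "0 \<le> q" "y = ennreal r" "0 \<le> r" by (cases x; cases y) auto
  then show ?thesis using assms convex_powr_nonneg[of q r \<theta> p]
    by (simp add: ennreal_mult[symmetric] ennreal_plus[symmetric] epowr_ennreal del: ennreal_plus)
qed

lemma nn_integral_powr: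
  fixes c e :: real
  assumes "0 < e" "0 \<le> c"
  shows "(\<integral>\<^sup>+s. ennreal (s powr (e - 1)) * indicator {0<..<c} s \<partial>lborel) = ennreal (c powr e / e)"
proof -
  have "((\<lambda>x. x powr (e - 1)) has_integral (c powr e / e)) {0..c}"
    using has_integral_powr_from_0[of "e - 1" c] assms by simp
  then have "((\<lambda>x. x powr (e - 1) * indicator {0..c} x) has_integral (c powr e / e)) UNIV"
    by (subst (asm) has_integral_restrict_UNIV[symmetric]) (simp add: indicator_def of_bool_def if_distrib cong: if_cong)
  then have "(\<integral>\<^sup>+s. ennreal (s powr (e - 1) * indicator {0..c} s) \<partial>lborel) = ennreal (c powr e / e)"
    by (intro nn_integral_has_integral_lborel) auto
  moreover have "(\<integral>\<^sup>+s. ennreal (s powr (e - 1)) * indicator {0<..<c} s \<partial>lborel)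
      = (\<integral>\<^sup>+s. ennreal (s powr (e - 1) * indicator {0..c} s) \<partial>lborel)"
    by (rule nn_integral_cong_AE)
      (use AE_lborel_singleton[of 0] AE_lborel_singleton[of c] in eventually_elim, auto simp: indicator_def)
  ultimately show ?thesis by simp
qed

text \<open>The constraint \<open>0 < s\<close> is kept in the indicator because \<open>ennreal\<close> maps negative numbers to \<open>0\<close>.\<close>

lemma epowr_layer_cake:
  assumes "0 < p"
  shows "epowr y p = (\<integral>\<^sup>+s. ennreal (p * s powr (p - 1)) * indicator {s. 0 < s \<and> ennreal s < y} s \<partial>lborel)"
proof -
  have fin: "(\<integral>\<^sup>+s. ennreal (p * s powr (p - 1)) * indicator {0<..<c} s \<partial>lborel) = ennreal (c powr p)"
    if "0 \<le> c" for c
  proof -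
    have "(\<integral>\<^sup>+s. ennreal (p * s powr (p - 1)) * indicator {0<..<c} s \<partial>lborel)
        = ennreal p * (\<integral>\<^sup>+s. ennreal (s powr (p - 1)) * indicator {0<..<c} s \<partial>lborel)"
      using assms by (subst nn_integral_cmult[symmetric]) (auto simp: ennreal_mult mult.assoc)
    also have "\<dots> = ennreal (c powr p)"
      using assms that by (subst nn_integral_powr) (auto simp: ennreal_mult[symmetric])
    finally show ?thesis .
  qed
  show ?thesis
  proof (cases y)
    case (real c)
    then have "{s. 0 < s \<and> ennreal s < y} = {0<..<c}" by (auto simp: ennreal_less_iff)
    then show ?thesis using fin[OF real(1)] real by (simp add: epowr_ennreal)
  next
    case top
    have "ennreal (real k powr p) \<le> (\<integral>\<^sup>+s. ennreal (p * s powr (p - 1)) * indicator {s. 0 < s \<and> ennreal s < y} s \<partial>lborel)" for k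
      unfolding fin[of "real k", symmetric, OF of_nat_0_le_iff]
      by (rule nn_integral_mono) (auto simp: indicator_def top)
    moreover have "filterlim (\<lambda>k. real k powr p) at_top sequentially"
      using assms by real_asymp
    ultimately have "(\<integral>\<^sup>+s. ennreal (p * s powr (p - 1)) * indicator {s. 0 < s \<and> ennreal s < y} s \<partial>lborel) = top"
    proof -
      let ?J = "\<integral>\<^sup>+s. ennreal (p * s powr (p - 1)) * indicator {s. 0 < s \<and> ennreal s < y} s \<partial>lborel"
      assume le: "\<And>k. ennreal (real k powr p) \<le> ?J" and lim: "filterlim (\<lambda>k. real k powr p) at_top sequentially"
      show "?J = top"
      proof (rule ccontr)
        assume "?J \<noteq> top"
        then obtain c where c: "?J = ennreal c" "0 \<le> c" by (cases ?J) auto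
        from lim obtain k where "real k powr p > c"
          by (auto simp: filterlim_at_top_dense eventually_sequentially)
        then show False using le[of k] c by (simp add: ennreal_le_iff)
      qed
    qed
    then show ?thesis by (simp add: top)
  qed
qed

section \<open>Decreasing rearrangements\<close>

abbreviation U :: "real measure" where "U \<equiv> restrict_space lborel {0<..<1}"

lemma nn_integral_lebesgue_on_unit: "(\<integral>\<^sup>+t. f t \<partial>lebesgue_on {0<..<1}) = (\<integral>\<^sup>+t. f t \<partial>U)"
  by (simp add: nn_integral_restrict_space nn_integral_completion)

lemma nn_integral_U: "(\<integral>\<^sup>+t. f t \<partial>U) = (\<integral>\<^sup>+t. f t * indicator {0<..<1} t \<partial>lborel)"
  by (simp add: nn_integral_restrict_space)

lemma space_U: "space U = {0<..<1}"
  by (simp add: space_restrict_space)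

lemma measurable_U: "f \<in> borel_measurable borel \<Longrightarrow> f \<in> borel_measurable U"
  by (intro measurable_restrict_space1) simp

context prob_space begin

lemma distr_fun_le_1: "distr_fun M h s \<le> 1"
  unfolding distr_fun_def by (rule emeasure_le_1)

lemma distr_fun_antimono: "h \<in> borel_measurable M \<Longrightarrow> s \<le> s' \<Longrightarrow> distr_fun M h s' \<le> distr_fun M h s"
  unfolding distr_fun_def by (rule emeasure_mono) (auto intro: le_less_trans)

lemma distr_fun_top: "distr_fun M h top = 0"
  by (simp add: distr_fun_def)

lemma distr_fun_rearrangement:
  assumes [measurable]: "h \<in> borel_measurable M"
  shows "distr_fun M h (rearrangement M h t) \<le> ennreal t"
proof -
  let ?S = "{s. distr_fun M h s \<le> ennreal t}"
  have "top \<in> ?S" by (simp add: distr_fun_top)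
  then obtain f :: "nat \<Rightarrow> ennreal" where f: "decseq f" "range f \<subseteq> ?S" "Inf ?S = (INF i. f i)"
    using ennreal_Inf_countable_INF[of ?S] by blast
  have "{x \<in> space M. h x > Inf ?S} = (\<Union>i. {x \<in> space M. h x > f i})"
    unfolding f(3) by (auto simp: INF_less_iff)
  moreover have "emeasure M (\<Union>i. {x \<in> space M. h x > f i}) = (SUP i. emeasure M {x \<in> space M. h x > f i})"
    using f(1) by (intro SUP_emeasure_incseq[symmetric]) (auto simp: incseq_def decseq_def intro: le_less_trans)
  moreover have "\<dots> \<le> ennreal t" using f(2) by (auto intro!: SUP_least simp: distr_fun_def)
  ultimately show ?thesis by (simp add: distr_fun_def rearrangement_def)
qed

text \<open>The rearrangement is the generalised inverse of the distribution function.\<close>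

lemma less_rearrangement_iff:
  assumes h: "h \<in> borel_measurable M"
  shows "s < rearrangement M h t \<longleftrightarrow> ennreal t < distr_fun M h s"
proof
  assume "s < rearrangement M h t"
  then have "s \<notin> {s. distr_fun M h s \<le> ennreal t}"
    unfolding rearrangement_def using Inf_lower[of s "{s. distr_fun M h s \<le> ennreal t}"] by (metis leD)
  then show "ennreal t < distr_fun M h s" by auto
next
  assume *: "ennreal t < distr_fun M h s"
  show "s < rearrangement M h t"
  proof (rule ccontr)
    assume "\<not> s < rearrangement M h t"
    then have "distr_fun M h s \<le> distr_fun M h (rearrangement M h t)" using distr_fun_antimono[OF h] by simp
    also have "\<dots> \<le> ennreal t" by (rule distr_fun_rearrangement[OF h])
    finally show False using * by simp
  qed
qed

lemma rearrangement_antimono: "t \<le> t' \<Longrightarrow> rearrangement M h t' \<le> rearrangement M h t"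
  unfolding rearrangement_def by (rule Inf_superset_mono) (auto intro: order_trans ennreal_leI)

lemma measurable_rearrangement [measurable]:
  assumes "h \<in> borel_measurable M"
  shows "rearrangement M h \<in> borel_measurable borel"
proof (rule borel_measurableI_greater)
  fix s
  have "{t. s < rearrangement M h t} = {t. ennreal t < distr_fun M h s}"
    using less_rearrangement_iff[OF assms] by auto
  also have "\<dots> \<in> sets borel" by measurable
  finally show "{t \<in> space borel. s < rearrangement M h t} \<in> sets borel" by simp
qed

lemma emeasure_U_less:
  assumes "a \<le> 1" shows "emeasure U {t \<in> space U. ennreal t < a} = a"
proof -
  obtain c where c: "a = ennreal c" "0 \<le> c" "c \<le> 1"
  proof (cases a)
    case (real c)
    then show ?thesis using assms that by (simp add: ennreal_le_1)
  next
    case top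
    then show ?thesis using assms by (simp add: top_unique)
  qed
  have "{t \<in> space U. ennreal t < a} = {0<..<c}"
    using c by (auto simp: space_U ennreal_less_iff)
  moreover have "emeasure U {0<..<c} = emeasure lborel {0<..<c}"
    using c by (intro emeasure_restrict_space) auto
  ultimately show ?thesis using c by simp
qed

lemma distr_eqI_greater:
  fixes f :: "'b \<Rightarrow> ennreal" and g :: "'c \<Rightarrow> ennreal"
  assumes [measurable]: "f \<in> borel_measurable A" "g \<in> borel_measurable B"
    and fin: "emeasure A (space A) < \<infinity>" "emeasure A (space A) = emeasure B (space B)"
    and eq: "\<And>s. emeasure A {x \<in> space A. s < f x} = emeasure B {x \<in> space B. s < g x}"
  shows "distr A borel f = distr B borel g"
proof (rule measure_eqI_generator_eq[where E="insert UNIV (range greaterThan)" and \<Omega>=UNIV and A="\<lambda>_. UNIV"])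
  show "Int_stable (insert UNIV (range (greaterThan :: ennreal \<Rightarrow> _)))"
  proof (rule Int_stableI)
    fix a b :: "ennreal set"
    assume "a \<in> insert UNIV (range greaterThan)" "b \<in> insert UNIV (range greaterThan)"
    moreover have "{x<..} \<inter> {y<..} = {max x y<..}" for x y :: ennreal by auto
    ultimately show "a \<inter> b \<in> insert UNIV (range greaterThan)" by auto
  qed
  have *: "sigma_sets UNIV (insert UNIV (range (greaterThan :: ennreal \<Rightarrow> _))) = sets borel"
  proof -
    have "sets (borel :: ennreal measure) = sigma_sets UNIV (range greaterThan)" by (subst borel_Ioi) simp
    moreover have "sigma_sets UNIV (insert UNIV (range (greaterThan :: ennreal \<Rightarrow> _))) = sigma_sets UNIV (range greaterThan)"
      by (rule sigma_sets_eqI) (auto intro: sigma_sets_top sigma_sets.Basic)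
    ultimately show ?thesis by simp
  qed
  show "sets (distr A borel f) = sigma_sets UNIV (insert UNIV (range greaterThan))"
    "sets (distr B borel g) = sigma_sets UNIV (insert UNIV (range greaterThan))" using * by simp_all
  fix X assume "X \<in> insert UNIV (range (greaterThan :: ennreal \<Rightarrow> _))"
  then consider "X = UNIV" | s where "X = {s<..}" by auto
  then show "emeasure (distr A borel f) X = emeasure (distr B borel g) X"
  proof cases
    case 1 then show ?thesis using fin by (simp add: emeasure_distr)
  next
    case 2
    have "f -` {s<..} \<inter> space A = {x \<in> space A. s < f x}" "g -` {s<..} \<inter> space B = {x \<in> space B. s < g x}" by auto
    then show ?thesis using 2 eq[of s] by (simp add: emeasure_distr)
  qed
qed (use fin in \<open>auto simp: emeasure_distr\<close>)

text \<open>A function and its rearrangement are equimeasurable. Since \<open>s < f\<^sup>*(t)\<close> means \<open>t < \<lambda>\<^sub>f(s)\<close>, the set of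
  these \<open>t\<close> is an interval of length \<open>\<lambda>\<^sub>f(s)\<close>.\<close>

lemma distr_rearrangement:
  assumes h [measurable]: "h \<in> borel_measurable M"
  shows "distr U borel (rearrangement M h) = distr M borel h"
proof (rule distr_eqI_greater)
  show "rearrangement M h \<in> borel_measurable U" by (rule measurable_U) measurable
  show "emeasure U (space U) < \<infinity>" "emeasure U (space U) = emeasure M (space M)"
    by (simp_all add: space_U emeasure_restrict_space emeasure_space_1)
  show "emeasure U {t \<in> space U. s < rearrangement M h t} = emeasure M {x \<in> space M. s < h x}" for s
    unfolding less_rearrangement_iff[OF h] using emeasure_U_less[OF distr_fun_le_1, of h s] by (simp add: distr_fun_def)
qed (rule h)

lemma nn_integral_rearrangement:
  assumes [measurable]: "h \<in> borel_measurable M" "\<psi> \<in> borel_measurable borel"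
  shows "(\<integral>\<^sup>+t. \<psi> (rearrangement M h t) \<partial>U) = (\<integral>\<^sup>+x. \<psi> (h x) \<partial>M)"
proof -
  have [measurable]: "rearrangement M h \<in> borel_measurable U" by (rule measurable_U) measurable
  have "(\<integral>\<^sup>+t. \<psi> (rearrangement M h t) \<partial>U) = (\<integral>\<^sup>+y. \<psi> y \<partial>distr U borel (rearrangement M h))"
    by (subst nn_integral_distr) auto
  also have "\<dots> = (\<integral>\<^sup>+y. \<psi> y \<partial>distr M borel h)" by (simp add: distr_rearrangement)
  also have "\<dots> = (\<integral>\<^sup>+x. \<psi> (h x) \<partial>M)" by (subst nn_integral_distr) auto
  finally show ?thesis .
qed

lemma rearrangement_mono:
  assumes [measurable]: "f \<in> borel_measurable M" "g \<in> borel_measurable M" and "AE x in M. g x \<le> f x"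
  shows "rearrangement M g t \<le> rearrangement M f t"
proof -
  have "distr_fun M g s \<le> distr_fun M f s" for s
    unfolding distr_fun_def using assms(3) by (intro emeasure_mono_AE) (auto elim: eventually_mono)
  then show ?thesis unfolding rearrangement_def by (intro Inf_superset_mono) (auto intro: order_trans)
qed

lemma rearrangement_cmult:
  assumes [measurable]: "f \<in> borel_measurable M" and "0 < \<alpha>"
  shows "rearrangement M (\<lambda>x. ennreal \<alpha> * f x) t = ennreal \<alpha> * rearrangement M f t"
proof -
  have iff: "s < ennreal \<alpha> * y \<longleftrightarrow> ennreal (1 / \<alpha>) * s < y" for s y
  proof -
    have 1: "ennreal (1 / \<alpha>) * (ennreal \<alpha> * y) = y" "ennreal \<alpha> * (ennreal (1 / \<alpha>) * s) = s" for y s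
      using assms(2) by (simp_all add: mult.assoc[symmetric] ennreal_mult[symmetric])
    show ?thesis
    proof
      assume "s < ennreal \<alpha> * y"
      then have "ennreal (1 / \<alpha>) * s < ennreal (1 / \<alpha>) * (ennreal \<alpha> * y)"
        using assms(2) by (intro ennreal_mult_strict_left_mono) auto
      then show "ennreal (1 / \<alpha>) * s < y" by (simp only: 1)
    next
      assume "ennreal (1 / \<alpha>) * s < y"
      then have "ennreal \<alpha> * (ennreal (1 / \<alpha>) * s) < ennreal \<alpha> * y"
        using assms(2) by (intro ennreal_mult_strict_left_mono) auto
      then show "s < ennreal \<alpha> * y" by (simp only: 1)
    qed
  qed
  have "s < rearrangement M (\<lambda>x. ennreal \<alpha> * f x) t \<longleftrightarrow> s < ennreal \<alpha> * rearrangement M f t" for s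
    by (simp add: less_rearrangement_iff iff distr_fun_def)
  then show ?thesis by (metis dense_le_bounded linorder_neqE less_irrefl)
qed

text \<open>The distribution functions increase to that of the limit by continuity of the measure, and
  \<open>less_rearrangement_iff\<close> transfers this to rearrangements.\<close>

lemma rearrangement_SUP:
  assumes F [measurable]: "\<And>j::nat. F j \<in> borel_measurable M" and f [measurable]: "f \<in> borel_measurable M"
    and AE: "AE x in M. incseq (\<lambda>j. F j x) \<and> (\<lambda>j. F j x) \<longlonglongrightarrow> f x"
  shows "incseq (\<lambda>j. rearrangement M (F j) t)" "rearrangement M f t = (SUP j. rearrangement M (F j) t)"
proof -
  have AE': "AE x in M. (\<forall>i j. i \<le> j \<longrightarrow> F i x \<le> F j x) \<and> f x = (SUP j. F j x)"
    using AE
  proof eventually_elim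
    case (elim x)
    then have "f x = (SUP j. F j x)" using LIMSEQ_SUP[of "\<lambda>j. F j x"] LIMSEQ_unique by blast
    with elim show ?case by (simp add: incseq_def)
  qed
  show inc: "incseq (\<lambda>j. rearrangement M (F j) t)"
    unfolding incseq_def using AE' by (auto intro!: rearrangement_mono F elim: eventually_mono)
  have d: "distr_fun M f s = (SUP j. distr_fun M (F j) s)" for s
  proof -
    \<comment> \<open>The partial suprema increase everywhere, the \<open>F j\<close> only almost everywhere.\<close>
    have "distr_fun M f s = emeasure M (\<Union>j. {x \<in> space M. s < (SUP i\<in>{..j}. F i x)})"
      unfolding distr_fun_def using AE'
    proof (intro emeasure_eq_AE, eventually_elim)
      case (elim x)
      have "s < f x \<longleftrightarrow> (\<exists>j. s < F j x)" using elim by (simp add: less_SUP_iff)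
      moreover have "(\<exists>j. s < F j x) \<longleftrightarrow> (\<exists>j. s < (SUP i\<in>{..j}. F i x))" by (auto simp: less_SUP_iff)
      ultimately show ?case by auto
    qed auto
    also have "\<dots> = (SUP j. emeasure M {x \<in> space M. s < (SUP i\<in>{..j}. F i x)})"
      by (intro SUP_emeasure_incseq[symmetric])
        (auto simp: incseq_def less_SUP_iff intro: order_trans)
    also have "\<dots> = (SUP j. distr_fun M (F j) s)"
    proof (rule SUP_cong[OF refl])
      fix j
      show "emeasure M {x \<in> space M. s < (SUP i\<in>{..j}. F i x)} = distr_fun M (F j) s"
        unfolding distr_fun_def using AE'
        by (intro emeasure_eq_AE) (auto simp: less_SUP_iff elim!: eventually_mono intro: less_le_trans)
    qed
    finally show ?thesis .
  qed
  have "s < rearrangement M f t \<longleftrightarrow> s < (SUP j. rearrangement M (F j) t)" for s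
    by (simp add: less_rearrangement_iff less_SUP_iff d)
  then show "rearrangement M f t = (SUP j. rearrangement M (F j) t)"
    by (metis linorder_neqE less_irrefl)
qed

end

section \<open>Lorentz norms\<close>

text \<open>For \<open>e = p/r\<close> this is the \<open>p\<close>-th power of the norm of \<open>L\<^bsup>r,p\<^esup>\<close>. The power is easier to handle than the
  norm: it is convex and additive in the weight.\<close>

definition lorentz_int :: "'a measure \<Rightarrow> real \<Rightarrow> real \<Rightarrow> ('a \<Rightarrow> ennreal) \<Rightarrow> ennreal" where
  "lorentz_int M e p h = (\<integral>\<^sup>+t. ennreal (t powr (e - 1)) * epowr (rearrangement M h t) p \<partial>U)"

lemma lorentz_norm_eq:
  assumes "0 < r" "1 \<le> p"
  shows "lorentz_norm M (ennreal r) (ennreal p) h = epowr (lorentz_int M (p / r) p h) (1 / p)"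
proof -
  have 1: "enn2real (1 / ennreal r) = 1 / r" "enn2real (1 / ennreal p) = 1 / p"
    using assms by (simp_all add: divide_ennreal flip: ennreal_1)
  have "(\<integral>\<^sup>+t. epowr (ennreal (t powr (1 / r - 1 / p)) * rearrangement M h t) p \<partial>U)
      = (\<integral>\<^sup>+t. ennreal (t powr (p / r - 1)) * epowr (rearrangement M h t) p \<partial>U)"
  proof (rule nn_integral_cong)
    fix t :: real assume "t \<in> space U"
    then have "0 < t" by (simp add: space_U)
    moreover have "(1 / r - 1 / p) * p = p / r - 1" using assms by (simp add: field_simps)
    ultimately show "epowr (ennreal (t powr (1 / r - 1 / p)) * rearrangement M h t) p
        = ennreal (t powr (p / r - 1)) * epowr (rearrangement M h t) p"
      using assms by (simp add: epowr_mult epowr_ennreal powr_powr)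
  qed
  then show ?thesis
    using assms by (simp add: lorentz_norm_def Lnorm_def lorentz_int_def 1 nn_integral_lebesgue_on_unit)
qed

context prob_space begin

lemma measurable_rearrangement_U [measurable]:
  "h \<in> borel_measurable M \<Longrightarrow> rearrangement M h \<in> borel_measurable U"
  by (rule measurable_U) (rule measurable_rearrangement)

lemma measurable_id_U [measurable]: "(\<lambda>t. t) \<in> borel_measurable U"
  by (rule measurable_U) simp

lemma emeasure_U_lessThan: "0 \<le> a \<Longrightarrow> a \<le> 1 \<Longrightarrow> (\<integral>\<^sup>+t. indicator {..<a} t \<partial>U) = ennreal a"
proof -
  assume a: "0 \<le> a" "a \<le> 1"
  have "(\<integral>\<^sup>+t. indicator {..<a} t \<partial>U) = (\<integral>\<^sup>+t. indicator {0<..<a} t \<partial>lborel)"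
    unfolding nn_integral_U by (rule nn_integral_cong) (use a in \<open>auto simp: indicator_def\<close>)
  then show ?thesis using a by simp
qed

text \<open>Split \<open>f\<^sup>*\<^sup>p\<close> at height \<open>c\<close> and use equimeasurability for the part above \<open>c\<close>; subtraction on
  \<open>ennreal\<close> is truncated at \<open>0\<close>, so \<open>y - c\<close> is the positive part.\<close>

lemma truncated_integral_le:
  assumes [measurable]: "f \<in> borel_measurable M" and a: "0 \<le> a" "a \<le> 1"
  shows "(\<integral>\<^sup>+t. indicator {..<a} t * epowr (rearrangement M f t) p \<partial>U)
    \<le> ennreal a * c + (\<integral>\<^sup>+x. (epowr (f x) p - c) \<partial>M)"
proof -
  have le: "y \<le> c + (y - c)" for y :: ennreal
    by (cases "c \<le> y") (auto simp: add_diff_inverse_ennreal intro: order_trans[of _ c])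
  have "(\<integral>\<^sup>+t. indicator {..<a} t * epowr (rearrangement M f t) p \<partial>U)
      \<le> (\<integral>\<^sup>+t. c * indicator {..<a} t + (epowr (rearrangement M f t) p - c) \<partial>U)"
    by (rule nn_integral_mono) (auto simp: indicator_def le)
  also have "\<dots> = (\<integral>\<^sup>+t. c * indicator {..<a} t \<partial>U) + (\<integral>\<^sup>+t. (epowr (rearrangement M f t) p - c) \<partial>U)"
    by (rule nn_integral_add) (auto intro!: measurable_U)
  also have "(\<integral>\<^sup>+t. c * indicator {..<a} t \<partial>U) = ennreal a * c"
    using a by (subst nn_integral_cmult) (auto intro!: measurable_U simp: emeasure_U_lessThan mult.commute)
  also have "(\<integral>\<^sup>+t. (epowr (rearrangement M f t) p - c) \<partial>U) = (\<integral>\<^sup>+x. (epowr (f x) p - c) \<partial>M)"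
    by (rule nn_integral_rearrangement) measurable
  finally show ?thesis .
qed

text \<open>At \<open>c = f\<^sup>*(a)\<^sup>p\<close> the split is exact, because \<open>f\<^sup>*\<close> is at least \<open>f\<^sup>*(a)\<close> before \<open>a\<close> and at most \<open>f\<^sup>*(a)\<close>
  after \<open>a\<close>.\<close>

lemma truncated_integral_ge:
  assumes [measurable]: "f \<in> borel_measurable M" and a: "0 \<le> a" "a \<le> 1"
    and p: "0 \<le> p" and fin: "rearrangement M f a < top"
  defines "c \<equiv> epowr (rearrangement M f a) p"
  shows "ennreal a * c + (\<integral>\<^sup>+x. (epowr (f x) p - c) \<partial>M)
    \<le> (\<integral>\<^sup>+t. indicator {..<a} t * epowr (rearrangement M f t) p \<partial>U)"
proof -
  have c: "c < top" using fin by (simp add: c_def epowr_less_top_iff)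
  have "ennreal a * c + (\<integral>\<^sup>+x. (epowr (f x) p - c) \<partial>M)
      = (\<integral>\<^sup>+t. c * indicator {..<a} t \<partial>U) + (\<integral>\<^sup>+t. (epowr (rearrangement M f t) p - c) \<partial>U)"
  proof -
    have "(\<integral>\<^sup>+t. c * indicator {..<a} t \<partial>U) = ennreal a * c"
      using a by (subst nn_integral_cmult) (auto intro!: measurable_U simp: emeasure_U_lessThan mult.commute)
    moreover have "(\<integral>\<^sup>+t. (epowr (rearrangement M f t) p - c) \<partial>U) = (\<integral>\<^sup>+x. (epowr (f x) p - c) \<partial>M)"
      by (rule nn_integral_rearrangement) measurable
    ultimately show ?thesis by simp
  qed
  also have "\<dots> = (\<integral>\<^sup>+t. c * indicator {..<a} t + (epowr (rearrangement M f t) p - c) \<partial>U)"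
    by (rule nn_integral_add[symmetric]) (auto intro!: measurable_U)
  also have "\<dots> \<le> (\<integral>\<^sup>+t. indicator {..<a} t * epowr (rearrangement M f t) p \<partial>U)"
  proof (rule nn_integral_mono)
    fix t
    show "c * indicator {..<a} t + (epowr (rearrangement M f t) p - c)
        \<le> indicator {..<a} t * epowr (rearrangement M f t) p"
    proof (cases "t < a")
      case True
      then have "c \<le> epowr (rearrangement M f t) p"
        unfolding c_def using p by (intro epowr_mono rearrangement_antimono) auto
      then show ?thesis using True by (simp add: add_diff_inverse_ennreal)
    next
      case False
      then have "epowr (rearrangement M f t) p \<le> c"
        unfolding c_def using p by (intro epowr_mono rearrangement_antimono) auto
      then show ?thesis using False c by (auto simp: diff_eq_0_iff_ennreal intro: le_less_trans)
    qed
  qed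
  finally show ?thesis .
qed

text \<open>\<open>\<integral>\<^sub>0\<^sup>a (f\<^sup>*)\<^sup>p\<close> is the minimum over \<open>c\<close> of \<open>a c + \<integral> (f\<^sup>p - c)\<^sup>+\<close>, attained at \<open>c = f\<^sup>*(a)\<^sup>p\<close>.
  This expression is jointly convex in \<open>f\<close> and \<open>c\<close>, so its minimum over \<open>c\<close> is convex in \<open>f\<close>.\<close>

lemma truncated_integral_convex:
  assumes [measurable]: "f \<in> borel_measurable M" "g \<in> borel_measurable M"
    and a: "0 < a" "a \<le> 1" and p: "1 \<le> p" and \<theta>: "0 < \<theta>" "\<theta> < 1"
  shows "(\<integral>\<^sup>+t. indicator {..<a} t * epowr (rearrangement M (\<lambda>x. ennreal \<theta> * f x + ennreal (1 - \<theta>) * g x) t) p \<partial>U)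
    \<le> ennreal \<theta> * (\<integral>\<^sup>+t. indicator {..<a} t * epowr (rearrangement M f t) p \<partial>U)
      + ennreal (1 - \<theta>) * (\<integral>\<^sup>+t. indicator {..<a} t * epowr (rearrangement M g t) p \<partial>U)"
    (is "?K (\<lambda>x. ?F x) \<le> _ * ?K f + _ * ?K g")
proof -
  \<comment> \<open>The choice \<open>c = f\<^sup>*(a)\<^sup>p\<close> needs a finite value; otherwise the right-hand side is infinite.\<close>
  have inf: "?K h = top" if [measurable]: "h \<in> borel_measurable M" and "rearrangement M h a = top" for h
  proof -
    have "(\<integral>\<^sup>+t. top * indicator {..<a} t \<partial>U) \<le> ?K h"
    proof (rule nn_integral_mono)
      fix t
      have "rearrangement M h t = top" if "t < a"
        using rearrangement_antimono[of t a h] that \<open>rearrangement M h a = top\<close> by (simp add: top_unique)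
      then show "top * indicator {..<a} t \<le> indicator {..<a} t * epowr (rearrangement M h t) p"
        by (cases "t < a") auto
    qed
    also have "(\<integral>\<^sup>+t. top * indicator {..<a} t \<partial>U) = top * ennreal a"
      using a by (subst nn_integral_cmult) (auto intro!: measurable_U simp: emeasure_U_lessThan)
    finally show ?thesis using a by (simp add: ennreal_top_mult top_unique)
  qed
  show ?thesis
  proof (cases "rearrangement M f a = top \<or> rearrangement M g a = top")
    case True
    then have "ennreal \<theta> * ?K f + ennreal (1 - \<theta>) * ?K g = top"
      using inf[of f] inf[of g] \<theta> by (auto simp: ennreal_mult_top)
    then show ?thesis by (simp only: top_greatest)
  next
    case False
    define cf cg where "cf = epowr (rearrangement M f a) p" and "cg = epowr (rearrangement M g a) p"
    define c where "c = ennreal \<theta> * cf + ennreal (1 - \<theta>) * cg"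
    have fin: "cf < top" "cg < top" using False by (auto simp: cf_def cg_def epowr_less_top_iff top.not_eq_extremum)
    then have c: "c \<noteq> top" by (auto simp: c_def ennreal_mult_eq_top_iff)
    have le: "y \<le> b + (y - b)" for y b :: ennreal
      by (cases "b \<le> y") (auto simp: add_diff_inverse_ennreal intro: order_trans[of _ b])
    have pt: "epowr (?F x) p - c \<le> ennreal \<theta> * (epowr (f x) p - cf) + ennreal (1 - \<theta>) * (epowr (g x) p - cg)" for x
    proof -
      have "epowr (?F x) p \<le> ennreal \<theta> * epowr (f x) p + ennreal (1 - \<theta>) * epowr (g x) p"
        by (rule epowr_convex[OF \<theta> p])
      also have "\<dots> \<le> ennreal \<theta> * (cf + (epowr (f x) p - cf)) + ennreal (1 - \<theta>) * (cg + (epowr (g x) p - cg))"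
        by (intro add_mono mult_left_mono le) auto
      also have "\<dots> = c + (ennreal \<theta> * (epowr (f x) p - cf) + ennreal (1 - \<theta>) * (epowr (g x) p - cg))"
        by (simp add: c_def algebra_simps)
      finally show ?thesis using c by (simp add: ennreal_minus_le_iff)
    qed
    have "?K (\<lambda>x. ?F x) \<le> ennreal a * c + (\<integral>\<^sup>+x. (epowr (?F x) p - c) \<partial>M)"
      using a by (intro truncated_integral_le) auto
    also have "\<dots> \<le> ennreal a * c + (\<integral>\<^sup>+x. ennreal \<theta> * (epowr (f x) p - cf) + ennreal (1 - \<theta>) * (epowr (g x) p - cg) \<partial>M)"
      by (intro add_left_mono nn_integral_mono pt)
    also have "\<dots> = ennreal \<theta> * (ennreal a * cf + (\<integral>\<^sup>+x. (epowr (f x) p - cf) \<partial>M))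
        + ennreal (1 - \<theta>) * (ennreal a * cg + (\<integral>\<^sup>+x. (epowr (g x) p - cg) \<partial>M))"
      by (simp add: nn_integral_add nn_integral_cmult c_def algebra_simps)
    also have "\<dots> \<le> ennreal \<theta> * ?K f + ennreal (1 - \<theta>) * ?K g"
      unfolding cf_def cg_def using a p False
      by (intro add_mono mult_left_mono truncated_integral_ge) (auto simp: top.not_eq_extremum)
    finally show ?thesis .
  qed
qed

text \<open>For \<open>e \<le> 1\<close> the weight \<open>t\<^bsup>e-1\<^esup>\<close> is decreasing and therefore a mixture of indicators of intervals \<open>(0,a)\<close>;
  the summand \<open>1\<close> is the indicator of the whole interval.\<close>

lemma powr_weight_mixture:
  assumes "0 < t" "t < 1" "e \<le> 1"
  shows "ennreal (t powr (e - 1)) = 1 + (\<integral>\<^sup>+a. ennreal ((1 - e) * a powr (e - 2)) * indicator {..<a} t \<partial>U)"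
proof -
  have "(\<integral>\<^sup>+a. ennreal ((1 - e) * a powr (e - 2)) * indicator {..<a} t \<partial>U)
      = (\<integral>\<^sup>+a. ennreal ((1 - e) * a powr (e - 2)) * indicator {t..1} a \<partial>lborel)"
    unfolding nn_integral_U
  proof (rule nn_integral_cong_AE)
    show "AE a in lborel. ennreal ((1 - e) * a powr (e - 2)) * indicator {..<a} t * indicator {0<..<1} a
        = ennreal ((1 - e) * a powr (e - 2)) * indicator {t..1} a"
      using AE_lborel_singleton[of t] AE_lborel_singleton[of 1]
      by eventually_elim (use assms in \<open>auto simp: indicator_def\<close>)
  qed
  also have "\<dots> = ennreal (- (1 powr (e - 1)) - (- (t powr (e - 1))))"
  proof (rule nn_integral_FTC_Icc[where F="\<lambda>a. - (a powr (e - 1))"])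
    fix x assume "x \<in> {t..1}"
    with assms show "((\<lambda>a. - (a powr (e - 1))) has_real_derivative (1 - e) * x powr (e - 2)) (at x)"
      using assms by (auto intro!: derivative_eq_intros simp: algebra_simps)
  qed (use assms in auto)
  finally have "(\<integral>\<^sup>+a. ennreal ((1 - e) * a powr (e - 2)) * indicator {..<a} t \<partial>U) = ennreal (t powr (e - 1) - 1)"
    by simp
  moreover have "1 \<le> t powr (e - 1)" using powr_mono'[of "e - 1" 0 t] assms by simp
  ultimately show ?thesis by (simp flip: ennreal_1 ennreal_plus)
qed

lemma lorentz_int_mixture:
  assumes [measurable]: "f \<in> borel_measurable M" and e: "e \<le> 1"
  shows "lorentz_int M e p f = (\<integral>\<^sup>+t. indicator {..<1} t * epowr (rearrangement M f t) p \<partial>U)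
    + (\<integral>\<^sup>+a. ennreal ((1 - e) * a powr (e - 2)) * (\<integral>\<^sup>+t. indicator {..<a} t * epowr (rearrangement M f t) p \<partial>U) \<partial>U)"
proof -
  interpret U: prob_space U by (rule prob_spaceI) (simp add: space_U emeasure_restrict_space)
  interpret UU: pair_sigma_finite U U by unfold_locales
  have m1: "(\<lambda>z. fst z) \<in> borel_measurable (U \<Otimes>\<^sub>M U)" "(\<lambda>z. snd z) \<in> borel_measurable (U \<Otimes>\<^sub>M U)"
    by (rule measurable_compose[OF measurable_fst measurable_id_U], rule measurable_compose[OF measurable_snd measurable_id_U])
  have m2: "(\<lambda>z. indicator {..<fst z} (snd z) :: ennreal) \<in> borel_measurable (U \<Otimes>\<^sub>M U)"
    and m2': "(\<lambda>z. indicator {..<snd z} (fst z) :: ennreal) \<in> borel_measurable (U \<Otimes>\<^sub>M U)"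
    unfolding indicator_def lessThan_iff using m1 by measurable
  have mw: "(\<lambda>a. ennreal ((1 - e) * a powr (e - 2))) \<in> borel_measurable U" by measurable
  have mr: "(\<lambda>t. epowr (rearrangement M f t) p) \<in> borel_measurable U" by measurable
  have "lorentz_int M e p f = (\<integral>\<^sup>+t. epowr (rearrangement M f t) p
      + epowr (rearrangement M f t) p * (\<integral>\<^sup>+a. ennreal ((1 - e) * a powr (e - 2)) * indicator {..<a} t \<partial>U) \<partial>U)"
    unfolding lorentz_int_def
    by (rule nn_integral_cong) (use e in \<open>simp add: space_U powr_weight_mixture algebra_simps\<close>)
  also have "\<dots> = (\<integral>\<^sup>+t. epowr (rearrangement M f t) p \<partial>U)
      + (\<integral>\<^sup>+t. epowr (rearrangement M f t) p * (\<integral>\<^sup>+a. ennreal ((1 - e) * a powr (e - 2)) * indicator {..<a} t \<partial>U) \<partial>U)"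
  proof (rule nn_integral_add[OF mr])
    have "(\<lambda>(t, a). ennreal ((1 - e) * a powr (e - 2)) * indicator {..<a} t) \<in> borel_measurable (U \<Otimes>\<^sub>M U)"
      unfolding split_beta' by (intro borel_measurable_times_ennreal measurable_compose[OF measurable_snd mw] m2')
    then have "(\<lambda>t. \<integral>\<^sup>+a. ennreal ((1 - e) * a powr (e - 2)) * indicator {..<a} t \<partial>U) \<in> borel_measurable U"
      by (rule U.borel_measurable_nn_integral)
    then show "(\<lambda>t. epowr (rearrangement M f t) p * (\<integral>\<^sup>+a. ennreal ((1 - e) * a powr (e - 2)) * indicator {..<a} t \<partial>U)) \<in> borel_measurable U"
      using mr by measurable
  qed
  also have "(\<integral>\<^sup>+t. epowr (rearrangement M f t) p * (\<integral>\<^sup>+a. ennreal ((1 - e) * a powr (e - 2)) * indicator {..<a} t \<partial>U) \<partial>U)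
      = (\<integral>\<^sup>+t. \<integral>\<^sup>+a. epowr (rearrangement M f t) p * (ennreal ((1 - e) * a powr (e - 2)) * indicator {..<a} t) \<partial>U \<partial>U)"
    by (intro nn_integral_cong nn_integral_cmult[symmetric] borel_measurable_times_ennreal mw)
      (auto simp: indicator_def)
  also have "\<dots> = (\<integral>\<^sup>+a. \<integral>\<^sup>+t. epowr (rearrangement M f t) p * (ennreal ((1 - e) * a powr (e - 2)) * indicator {..<a} t) \<partial>U \<partial>U)"
  proof (rule UU.Fubini')
    show "(\<lambda>(a, t). epowr (rearrangement M f t) p * (ennreal ((1 - e) * a powr (e - 2)) * indicator {..<a} t)) \<in> borel_measurable (U \<Otimes>\<^sub>M U)"
      unfolding split_beta'
      by (intro borel_measurable_times_ennreal measurable_compose[OF measurable_snd mr] measurable_compose[OF measurable_fst mw] m2)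
  qed
  also have "\<dots> = (\<integral>\<^sup>+a. ennreal ((1 - e) * a powr (e - 2)) * (\<integral>\<^sup>+t. indicator {..<a} t * epowr (rearrangement M f t) p \<partial>U) \<partial>U)"
  proof (rule nn_integral_cong)
    fix a
    have "(\<lambda>t. indicator {..<a} t * epowr (rearrangement M f t) p) \<in> borel_measurable U"
      using mr by (intro borel_measurable_times_ennreal measurable_U) auto
    then show "(\<integral>\<^sup>+t. epowr (rearrangement M f t) p * (ennreal ((1 - e) * a powr (e - 2)) * indicator {..<a} t) \<partial>U)
        = ennreal ((1 - e) * a powr (e - 2)) * (\<integral>\<^sup>+t. indicator {..<a} t * epowr (rearrangement M f t) p \<partial>U)"
      by (subst nn_integral_cmult[symmetric]) (auto simp: mult_ac)
  qed
  also have "(\<integral>\<^sup>+t. epowr (rearrangement M f t) p \<partial>U) = (\<integral>\<^sup>+t. indicator {..<1} t * epowr (rearrangement M f t) p \<partial>U)"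
    by (rule nn_integral_cong) (auto simp: space_U)
  finally show ?thesis .
qed

declare measurable_id_U [measurable del]

end

context prob_space begin

lemma measurable_truncated_integral:
  assumes [measurable]: "f \<in> borel_measurable M"
  shows "(\<lambda>a. \<integral>\<^sup>+t. indicator {..<a} t * epowr (rearrangement M f t) p \<partial>U) \<in> borel_measurable U"
proof -
  interpret U: prob_space U by (rule prob_spaceI) (simp add: space_U emeasure_restrict_space)
  have m1: "(\<lambda>z. fst z) \<in> borel_measurable (U \<Otimes>\<^sub>M U)" "(\<lambda>z. snd z) \<in> borel_measurable (U \<Otimes>\<^sub>M U)"
    by (rule measurable_compose[OF measurable_fst measurable_id_U], rule measurable_compose[OF measurable_snd measurable_id_U])
  have m2: "(\<lambda>z. indicator {..<fst z} (snd z) :: ennreal) \<in> borel_measurable (U \<Otimes>\<^sub>M U)"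
    unfolding indicator_def lessThan_iff using m1 by measurable
  have mr: "(\<lambda>t. epowr (rearrangement M f t) p) \<in> borel_measurable U" by measurable
  have "(\<lambda>(a, t). indicator {..<a} t * epowr (rearrangement M f t) p) \<in> borel_measurable (U \<Otimes>\<^sub>M U)"
    unfolding split_beta' by (intro borel_measurable_times_ennreal measurable_compose[OF measurable_snd mr] m2)
  then show ?thesis by (rule U.borel_measurable_nn_integral)
qed

text \<open>A mixture of the convex functionals \<open>f \<mapsto> \<integral>\<^sub>0\<^sup>a f\<^sup>*\<^sup>p\<close> is convex. This is where \<open>e \<le> 1\<close>, that is \<open>p \<le> r\<close>, is
  used.\<close>

lemma lorentz_int_convex:
  assumes [measurable]: "f \<in> borel_measurable M" "g \<in> borel_measurable M"
    and e: "e \<le> 1" and p: "1 \<le> p" and \<theta>: "0 < \<theta>" "\<theta> < 1"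
  shows "lorentz_int M e p (\<lambda>x. ennreal \<theta> * f x + ennreal (1 - \<theta>) * g x)
    \<le> ennreal \<theta> * lorentz_int M e p f + ennreal (1 - \<theta>) * lorentz_int M e p g"
proof -
  define K where "K = (\<lambda>h a. \<integral>\<^sup>+t. indicator {..<a} t * epowr (rearrangement M h t) p \<partial>U)"
  define w where "w = (\<lambda>a. ennreal ((1 - e) * a powr (e - 2)))"
  let ?F = "\<lambda>x. ennreal \<theta> * f x + ennreal (1 - \<theta>) * g x"
  have mix: "lorentz_int M e p h = K h 1 + (\<integral>\<^sup>+a. w a * K h a \<partial>U)" if "h \<in> borel_measurable M" for h
    unfolding K_def w_def by (rule lorentz_int_mixture[OF that e])
  have K: "K ?F a \<le> ennreal \<theta> * K f a + ennreal (1 - \<theta>) * K g a" if "0 < a" "a \<le> 1" for a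
    unfolding K_def by (rule truncated_integral_convex[OF assms(1,2) that p \<theta>])
  have [measurable]: "w \<in> borel_measurable U" unfolding w_def by (rule measurable_U) measurable
  have [measurable]: "K f \<in> borel_measurable U" "K g \<in> borel_measurable U"
    unfolding K_def by (rule measurable_truncated_integral[OF assms(1)], rule measurable_truncated_integral[OF assms(2)])
  have "(\<integral>\<^sup>+a. w a * K ?F a \<partial>U) \<le> (\<integral>\<^sup>+a. ennreal \<theta> * (w a * K f a) + ennreal (1 - \<theta>) * (w a * K g a) \<partial>U)"
  proof (rule nn_integral_mono)
    fix a assume "a \<in> space U"
    then have "w a * K ?F a \<le> w a * (ennreal \<theta> * K f a + ennreal (1 - \<theta>) * K g a)"
      by (intro mult_left_mono K) (auto simp: space_U)
    then show "w a * K ?F a \<le> ennreal \<theta> * (w a * K f a) + ennreal (1 - \<theta>) * (w a * K g a)"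
      by (simp add: algebra_simps)
  qed
  also have "\<dots> = ennreal \<theta> * (\<integral>\<^sup>+a. w a * K f a \<partial>U) + ennreal (1 - \<theta>) * (\<integral>\<^sup>+a. w a * K g a \<partial>U)"
    by (simp add: nn_integral_add nn_integral_cmult)
  finally have "K ?F 1 + (\<integral>\<^sup>+a. w a * K ?F a \<partial>U)
      \<le> (ennreal \<theta> * K f 1 + ennreal (1 - \<theta>) * K g 1)
        + (ennreal \<theta> * (\<integral>\<^sup>+a. w a * K f a \<partial>U) + ennreal (1 - \<theta>) * (\<integral>\<^sup>+a. w a * K g a \<partial>U))"
    by (intro add_mono K) auto
  then show ?thesis by (simp add: mix algebra_simps)
qed

lemma lorentz_int_cmult:
  assumes [measurable]: "f \<in> borel_measurable M" and "0 < \<alpha>" "0 < p"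
  shows "lorentz_int M e p (\<lambda>x. ennreal \<alpha> * f x) = ennreal (\<alpha> powr p) * lorentz_int M e p f"
proof -
  have "lorentz_int M e p (\<lambda>x. ennreal \<alpha> * f x)
      = (\<integral>\<^sup>+t. ennreal (\<alpha> powr p) * (ennreal (t powr (e - 1)) * epowr (rearrangement M f t) p) \<partial>U)"
    unfolding lorentz_int_def
    by (rule nn_integral_cong) (use assms in \<open>simp add: rearrangement_cmult epowr_mult epowr_ennreal mult_ac\<close>)
  also have "\<dots> = ennreal (\<alpha> powr p) * lorentz_int M e p f"
    unfolding lorentz_int_def by (rule nn_integral_cmult) (use measurable_id_U in measurable)
  finally show ?thesis .
qed

lemma lorentz_int_mono:
  assumes "f \<in> borel_measurable M" "g \<in> borel_measurable M" "AE x in M. g x \<le> f x" "0 \<le> p"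
  shows "lorentz_int M e p g \<le> lorentz_int M e p f"
  unfolding lorentz_int_def
  by (intro nn_integral_mono mult_left_mono epowr_mono rearrangement_mono assms) auto

lemma lorentz_int_ge:
  assumes [measurable]: "f \<in> borel_measurable M" and "e \<le> 1"
  shows "(\<integral>\<^sup>+x. epowr (f x) p \<partial>M) \<le> lorentz_int M e p f"
proof -
  have "(\<integral>\<^sup>+x. epowr (f x) p \<partial>M) = (\<integral>\<^sup>+t. epowr (rearrangement M f t) p \<partial>U)"
    by (rule nn_integral_rearrangement[symmetric]) measurable
  also have "\<dots> \<le> lorentz_int M e p f"
    unfolding lorentz_int_def
  proof (rule nn_integral_mono)
    fix t :: real assume "t \<in> space U"
    then have "1 \<le> t powr (e - 1)" using powr_mono'[of "e - 1" 0 t] assms by (simp add: space_U)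
    then have "1 * epowr (rearrangement M f t) p \<le> ennreal (t powr (e - 1)) * epowr (rearrangement M f t) p"
      by (intro mult_right_mono) auto
    then show "epowr (rearrangement M f t) p \<le> ennreal (t powr (e - 1)) * epowr (rearrangement M f t) p" by simp
  qed
  finally show ?thesis .
qed

lemma lorentz_int_eq_0_iff:
  assumes [measurable]: "f \<in> borel_measurable M" and "e \<le> 1" "0 < p"
  shows "lorentz_int M e p f = 0 \<longleftrightarrow> (AE x in M. f x = 0)"
proof
  assume "lorentz_int M e p f = 0"
  then have "(\<integral>\<^sup>+x. epowr (f x) p \<partial>M) = 0" using lorentz_int_ge[OF assms(1,2), of p] by simp
  then have "AE x in M. epowr (f x) p = 0" by (subst (asm) nn_integral_0_iff_AE) auto
  then show "AE x in M. f x = 0" using assms(3) by (simp add: epowr_eq_0_iff)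
next
  assume "AE x in M. f x = 0"
  then have "lorentz_int M e p f \<le> lorentz_int M e p (\<lambda>x. 0)"
    using assms(3) by (intro lorentz_int_mono) auto
  also have "rearrangement M (\<lambda>x. 0) t = 0" for t
    unfolding rearrangement_def using Inf_lower[of 0 "{s. distr_fun M (\<lambda>x. 0) s \<le> ennreal t}"]
    by (simp add: distr_fun_def)
  then have "lorentz_int M e p (\<lambda>x. 0) = 0" by (simp add: lorentz_int_def)
  finally show "lorentz_int M e p f = 0" by simp
qed

text \<open>A convex functional that is positively homogeneous of degree \<open>p\<close> has a subadditive \<open>p\<close>-th root: if
  \<open>f\<close> and \<open>g\<close> have roots \<open>A\<close> and \<open>B\<close>, write \<open>f + g\<close> as the convex combination of \<open>(A + B)/A f\<close> and
  \<open>(A + B)/B g\<close> with weights \<open>A/(A + B)\<close> and \<open>B/(A + B)\<close>.\<close>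

lemma lorentz_int_subadditive:
  assumes [measurable]: "f \<in> borel_measurable M" "g \<in> borel_measurable M" and e: "e \<le> 1" and p: "1 \<le> p"
  shows "epowr (lorentz_int M e p (\<lambda>x. f x + g x)) (1 / p)
    \<le> epowr (lorentz_int M e p f) (1 / p) + epowr (lorentz_int M e p g) (1 / p)"
proof -
  let ?N = "lorentz_int M e p"
  have p0: "0 < p" using p by simp
  consider "?N f = top \<or> ?N g = top" | "?N f = 0" | "?N g = 0"
    | "0 < ?N f" "?N f < top" "0 < ?N g" "?N g < top"
    using not_gr_zero[of "?N f"] not_gr_zero[of "?N g"] top.not_eq_extremum[of "?N f"] top.not_eq_extremum[of "?N g"]
    by blast
  then show ?thesis
  proof cases
    case 1
    then show ?thesis by (auto simp: top_unique)
  next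
    case 2
    then have "AE x in M. f x = 0" using lorentz_int_eq_0_iff[OF assms(1) e p0] by simp
    then have "?N (\<lambda>x. f x + g x) \<le> ?N g"
      using p by (intro lorentz_int_mono) (auto elim: eventually_mono)
    then have "epowr (?N (\<lambda>x. f x + g x)) (1 / p) \<le> epowr (?N g) (1 / p)" using p by (intro epowr_mono) auto
    then show ?thesis by (simp add: add_increasing)
  next
    case 3
    then have "AE x in M. g x = 0" using lorentz_int_eq_0_iff[OF assms(2) e p0] by simp
    then have "?N (\<lambda>x. f x + g x) \<le> ?N f"
      using p by (intro lorentz_int_mono) (auto elim: eventually_mono)
    then have "epowr (?N (\<lambda>x. f x + g x)) (1 / p) \<le> epowr (?N f) (1 / p)" using p by (intro epowr_mono) auto
    then show ?thesis by (simp add: add_increasing2)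
  next
    case 4
    obtain A where A: "epowr (?N f) (1 / p) = ennreal A" "0 < A"
      using 4(1,2) p by (cases "?N f") (auto simp: epowr_ennreal)
    obtain B where B: "epowr (?N g) (1 / p) = ennreal B" "0 < B"
      using 4(3,4) p by (cases "?N g") (auto simp: epowr_ennreal)
    have Nf: "?N f = ennreal (A powr p)" using arg_cong[OF A(1), of "\<lambda>y. epowr y p"] A(2) p0
      by (simp add: epowr_inverse' epowr_ennreal)
    have Ng: "?N g = ennreal (B powr p)" using arg_cong[OF B(1), of "\<lambda>y. epowr y p"] B(2) p0
      by (simp add: epowr_inverse' epowr_ennreal)
    define \<theta> where "\<theta> = A / (A + B)"
    have \<theta>: "0 < \<theta>" "\<theta> < 1" "1 - \<theta> = B / (A + B)" using A(2) B(2) by (auto simp: \<theta>_def field_simps)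
    define a b where "a = (A + B) / A" and "b = (A + B) / B"
    have ab: "0 < a" "0 < b" using A(2) B(2) by (auto simp: a_def b_def)
    have 1: "ennreal \<theta> * ennreal a = 1" "ennreal (1 - \<theta>) * ennreal b = 1"
      using A(2) B(2) \<theta>(1,2) unfolding \<theta>(3)
      by (auto simp: \<theta>_def a_def b_def ennreal_mult[symmetric])
    have "?N (\<lambda>x. f x + g x) = ?N (\<lambda>x. ennreal \<theta> * (ennreal a * f x) + ennreal (1 - \<theta>) * (ennreal b * g x))"
      by (simp only: mult.assoc[symmetric] 1 mult_1)
    also have "\<dots> \<le> ennreal \<theta> * ?N (\<lambda>x. ennreal a * f x) + ennreal (1 - \<theta>) * ?N (\<lambda>x. ennreal b * g x)"
      using e p \<theta> by (intro lorentz_int_convex) auto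
    also have "\<dots> = ennreal (\<theta> * (a powr p * A powr p) + (1 - \<theta>) * (b powr p * B powr p))"
      using ab \<theta>(1,2) p0 by (simp add: lorentz_int_cmult Nf Ng ennreal_mult[symmetric] ennreal_plus[symmetric] del: ennreal_plus)
    also have "\<theta> * (a powr p * A powr p) + (1 - \<theta>) * (b powr p * B powr p) = (A + B) powr p"
    proof -
      have "a * A = A + B" "b * B = A + B" using A(2) B(2) by (simp_all add: a_def b_def)
      then have "a powr p * A powr p = (A + B) powr p" "b powr p * B powr p = (A + B) powr p"
        by (simp_all only: powr_mult[symmetric])
      then show ?thesis by (simp add: left_diff_distrib)
    qed
    finally have "epowr (?N (\<lambda>x. f x + g x)) (1 / p) \<le> epowr (ennreal ((A + B) powr p)) (1 / p)"
      using p by (intro epowr_mono) auto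
    also have "\<dots> = ennreal (A + B)" using A(2) B(2) p0 by (simp add: epowr_ennreal powr_powr)
    also have "\<dots> = epowr (?N f) (1 / p) + epowr (?N g) (1 / p)" using A B by simp
    finally show ?thesis .
  qed
qed

text \<open>After scaling to \<open>lorentz_int M e p f = 1\<close>, the bound \<open>y \<le> 1 + y\<^sup>p\<close> gives the value \<open>2\<close>.\<close>

lemma nn_integral_le_lorentz:
  assumes [measurable]: "f \<in> borel_measurable M" and e: "e \<le> 1" and p: "1 \<le> p"
  shows "(\<integral>\<^sup>+x. f x \<partial>M) \<le> ennreal 2 * epowr (lorentz_int M e p f) (1 / p)"
proof -
  let ?N = "lorentz_int M e p"
  have p0: "0 < p" using p by simp
  consider "?N f = top" | "?N f = 0" | "0 < ?N f" "?N f < top"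
    using not_gr_zero[of "?N f"] top.not_eq_extremum[of "?N f"] by blast
  then show ?thesis
  proof cases
    case 1 then show ?thesis by (simp add: ennreal_mult_top)
  next
    case 2
    then have "AE x in M. f x = 0" using lorentz_int_eq_0_iff[OF assms(1) e p0] by simp
    then have "(\<integral>\<^sup>+x. f x \<partial>M) = 0" by (subst nn_integral_0_iff_AE) auto
    then show ?thesis by simp
  next
    case 3
    obtain A where A: "epowr (?N f) (1 / p) = ennreal A" "0 < A"
      using 3 p by (cases "?N f") (auto simp: epowr_ennreal)
    have Nf: "?N f = ennreal (A powr p)" using arg_cong[OF A(1), of "\<lambda>y. epowr y p"] A(2) p0
      by (simp add: epowr_inverse' epowr_ennreal)
    have le: "y \<le> 1 + epowr y p" for y
    proof (cases "y \<le> 1")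
      case True then show ?thesis by (auto intro: order_trans)
    next
      case False
      have "y \<le> epowr y p"
      proof (cases y)
        case (real c)
        then have "1 \<le> c" using False by (metis ennreal_1 ennreal_leI nle_le)
        then show ?thesis using real powr_mono[of 1 p c] p by (simp add: epowr_ennreal ennreal_leI)
      qed simp
      then show ?thesis by (rule order_trans) simp
    qed
    have "(\<integral>\<^sup>+x. ennreal (1 / A) * f x \<partial>M) \<le> (\<integral>\<^sup>+x. 1 + epowr (ennreal (1 / A) * f x) p \<partial>M)"
      by (intro nn_integral_mono le)
    also have "\<dots> = 1 + (\<integral>\<^sup>+x. epowr (ennreal (1 / A) * f x) p \<partial>M)"
      by (subst nn_integral_add) (auto simp: emeasure_space_1)
    also have "(\<integral>\<^sup>+x. epowr (ennreal (1 / A) * f x) p \<partial>M) \<le> ?N (\<lambda>x. ennreal (1 / A) * f x)"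
      by (rule lorentz_int_ge[OF _ e]) measurable
    also have "\<dots> = ennreal ((1 / A) powr p) * ennreal (A powr p)"
      using A(2) p0 by (subst lorentz_int_cmult) (auto simp: Nf)
    also have "\<dots> = 1" using A(2) by (simp add: ennreal_mult[symmetric] powr_mult[symmetric])
    finally have "ennreal (1 / A) * (\<integral>\<^sup>+x. f x \<partial>M) \<le> 2" by (simp add: nn_integral_cmult add_left_mono)
    then have "ennreal A * (ennreal (1 / A) * (\<integral>\<^sup>+x. f x \<partial>M)) \<le> ennreal A * 2" by (rule mult_left_mono) simp
    moreover have "ennreal A * (ennreal (1 / A) * (\<integral>\<^sup>+x. f x \<partial>M)) = (\<integral>\<^sup>+x. f x \<partial>M)"
      using A(2) by (simp add: mult.assoc[symmetric] ennreal_mult[symmetric])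
    ultimately show ?thesis using A by (simp add: mult.commute)
  qed
qed

lemma lorentz_int_const:
  assumes "0 < e"
  shows "lorentz_int M e p (\<lambda>_. 1) < top"
proof -
  have "lorentz_int M e p (\<lambda>_. 1) = (\<integral>\<^sup>+t. ennreal (t powr (e - 1)) * indicator {0<..<1} t \<partial>lborel)"
    unfolding lorentz_int_def nn_integral_U
  proof (rule nn_integral_cong)
    fix t :: real
    have "rearrangement M (\<lambda>_. 1) t = 1" if "0 < t" "t < 1"
    proof (rule antisym)
      show "rearrangement M (\<lambda>_. 1) t \<le> 1"
        unfolding rearrangement_def by (rule Inf_lower) (simp add: distr_fun_def)
      show "1 \<le> rearrangement M (\<lambda>_. 1) t"
      proof (rule ccontr)
        assume "\<not> 1 \<le> rearrangement M (\<lambda>_. 1) t"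
        then have "distr_fun M (\<lambda>_. 1) (rearrangement M (\<lambda>_. 1) t) = 1"
          by (simp add: distr_fun_def not_le emeasure_space_1)
        moreover have "distr_fun M (\<lambda>_. 1) (rearrangement M (\<lambda>_. 1) t) \<le> ennreal t"
          by (rule distr_fun_rearrangement) simp
        ultimately show False using that by (simp add: ennreal_ge_1)
      qed
    qed
    then show "ennreal (t powr (e - 1)) * epowr (rearrangement M (\<lambda>_. 1) t) p * indicator {0<..<1} t
        = ennreal (t powr (e - 1)) * indicator {0<..<1} t" by (auto simp: indicator_def)
  qed
  also have "\<dots> < top" using assms by (subst nn_integral_powr) auto
  finally show ?thesis .
qed

theorem ri_norm_lorentz:
  assumes "1 \<le> p" "p \<le> r"
  shows "ri_norm M (lorentz_norm M (ennreal r) (ennreal p))"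
proof -
  have r: "0 < r" and e: "0 < p / r" "p / r \<le> 1" and p0: "0 < p" using assms by auto
  have L: "lorentz_norm M (ennreal r) (ennreal p) = (\<lambda>h. epowr (lorentz_int M (p / r) p h) (1 / p))"
    by (rule ext) (rule lorentz_norm_eq[OF r assms(1)])
  have p1: "0 < 1 / p" using p0 by simp
  let ?N = "lorentz_int M (p / r) p"
  show ?thesis
    unfolding ri_norm_def banach_function_norm_def L
  proof (intro conjI ballI allI impI)
    fix f :: "'a \<Rightarrow> ennreal" assume [measurable]: "f \<in> borel_measurable M"
    show "(epowr (?N f) (1 / p) = 0) = (AE x in M. f x = 0)"
      using lorentz_int_eq_0_iff[OF _ e(2) p0] by (simp only: epowr_eq_0_iff[OF p1]) measurable
    {
      fix g :: "'a \<Rightarrow> ennreal" assume [measurable]: "g \<in> borel_measurable M"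
      show "epowr (?N (\<lambda>x. f x + g x)) (1 / p) \<le> epowr (?N f) (1 / p) + epowr (?N g) (1 / p)"
        by (rule lorentz_int_subadditive[OF _ _ e(2) assms(1)]) measurable
      assume "AE x in M. g x \<le> f x"
      then show "epowr (?N g) (1 / p) \<le> epowr (?N f) (1 / p)"
        using p0 by (intro epowr_mono lorentz_int_mono) auto
    }
    {
      fix \<alpha> :: real assume \<alpha>: "0 \<le> \<alpha>"
      show "epowr (?N (\<lambda>x. ennreal \<alpha> * f x)) (1 / p) = ennreal \<alpha> * epowr (?N f) (1 / p)"
      proof (cases "\<alpha> = 0")
        case True
        have "?N (\<lambda>x. 0) = 0" using lorentz_int_eq_0_iff[of "\<lambda>x. 0", OF _ e(2) p0] by simp
        then show ?thesis using True by simp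
      next
        case False
        then show ?thesis using \<alpha> p0
          by (simp add: lorentz_int_cmult epowr_mult epowr_ennreal powr_powr)
      qed
    }
  next
    fix F :: "nat \<Rightarrow> 'a \<Rightarrow> ennreal" and f :: "'a \<Rightarrow> ennreal"
    assume *: "(\<forall>j. F j \<in> borel_measurable M) \<and> f \<in> borel_measurable M \<and>
        (AE x in M. incseq (\<lambda>j. F j x) \<and> (\<lambda>j. F j x) \<longlonglongrightarrow> f x)"
    then have [measurable]: "\<And>j. F j \<in> borel_measurable M" "f \<in> borel_measurable M" by auto
    have inc: "incseq (\<lambda>j. rearrangement M (F j) t)" and sup: "rearrangement M f t = (SUP j. rearrangement M (F j) t)" for t
      using rearrangement_SUP[of F f t] * by auto
    have incN: "incseq (\<lambda>j. epowr (?N (F j)) (1 / p))"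
      unfolding incseq_def lorentz_int_def using inc p0
      by (auto intro!: epowr_mono nn_integral_mono mult_left_mono simp: incseq_def)
    then show "incseq (\<lambda>j. epowr (?N (F j)) (1 / p))" .
    have "?N f = (SUP j. ?N (F j))"
      unfolding lorentz_int_def sup epowr_SUP[OF p0] SUP_mult_left_ennreal
    proof (rule nn_integral_monotone_convergence_SUP)
      show "incseq (\<lambda>j t. ennreal (t powr (p / r - 1)) * epowr (rearrangement M (F j) t) p)"
        using inc p0 by (auto intro!: epowr_mono mult_left_mono simp: incseq_def le_fun_def)
    qed (use measurable_id_U in measurable)
    then have "epowr (?N f) (1 / p) = (SUP j. epowr (?N (F j)) (1 / p))" by (simp add: epowr_SUP[OF p1])
    then show "(\<lambda>j. epowr (?N (F j)) (1 / p)) \<longlonglongrightarrow> epowr (?N f) (1 / p)"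
      using LIMSEQ_SUP[OF incN] by simp
  next
    show "epowr (?N (\<lambda>_. 1)) (1 / p) < \<infinity>" using lorentz_int_const[OF e(1)] by (simp add: epowr_less_top_iff)
    show "\<exists>C\<ge>0. \<forall>f\<in>borel_measurable M. (\<integral>\<^sup>+x. f x \<partial>M) \<le> ennreal C * epowr (?N f) (1 / p)"
      by (rule exI[of _ 2]) (use nn_integral_le_lorentz[OF _ e(2) assms(1)] in auto)
  next
    fix f g :: "'a \<Rightarrow> real"
    assume "distr_fun M (\<lambda>x. ennreal \<bar>f x\<bar>) = distr_fun M (\<lambda>x. ennreal \<bar>g x\<bar>)"
    then have "rearrangement M (\<lambda>x. ennreal \<bar>f x\<bar>) = rearrangement M (\<lambda>x. ennreal \<bar>g x\<bar>)"
      by (simp add: rearrangement_def fun_eq_iff)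
    then show "fnorm (\<lambda>h. epowr (?N h) (1 / p)) f = fnorm (\<lambda>h. epowr (?N h) (1 / p)) g"
      by (simp add: fnorm_def lorentz_int_def)
  qed
qed

text \<open>Write \<open>f\<^sup>*(t)\<^sup>p\<close> as the integral of \<open>p s\<^bsup>p-1\<^esup>\<close> over \<open>s < f\<^sup>*(t)\<close>, exchange the integrals, and
  replace \<open>s < f\<^sup>*(t)\<close> by \<open>t < \<lambda>\<^sub>f(s)\<close>; the integral of \<open>t\<^bsup>e-1\<^esup>\<close> is then \<open>\<lambda>\<^sub>f(s)\<^sup>e / e\<close>. In this form the Lorentz
  norm only sees measures of level sets.\<close>

lemma lorentz_int_layer_cake:
  assumes [measurable]: "f \<in> borel_measurable M" and e: "0 < e" and p: "0 < p"
  shows "lorentz_int M e p f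
    = (\<integral>\<^sup>+s. ennreal (p * s powr (p - 1)) * (ennreal (1 / e) * epowr (distr_fun M f (ennreal s)) e) * indicator {0<..} s \<partial>lborel)"
proof -
  interpret U: prob_space U by (rule prob_spaceI) (simp add: space_U emeasure_restrict_space)
  interpret UL: pair_sigma_finite U lborel by unfold_locales
  let ?a = "\<lambda>s. ennreal (p * s powr (p - 1)) * indicator {0<..} s" and ?w = "\<lambda>t. ennreal (t powr (e - 1))"
  let ?i = "\<lambda>t s. indicator {s. ennreal s < rearrangement M f t} s :: ennreal"
  have m1: "(\<lambda>z. rearrangement M f (fst z)) \<in> borel_measurable (U \<Otimes>\<^sub>M lborel)"
    by (rule measurable_compose[OF measurable_fst measurable_rearrangement_U]) measurable
  have m2: "(\<lambda>z. ennreal (snd z)) \<in> borel_measurable (U \<Otimes>\<^sub>M lborel)"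
    using measurable_compose[OF measurable_snd, of "\<lambda>s. ennreal s" lborel borel U] by simp
  have m3: "(\<lambda>z. ?i (fst z) (snd z)) \<in> borel_measurable (U \<Otimes>\<^sub>M lborel)"
    unfolding indicator_def mem_Collect_eq using m1 m2 by measurable
  have ma: "?a \<in> borel_measurable lborel" by measurable
  have mw: "?w \<in> borel_measurable U" by (rule measurable_U) measurable
  have m4: "(\<lambda>(t, s). ?w t * (?a s * ?i t s)) \<in> borel_measurable (U \<Otimes>\<^sub>M lborel)"
    unfolding split_beta'
    by (intro borel_measurable_times_ennreal measurable_compose[OF measurable_snd ma] measurable_compose[OF measurable_fst mw] m3)
  have "lorentz_int M e p f = (\<integral>\<^sup>+t. \<integral>\<^sup>+s. ?w t * (?a s * ?i t s) \<partial>lborel \<partial>U)"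
    unfolding lorentz_int_def
  proof (rule nn_integral_cong)
    fix t
    have "epowr (rearrangement M f t) p = (\<integral>\<^sup>+s. ?a s * ?i t s \<partial>lborel)"
      unfolding epowr_layer_cake[OF p] by (rule nn_integral_cong) (auto simp: indicator_def)
    then show "?w t * epowr (rearrangement M f t) p = (\<integral>\<^sup>+s. ?w t * (?a s * ?i t s) \<partial>lborel)"
      by (simp add: nn_integral_cmult)
  qed
  also have "\<dots> = (\<integral>\<^sup>+s. \<integral>\<^sup>+t. ?w t * (?a s * ?i t s) \<partial>U \<partial>lborel)"
    by (rule UL.Fubini'[symmetric]) (rule m4)
  also have "\<dots> = (\<integral>\<^sup>+s. ennreal (p * s powr (p - 1)) * (ennreal (1 / e) * epowr (distr_fun M f (ennreal s)) e) * indicator {0<..} s \<partial>lborel)"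
  proof (rule nn_integral_cong)
    fix s
    obtain c where c: "distr_fun M f (ennreal s) = ennreal c" "0 \<le> c" "c \<le> 1"
      using distr_fun_le_1[of f "ennreal s"] by (cases "distr_fun M f (ennreal s)") (auto simp: top_unique ennreal_le_1)
    have "(\<integral>\<^sup>+t. ?w t * ?i t s \<partial>U) = (\<integral>\<^sup>+t. ?w t * indicator {0<..<c} t \<partial>lborel)"
      unfolding nn_integral_U using c
      by (intro nn_integral_cong) (auto simp: indicator_def less_rearrangement_iff ennreal_less_iff)
    also have "\<dots> = ennreal (1 / e) * epowr (ennreal c) e"
      using c e by (simp add: nn_integral_powr epowr_ennreal ennreal_mult[symmetric])
    finally have *: "(\<integral>\<^sup>+t. ?w t * ?i t s \<partial>U) = ennreal (1 / e) * epowr (distr_fun M f (ennreal s)) e" using c by simp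
    have "(\<lambda>t. ?i t s) \<in> borel_measurable U"
      unfolding indicator_def mem_Collect_eq by measurable
    then have "(\<integral>\<^sup>+t. ?a s * (?w t * ?i t s) \<partial>U) = ?a s * (\<integral>\<^sup>+t. ?w t * ?i t s \<partial>U)"
      by (intro nn_integral_cmult borel_measurable_times_ennreal mw)
    then show "(\<integral>\<^sup>+t. ?w t * (?a s * ?i t s) \<partial>U)
        = ennreal (p * s powr (p - 1)) * (ennreal (1 / e) * epowr (distr_fun M f (ennreal s)) e) * indicator {0<..} s"
      by (simp add: * mult_ac)
  qed
  finally show ?thesis .
qed

end

section \<open>Essential suprema along lines\<close>

lemma measurable_completion_AE:
  fixes f g :: "'a \<Rightarrow> ennreal"
  assumes g: "g \<in> borel_measurable M" and eq: "AE x in M. f x = g x"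
  shows "f \<in> borel_measurable (completion M)"
proof (rule measurableI)
  fix A :: "ennreal set" assume A: "A \<in> sets borel"
  show "f -` A \<inter> space (completion M) \<in> sets (completion M)"
  proof (rule completion.in_sets_AE)
    show "g -` A \<inter> space M \<in> sets (completion M)" using measurable_sets[OF g A] by auto
    show "AE x in completion M. (x \<in> g -` A \<inter> space M) = (x \<in> f -` A \<inter> space (completion M))"
      unfolding AE_completion_iff using eq by eventually_elim auto
  qed auto
qed simp

lemma less_esssup_iff:
  fixes g :: "'a \<Rightarrow> ennreal"
  assumes g: "g \<in> borel_measurable M"
  shows "s < esssup M g \<longleftrightarrow> emeasure M {t \<in> space M. s < g t} \<noteq> 0"
proof
  assume "s < esssup M g"
  then show "emeasure M {t \<in> space M. s < g t} \<noteq> 0" using esssup_pos_measure[OF g, of s] by (metis less_irrefl)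
next
  assume *: "emeasure M {t \<in> space M. s < g t} \<noteq> 0"
  show "s < esssup M g"
  proof (rule ccontr)
    assume "\<not> s < esssup M g"
    then have "{t \<in> space M. s < g t} \<subseteq> {t \<in> space M. esssup M g < g t}" by auto
    then have "emeasure M {t \<in> space M. s < g t} \<le> emeasure M {t \<in> space M. esssup M g < g t}"
      by (rule emeasure_mono) (use g in measurable)
    then show False using * esssup_zero_measure[of M g] by simp
  qed
qed

context unit_interval begin

lemma AE_lebesgue_on: "(AE t in lebesgue_on I. P t) \<longleftrightarrow> (AE t in R. P t)"
proof -
  have "(AE t in lebesgue_on I. P t) \<longleftrightarrow> (AE t in lebesgue. t \<in> I \<longrightarrow> P t)"
    by (rule AE_restrict_space_iff) auto
  also have "\<dots> \<longleftrightarrow> (AE t in lborel. t \<in> I \<longrightarrow> P t)" by (rule AE_completion_iff)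
  also have "\<dots> \<longleftrightarrow> (AE t in R. P t)" by (rule AE_restrict_space_iff[symmetric]) auto
  finally show ?thesis .
qed

lemma esssup_lebesgue_on:
  fixes g g' :: "real \<Rightarrow> ennreal"
  assumes g': "g' \<in> borel_measurable R" and eq: "AE t in R. g t = g' t"
  shows "esssup (lebesgue_on I) g = esssup R g'"
proof -
  have "(\<lambda>t. if t \<in> I then g' t else 0) \<in> borel_measurable lborel"
    using g' by (subst (asm) measurable_restrict_space_iff) auto
  moreover have "AE t in lborel. (if t \<in> I then g t else 0) = (if t \<in> I then g' t else 0)"
    using eq by (subst (asm) AE_restrict_space_iff) (auto elim: eventually_mono)
  ultimately have "(\<lambda>t. if t \<in> I then g t else 0) \<in> borel_measurable lebesgue"
    by (rule measurable_completion_AE)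
  then have g: "g \<in> borel_measurable (lebesgue_on I)"
    by (subst measurable_restrict_space_iff[where c=0]) auto
  have "(AE t in R. g t \<le> z) \<longleftrightarrow> (AE t in R. g' t \<le> z)" for z
  proof
    assume "AE t in R. g t \<le> z" then show "AE t in R. g' t \<le> z" using eq by eventually_elim simp
  next
    assume "AE t in R. g' t \<le> z" then show "AE t in R. g t \<le> z" using eq by eventually_elim simp
  qed
  then show ?thesis using g g' by (simp add: esssup_eq_AE AE_lebesgue_on)
qed

abbreviation Linf :: "(real \<Rightarrow> ennreal) \<Rightarrow> ennreal" where "Linf \<equiv> Lnorm (lebesgue_on I) \<infinity>"

text \<open>The function \<open>mixed_psi\<close> for a Borel function, with the Borel measure on the line.\<close>

definition line_sup :: "nat \<Rightarrow> nat \<Rightarrow> ((nat \<Rightarrow> real) \<Rightarrow> real) \<Rightarrow> (nat \<Rightarrow> real) \<Rightarrow> ennreal" where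
  "line_sup n k f y = esssup R (\<lambda>t. ennreal \<bar>f (insert_coord n k y t)\<bar>)"

lemma mixed_psi_eq: "mixed_psi n Linf k f y = esssup (lebesgue_on I) (\<lambda>t. ennreal \<bar>f (insert_coord n k y t)\<bar>)"
  by (simp add: mixed_psi_def fnorm_def Lnorm_def)

context
  fixes n k :: nat
  assumes k: "k < n"
begin

lemmas measurable_insert [measurable] = measurable_insert_coord[OF prob_R k]
lemmas measurable_delete [measurable] = measurable_delete_coord[OF prob_R k]

lemma delete_in_space: "x \<in> space (Q n) \<Longrightarrow> delete_coord n k x \<in> space (Q (n - 1))"
  by (rule measurable_space[OF measurable_delete])

lemma insert_delete: "x \<in> space (Q n) \<Longrightarrow> insert_coord n k (delete_coord n k x) t = x(k := t)"
  by (rule insert_delete_coord[OF k]) (simp add: space_PiM PiE_iff)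

lemma measurable_insert_section: "y \<in> space (Q (n - 1)) \<Longrightarrow> (\<lambda>t. insert_coord n k y t) \<in> R \<rightarrow>\<^sub>M Q n"
  using measurable_compose[OF measurable_Pair1' measurable_insert] by simp

lemma nn_integral_delete:
  assumes "h \<in> borel_measurable (Q (n - 1))"
  shows "(\<integral>\<^sup>+x. h (delete_coord n k x) \<partial>Q n) = (\<integral>\<^sup>+y. h y \<partial>Q (n - 1))"
proof -
  have "h \<in> borel_measurable (distr (Q n) (Q (n - 1)) (delete_coord n k))" using assms by simp
  from nn_integral_distr[OF measurable_delete this] show ?thesis
    unfolding distr_delete_coord[OF prob_R k] by (rule sym)
qed

lemma AE_insert:
  assumes "AE x in Q n. P x"
  shows "AE y in Q (n - 1). AE t in R. P (insert_coord n k y t)"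
proof -
  obtain N where N: "{x \<in> space (Q n). \<not> P x} \<subseteq> N" "N \<in> sets (Q n)" "emeasure (Q n) N = 0"
    by (rule AE_E[OF assms]) (rule that)
  define h where "h = (\<lambda>y. \<integral>\<^sup>+t. indicator N (insert_coord n k y t) \<partial>R)"
  have m: "(\<lambda>(y, t). indicator N (insert_coord n k y t) :: ennreal) \<in> borel_measurable (Q (n - 1) \<Otimes>\<^sub>M R)"
    using measurable_compose[OF measurable_insert borel_measurable_indicator[OF N(2)]] by (simp add: split_beta')
  have h [measurable]: "h \<in> borel_measurable (Q (n - 1))"
    unfolding h_def by (rule R.borel_measurable_nn_integral[OF m])
  have "0 = (\<integral>\<^sup>+x. indicator N x \<partial>Q n)" using N by simp
  also have "\<dots> = (\<integral>\<^sup>+x. \<integral>\<^sup>+t. indicator N (x(k := t)) \<partial>R \<partial>Q n)"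
    using k N by (intro R.nn_integral_update[symmetric]) auto
  also have "\<dots> = (\<integral>\<^sup>+x. h (delete_coord n k x) \<partial>Q n)"
    by (intro nn_integral_cong) (simp add: h_def insert_delete)
  also have "\<dots> = (\<integral>\<^sup>+y. h y \<partial>Q (n - 1))" by (rule nn_integral_delete[OF h])
  finally have "AE y in Q (n - 1). h y = 0" by (intro iffD1[OF nn_integral_0_iff_AE[OF h]]) (rule sym)
  then show ?thesis using AE_space
  proof eventually_elim
    case (elim y)
    have [measurable]: "(\<lambda>t. indicator N (insert_coord n k y t) :: ennreal) \<in> borel_measurable R"
      using measurable_compose[OF measurable_insert_section[OF elim(2)] borel_measurable_indicator[OF N(2)]] by simp
    have "AE t in R. (indicator N (insert_coord n k y t) :: ennreal) = 0"
      using elim(1) unfolding h_def by (subst (asm) nn_integral_0_iff_AE) auto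
    then show ?case using AE_space
    proof eventually_elim
      case (elim t)
      have "insert_coord n k y t \<in> space (Q n)"
        using measurable_space[OF measurable_insert_section[OF \<open>y \<in> space _\<close>]] elim by simp
      then show ?case using N(1) elim(1) by (auto simp: indicator_def split: if_splits)
    qed
  qed
qed

lemma measurable_emeasure_line:
  assumes [measurable]: "f \<in> borel_measurable (Q n)"
  shows "(\<lambda>y. emeasure R {t \<in> space R. s < ennreal \<bar>f (insert_coord n k y t)\<bar>}) \<in> borel_measurable (Q (n - 1))"
proof -
  have "(\<lambda>z. indicator {x \<in> space (Q n). s < ennreal \<bar>f x\<bar>} ((\<lambda>(y, t). insert_coord n k y t) z) :: ennreal)
      \<in> borel_measurable (Q (n - 1) \<Otimes>\<^sub>M R)"
    by (rule measurable_compose[OF measurable_insert]) measurable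
  then have A: "(\<lambda>y. \<integral>\<^sup>+t. indicator {x \<in> space (Q n). s < ennreal \<bar>f x\<bar>} (insert_coord n k y t) \<partial>R) \<in> borel_measurable (Q (n - 1))"
    by (intro R.borel_measurable_nn_integral) (simp add: split_beta')
  have B: "(\<integral>\<^sup>+t. indicator {x \<in> space (Q n). s < ennreal \<bar>f x\<bar>} (insert_coord n k y t) \<partial>R)
      = emeasure R {t \<in> space R. s < ennreal \<bar>f (insert_coord n k y t)\<bar>}" if y: "y \<in> space (Q (n - 1))" for y
  proof -
    note m = measurable_insert_section[OF y]
    have [measurable]: "(\<lambda>t. f (insert_coord n k y t)) \<in> borel_measurable R"
      by (rule measurable_compose[OF m assms])
    have "(\<integral>\<^sup>+t. indicator {x \<in> space (Q n). s < ennreal \<bar>f x\<bar>} (insert_coord n k y t) \<partial>R)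
        = (\<integral>\<^sup>+t. indicator {t \<in> space R. s < ennreal \<bar>f (insert_coord n k y t)\<bar>} t \<partial>R)"
      using measurable_space[OF m] by (intro nn_integral_cong) (auto simp: indicator_def)
    also have "\<dots> = emeasure R {t \<in> space R. s < ennreal \<bar>f (insert_coord n k y t)\<bar>}"
      by (intro nn_integral_indicator) measurable
    finally show ?thesis .
  qed
  show ?thesis by (rule iffD1[OF measurable_cong[OF B] A])
qed

lemma less_line_sup_iff:
  assumes [measurable]: "f \<in> borel_measurable (Q n)" and y: "y \<in> space (Q (n - 1))"
  shows "s < line_sup n k f y \<longleftrightarrow> emeasure R {t \<in> space R. s < ennreal \<bar>f (insert_coord n k y t)\<bar>} \<noteq> 0"
proof -
  note [measurable] = measurable_insert_section[OF y]
  show ?thesis unfolding line_sup_def by (rule less_esssup_iff) measurable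
qed

lemma measurable_line_sup:
  assumes f: "f \<in> borel_measurable (Q n)"
  shows "line_sup n k f \<in> borel_measurable (Q (n - 1))"
proof (rule borel_measurableI_greater)
  fix s
  note [measurable] = measurable_emeasure_line[OF f, of s]
  have "{y \<in> space (Q (n - 1)). s < line_sup n k f y}
      = {y \<in> space (Q (n - 1)). emeasure R {t \<in> space R. s < ennreal \<bar>f (insert_coord n k y t)\<bar>} \<noteq> 0}"
    using less_line_sup_iff[OF f] by auto
  also have "\<dots> \<in> sets (Q (n - 1))" by measurable
  finally show "{y \<in> space (Q (n - 1)). s < line_sup n k f y} \<in> sets (Q (n - 1))" .
qed

lemma mixed_psi_AE_eq:
  assumes f': "f' \<in> borel_measurable (Q n)" and eq: "AE x in Q n. f x = f' x"
  shows "AE y in Q (n - 1). mixed_psi n Linf k f y = line_sup n k f' y"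
  using AE_insert[OF eq] AE_space
proof eventually_elim
  case (elim y)
  note [measurable] = f' measurable_insert_section[OF elim(2)]
  show ?case unfolding mixed_psi_eq line_sup_def
  proof (rule esssup_lebesgue_on)
    show "(\<lambda>t. ennreal \<bar>f' (insert_coord n k y t)\<bar>) \<in> borel_measurable R" by measurable
    show "AE t in R. ennreal \<bar>f (insert_coord n k y t)\<bar> = ennreal \<bar>f' (insert_coord n k y t)\<bar>"
      using elim(1) by eventually_elim simp
  qed
qed

lemma measurable_mixed_psi:
  assumes "f \<in> borel_measurable (cube I n)"
  shows "mixed_psi n Linf k f \<in> borel_measurable (cube I (n - 1))"
proof -
  obtain f' where f': "f' \<in> borel_measurable (Q n)" "AE x in Q n. f x = f' x"
    using cube_borel_version[OF assms] by blast
  show ?thesis unfolding cube_def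
    by (rule measurable_completion_AE[OF measurable_line_sup[OF f'(1)] mixed_psi_AE_eq[OF f']])
qed

text \<open>The distribution function on \<open>I\<^bsup>n-1\<^esup>\<close> is read off in \<open>I\<^sup>n\<close>, as the measure of a cylinder in direction \<open>k\<close>. All
  later estimates can then take place in one space for all \<open>k\<close>.\<close>

lemma distr_fun_mixed_psi:
  assumes f': "f' \<in> borel_measurable (Q n)" and eq: "AE x in Q n. f x = f' x"
  shows "distr_fun (cube I (n - 1)) (mixed_psi n Linf k f) s
    = emeasure (Q n) {x \<in> space (Q n). emeasure R {t \<in> space R. s < ennreal \<bar>f' (x(k := t))\<bar>} \<noteq> 0}"
proof -
  note [measurable] = measurable_line_sup[OF f'] measurable_cube[OF measurable_line_sup[OF f']]
  have psi: "mixed_psi n Linf k f \<in> borel_measurable (cube I (n - 1))"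
    unfolding cube_def by (rule measurable_completion_AE[OF measurable_line_sup[OF f'] mixed_psi_AE_eq[OF f' eq]])
  have S: "{y \<in> space (Q (n - 1)). s < line_sup n k f' y} \<in> sets (Q (n - 1))"
    using measurable_line_sup[OF f'] by measurable
  have "distr_fun (cube I (n - 1)) (mixed_psi n Linf k f) s
      = emeasure (cube I (n - 1)) {y \<in> space (cube I (n - 1)). s < line_sup n k f' y}"
    unfolding distr_fun_def
  proof (rule emeasure_eq_AE)
    show "AE y in cube I (n - 1). (y \<in> {y \<in> space (cube I (n - 1)). s < mixed_psi n Linf k f y})
        = (y \<in> {y \<in> space (cube I (n - 1)). s < line_sup n k f' y})"
      unfolding AE_cube using mixed_psi_AE_eq[OF f' eq] by eventually_elim auto
    show "{y \<in> space (cube I (n - 1)). s < mixed_psi n Linf k f y} \<in> sets (cube I (n - 1))"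
      using psi by measurable
    show "{y \<in> space (cube I (n - 1)). s < line_sup n k f' y} \<in> sets (cube I (n - 1))"
      using measurable_cube[OF measurable_line_sup[OF f']] by measurable
  qed
  also have "\<dots> = emeasure (Q (n - 1)) {y \<in> space (Q (n - 1)). s < line_sup n k f' y}"
    unfolding space_cube unfolding cube_def
    by (simp only: emeasure_completion[OF sets_completionI_sets[OF S]] main_part[OF S])
  also have "\<dots> = (\<integral>\<^sup>+y. indicator {y \<in> space (Q (n - 1)). s < line_sup n k f' y} y \<partial>Q (n - 1))"
    by (rule nn_integral_indicator[symmetric]) measurable
  also have "\<dots> = (\<integral>\<^sup>+x. indicator {y \<in> space (Q (n - 1)). s < line_sup n k f' y} (delete_coord n k x) \<partial>Q n)"
    by (rule nn_integral_delete[symmetric]) measurable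
  also have "\<dots> = (\<integral>\<^sup>+x. indicator {x \<in> space (Q n). s < line_sup n k f' (delete_coord n k x)} x \<partial>Q n)"
    by (intro nn_integral_cong) (auto simp: indicator_def delete_in_space[simplified])
  also have "\<dots> = emeasure (Q n) {x \<in> space (Q n). s < line_sup n k f' (delete_coord n k x)}"
    by (rule nn_integral_indicator) (use measurable_compose[OF measurable_delete measurable_line_sup[OF f']] in measurable)
  also have "{x \<in> space (Q n). s < line_sup n k f' (delete_coord n k x)}
      = {x \<in> space (Q n). emeasure R {t \<in> space R. s < ennreal \<bar>f' (x(k := t))\<bar>} \<noteq> 0}"
    using less_line_sup_iff[OF f' delete_in_space] by (auto simp: insert_delete)
  finally show ?thesis .
qed

lemma measurable_line_level_set:
  assumes f': "f' \<in> borel_measurable (Q n)"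
  shows "{x \<in> space (Q n). emeasure R {t \<in> space R. s < ennreal \<bar>f' (x(k := t))\<bar>} \<noteq> 0} \<in> sets (Q n)"
proof -
  note [measurable] = measurable_compose[OF measurable_delete measurable_line_sup[OF f']]
  have "{x \<in> space (Q n). emeasure R {t \<in> space R. s < ennreal \<bar>f' (x(k := t))\<bar>} \<noteq> 0}
      = {x \<in> space (Q n). s < line_sup n k f' (delete_coord n k x)}"
    using less_line_sup_iff[OF f' delete_in_space] by (auto simp: insert_delete)
  also have "\<dots> \<in> sets (Q n)" by measurable
  finally show ?thesis .
qed

end

lemma prob_cube: "prob_space (cube I n)"
proof -
  interpret Q: prob_space "Q n" by (rule prob_Q)
  show ?thesis by (rule prob_spaceI) (simp add: cube_def Q.emeasure_space_1)
qed

end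

section \<open>Level sets of Sobolev functions\<close>

text \<open>Where \<open>y\<close> is below the threshold \<open>\<tau>\<close> it is bounded by \<open>\<tau>\<close>, and above it \<open>y = y\<^bsup>1-p\<^esup> y\<^sup>p \<le> \<tau>\<^bsup>1-p\<^esup> y\<^sup>p\<close>. The
  threshold will depend on the level of the level set under consideration.\<close>

lemma young_threshold:
  fixes y \<tau> p :: real
  assumes "0 \<le> y" "0 < \<tau>" "1 \<le> p"
  shows "y \<le> \<tau> powr (1 - p) * y powr p + \<tau>"
proof (cases "y \<le> \<tau>")
  case True
  then show ?thesis using assms by (simp add: add_increasing)
next
  case False
  then have "y powr (1 - p) \<le> \<tau> powr (1 - p)" using assms by (intro powr_mono2') auto
  then have "y powr (1 - p) * y powr p \<le> \<tau> powr (1 - p) * y powr p" by (intro mult_right_mono) auto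
  moreover have "y powr (1 - p) * y powr p = y" using False assms by (simp add: powr_add[symmetric])
  ultimately show ?thesis using assms by linarith
qed

text \<open>Here \<open>a1\<close> and \<open>a2\<close> stand for \<open>a(s)\<close> and \<open>a(2s)\<close>, the sums of the measures of the projections of the level
  sets, and \<open>\<mu>\<close> for the measure of the level set. With \<open>\<tau>\<close> a multiple of \<open>s a(2s)\<^bsup>-1/(n-1)\<^esup>\<close> and
  \<open>\<mu> \<le> a(s)\<^bsup>n/(n-1)\<^esup>\<close>, the term \<open>2 n \<tau> \<mu>\<close> is at most half of \<open>s a(2s)\<close>, unless \<open>a(2s) \<le> \<delta> a(s)\<close>. In the
  exceptional case the second summand of the claim suffices.\<close>

lemma level_recursion:
  fixes n :: nat and p s a1 a2 \<mu> \<gamma> \<delta> :: real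
  defines "e \<equiv> (n - p) / (n - 1)" and "\<kappa> \<equiv> \<delta> powr (n / (n - 1)) / (4 * n)"
  assumes n: "2 \<le> n" and p: "1 \<le> p" "p < n" and s: "0 < s" and nonneg: "0 \<le> a1" "0 \<le> a2" "0 \<le> \<mu>" "0 \<le> \<gamma>"
    and \<delta>: "0 < \<delta>" and lw: "\<mu> ^ (n - 1) \<le> a1 ^ n"
    and est: "\<And>\<tau>. 0 < \<tau> \<Longrightarrow> s * a2 \<le> n * (\<tau> powr (1 - p) * \<gamma> + 2 * \<tau> * \<mu>)"
  shows "s powr p * a2 powr e \<le> 2 * n * \<kappa> powr (1 - p) * \<gamma> + \<delta> powr e * (s powr p * a1 powr e)"
proof (cases "a2 \<le> \<delta> * a1")
  case True
  have "0 \<le> e" using p n by (auto simp: e_def)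
  then have "a2 powr e \<le> (\<delta> * a1) powr e" using True nonneg by (intro powr_mono2) auto
  then have "s powr p * a2 powr e \<le> s powr p * (\<delta> powr e * a1 powr e)"
    using \<delta> nonneg by (intro mult_left_mono) (auto simp: powr_mult)
  moreover have "0 \<le> 2 * n * \<kappa> powr (1 - p) * \<gamma>" using nonneg by simp
  ultimately show ?thesis by (simp add: algebra_simps)
next
  case False
  then have a2: "0 < a2" using \<delta> nonneg by (smt (verit) mult_nonneg_nonneg)
  have n1: "0 < real n - 1" "real (n - 1) = real n - 1" using n by (auto simp: of_nat_diff)
  have \<kappa>: "0 < \<kappa>" using \<delta> n by (simp add: \<kappa>_def)
  have "\<mu> \<le> a1 powr (n / (n - 1))"
  proof (cases "\<mu> = 0")
    case False
    have "\<mu> = (\<mu> powr (real (n - 1))) powr (1 / (real n - 1))"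
      using n1 nonneg by (simp add: powr_powr)
    also have "\<mu> powr (real (n - 1)) = \<mu> ^ (n - 1)" using False nonneg by (simp add: powr_realpow)
    also have "(\<mu> ^ (n - 1)) powr (1 / (real n - 1)) \<le> (a1 ^ n) powr (1 / (real n - 1))"
      using lw nonneg n1 by (intro powr_mono2) auto
    also have "a1 ^ n = a1 powr n" using nonneg n by (cases "a1 = 0") (auto simp: powr_realpow)
    also have "(a1 powr n) powr (1 / (real n - 1)) = a1 powr (n / (n - 1))" unfolding n1(2) by (simp add: powr_powr)
    finally show ?thesis .
  qed simp
  also have "\<dots> \<le> (a2 / \<delta>) powr (n / (n - 1))"
    using False \<delta> nonneg n1 by (intro powr_mono2) (auto simp: field_simps)
  also have "\<dots> = a2 powr (n / (n - 1)) / \<delta> powr (n / (n - 1))"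
    using a2 \<delta> by (simp add: powr_divide)
  finally have \<mu>: "\<mu> \<le> a2 powr (n / (n - 1)) / \<delta> powr (n / (n - 1))" .
  define \<tau> where "\<tau> = \<kappa> * s * a2 powr (- 1 / (real n - 1))"
  have \<tau>: "0 < \<tau>" using \<kappa> s a2 by (simp add: \<tau>_def)
  have "n * (2 * \<tau> * \<mu>) \<le> n * (2 * \<tau> * (a2 powr (n / (n - 1)) / \<delta> powr (n / (n - 1))))"
    using \<tau> \<mu> by (intro mult_left_mono) auto
  also have "\<dots> = s / 2 * (a2 powr (- 1 / (real n - 1)) * a2 powr (n / (n - 1)))"
    using \<delta> n by (simp add: \<tau>_def \<kappa>_def field_simps)
  also have "a2 powr (- 1 / (real n - 1)) * a2 powr (n / (n - 1)) = a2"
  proof -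
    have "- 1 / (real n - 1) + real n / real (n - 1) = 1"
      using n1(1) unfolding n1(2) by (simp add: diff_divide_distrib[symmetric])
    then show ?thesis using a2 by (simp add: powr_add[symmetric])
  qed
  finally have "n * (2 * \<tau> * \<mu>) \<le> s * a2 / 2" by simp
  moreover have "s * a2 \<le> n * (\<tau> powr (1 - p) * \<gamma>) + n * (2 * \<tau> * \<mu>)"
    using est[OF \<tau>] by (simp add: distrib_left)
  ultimately have "s * a2 \<le> 2 * n * (\<tau> powr (1 - p) * \<gamma>)" by linarith
  also have "\<tau> powr (1 - p) = \<kappa> powr (1 - p) * s powr (1 - p) * a2 powr ((p - 1) / (real n - 1))"
  proof -
    have "(- 1 / (real n - 1)) * (1 - p) = (p - 1) / (real n - 1)" using n1 by (simp add: field_simps)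
    then show ?thesis using \<kappa> s a2 by (simp add: \<tau>_def powr_mult powr_powr)
  qed
  finally have "s powr (p - 1) * a2 powr (- (p - 1) / (real n - 1)) * (s * a2)
      \<le> s powr (p - 1) * a2 powr (- (p - 1) / (real n - 1))
        * (2 * n * (\<kappa> powr (1 - p) * s powr (1 - p) * a2 powr ((p - 1) / (real n - 1)) * \<gamma>))"
    using s a2 by (intro mult_left_mono) auto
  also have "\<dots> = 2 * n * \<kappa> powr (1 - p) * \<gamma> * (s powr (p - 1) * s powr (1 - p))
      * (a2 powr (- (p - 1) / (real n - 1)) * a2 powr ((p - 1) / (real n - 1)))"
    by (simp add: mult_ac)
  also have "s powr (p - 1) * s powr (1 - p) = 1" using s by (simp add: powr_add[symmetric])
  also have "a2 powr (- (p - 1) / (real n - 1)) * a2 powr ((p - 1) / (real n - 1)) = 1"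
    using a2 by (simp add: powr_add[symmetric] add_divide_distrib[symmetric])
  also have "s powr (p - 1) * a2 powr (- (p - 1) / (real n - 1)) * (s * a2)
      = (s powr (p - 1) * s powr 1) * (a2 powr (- (p - 1) / (real n - 1)) * a2 powr 1)"
    using s a2 by (simp add: mult_ac)
  also have "\<dots> = s powr p * a2 powr e"
  proof -
    have "- (p - 1) / (real n - 1) + 1 = e" using n1 by (simp add: e_def field_simps)
    then show ?thesis by (simp only: powr_add[symmetric]) simp
  qed
  finally have "s powr p * a2 powr e \<le> 2 * n * \<kappa> powr (1 - p) * \<gamma>" by simp
  moreover have "0 \<le> \<delta> powr e * (s powr p * a1 powr e)" by simp
  ultimately show ?thesis by linarith
qed

context unit_interval begin

text \<open>Up to null sets, the cylinder over the projection of the level set along the \<open>k\<close>th axis.\<close>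

definition projection :: "nat \<Rightarrow> nat \<Rightarrow> ((nat \<Rightarrow> real) \<Rightarrow> real) \<Rightarrow> real \<Rightarrow> (nat \<Rightarrow> real) set" where
  "projection n k u s = {x \<in> space (Q n). emeasure R {t \<in> space R. ennreal s < ennreal \<bar>u (x(k := t))\<bar>} \<noteq> 0}"

lemma projection_sets: "u \<in> borel_measurable (Q n) \<Longrightarrow> k < n \<Longrightarrow> projection n k u s \<in> sets (Q n)"
  unfolding projection_def by (rule measurable_line_level_set)

lemma projection_update:
  "x \<in> space (Q n) \<Longrightarrow> k < n \<Longrightarrow> t \<in> space R \<Longrightarrow> x \<in> projection n k u s \<longleftrightarrow> x(k := t) \<in> projection n k u s"
  using Q_update[of x n k t] by (simp add: projection_def)

lemma measurable_section:
  assumes "u \<in> borel_measurable (Q n)" "k < n" "x \<in> space (Q n)"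
  shows "(\<lambda>t. u (x(k := t))) \<in> borel_measurable R"
proof -
  have "(\<lambda>t. (\<lambda>(x, t). x(k := t)) (x, t)) \<in> R \<rightarrow>\<^sub>M Q n"
    using assms by (intro measurable_compose[OF measurable_Pair1' R.measurable_update]) auto
  then have "(\<lambda>t. x(k := t)) \<in> R \<rightarrow>\<^sub>M Q n" by simp
  then show ?thesis by (rule measurable_compose[OF _ assms(1)])
qed

lemma AE_level_set_in_projection:
  assumes u: "u \<in> borel_measurable (Q n)" and k: "k < n" and s: "0 \<le> s"
  shows "AE x in Q n. s < \<bar>u x\<bar> \<longrightarrow> x \<in> projection n k u s"
proof -
  note [measurable] = u projection_sets[OF u k, of s]
  define N where "N = {x \<in> space (Q n). s < \<bar>u x\<bar>} - projection n k u s"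
  have N [measurable]: "N \<in> sets (Q n)" unfolding N_def by measurable
  have "emeasure (Q n) N = (\<integral>\<^sup>+x. \<integral>\<^sup>+t. indicator N (x(k := t)) \<partial>R \<partial>Q n)"
    using k by (subst R.nn_integral_update) auto
  also have "\<dots> = (\<integral>\<^sup>+x. 0 \<partial>Q n)"
  proof (rule nn_integral_cong)
    fix x assume x: "x \<in> space (Q n)"
    note [measurable] = measurable_section[OF u k x]
    show "(\<integral>\<^sup>+t. indicator N (x(k := t)) \<partial>R) = 0"
    proof (cases "x \<in> projection n k u s")
      case True
      then have "(\<integral>\<^sup>+t. indicator N (x(k := t)) \<partial>R) = (\<integral>\<^sup>+t. 0 \<partial>R)"
        using projection_update[OF x k, of _ u s] by (intro nn_integral_cong) (auto simp: N_def indicator_def)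
      then show ?thesis by simp
    next
      case False
      then have 0: "emeasure R {t \<in> space R. ennreal s < ennreal \<bar>u (x(k := t))\<bar>} = 0"
        using x by (simp add: projection_def)
      have "(\<integral>\<^sup>+t. indicator N (x(k := t)) \<partial>R) \<le> (\<integral>\<^sup>+t. indicator {t \<in> space R. ennreal s < ennreal \<bar>u (x(k := t))\<bar>} t \<partial>R)"
        using s by (intro nn_integral_mono) (auto simp: N_def indicator_def ennreal_less_iff)
      also have "\<dots> = emeasure R {t \<in> space R. ennreal s < ennreal \<bar>u (x(k := t))\<bar>}"
        by (rule nn_integral_indicator) measurable
      finally show ?thesis using 0 by simp
    qed
  qed
  finally have "N \<in> null_sets (Q n)" by (simp add: null_sets_def N)
  then have "AE x in Q n. x \<notin> N" by (rule AE_not_in)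
  then show ?thesis using AE_space by eventually_elim (auto simp: N_def)
qed

text \<open>Apply the Loomis--Whitney inequality to the level set and its projections. The second alternative
  covers \<open>n = 1\<close>, where the power on the left is \<open>1\<close> even for a null set.\<close>

lemma level_set_le_projections:
  assumes u: "u \<in> borel_measurable (Q n)" and n: "0 < n" and s: "0 \<le> s"
  shows "measure (Q n) {x \<in> space (Q n). s < \<bar>u x\<bar>} ^ (n - 1)
    \<le> (\<Sum>k<n. measure (Q n) (projection n k u s)) ^ n \<or> measure (Q n) {x \<in> space (Q n). s < \<bar>u x\<bar>} = 0"
proof -
  interpret Q: prob_space "Q n" by (rule prob_Q)
  note [measurable] = u
  define F where "F = {x \<in> space (Q n). s < \<bar>u x\<bar>} \<inter> (\<Inter>k\<in>{..<n}. projection n k u s)"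
  have F: "F \<in> sets (Q n)"
    unfolding F_def using n projection_sets[OF u] by (intro sets.Int sets.finite_INT) auto
  have "AE x in Q n. \<forall>k\<in>{..<n}. s < \<bar>u x\<bar> \<longrightarrow> x \<in> projection n k u s"
    by (intro AE_finite_allI AE_level_set_in_projection u s) auto
  then have eq: "measure (Q n) {x \<in> space (Q n). s < \<bar>u x\<bar>} = measure (Q n) F"
    using F by (intro Q.finite_measure_eq_AE) (auto simp: F_def elim: eventually_mono)
  show ?thesis
  proof (cases "F = {}")
    case True then show ?thesis using eq by simp
  next
    case False
    have "measure (Q n) F ^ (card {..<n} - 1) \<le> (\<Sum>k\<in>{..<n}. measure (Q n) (projection n k u s)) ^ card {..<n}"
      by (rule R.loomis_whitney[OF _ _ F False])
        (use n projection_sets[OF u] projection_update in \<open>auto simp: F_def\<close>)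
    then show ?thesis using eq by simp
  qed
qed

text \<open>A line that meets the level set at height \<open>2s\<close> contributes at least \<open>s\<close> to the right-hand side by
  \<open>level_crossing_estimate\<close>; integrate over all lines in direction \<open>k\<close>.\<close>

lemma projection_level_estimate:
  assumes u: "integrable (Q n) u" and g: "integrable (Q n) g" and k: "k < n" and s: "0 < s"
    and m: "\<And>x t. m (x(k := t)) = m x" and rep: "AE x in Q n. u x = m x + primitive k g x"
  shows "ennreal s * emeasure (Q n) (projection n k u (2 * s))
    \<le> (\<integral>\<^sup>+x. indicator {x. s < \<bar>u x\<bar> \<and> \<bar>u x\<bar> \<le> 2 * s} x * ennreal \<bar>g x\<bar> \<partial>Q n)
      + ennreal s * emeasure (Q n) {x \<in> space (Q n). s < \<bar>u x\<bar>}"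
proof -
  have mu [measurable]: "u \<in> borel_measurable (Q n)" and mg [measurable]: "g \<in> borel_measurable (Q n)" using u g by auto
  have J: "finite {..<n}" "k \<in> {..<n}" using k by auto
  define a where "a = (\<lambda>x. indicator {x. s < \<bar>u x\<bar> \<and> \<bar>u x\<bar> \<le> 2 * s} x * ennreal \<bar>g x\<bar>)"
  define b where "b = (\<lambda>x. indicator {x. s < \<bar>u x\<bar>} x :: ennreal)"
  have a [measurable]: "a \<in> borel_measurable (Q n)" and b [measurable]: "b \<in> borel_measurable (Q n)"
    unfolding a_def b_def indicator_def mem_Collect_eq by measurable
  have ma: "(\<lambda>x. \<integral>\<^sup>+t. a (x(k := t)) \<partial>R) \<in> borel_measurable (Q n)"
    and mb: "(\<lambda>x. \<integral>\<^sup>+t. b (x(k := t)) \<partial>R) \<in> borel_measurable (Q n)"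
    using measurable_compose[OF R.measurable_update[OF J(2)] a] measurable_compose[OF R.measurable_update[OF J(2)] b]
    by (auto intro!: R.borel_measurable_nn_integral simp: split_beta')
  have "ennreal s * emeasure (Q n) (projection n k u (2 * s)) = (\<integral>\<^sup>+x. ennreal s * indicator (projection n k u (2 * s)) x \<partial>Q n)"
    using projection_sets[OF mu k] by (subst nn_integral_cmult) auto
  also have "\<dots> \<le> (\<integral>\<^sup>+x. (\<integral>\<^sup>+t. a (x(k := t)) \<partial>R) + ennreal s * (\<integral>\<^sup>+t. b (x(k := t)) \<partial>R) \<partial>Q n)"
  proof (rule nn_integral_mono_AE)
    show "AE x in Q n. ennreal s * indicator (projection n k u (2 * s)) x
        \<le> (\<integral>\<^sup>+t. a (x(k := t)) \<partial>R) + ennreal s * (\<integral>\<^sup>+t. b (x(k := t)) \<partial>R)"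
      using R.integrable_update[OF J g] R.AE_update[OF J rep] AE_space
    proof eventually_elim
      case (elim x)
      note [measurable] = measurable_section[OF mu k elim(3)]
      show ?case
      proof (cases "x \<in> projection n k u (2 * s)")
        case True
        have "ennreal s \<le> (\<integral>\<^sup>+t. indicator {t. s < \<bar>u (x(k := t))\<bar> \<and> \<bar>u (x(k := t))\<bar> \<le> 2 * s} t * ennreal \<bar>g (x(k := t))\<bar> \<partial>R)
            + ennreal s * emeasure R {t \<in> space R. \<bar>u (x(k := t))\<bar> > s}"
        proof (rule level_crossing_estimate[OF I_sets interval unit elim(1) _ _ s])
          show "(\<lambda>t. u (x(k := t))) \<in> borel_measurable R" by measurable
          show "AE t in R. u (x(k := t)) = m x + (\<integral>xa. indicator {..<t} xa * g (x(k := xa)) \<partial>R)"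
            using elim(2) by eventually_elim (simp add: m primitive_update)
          show "emeasure R {t \<in> space R. 2 * s < \<bar>u (x(k := t))\<bar>} \<noteq> 0"
            using True s by (simp add: projection_def ennreal_less_iff)
        qed
        also have "(\<integral>\<^sup>+t. indicator {t. s < \<bar>u (x(k := t))\<bar> \<and> \<bar>u (x(k := t))\<bar> \<le> 2 * s} t * ennreal \<bar>g (x(k := t))\<bar> \<partial>R)
            = (\<integral>\<^sup>+t. a (x(k := t)) \<partial>R)"
          by (intro nn_integral_cong) (auto simp: a_def indicator_def)
        also have "emeasure R {t \<in> space R. \<bar>u (x(k := t))\<bar> > s} = (\<integral>\<^sup>+t. indicator {t \<in> space R. \<bar>u (x(k := t))\<bar> > s} t \<partial>R)"
          by (rule nn_integral_indicator[symmetric]) measurable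
        also have "\<dots> = (\<integral>\<^sup>+t. b (x(k := t)) \<partial>R)"
          by (intro nn_integral_cong) (auto simp: b_def indicator_def)
        finally show ?thesis using True by (simp add: fun_upd_def)
      qed simp
    qed
  qed
  also have "\<dots> = (\<integral>\<^sup>+x. \<integral>\<^sup>+t. a (x(k := t)) \<partial>R \<partial>Q n) + ennreal s * (\<integral>\<^sup>+x. \<integral>\<^sup>+t. b (x(k := t)) \<partial>R \<partial>Q n)"
    using ma mb by (subst nn_integral_add) (auto simp: nn_integral_cmult)
  also have "\<dots> = (\<integral>\<^sup>+x. a x \<partial>Q n) + ennreal s * (\<integral>\<^sup>+x. b x \<partial>Q n)"
    by (simp only: R.nn_integral_update[OF J a] R.nn_integral_update[OF J b])
  also have "(\<integral>\<^sup>+x. b x \<partial>Q n) = (\<integral>\<^sup>+x. indicator {x \<in> space (Q n). s < \<bar>u x\<bar>} x \<partial>Q n)"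
    by (intro nn_integral_cong) (auto simp: b_def indicator_def)
  also have "\<dots> = emeasure (Q n) {x \<in> space (Q n). s < \<bar>u x\<bar>}"
    by (rule nn_integral_indicator) measurable
  finally show ?thesis by (simp add: a_def)
qed

end

context unit_interval begin

declare measurable_Q_component [measurable del]

definition crit :: "nat \<Rightarrow> real \<Rightarrow> real" where "crit n p = (real n - p) / real (n - 1)"

definition proj_sum :: "nat \<Rightarrow> ((nat \<Rightarrow> real) \<Rightarrow> real) \<Rightarrow> real \<Rightarrow> real" where
  "proj_sum n u s = (\<Sum>k<n. measure (Q n) (projection n k u s))"

definition level_meas :: "nat \<Rightarrow> ((nat \<Rightarrow> real) \<Rightarrow> real) \<Rightarrow> real \<Rightarrow> real" where
  "level_meas n u s = measure (Q n) {x \<in> space (Q n). s < \<bar>u x\<bar>}"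

definition energy :: "nat \<Rightarrow> real \<Rightarrow> (nat \<Rightarrow> (nat \<Rightarrow> real) \<Rightarrow> real) \<Rightarrow> (nat \<Rightarrow> real) \<Rightarrow> real" where
  "energy n p g x = (\<Sum>k<n. \<bar>g k x\<bar> powr p)"

text \<open>The summand \<open>s\<^sup>p \<mu>(s)\<close> pays for lines on which \<open>u\<close> never drops below the level \<open>s\<close>, where the gradient
  gives no information.\<close>

definition level_energy ::
  "nat \<Rightarrow> real \<Rightarrow> ((nat \<Rightarrow> real) \<Rightarrow> real) \<Rightarrow> (nat \<Rightarrow> (nat \<Rightarrow> real) \<Rightarrow> real) \<Rightarrow> real \<Rightarrow> ennreal" where
  "level_energy n p u g s =
     (\<integral>\<^sup>+x. indicator {x. s < \<bar>u x\<bar> \<and> \<bar>u x\<bar> \<le> 2 * s} x * ennreal (energy n p g x) \<partial>Q n)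
     + ennreal (s powr p * level_meas n u s)"

lemma measurable_antimono_real:
  fixes f :: "real \<Rightarrow> real"
  assumes "\<And>s s'. s \<le> s' \<Longrightarrow> f s' \<le> f s"
  shows "f \<in> borel_measurable borel"
proof -
  have "mono (\<lambda>s. - f s)" using assms by (auto simp: mono_def)
  then have "(\<lambda>s. - f s) \<in> borel_measurable borel" by (rule borel_measurable_mono)
  then have "(\<lambda>s. - (- f s)) \<in> borel_measurable borel" by (rule borel_measurable_uminus)
  then show ?thesis by simp
qed

lemma projection_antimono:
  assumes mu: "u \<in> borel_measurable (Q n)"
  shows "s \<le> s' \<Longrightarrow> k < n \<Longrightarrow> measure (Q n) (projection n k u s') \<le> measure (Q n) (projection n k u s)"
proof (rule finite_measure.finite_measure_mono)
  show "finite_measure (Q n)" using prob_Q by (rule prob_space.finite_measure)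
  assume s: "s \<le> s'" and k: "k < n"
  show "projection n k u s \<in> sets (Q n)" by (rule projection_sets[OF mu k])
  show "projection n k u s' \<subseteq> projection n k u s"
  proof
    fix x assume x: "x \<in> projection n k u s'"
    then have xs: "x \<in> space (Q n)" by (simp add: projection_def)
    note [measurable] = measurable_section[OF mu k xs]
    have "emeasure R {t \<in> space R. ennreal s' < ennreal \<bar>u (x(k := t))\<bar>} \<le> emeasure R {t \<in> space R. ennreal s < ennreal \<bar>u (x(k := t))\<bar>}"
    proof (rule emeasure_mono)
      show "{t \<in> space R. ennreal s < ennreal \<bar>u (x(k := t))\<bar>} \<in> sets R" by measurable
    qed (use ennreal_leI[OF s] in \<open>auto intro: le_less_trans\<close>)
    then show "x \<in> projection n k u s" using x by (auto simp: projection_def)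
  qed
qed

lemma measurable_proj_sum: "u \<in> borel_measurable (Q n) \<Longrightarrow> proj_sum n u \<in> borel_measurable borel"
  unfolding proj_sum_def by (rule measurable_antimono_real) (auto intro!: sum_mono projection_antimono)

context
  fixes n :: nat and p :: real and u :: "(nat \<Rightarrow> real) \<Rightarrow> real" and g :: "nat \<Rightarrow> (nat \<Rightarrow> real) \<Rightarrow> real"
  assumes n: "2 \<le> n" and p: "1 \<le> p" "p < n"
    and u: "integrable (Q n) u" and g: "\<And>k. k < n \<Longrightarrow> integrable (Q n) (g k)"
    and rep: "\<And>k. k < n \<Longrightarrow> \<exists>m. (\<forall>x t. m (x(k := t)) = m x) \<and> (AE x in Q n. u x = m x + primitive k (g k) x)"
    and energy_finite: "(\<integral>\<^sup>+x. ennreal (\<Sum>k<n. \<bar>g k x\<bar> powr p) \<partial>Q n) < top"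
begin

interpretation Q: prob_space "Q n" by (rule prob_Q)

lemma mu [measurable]: "u \<in> borel_measurable (Q n)" using u by simp

lemma menergy [measurable]: "energy n p g \<in> borel_measurable (Q n)"
proof -
  have "(\<lambda>x. \<bar>g k x\<bar> powr p) \<in> borel_measurable (Q n)" if "k < n" for k
  proof -
    have [measurable]: "g k \<in> borel_measurable (Q n)" using g[OF that] by simp
    show ?thesis by measurable
  qed
  then show ?thesis unfolding energy_def by (intro borel_measurable_sum) auto
qed

lemma measurable_proj_sum' [measurable]: "proj_sum n u \<in> borel_measurable borel"
  by (rule measurable_proj_sum[OF mu])

lemma crit_pos: "0 < crit n p" "crit n p \<le> 1"
  using n p by (auto simp: crit_def)

lemma level_energy_finite: "level_energy n p u g s < top"
proof -
  have "(\<integral>\<^sup>+x. indicator {x. s < \<bar>u x\<bar> \<and> \<bar>u x\<bar> \<le> 2 * s} x * ennreal (energy n p g x) \<partial>Q n) \<le> (\<integral>\<^sup>+x. ennreal (energy n p g x) \<partial>Q n)"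
    by (intro nn_integral_mono) (auto simp: indicator_def)
  then show ?thesis using energy_finite by (auto simp: level_energy_def energy_def intro: le_less_trans)
qed

text \<open>Split both \<open>|g|\<close> and, in the term \<open>s \<mu>(s)\<close>, the number \<open>s\<close> at the threshold \<open>\<tau>\<close>.\<close>

lemma single_projection_estimate:
  assumes s: "0 < s" and \<tau>: "0 < \<tau>" and k: "k < n"
  shows "s * measure (Q n) (projection n k u (2 * s)) \<le> \<tau> powr (1 - p) * enn2real (level_energy n p u g s) + 2 * \<tau> * level_meas n u s"
proof -
  let ?A = "{x. s < \<bar>u x\<bar> \<and> \<bar>u x\<bar> \<le> 2 * s}"
  have mA [measurable]: "(\<lambda>x. indicator ?A x :: ennreal) \<in> borel_measurable (Q n)"
    unfolding indicator_def mem_Collect_eq by measurable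
  obtain m where m: "\<And>x t. m (x(k := t)) = m x" "AE x in Q n. u x = m x + primitive k (g k) x"
    using rep[OF k] by blast
  have pos: "0 \<le> energy n p g x" for x by (simp add: energy_def sum_nonneg)
  have lm: "0 \<le> level_meas n u s" by (simp add: level_meas_def)
  have "ennreal s * emeasure (Q n) (projection n k u (2 * s))
      \<le> (\<integral>\<^sup>+x. indicator ?A x * ennreal \<bar>g k x\<bar> \<partial>Q n) + ennreal s * emeasure (Q n) {x \<in> space (Q n). s < \<bar>u x\<bar>}"
    by (rule projection_level_estimate[OF u g[OF k] k s m])
  also have "(\<integral>\<^sup>+x. indicator ?A x * ennreal \<bar>g k x\<bar> \<partial>Q n)
      \<le> (\<integral>\<^sup>+x. ennreal (\<tau> powr (1 - p)) * (indicator ?A x * ennreal (energy n p g x)) + ennreal \<tau> * indicator ?A x \<partial>Q n)"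
  proof (rule nn_integral_mono)
    fix x
    have "\<bar>g k x\<bar> \<le> \<tau> powr (1 - p) * \<bar>g k x\<bar> powr p + \<tau>" using \<tau> p by (intro young_threshold) auto
    also have "\<dots> \<le> \<tau> powr (1 - p) * energy n p g x + \<tau>"
      unfolding energy_def using k by (intro add_right_mono mult_left_mono member_le_sum) auto
    finally have "ennreal \<bar>g k x\<bar> \<le> ennreal (\<tau> powr (1 - p)) * ennreal (energy n p g x) + ennreal \<tau>"
      using \<tau> pos[of x] by (simp add: ennreal_mult[symmetric] ennreal_plus[symmetric] ennreal_leI del: ennreal_plus)
    then show "indicator ?A x * ennreal \<bar>g k x\<bar>
        \<le> ennreal (\<tau> powr (1 - p)) * (indicator ?A x * ennreal (energy n p g x)) + ennreal \<tau> * indicator ?A x"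
      by (auto simp: indicator_def)
  qed
  also have "\<dots> = ennreal (\<tau> powr (1 - p)) * (\<integral>\<^sup>+x. indicator ?A x * ennreal (energy n p g x) \<partial>Q n)
      + ennreal \<tau> * (\<integral>\<^sup>+x. indicator ?A x \<partial>Q n)"
    by (subst nn_integral_add) (auto simp: nn_integral_cmult)
  also have "(\<integral>\<^sup>+x. indicator ?A x \<partial>Q n) \<le> (\<integral>\<^sup>+x. indicator {x \<in> space (Q n). s < \<bar>u x\<bar>} x \<partial>Q n)"
    by (intro nn_integral_mono) (auto simp: indicator_def)
  also have "\<dots> = ennreal (level_meas n u s)"
    unfolding level_meas_def by (simp add: Q.emeasure_eq_measure)
  also have "ennreal s * emeasure (Q n) {x \<in> space (Q n). s < \<bar>u x\<bar>} = ennreal (s * level_meas n u s)"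
    using s lm by (simp add: level_meas_def Q.emeasure_eq_measure ennreal_mult)
  also have "\<dots> \<le> ennreal (\<tau> powr (1 - p) * (s powr p * level_meas n u s) + \<tau> * level_meas n u s)"
  proof (rule ennreal_leI)
    have "s * level_meas n u s \<le> (\<tau> powr (1 - p) * s powr p + \<tau>) * level_meas n u s"
      using young_threshold[of s \<tau> p] s \<tau> p lm by (intro mult_right_mono) auto
    then show "s * level_meas n u s \<le> \<tau> powr (1 - p) * (s powr p * level_meas n u s) + \<tau> * level_meas n u s"
      by (simp add: algebra_simps)
  qed
  finally have "ennreal s * emeasure (Q n) (projection n k u (2 * s))
      \<le> ennreal (\<tau> powr (1 - p)) * (\<integral>\<^sup>+x. indicator ?A x * ennreal (energy n p g x) \<partial>Q n) + ennreal \<tau> * ennreal (level_meas n u s)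
        + ennreal (\<tau> powr (1 - p) * (s powr p * level_meas n u s) + \<tau> * level_meas n u s)"
    by (simp add: add_left_mono add_right_mono mult_left_mono)
  also have "\<dots> = ennreal (\<tau> powr (1 - p)) * level_energy n p u g s + ennreal (2 * \<tau> * level_meas n u s)"
  proof -
    have 1: "ennreal (\<tau> powr (1 - p) * (s powr p * level_meas n u s) + \<tau> * level_meas n u s)
        = ennreal (\<tau> powr (1 - p)) * ennreal (s powr p * level_meas n u s) + ennreal (\<tau> * level_meas n u s)"
      using lm \<tau> by (simp add: ennreal_plus ennreal_mult)
    have 2: "ennreal (2 * \<tau> * level_meas n u s) = ennreal (\<tau> * level_meas n u s) + ennreal (\<tau> * level_meas n u s)"
      using lm \<tau> by (simp add: ennreal_plus[symmetric] del: ennreal_plus)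
    show ?thesis unfolding 1 2 level_energy_def using lm \<tau> by (simp add: ennreal_mult algebra_simps)
  qed
  also have "\<dots> = ennreal (\<tau> powr (1 - p) * enn2real (level_energy n p u g s) + 2 * \<tau> * level_meas n u s)"
  proof -
    have "level_energy n p u g s = ennreal (enn2real (level_energy n p u g s))" using level_energy_finite by simp
    then have "ennreal (\<tau> powr (1 - p)) * level_energy n p u g s = ennreal (\<tau> powr (1 - p) * enn2real (level_energy n p u g s))"
      by (metis enn2real_nonneg ennreal_mult powr_ge_zero)
    then show ?thesis using lm \<tau> by (simp add: ennreal_plus)
  qed
  finally show ?thesis
    using s lm \<tau> by (simp add: Q.emeasure_eq_measure ennreal_mult[symmetric] ennreal_plus[symmetric] ennreal_le_iff del: ennreal_plus)
qed

lemma proj_sum_recursion: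
  assumes s: "0 < s" and \<delta>: "0 < \<delta>"
  shows "ennreal (s powr p * proj_sum n u (2 * s) powr crit n p)
    \<le> ennreal (2 * n * (\<delta> powr (n / (n - 1)) / (4 * n)) powr (1 - p)) * level_energy n p u g s
      + ennreal (\<delta> powr crit n p * (s powr p * proj_sum n u s powr crit n p))"
proof -
  let ?C = "2 * n * (\<delta> powr (n / (n - 1)) / (4 * n)) powr (1 - p)"
  have "s powr p * proj_sum n u (2 * s) powr crit n p \<le> ?C * enn2real (level_energy n p u g s) + \<delta> powr crit n p * (s powr p * proj_sum n u s powr crit n p)"
    unfolding crit_def
  proof (rule level_recursion[OF n p s _ _ _ _ \<delta>])
    show "0 \<le> proj_sum n u s" "0 \<le> proj_sum n u (2 * s)" "0 \<le> level_meas n u s" "0 \<le> enn2real (level_energy n p u g s)"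
      by (auto simp: proj_sum_def level_meas_def sum_nonneg)
    have "0 \<le> (\<Sum>k<n. measure (Q n) (projection n k u s)) ^ n" by (intro zero_le_power sum_nonneg) auto
    then show "level_meas n u s ^ (n - 1) \<le> proj_sum n u s ^ n"
      using level_set_le_projections[OF mu, of s] s n by (auto simp: level_meas_def proj_sum_def zero_power)
    show "s * proj_sum n u (2 * s) \<le> n * (\<tau> powr (1 - p) * enn2real (level_energy n p u g s) + 2 * \<tau> * level_meas n u s)" if \<tau>: "0 < \<tau>" for \<tau>
    proof -
      have "s * proj_sum n u (2 * s) = (\<Sum>k<n. s * measure (Q n) (projection n k u (2 * s)))"
        by (simp add: proj_sum_def sum_distrib_left)
      also have "\<dots> \<le> (\<Sum>k<n. \<tau> powr (1 - p) * enn2real (level_energy n p u g s) + 2 * \<tau> * level_meas n u s)"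
        using single_projection_estimate[OF s \<tau>] by (intro sum_mono) auto
      finally show ?thesis by simp
    qed
  qed
  then have "ennreal (s powr p * proj_sum n u (2 * s) powr crit n p)
      \<le> ennreal (?C * enn2real (level_energy n p u g s) + \<delta> powr crit n p * (s powr p * proj_sum n u s powr crit n p))"
    by (rule ennreal_leI)
  also have "\<dots> = ennreal ?C * ennreal (enn2real (level_energy n p u g s)) + ennreal (\<delta> powr crit n p * (s powr p * proj_sum n u s powr crit n p))"
    by (simp add: ennreal_plus ennreal_mult)
  also have "ennreal (enn2real (level_energy n p u g s)) = level_energy n p u g s" using level_energy_finite by simp
  finally show ?thesis .
qed

lemma measurable_level_meas [measurable]: "level_meas n u \<in> borel_measurable borel"
  unfolding level_meas_def by (rule measurable_antimono_real) (auto intro!: Q.finite_measure_mono)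

lemma measurable_level_energy: "level_energy n p u g \<in> borel_measurable lborel"
proof -
  have m1: "(\<lambda>z. \<bar>u (snd z)\<bar>) \<in> borel_measurable (lborel \<Otimes>\<^sub>M Q n)"
    by (rule measurable_compose[OF measurable_snd, of "\<lambda>x. \<bar>u x\<bar>"]) measurable
  have m2: "fst \<in> borel_measurable (lborel \<Otimes>\<^sub>M Q n)"
    using measurable_fst[of lborel "Q n"] by simp
  have mi: "(\<lambda>z. indicator {x. fst z < \<bar>u x\<bar> \<and> \<bar>u x\<bar> \<le> 2 * fst z} (snd z) :: ennreal) \<in> borel_measurable (lborel \<Otimes>\<^sub>M Q n)"
    unfolding indicator_def mem_Collect_eq using m1 m2 by measurable
  have me: "(\<lambda>x. ennreal (energy n p g x)) \<in> borel_measurable (Q n)" by measurable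
  have "(\<lambda>(s, x). indicator {x. s < \<bar>u x\<bar> \<and> \<bar>u x\<bar> \<le> 2 * s} x * ennreal (energy n p g x)) \<in> borel_measurable (lborel \<Otimes>\<^sub>M Q n)"
    unfolding split_beta' by (intro borel_measurable_times_ennreal mi measurable_compose[OF measurable_snd me])
  then have "(\<lambda>s. \<integral>\<^sup>+x. indicator {x. s < \<bar>u x\<bar> \<and> \<bar>u x\<bar> \<le> 2 * s} x * ennreal (energy n p g x) \<partial>Q n) \<in> borel_measurable lborel"
    by (rule Q.borel_measurable_nn_integral)
  moreover have "(\<lambda>s. ennreal (s powr p * level_meas n u s)) \<in> borel_measurable lborel" by measurable
  ultimately show ?thesis unfolding level_energy_def by (rule borel_measurable_add)
qed

text \<open>By Tonelli: a point \<open>x\<close> lies in the shell \<open>s < |u x| \<le> 2s\<close> for \<open>s\<close> between \<open>|u x|/2\<close> and \<open>|u x|\<close>, an interval on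
  which the integral of \<open>1/s\<close> is at most \<open>1\<close>. The shells with \<open>ds/s\<close> thus add up to at most the full
  energy, and the remaining summand is the layer cake formula for \<open>\<integral> |u|\<^sup>p\<close>.\<close>

lemma level_energy_integral:
  "(\<integral>\<^sup>+s. ennreal (1 / s) * level_energy n p u g s * indicator {0<..} s \<partial>lborel)
    \<le> (\<integral>\<^sup>+x. ennreal (energy n p g x) \<partial>Q n) + (\<integral>\<^sup>+x. epowr (ennreal \<bar>u x\<bar>) p \<partial>Q n)"
proof -
  interpret LQ: pair_sigma_finite lborel "Q n" by unfold_locales
  let ?i = "\<lambda>s x. indicator {x. s < \<bar>u x\<bar> \<and> \<bar>u x\<bar> \<le> 2 * s} x :: ennreal"
  let ?w = "\<lambda>s. ennreal (1 / s) * indicator {0<..} s"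
  have mw: "?w \<in> borel_measurable lborel" by measurable
  have m1: "(\<lambda>z. \<bar>u (snd z)\<bar>) \<in> borel_measurable (lborel \<Otimes>\<^sub>M Q n)"
    by (rule measurable_compose[OF measurable_snd, of "\<lambda>x. \<bar>u x\<bar>"]) measurable
  have m2: "fst \<in> borel_measurable (lborel \<Otimes>\<^sub>M Q n)"
    using measurable_fst[of lborel "Q n"] by simp
  have mi: "(\<lambda>z. ?i (fst z) (snd z)) \<in> borel_measurable (lborel \<Otimes>\<^sub>M Q n)"
    unfolding indicator_def mem_Collect_eq using m1 m2 by measurable
  have me: "(\<lambda>x. ennreal (energy n p g x)) \<in> borel_measurable (Q n)" by measurable
  have m3: "(\<lambda>(s, x). ?w s * (?i s x * ennreal (energy n p g x))) \<in> borel_measurable (lborel \<Otimes>\<^sub>M Q n)"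
    unfolding split_beta'
    by (intro borel_measurable_times_ennreal measurable_compose[OF measurable_fst mw] mi measurable_compose[OF measurable_snd me])
  have m4: "(\<lambda>s. \<integral>\<^sup>+x. ?w s * (?i s x * ennreal (energy n p g x)) \<partial>Q n) \<in> borel_measurable lborel"
    by (rule Q.borel_measurable_nn_integral[OF m3])
  have mi': "(\<lambda>x. ?i s x * ennreal (energy n p g x)) \<in> borel_measurable (Q n)" for s
  proof (rule borel_measurable_times_ennreal[OF _ me])
    show "(\<lambda>x. ?i s x) \<in> borel_measurable (Q n)" unfolding indicator_def mem_Collect_eq by measurable
  qed
  have "(\<integral>\<^sup>+s. ennreal (1 / s) * level_energy n p u g s * indicator {0<..} s \<partial>lborel)
      = (\<integral>\<^sup>+s. (\<integral>\<^sup>+x. ?w s * (?i s x * ennreal (energy n p g x)) \<partial>Q n) + ?w s * ennreal (s powr p * level_meas n u s) \<partial>lborel)"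
    by (intro nn_integral_cong) (simp add: level_energy_def nn_integral_cmult mi' algebra_simps)
  also have "\<dots> = (\<integral>\<^sup>+s. \<integral>\<^sup>+x. ?w s * (?i s x * ennreal (energy n p g x)) \<partial>Q n \<partial>lborel)
      + (\<integral>\<^sup>+s. ?w s * ennreal (s powr p * level_meas n u s) \<partial>lborel)"
    by (rule nn_integral_add[OF m4]) measurable
  finally have split: "(\<integral>\<^sup>+s. ennreal (1 / s) * level_energy n p u g s * indicator {0<..} s \<partial>lborel)
      = (\<integral>\<^sup>+s. \<integral>\<^sup>+x. ?w s * (?i s x * ennreal (energy n p g x)) \<partial>Q n \<partial>lborel)
        + (\<integral>\<^sup>+s. ?w s * ennreal (s powr p * level_meas n u s) \<partial>lborel)" .
  have "(\<integral>\<^sup>+s. \<integral>\<^sup>+x. ?w s * (?i s x * ennreal (energy n p g x)) \<partial>Q n \<partial>lborel)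
      = (\<integral>\<^sup>+x. \<integral>\<^sup>+s. ?w s * (?i s x * ennreal (energy n p g x)) \<partial>lborel \<partial>Q n)"
    by (rule LQ.Fubini'[OF m3, symmetric])
  also have "\<dots> \<le> (\<integral>\<^sup>+x. ennreal (energy n p g x) \<partial>Q n)"
  proof (rule nn_integral_mono)
    fix x
    have mix: "(\<lambda>s. ?w s * ?i s x) \<in> borel_measurable lborel"
    proof (rule borel_measurable_times_ennreal[OF mw])
      show "(\<lambda>s. ?i s x) \<in> borel_measurable lborel" unfolding indicator_def mem_Collect_eq by measurable
    qed
    have eq: "(\<integral>\<^sup>+s. ?w s * (?i s x * ennreal (energy n p g x)) \<partial>lborel) = (\<integral>\<^sup>+s. ?w s * ?i s x \<partial>lborel) * ennreal (energy n p g x)"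
      using mix by (subst nn_integral_multc[symmetric]) (auto simp: mult.assoc)
    have "(\<integral>\<^sup>+s. ?w s * ?i s x \<partial>lborel) \<le> (\<integral>\<^sup>+s. ennreal (2 / \<bar>u x\<bar>) * indicator {\<bar>u x\<bar> / 2..\<bar>u x\<bar>} s \<partial>lborel)"
      by (intro nn_integral_mono) (auto simp: indicator_def field_simps intro!: ennreal_leI)
    also have "\<dots> = ennreal (2 / \<bar>u x\<bar>) * ennreal (\<bar>u x\<bar> / 2)"
      by (subst nn_integral_cmult) auto
    also have "\<dots> \<le> 1" by (cases "u x = 0") (auto simp: ennreal_mult[symmetric])
    finally have "(\<integral>\<^sup>+s. ?w s * ?i s x \<partial>lborel) * ennreal (energy n p g x) \<le> 1 * ennreal (energy n p g x)"
      by (rule mult_right_mono) simp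
    then show "(\<integral>\<^sup>+s. ?w s * (?i s x * ennreal (energy n p g x)) \<partial>lborel) \<le> ennreal (energy n p g x)"
      unfolding eq by simp
  qed
  finally have le1: "(\<integral>\<^sup>+s. \<integral>\<^sup>+x. ?w s * (?i s x * ennreal (energy n p g x)) \<partial>Q n \<partial>lborel) \<le> (\<integral>\<^sup>+x. ennreal (energy n p g x) \<partial>Q n)" .
  have le2: "(\<integral>\<^sup>+s. ?w s * ennreal (s powr p * level_meas n u s) \<partial>lborel) \<le> (\<integral>\<^sup>+x. epowr (ennreal \<bar>u x\<bar>) p \<partial>Q n)"
  proof -
    have "(\<integral>\<^sup>+s. ?w s * ennreal (s powr p * level_meas n u s) \<partial>lborel)
        \<le> (\<integral>\<^sup>+s. ennreal (p * s powr (p - 1)) * (ennreal (1 / 1) * epowr (distr_fun (Q n) (\<lambda>x. ennreal \<bar>u x\<bar>) (ennreal s)) 1) * indicator {0<..} s \<partial>lborel)"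
    proof (rule nn_integral_mono)
      fix s :: real
      show "?w s * ennreal (s powr p * level_meas n u s)
          \<le> ennreal (p * s powr (p - 1)) * (ennreal (1 / 1) * epowr (distr_fun (Q n) (\<lambda>x. ennreal \<bar>u x\<bar>) (ennreal s)) 1) * indicator {0<..} s"
      proof (cases "0 < s")
        case True
        have d: "distr_fun (Q n) (\<lambda>x. ennreal \<bar>u x\<bar>) (ennreal s) = ennreal (level_meas n u s)"
          using True by (simp add: distr_fun_def level_meas_def Q.emeasure_eq_measure ennreal_less_iff)
        have lm: "0 \<le> level_meas n u s" by (simp add: level_meas_def)
        have "1 / s * (s powr p * level_meas n u s) = s powr (p - 1) * level_meas n u s"
          using True by (simp add: powr_diff)
        also have "\<dots> \<le> p * s powr (p - 1) * level_meas n u s"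
          using p lm mult_right_mono[of 1 p "s powr (p - 1)"] by (intro mult_right_mono) auto
        finally have "ennreal (1 / s * (s powr p * level_meas n u s)) \<le> ennreal (p * s powr (p - 1) * level_meas n u s)"
          by (rule ennreal_leI)
        then show ?thesis using True lm p by (simp add: d ennreal_mult[symmetric])
      qed simp
    qed
    also have "\<dots> = lorentz_int (Q n) 1 p (\<lambda>x. ennreal \<bar>u x\<bar>)"
      using p by (intro Q.lorentz_int_layer_cake[symmetric]) auto
    also have "\<dots> = (\<integral>\<^sup>+t. epowr (rearrangement (Q n) (\<lambda>x. ennreal \<bar>u x\<bar>) t) p \<partial>U)"
      unfolding lorentz_int_def by (intro nn_integral_cong) (auto simp: space_U)
    also have "\<dots> = (\<integral>\<^sup>+x. epowr (ennreal \<bar>u x\<bar>) p \<partial>Q n)"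
      by (rule Q.nn_integral_rearrangement) measurable
    finally show ?thesis .
  qed
  show ?thesis unfolding split by (rule add_mono[OF le1 le2])
qed

text \<open>Integrating the recursion against \<open>ds/s\<close> over \<open>(0,T)\<close> bounds \<open>J(2T) = \<integral>\<^sub>0\<^bsup>2T\<^esup> s\<^bsup>p-1\<^esup> a(s)\<^sup>e ds\<close> by a multiple
  of the energy and of \<open>\<integral> |u|\<^sup>p\<close>, plus half of \<open>J(T) \<le> J(2T)\<close>. Since \<open>a\<close> is bounded, \<open>J(2T)\<close> is finite and the
  last term can be absorbed; then let \<open>T\<close> tend to infinity.\<close>

lemma proj_sum_integral:
  defines "\<delta> \<equiv> (2 powr (- p - 1)) powr (1 / crit n p)"
  shows "(\<integral>\<^sup>+s. ennreal (s powr (p - 1) * proj_sum n u s powr crit n p) * indicator {0<..} s \<partial>lborel)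
    \<le> ennreal (2 powr (p + 1) * (2 * n * (\<delta> powr (n / (n - 1)) / (4 * n)) powr (1 - p)))
      * ((\<integral>\<^sup>+x. ennreal (energy n p g x) \<partial>Q n) + (\<integral>\<^sup>+x. epowr (ennreal \<bar>u x\<bar>) p \<partial>Q n))"
proof -
  define C where "C = 2 * n * (\<delta> powr (n / (n - 1)) / (4 * n)) powr (1 - p)"
  define G where "G = (\<integral>\<^sup>+x. ennreal (energy n p g x) \<partial>Q n) + (\<integral>\<^sup>+x. epowr (ennreal \<bar>u x\<bar>) p \<partial>Q n)"
  define f where "f = (\<lambda>s. s powr (p - 1) * proj_sum n u s powr crit n p)"
  define J where "J = (\<lambda>T. \<integral>\<^sup>+s. ennreal (f s) * indicator {0<..<T} s \<partial>lborel)"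
  have C0: "0 \<le> C" by (simp add: C_def)
  have [measurable]: "f \<in> borel_measurable borel" unfolding f_def by measurable
  \<comment> \<open>The substitution \<open>s \<mapsto> 2s\<close> costs a factor \<open>2\<^sup>p\<close>, so this \<open>\<delta>\<close> leaves the factor \<open>1/2\<close> in front of \<open>J\<close>.\<close>
  have \<delta>: "0 < \<delta>" "\<delta> powr crit n p = 2 powr (- p - 1)"
    using crit_pos by (auto simp: \<delta>_def powr_powr)
  have proj_le: "proj_sum n u s \<le> n" for s
  proof -
    have "proj_sum n u s \<le> (\<Sum>k<n. 1)" unfolding proj_sum_def by (intro sum_mono) simp
    then show ?thesis by simp
  qed
  have proj_nonneg: "0 \<le> proj_sum n u s" for s by (simp add: proj_sum_def sum_nonneg)
  have Jfin: "J T < top" if "0 \<le> T" for T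
  proof -
    have "J T \<le> (\<integral>\<^sup>+s. ennreal (n powr crit n p) * (ennreal (s powr (p - 1)) * indicator {0<..<T} s) \<partial>lborel)"
      unfolding J_def
    proof (rule nn_integral_mono)
      fix s :: real
      have "f s \<le> n powr crit n p * s powr (p - 1)"
        unfolding f_def using proj_le[of s] proj_nonneg[of s] crit_pos
        by (subst mult.commute) (intro mult_right_mono powr_mono2, auto)
      then have "ennreal (f s) \<le> ennreal (n powr crit n p) * ennreal (s powr (p - 1))"
        by (simp add: ennreal_mult[symmetric] ennreal_leI)
      then show "ennreal (f s) * indicator {0<..<T} s \<le> ennreal (n powr crit n p) * (ennreal (s powr (p - 1)) * indicator {0<..<T} s)"
        by (auto simp: indicator_def)
    qed
    also have "\<dots> = ennreal (n powr crit n p) * ennreal (T powr p / p)"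
      using p that by (subst nn_integral_cmult) (auto simp: nn_integral_powr)
    also have "\<dots> < top" by (simp add: ennreal_mult_less_top)
    finally show ?thesis .
  qed
  have bound: "J (2 * T) \<le> ennreal (2 powr (p + 1) * C) * G" if T: "0 \<le> T" for T
  proof -
    have "J (2 * T) = 2 * (\<integral>\<^sup>+s. ennreal (f (0 + 2 * s)) * indicator {0<..<2 * T} (0 + 2 * s) \<partial>lborel)"
      unfolding J_def by (subst nn_integral_real_affine[where c=2 and t=0]) auto
    also have "(\<integral>\<^sup>+s. ennreal (f (0 + 2 * s)) * indicator {0<..<2 * T} (0 + 2 * s) \<partial>lborel)
        = (\<integral>\<^sup>+s. ennreal (2 powr (p - 1)) * (ennreal (1 / s) * ennreal (s powr p * proj_sum n u (2 * s) powr crit n p) * indicator {0<..<T} s) \<partial>lborel)"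
    proof (rule nn_integral_cong)
      fix s :: real
      show "ennreal (f (0 + 2 * s)) * indicator {0<..<2 * T} (0 + 2 * s)
          = ennreal (2 powr (p - 1)) * (ennreal (1 / s) * ennreal (s powr p * proj_sum n u (2 * s) powr crit n p) * indicator {0<..<T} s)"
        by (cases "0 < s") (auto simp: f_def indicator_def ennreal_mult[symmetric] powr_mult powr_diff)
    qed
    also have "\<dots> = ennreal (2 powr (p - 1)) * (\<integral>\<^sup>+s. ennreal (1 / s) * ennreal (s powr p * proj_sum n u (2 * s) powr crit n p) * indicator {0<..<T} s \<partial>lborel)"
      by (rule nn_integral_cmult) measurable
    finally have J_eq: "J (2 * T) = 2 * (ennreal (2 powr (p - 1))
        * (\<integral>\<^sup>+s. ennreal (1 / s) * ennreal (s powr p * proj_sum n u (2 * s) powr crit n p) * indicator {0<..<T} s \<partial>lborel))" .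
    have "(\<integral>\<^sup>+s. ennreal (1 / s) * ennreal (s powr p * proj_sum n u (2 * s) powr crit n p) * indicator {0<..<T} s \<partial>lborel)
        \<le> (\<integral>\<^sup>+s. ennreal C * (ennreal (1 / s) * level_energy n p u g s * indicator {0<..} s) + ennreal (2 powr (- p - 1)) * (ennreal (f s) * indicator {0<..<T} s) \<partial>lborel)"
    proof (rule nn_integral_mono)
      fix s :: real
      show "ennreal (1 / s) * ennreal (s powr p * proj_sum n u (2 * s) powr crit n p) * indicator {0<..<T} s
          \<le> ennreal C * (ennreal (1 / s) * level_energy n p u g s * indicator {0<..} s) + ennreal (2 powr (- p - 1)) * (ennreal (f s) * indicator {0<..<T} s)"
      proof (cases "s \<in> {0<..<T}")
        case True
        then have s: "0 < s" by simp
        have "ennreal (1 / s) * ennreal (s powr p * proj_sum n u (2 * s) powr crit n p)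
            \<le> ennreal (1 / s) * (ennreal C * level_energy n p u g s + ennreal (2 powr (- p - 1) * (s powr p * proj_sum n u s powr crit n p)))"
          using proj_sum_recursion[OF s \<delta>(1)] unfolding \<delta>(2) C_def by (rule mult_left_mono) simp
        also have "\<dots> = ennreal C * (ennreal (1 / s) * level_energy n p u g s) + ennreal (1 / s) * ennreal (2 powr (- p - 1) * (s powr p * proj_sum n u s powr crit n p))"
          by (simp add: algebra_simps)
        also have "ennreal (1 / s) * ennreal (2 powr (- p - 1) * (s powr p * proj_sum n u s powr crit n p)) = ennreal (2 powr (- p - 1)) * ennreal (f s)"
          using s by (simp add: ennreal_mult[symmetric] f_def powr_diff)
        finally show ?thesis using True by simp
      qed simp
    qed
    also have "\<dots> = ennreal C * (\<integral>\<^sup>+s. ennreal (1 / s) * level_energy n p u g s * indicator {0<..} s \<partial>lborel) + ennreal (2 powr (- p - 1)) * J T"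
    proof -
      have [measurable]: "(\<lambda>s. ennreal (1 / s) * level_energy n p u g s * indicator {0<..} s) \<in> borel_measurable lborel"
        by (intro borel_measurable_times_ennreal measurable_level_energy) auto
      have "(\<lambda>s. ennreal (f s) * indicator {0<..<T} s) \<in> borel_measurable lborel" by measurable
      then show ?thesis unfolding J_def by (subst nn_integral_add) (auto simp: nn_integral_cmult)
    qed
    also have "\<dots> \<le> ennreal C * G + ennreal (2 powr (- p - 1)) * J (2 * T)"
    proof (intro add_mono mult_left_mono)
      show "(\<integral>\<^sup>+s. ennreal (1 / s) * level_energy n p u g s * indicator {0<..} s \<partial>lborel) \<le> G"
        unfolding G_def by (rule level_energy_integral)
      show "J T \<le> J (2 * T)"
        unfolding J_def using T by (intro nn_integral_mono) (auto simp: indicator_def)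
    qed auto
    finally have "J (2 * T) \<le> 2 * (ennreal (2 powr (p - 1)) * (ennreal C * G + ennreal (2 powr (- p - 1)) * J (2 * T)))"
      by (subst (1) J_eq) (intro mult_left_mono, auto)
    also have "\<dots> = ennreal (2 powr p * C) * G + ennreal (1 / 2) * J (2 * T)"
    proof -
      have 1: "2 * ennreal (2 powr (p - 1)) = ennreal (2 powr p)"
        by (simp add: powr_diff ennreal_mult[symmetric] flip: ennreal_numeral)
      have 2: "ennreal (2 powr p) * ennreal (2 powr (- p - 1)) = ennreal (1 / 2)"
      proof -
        have "2 powr p * 2 powr (- p - 1) = (2 :: real) powr (- 1)" by (simp only: powr_add[symmetric]) simp
        also have "\<dots> = 1 / 2" by (simp add: powr_minus_divide)
        finally show ?thesis by (simp only: ennreal_mult[symmetric] powr_ge_zero)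
      qed
      have "2 * (ennreal (2 powr (p - 1)) * (ennreal C * G + ennreal (2 powr (- p - 1)) * J (2 * T)))
          = ennreal (2 powr p) * (ennreal C * G) + ennreal (2 powr p) * ennreal (2 powr (- p - 1)) * J (2 * T)"
        by (simp only: mult.assoc[symmetric] 1 distrib_left)
      then show ?thesis unfolding 2 using C0 by (simp add: ennreal_mult mult.assoc)
    qed
    finally have *: "J (2 * T) \<le> ennreal (2 powr p * C) * G + ennreal (1 / 2) * J (2 * T)" .
    show ?thesis
    proof (cases "G = top")
      case True
      show ?thesis
      proof (cases "C = 0")
        case True
        then obtain x where x: "J (2 * T) = ennreal x" "0 \<le> x" using Jfin[of "2 * T"] T by (cases "J (2 * T)") auto
        have "ennreal x \<le> ennreal (1 / 2) * ennreal x"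
          using *[unfolded x(1)] unfolding True by (simp only: mult_zero_right ennreal_0 mult_zero_left add_0)
        also have "\<dots> = ennreal (1 / 2 * x)" by (rule ennreal_mult[symmetric]) (use x in auto)
        finally have "x \<le> 1 / 2 * x" using x(2) by (subst (asm) ennreal_le_iff) auto
        then show ?thesis using x by simp
      next
        case False
        then show ?thesis using \<open>G = top\<close> C0 by (simp add: ennreal_mult_top)
      qed
    next
      case False
      then obtain y where y: "G = ennreal y" "0 \<le> y" by (cases G) auto
      obtain x where x: "J (2 * T) = ennreal x" "0 \<le> x" using Jfin[of "2 * T"] T by (cases "J (2 * T)") auto
      have pos: "0 \<le> 2 powr p * C" "0 \<le> 2 powr p * C * y" "0 \<le> 1 / 2 * x" "0 \<le> (1 / 2 :: real)" using x(2) y(2) C0 by auto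
      have "ennreal x \<le> ennreal (2 powr p * C * y + 1 / 2 * x)"
        using *[unfolded x(1) y(1)]
        by (simp only: ennreal_plus[OF pos(2,3)] ennreal_mult[OF pos(1) y(2)] ennreal_mult[OF pos(4) x(2)])
      then have "x \<le> 2 * (2 powr p * C * y)" using x y C0 by (subst (asm) ennreal_le_iff) auto
      then show ?thesis unfolding x y using C0 y(2)
        by (simp add: ennreal_mult[symmetric] powr_add ennreal_leI mult_ac)
    qed
  qed
  have "(\<integral>\<^sup>+s. ennreal (f s) * indicator {0<..} s \<partial>lborel) = (\<integral>\<^sup>+s. (SUP m::nat. ennreal (f s) * indicator {0<..<2 * real m} s) \<partial>lborel)"
  proof (rule nn_integral_cong)
    fix s :: real
    obtain m :: nat where "s < real m" using reals_Archimedean2 by blast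
    then have m: "s < 2 * real m" by linarith
    show "ennreal (f s) * indicator {0<..} s = (SUP m::nat. ennreal (f s) * indicator {0<..<2 * real m} s)"
    proof (rule antisym)
      have "ennreal (f s) * indicator {0<..} s \<le> ennreal (f s) * indicator {0<..<2 * real m} s"
        using m by (auto simp: indicator_def)
      then show "ennreal (f s) * indicator {0<..} s \<le> (SUP m::nat. ennreal (f s) * indicator {0<..<2 * real m} s)"
        by (rule order_trans) (rule SUP_upper, simp)
      show "(SUP m::nat. ennreal (f s) * indicator {0<..<2 * real m} s) \<le> ennreal (f s) * indicator {0<..} s"
        by (rule SUP_least) (auto simp: indicator_def)
    qed
  qed
  also have "\<dots> = (SUP m::nat. J (2 * real m))"
    unfolding J_def by (rule nn_integral_monotone_convergence_SUP) (auto simp: incseq_def le_fun_def indicator_def)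
  also have "\<dots> \<le> ennreal (2 powr (p + 1) * C) * G"
    by (rule SUP_least) (rule bound, simp)
  finally show ?thesis by (simp add: f_def C_def G_def)
qed

declare mu [measurable del] menergy [measurable del] measurable_proj_sum' [measurable del] measurable_level_meas [measurable del]

end

end

section \<open>The Sobolev embedding\<close>

context unit_interval begin

lemma Lnorm_cube: "0 < p \<Longrightarrow> Lnorm (cube I n) (ennreal p) h = epowr (\<integral>\<^sup>+x. epowr (h x) p \<partial>Q n) (1 / p)"
  by (simp add: Lnorm_def nn_integral_cube)

lemma integrable_of_power:
  assumes [measurable]: "h \<in> borel_measurable (Q n)" and p: "1 \<le> p"
    and fin: "(\<integral>\<^sup>+x. epowr (ennreal \<bar>h x\<bar>) p \<partial>Q n) < top"
  shows "integrable (Q n) h"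
proof (rule integrableI_bounded)
  interpret Q: prob_space "Q n" by (rule prob_Q)
  have "(\<integral>\<^sup>+x. ennreal (norm (h x)) \<partial>Q n) \<le> (\<integral>\<^sup>+x. epowr (ennreal \<bar>h x\<bar>) p + 1 \<partial>Q n)"
  proof (rule nn_integral_mono)
    fix x
    have "ennreal \<bar>h x\<bar> \<le> ennreal (1 powr (1 - p) * \<bar>h x\<bar> powr p + 1)"
      by (rule ennreal_leI) (rule young_threshold, use p in auto)
    then show "ennreal (norm (h x)) \<le> epowr (ennreal \<bar>h x\<bar>) p + 1"
      by (simp add: epowr_ennreal ennreal_plus)
  qed
  also have "\<dots> = (\<integral>\<^sup>+x. epowr (ennreal \<bar>h x\<bar>) p \<partial>Q n) + 1"
    by (subst nn_integral_add) (auto simp: Q.emeasure_space_1)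
  also have "\<dots> < top" using fin by simp
  finally show "(\<integral>\<^sup>+x. ennreal (norm (h x)) \<partial>Q n) < \<infinity>" by simp
qed simp

lemma weak_gradient_is_weak_gradient:
  "\<exists>G. is_weak_gradient I n u G \<Longrightarrow> is_weak_gradient I n u (weak_gradient I n u)"
  unfolding weak_gradient_def by (erule someI_ex)

lemma abs_le_grad_length: "k < n \<Longrightarrow> \<bar>weak_gradient I n u k x\<bar> \<le> grad_length I n u x"
  unfolding grad_length_def
  by (rule real_le_rsqrt) (auto intro!: member_le_sum[of k "{..<n}" "\<lambda>i. (weak_gradient I n u i x)\<^sup>2"])

text \<open>Layer cake: the distribution function of \<open>\<psi>\<^sub>k(f, L\<^sup>\<infinity>)\<close> is the measure of the \<open>k\<close>th projection.\<close>

lemma lorentz_of_projections: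
  fixes n :: nat and p :: real
  assumes n: "2 \<le> n" and p: "1 \<le> p" "p < n"
    and fm: "f \<in> borel_measurable (cube I n)" and u: "u \<in> borel_measurable (Q n)" "AE x in Q n. f x = u x" and k: "k < n"
  shows "lorentz_int (cube I (n - 1)) (crit n p) p (mixed_psi n Linf k f)
    \<le> ennreal (p / crit n p) * (\<integral>\<^sup>+s. ennreal (s powr (p - 1) * proj_sum n u s powr crit n p) * indicator {0<..} s \<partial>lborel)"
proof -
  interpret Q: prob_space "Q n" by (rule prob_Q)
  interpret C: prob_space "cube I (n - 1)" by (rule prob_cube)
  have e: "0 < crit n p" "crit n p \<le> 1" using n p by (auto simp: crit_def)
  have mps: "(\<lambda>s. ennreal (s powr (p - 1) * proj_sum n u s powr crit n p) * indicator {0<..} s) \<in> borel_measurable lborel"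
    using measurable_proj_sum[OF u(1)] by measurable
  have "lorentz_int (cube I (n - 1)) (crit n p) p (mixed_psi n Linf k f)
      = (\<integral>\<^sup>+s. ennreal (p * s powr (p - 1)) * (ennreal (1 / crit n p)
          * epowr (distr_fun (cube I (n - 1)) (mixed_psi n Linf k f) (ennreal s)) (crit n p)) * indicator {0<..} s \<partial>lborel)"
    using p by (intro C.lorentz_int_layer_cake measurable_mixed_psi[OF k fm] e) auto
  also have "\<dots> \<le> (\<integral>\<^sup>+s. ennreal (p / crit n p) * (ennreal (s powr (p - 1) * proj_sum n u s powr crit n p) * indicator {0<..} s) \<partial>lborel)"
  proof (rule nn_integral_mono)
    fix s :: real
    show "ennreal (p * s powr (p - 1)) * (ennreal (1 / crit n p)
          * epowr (distr_fun (cube I (n - 1)) (mixed_psi n Linf k f) (ennreal s)) (crit n p)) * indicator {0<..} s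
        \<le> ennreal (p / crit n p) * (ennreal (s powr (p - 1) * proj_sum n u s powr crit n p) * indicator {0<..} s)"
    proof (cases "0 < s")
      case True
      have d: "distr_fun (cube I (n - 1)) (mixed_psi n Linf k f) (ennreal s) = ennreal (measure (Q n) (projection n k u s))"
        unfolding distr_fun_mixed_psi[OF k u] projection_def by (rule Q.emeasure_eq_measure)
      have le: "measure (Q n) (projection n k u s) \<le> proj_sum n u s"
        unfolding proj_sum_def using k by (intro member_le_sum) auto
      have "ennreal (p * s powr (p - 1)) * (ennreal (1 / crit n p) * ennreal (measure (Q n) (projection n k u s) powr crit n p))
          = ennreal (p / crit n p * (s powr (p - 1) * measure (Q n) (projection n k u s) powr crit n p))"
        using p e by (simp add: ennreal_mult[symmetric])
      also have "\<dots> \<le> ennreal (p / crit n p * (s powr (p - 1) * proj_sum n u s powr crit n p))"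
        using p e le by (intro ennreal_leI mult_left_mono powr_mono2) auto
      also have "\<dots> = ennreal (p / crit n p) * ennreal (s powr (p - 1) * proj_sum n u s powr crit n p)"
        using p e by (intro ennreal_mult) auto
      finally show ?thesis unfolding d using True by (simp add: epowr_ennreal)
    qed simp
  qed
  also have "\<dots> = ennreal (p / crit n p) * (\<integral>\<^sup>+s. ennreal (s powr (p - 1) * proj_sum n u s powr crit n p) * indicator {0<..} s \<partial>lborel)"
    by (rule nn_integral_cmult[OF mps])
  finally show ?thesis .
qed

lemma embedding_power_estimate:
  fixes n :: nat and p :: real
  assumes n: "2 \<le> n" and p: "1 \<le> p" "p < n"
  obtains C where "0 \<le> C" "\<And>f k. f \<in> fst (sobolev_W1 I n (Lnorm (cube I n) (ennreal p))) \<Longrightarrow> k < n \<Longrightarrow>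
    lorentz_int (cube I (n - 1)) (crit n p) p (mixed_psi n Linf k f)
      \<le> ennreal C * ((\<integral>\<^sup>+x. epowr (ennreal \<bar>f x\<bar>) p \<partial>Q n) + (\<integral>\<^sup>+x. epowr (ennreal \<bar>grad_length I n f x\<bar>) p \<partial>Q n))"
proof -
  define C0 where "C0 = 2 powr (p + 1) * (2 * n * (((2 powr (- p - 1)) powr (1 / crit n p)) powr (n / (n - 1)) / (4 * n)) powr (1 - p))"
  have C0: "0 \<le> C0" by (simp add: C0_def)
  have e: "0 < crit n p" "crit n p \<le> 1" using n p by (auto simp: crit_def)
  define C where "C = p / crit n p * C0 * n"
  have C: "0 \<le> C" using C0 p e by (simp add: C_def)
  show ?thesis
  proof (rule that[OF C])
    fix f k assume f: "f \<in> fst (sobolev_W1 I n (Lnorm (cube I n) (ennreal p)))" and k: "k < n"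
    let ?P = "\<integral>\<^sup>+x. epowr (ennreal \<bar>f x\<bar>) p \<partial>Q n" and ?D = "\<integral>\<^sup>+x. epowr (ennreal \<bar>grad_length I n f x\<bar>) p \<partial>Q n"
    have fm: "f \<in> borel_measurable (cube I n)" and ex: "\<exists>G. is_weak_gradient I n f G"
      using f by (auto simp: sobolev_W1_def fspace_of_def)
    have fin: "?P < top" "?D < top"
      using f p by (auto simp: sobolev_W1_def fspace_of_def fnorm_def Lnorm_cube epowr_less_top_iff)
    let ?G = "weak_gradient I n f"
    have G: "is_weak_gradient I n f ?G" by (rule weak_gradient_is_weak_gradient[OF ex])
    have mG: "?G i \<in> borel_measurable (cube I n)" if "i < n" for i
      using G that by (auto simp: is_weak_gradient_def locally_integrable_def)
    obtain u where u: "u \<in> borel_measurable (Q n)" "AE x in Q n. f x = u x"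
      using cube_borel_version[OF fm] by blast
    have "\<forall>i\<in>{..<n}. \<exists>g. g \<in> borel_measurable (Q n) \<and> (AE x in Q n. ?G i x = g x)"
    proof
      fix i assume "i \<in> {..<n}"
      then have "?G i \<in> borel_measurable (cube I n)" using mG by auto
      from cube_borel_version[OF this] show "\<exists>g. g \<in> borel_measurable (Q n) \<and> (AE x in Q n. ?G i x = g x)" by blast
    qed
    then obtain g where g: "\<forall>i\<in>{..<n}. g i \<in> borel_measurable (Q n) \<and> (AE x in Q n. ?G i x = g i x)"
      by (rule bchoice[THEN exE])
    have gm: "g i \<in> borel_measurable (Q n)" and gAE: "AE x in Q n. ?G i x = g i x" if "i < n" for i
      using g that by auto
    have Pu: "(\<integral>\<^sup>+x. epowr (ennreal \<bar>u x\<bar>) p \<partial>Q n) = ?P"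
      by (rule nn_integral_cong_AE) (use u(2) in eventually_elim, simp)
    have Dg: "(\<integral>\<^sup>+x. epowr (ennreal \<bar>g i x\<bar>) p \<partial>Q n) \<le> ?D" if "i < n" for i
    proof (rule nn_integral_mono_AE)
      show "AE x in Q n. epowr (ennreal \<bar>g i x\<bar>) p \<le> epowr (ennreal \<bar>grad_length I n f x\<bar>) p"
        using gAE[OF that]
      proof eventually_elim
        case (elim x)
        have "\<bar>g i x\<bar> \<le> \<bar>grad_length I n f x\<bar>" using abs_le_grad_length[OF that, of f x] elim by simp
        then show ?case using p by (intro epowr_mono ennreal_leI) auto
      qed
    qed
    have iu: "integrable (Q n) u" by (rule integrable_of_power[OF u(1) p(1)]) (simp add: Pu fin)
    have ig: "integrable (Q n) (g i)" if "i < n" for i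
      by (rule integrable_of_power[OF gm[OF that] p(1)]) (rule le_less_trans[OF Dg[OF that] fin(2)])
    have energy: "(\<integral>\<^sup>+x. ennreal (\<Sum>i<n. \<bar>g i x\<bar> powr p) \<partial>Q n) \<le> ennreal n * ?D"
    proof -
      have "(\<integral>\<^sup>+x. ennreal (\<Sum>i<n. \<bar>g i x\<bar> powr p) \<partial>Q n) = (\<integral>\<^sup>+x. (\<Sum>i<n. epowr (ennreal \<bar>g i x\<bar>) p) \<partial>Q n)"
        by (intro nn_integral_cong) (simp add: epowr_ennreal sum_ennreal)
      also have "\<dots> = (\<Sum>i<n. \<integral>\<^sup>+x. epowr (ennreal \<bar>g i x\<bar>) p \<partial>Q n)"
      proof (rule nn_integral_sum)
        fix i assume "i \<in> {..<n}"
        then have [measurable]: "g i \<in> borel_measurable (Q n)" using gm by auto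
        show "(\<lambda>x. epowr (ennreal \<bar>g i x\<bar>) p) \<in> borel_measurable (Q n)" by measurable
      qed
      also have "\<dots> \<le> (\<Sum>i<n. ?D)" using Dg by (intro sum_mono) auto
      also have "\<dots> = ennreal n * ?D" by (simp add: ennreal_of_nat_eq_real_of_nat)
      finally show ?thesis .
    qed
    have efin: "(\<integral>\<^sup>+x. ennreal (\<Sum>i<n. \<bar>g i x\<bar> powr p) \<partial>Q n) < top"
      by (rule le_less_trans[OF energy]) (use fin in \<open>simp add: ennreal_mult_less_top\<close>)
    have rep: "\<exists>m. (\<forall>x t. m (x(i := t)) = m x) \<and> (AE x in Q n. u x = m x + primitive i (g i) x)" if i: "i < n" for i
    proof -
      obtain m where "\<And>x t. m (x(i := t)) = m x" "AE x in Q n. u x = m x + primitive i (g i) x"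
        by (rule weak_gradient_line_representation[OF G i iu u(2) ig[OF i] gAE[OF i]]) (rule that)
      then show ?thesis by blast
    qed
    have "lorentz_int (cube I (n - 1)) (crit n p) p (mixed_psi n Linf k f)
        \<le> ennreal (p / crit n p) * (\<integral>\<^sup>+s. ennreal (s powr (p - 1) * proj_sum n u s powr crit n p) * indicator {0<..} s \<partial>lborel)"
      by (rule lorentz_of_projections[OF n p fm u k])
    also have "\<dots> \<le> ennreal (p / crit n p) * (ennreal C0 * ((\<integral>\<^sup>+x. ennreal (energy n p g x) \<partial>Q n) + (\<integral>\<^sup>+x. epowr (ennreal \<bar>u x\<bar>) p \<partial>Q n)))"
      unfolding C0_def by (rule mult_left_mono[OF proj_sum_integral[OF n p iu ig rep efin]]) simp_all
    also have "\<dots> \<le> ennreal (p / crit n p) * (ennreal C0 * (ennreal n * ?D + ennreal n * ?P))"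
    proof (intro mult_left_mono add_mono)
      show "(\<integral>\<^sup>+x. ennreal (energy n p g x) \<partial>Q n) \<le> ennreal n * ?D" using energy by (simp add: energy_def)
      have "1 * ?P \<le> ennreal n * ?P" using n by (intro mult_right_mono) (auto simp: ennreal_ge_1)
      then show "(\<integral>\<^sup>+x. epowr (ennreal \<bar>u x\<bar>) p \<partial>Q n) \<le> ennreal n * ?P" by (simp add: Pu)
    qed auto
    also have "\<dots> = ennreal C * (?P + ?D)"
    proof -
      have "0 \<le> p / crit n p" using p e by simp
      then have "ennreal C = ennreal (p / crit n p) * (ennreal C0 * ennreal n)"
        unfolding C_def using C0 by (simp only: ennreal_mult mult_nonneg_nonneg of_nat_0_le_iff mult.assoc)
      then show ?thesis by (simp only: distrib_left mult_ac add_ac)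
    qed
    finally show "lorentz_int (cube I (n - 1)) (crit n p) p (mixed_psi n Linf k f) \<le> ennreal C * (?P + ?D)" .
  qed
qed

text \<open>With \<open>r = p(n-1)/(n-p)\<close>, the exponent \<open>e = p/r\<close> is \<open>(n-p)/(n-1)\<close>, and \<open>p \<ge> 1\<close> makes it at most \<open>1\<close>.\<close>

lemma lorentz_exponent:
  fixes n :: nat and p :: real
  assumes "2 \<le> n" "1 \<le> p" "p < n"
  shows "p / (p * (real n - 1) / (real n - p)) = crit n p" "p \<le> p * (real n - 1) / (real n - p)"
    "0 < p * (real n - 1) / (real n - p)"
  using assms by (auto simp: crit_def of_nat_diff field_simps)

lemma sobolev_embedding:
  fixes n :: nat and p :: real
  assumes n: "2 \<le> n" and p: "1 \<le> p" "p < n"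
  shows "sobolev_W1 I n (Lnorm (cube I n) (ennreal p))
    \<hookrightarrow> mixed_space I n (lorentz_norm (cube I (n - 1)) (ennreal (p * (real n - 1) / (real n - p))) (ennreal p)) Linf"
proof -
  let ?W = "sobolev_W1 I n (Lnorm (cube I n) (ennreal p))"
  let ?L = "lorentz_norm (cube I (n - 1)) (ennreal (p * (real n - 1) / (real n - p))) (ennreal p)"
  have p0: "0 < p" using p by simp
  have L: "?L h = epowr (lorentz_int (cube I (n - 1)) (crit n p) p h) (1 / p)" for h
    using lorentz_norm_eq[OF lorentz_exponent(3)[OF n p] p(1)] by (simp only: lorentz_exponent(1)[OF n p])
  obtain C where C: "0 \<le> C" and est: "\<And>f k. f \<in> fst ?W \<Longrightarrow> k < n \<Longrightarrow>
    lorentz_int (cube I (n - 1)) (crit n p) p (mixed_psi n Linf k f)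
      \<le> ennreal C * ((\<integral>\<^sup>+x. epowr (ennreal \<bar>f x\<bar>) p \<partial>Q n) + (\<integral>\<^sup>+x. epowr (ennreal \<bar>grad_length I n f x\<bar>) p \<partial>Q n))"
    by (rule embedding_power_estimate[OF n p]) (rule that)
  define K where "K = (2 * C) powr (1 / p)"
  have norm_k: "?L (mixed_psi n Linf k f) \<le> ennreal K * snd ?W f" if f: "f \<in> fst ?W" and k: "k < n" for f k
  proof -
    let ?P = "\<integral>\<^sup>+x. epowr (ennreal \<bar>f x\<bar>) p \<partial>Q n" and ?D = "\<integral>\<^sup>+x. epowr (ennreal \<bar>grad_length I n f x\<bar>) p \<partial>Q n"
    define a b where "a = epowr ?P (1 / p)" and "b = epowr ?D (1 / p)"
    have W: "snd ?W f = a + b" using p0 by (simp add: sobolev_W1_def fnorm_def Lnorm_cube a_def b_def)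
    have "?P = epowr a p" "?D = epowr b p" by (simp_all add: a_def b_def epowr_inverse'[OF p0])
    then have "?P + ?D \<le> epowr (a + b) p + epowr (a + b) p"
      using p0 by (auto intro!: add_mono epowr_mono)
    also have "\<dots> = ennreal 2 * epowr (a + b) p" by (simp add: mult_2)
    finally have "lorentz_int (cube I (n - 1)) (crit n p) p (mixed_psi n Linf k f) \<le> ennreal C * (ennreal 2 * epowr (a + b) p)"
      using est[OF f k] by (meson mult_left_mono order_trans zero_le)
    also have "\<dots> = ennreal (2 * C) * epowr (a + b) p" using C by (simp add: ennreal_mult mult_ac)
    finally have "?L (mixed_psi n Linf k f) \<le> epowr (ennreal (2 * C) * epowr (a + b) p) (1 / p)"
      unfolding L using p0 by (intro epowr_mono) auto
    also have "\<dots> = ennreal K * (a + b)"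
      using p0 C by (simp add: epowr_mult epowr_inverse epowr_ennreal K_def)
    finally show ?thesis by (simp add: W)
  qed
  have Wfin: "snd ?W f < top" if "f \<in> fst ?W" for f
    using that by (auto simp: sobolev_W1_def fspace_of_def)
  show ?thesis unfolding embeds_def
  proof (intro conjI exI[of _ "n * K"] ballI)
    show "fst ?W \<subseteq> fst (mixed_space I n ?L Linf)"
    proof
      fix f assume f: "f \<in> fst ?W"
      have "?L (mixed_psi n Linf k f) < top" if "k < n" for k
        by (rule le_less_trans[OF norm_k[OF f that]]) (use Wfin[OF f] in \<open>simp add: ennreal_mult_less_top\<close>)
      moreover have "f \<in> borel_measurable (cube I n)" using f by (simp add: sobolev_W1_def fspace_of_def)
      ultimately show "f \<in> fst (mixed_space I n ?L Linf)" by (simp add: mixed_space_def mixed_space_k_def)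
    qed
    show "0 \<le> n * K" by (simp add: K_def)
    fix f assume f: "f \<in> fst ?W"
    have "snd (mixed_space I n ?L Linf) f = (\<Sum>k<n. ?L (mixed_psi n Linf k f))"
      by (simp add: mixed_space_def mixed_space_k_def)
    also have "\<dots> \<le> (\<Sum>k<n. ennreal K * snd ?W f)" using norm_k[OF f] by (intro sum_mono) auto
    also have "\<dots> = ennreal n * (ennreal K * snd ?W f)" by (simp add: ennreal_of_nat_eq_real_of_nat)
    also have "\<dots> = ennreal (n * K) * snd ?W f" by (simp add: ennreal_mult mult.assoc K_def)
    finally show "snd (mixed_space I n ?L Linf) f \<le> ennreal (n * K) * snd ?W f" .
  qed
qed

end

section \<open>Functions with a line primitive have weak derivatives\<close>

lemma compact_PiE_interval:
  fixes a b :: real and n :: nat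
  shows "compact (Pi\<^sub>E {..<n} (\<lambda>_. {a..b}))"
proof -
  have eq: "Pi\<^sub>E {..<n::nat} (\<lambda>_. {a..b}) = Pi\<^sub>E UNIV (\<lambda>i. if i < n then {a..b} else {undefined})"
  proof (rule set_eqI)
    fix x
    have "x \<in> Pi\<^sub>E {..<n} (\<lambda>_. {a..b}) \<longleftrightarrow> (\<forall>i. (i < n \<longrightarrow> x i \<in> {a..b}) \<and> (\<not> i < n \<longrightarrow> x i \<in> {undefined}))"
      unfolding PiE_iff extensional_def by (simp del: atLeastAtMost_iff) blast
    also have "\<dots> \<longleftrightarrow> x \<in> Pi\<^sub>E UNIV (\<lambda>i. if i < n then {a..b} else {undefined})"
      unfolding PiE_iff by (simp del: atLeastAtMost_iff)
    finally show "x \<in> Pi\<^sub>E {..<n} (\<lambda>_. {a..b}) \<longleftrightarrow> x \<in> Pi\<^sub>E UNIV (\<lambda>i. if i < n then {a..b} else {undefined})" .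
  qed
  have "compactin (product_topology (\<lambda>i. euclidean) UNIV) (Pi\<^sub>E UNIV (\<lambda>i. if i < n then {a..b} else {undefined}))"
    unfolding compactin_PiE by (auto simp: compactin_euclidean_iff)
  then show ?thesis unfolding eq euclidean_product_topology by (simp only: compactin_euclidean_iff)
qed

context
  fixes I :: "real set" and n k :: nat and \<phi> :: "(nat \<Rightarrow> real) \<Rightarrow> real"
  assumes test: "test_fun I n \<phi>" and k: "k < n"
begin

lemma test_fun_continuous: "continuous_on ({..<n} \<rightarrow>\<^sub>E UNIV) \<phi>"
  using test[unfolded test_fun_def smooth_fun_def, THEN conjunct1, rule_format, of "[]"] by simp

lemma test_fun_partial_continuous: "continuous_on ({..<n} \<rightarrow>\<^sub>E UNIV) (partial k \<phi>)"
  using test[unfolded test_fun_def smooth_fun_def, THEN conjunct1, rule_format, of "[k]"] k by simp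

lemma test_fun_has_partial:
  assumes x: "x \<in> {..<n} \<rightarrow>\<^sub>E UNIV"
  shows "((\<lambda>t. \<phi> (x(k := t))) has_real_derivative partial k \<phi> (x(k := t))) (at t)"
proof -
  have S: "(\<lambda>s. \<phi> (y(k := s))) differentiable (at (y k))" if "y \<in> {..<n} \<rightarrow>\<^sub>E UNIV" for y
    using test[unfolded test_fun_def smooth_fun_def, THEN conjunct1, rule_format, of "[]", THEN conjunct2, rule_format, OF _ k that]
    by simp
  have "x(k := t) \<in> {..<n} \<rightarrow>\<^sub>E UNIV" using x k by (auto simp: PiE_iff extensional_def)
  from S[OF this]
  have "(\<lambda>s. \<phi> (x(k := s))) differentiable (at t)" by (simp only: fun_upd_upd fun_upd_same)
  then show ?thesis unfolding partial_def by (simp add: DERIV_deriv_iff_real_differentiable)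
qed

lemma continuous_on_update: "continuous_on A (\<lambda>t::real. (x(k := t)) :: nat \<Rightarrow> real)"
proof (rule continuous_on_coordinatewise_then_product)
  fix i show "continuous_on A (\<lambda>t. (x(k := t)) i)" by (cases "i = k") auto
qed

lemma test_fun_partial_line_continuous:
  assumes x: "x \<in> {..<n} \<rightarrow>\<^sub>E UNIV"
  shows "continuous_on UNIV (\<lambda>t. partial k \<phi> (x(k := t)))"
  by (rule continuous_on_compose2[OF test_fun_partial_continuous continuous_on_update])
    (use x k in \<open>auto simp: PiE_iff extensional_def split: if_splits\<close>)

lemma test_fun_support:
  obtains a b where "{a..b} \<subseteq> interior I"
    "\<And>x. x \<in> {..<n} \<rightarrow>\<^sub>E UNIV \<Longrightarrow> x \<notin> Pi\<^sub>E {..<n} (\<lambda>_. {a..b}) \<Longrightarrow> \<phi> x = 0 \<and> partial k \<phi> x = 0"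
proof -
  obtain a b where ab: "{a..b} \<subseteq> interior I" "\<forall>x \<in> ({..<n} \<rightarrow>\<^sub>E UNIV) - ({..<n} \<rightarrow>\<^sub>E {a..b}). \<phi> x = 0"
    using test unfolding test_fun_def by blast
  show ?thesis
  proof (rule that[OF ab(1)])
    fix x assume x: "x \<in> {..<n} \<rightarrow>\<^sub>E UNIV" "x \<notin> Pi\<^sub>E {..<n} (\<lambda>_. {a..b})"
    have upd: "x(k := t) \<in> {..<n} \<rightarrow>\<^sub>E UNIV" for t using x k by (auto simp: PiE_iff extensional_def)
    have "\<exists>i<n. x i \<notin> {a..b}" using x by (force simp: PiE_iff)
    then obtain i where i: "i < n" "x i \<notin> {a..b}" by blast
    have zero: "\<phi> (x(k := t)) = 0" if "i \<noteq> k \<or> t \<notin> {a..b}" for t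
    proof -
      have "(x(k := t)) i \<notin> {a..b}" using that i by (auto simp del: atLeastAtMost_iff)
      then have "x(k := t) \<notin> {..<n} \<rightarrow>\<^sub>E {a..b}" using i by blast
      then show ?thesis using ab(2) upd by blast
    qed
    have "\<forall>\<^sub>F t in nhds (x k). 0 = \<phi> (x(k := t))"
    proof (cases "i = k")
      case False then show ?thesis using zero by simp
    next
      case True
      have "\<forall>\<^sub>F t in nhds (x k). t \<in> - {a..b}"
        using i True by (intro eventually_nhds_in_open) auto
      then show ?thesis by eventually_elim (use zero in auto)
    qed
    then have "((\<lambda>t. \<phi> (x(k := t))) has_real_derivative 0) (at (x k))"
      by (rule DERIV_cong_ev[OF refl _ refl, THEN iffD1]) auto
    then have "partial k \<phi> x = 0" unfolding partial_def by (rule DERIV_imp_deriv)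
    then show "\<phi> x = 0 \<and> partial k \<phi> x = 0" using ab(2) x by blast
  qed
qed

lemma test_fun_bounded:
  obtains B where "0 \<le> B" "\<And>x. x \<in> {..<n} \<rightarrow>\<^sub>E UNIV \<Longrightarrow> \<bar>\<phi> x\<bar> \<le> B \<and> \<bar>partial k \<phi> x\<bar> \<le> B"
proof -
  obtain a b where ab: "\<And>x. x \<in> {..<n} \<rightarrow>\<^sub>E UNIV \<Longrightarrow> x \<notin> Pi\<^sub>E {..<n} (\<lambda>_. {a..b}) \<Longrightarrow> \<phi> x = 0 \<and> partial k \<phi> x = 0"
    by (rule test_fun_support) (rule that)
  let ?K = "Pi\<^sub>E {..<n} (\<lambda>_. {a..b})"
  have sub: "?K \<subseteq> {..<n} \<rightarrow>\<^sub>E UNIV" by (rule PiE_mono) simp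
  have "compact (\<phi> ` ?K)" "compact (partial k \<phi> ` ?K)"
    by (intro compact_continuous_image compact_PiE_interval continuous_on_subset[OF test_fun_continuous sub]
        continuous_on_subset[OF test_fun_partial_continuous sub])+
  then have "bounded (\<phi> ` ?K)" "bounded (partial k \<phi> ` ?K)" by (simp_all add: compact_imp_bounded)
  then obtain B1 B2 where B: "\<forall>y\<in>\<phi> ` ?K. norm y \<le> B1" "\<forall>y\<in>partial k \<phi> ` ?K. norm y \<le> B2"
    unfolding bounded_iff by blast
  show ?thesis
  proof (rule that[of "max 0 (max B1 B2)"])
    fix x assume x: "x \<in> {..<n} \<rightarrow>\<^sub>E (UNIV :: real set)"
    show "\<bar>\<phi> x\<bar> \<le> max 0 (max B1 B2) \<and> \<bar>partial k \<phi> x\<bar> \<le> max 0 (max B1 B2)"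
    proof (cases "x \<in> ?K")
      case True
      then have "\<bar>\<phi> x\<bar> \<le> B1" "\<bar>partial k \<phi> x\<bar> \<le> B2" using B by auto
      then show ?thesis by auto
    next
      case False then show ?thesis using ab[OF x] by simp
    qed
  qed simp
qed

end

context unit_interval begin

lemma space_Q_subset: "x \<in> space (Q n) \<Longrightarrow> x \<in> {..<n} \<rightarrow>\<^sub>E UNIV"
  by (auto simp: space_PiM PiE_iff)

lemma measurable_continuous_on_cube:
  fixes f :: "(nat \<Rightarrow> real) \<Rightarrow> real"
  assumes f: "continuous_on ({..<n} \<rightarrow>\<^sub>E UNIV) f"
  shows "f \<in> borel_measurable (Q n)"
proof -
  have "(\<lambda>x. x) \<in> Q n \<rightarrow>\<^sub>M (borel :: (nat \<Rightarrow> real) measure)"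
  proof (rule measurable_coordinatewise_then_product)
    fix i
    show "(\<lambda>x. x i) \<in> borel_measurable (Q n)"
    proof (cases "i < n")
      case True then show ?thesis by (rule measurable_Q_component)
    next
      case False
      then have "x i = undefined" if "x \<in> space (Q n)" for x
        using that by (auto simp: space_PiM PiE_iff extensional_def)
      then have "(\<lambda>x. x i) \<in> borel_measurable (Q n) \<longleftrightarrow> (\<lambda>x. undefined :: real) \<in> borel_measurable (Q n)"
        by (rule measurable_cong)
      then show ?thesis by simp
    qed
  qed
  then have "(\<lambda>x. x) \<in> Q n \<rightarrow>\<^sub>M restrict_space borel ({..<n} \<rightarrow>\<^sub>E UNIV)"
    using space_Q_subset by (intro measurable_restrict_space2) auto
  from measurable_compose[OF this borel_measurable_continuous_on_restrict[OF f]] show ?thesis by simp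
qed

lemma integrable_mult_bounded:
  fixes f \<phi> :: "(nat \<Rightarrow> real) \<Rightarrow> real"
  assumes f: "integrable (Q n) f" and \<phi>: "\<phi> \<in> borel_measurable (Q n)" and B: "\<And>x. x \<in> space (Q n) \<Longrightarrow> \<bar>\<phi> x\<bar> \<le> B"
  shows "integrable (Q n) (\<lambda>x. f x * \<phi> x)"
proof (rule Bochner_Integration.integrable_bound)
  show "integrable (Q n) (\<lambda>x. B * f x)" using f by simp
  show "(\<lambda>x. f x * \<phi> x) \<in> borel_measurable (Q n)" using f \<phi> by (intro borel_measurable_times) auto
  show "AE x in Q n. norm (f x * \<phi> x) \<le> norm (B * f x)"
  proof (rule AE_I2)
    fix x assume "x \<in> space (Q n)"
    then have "\<bar>f x\<bar> * \<bar>\<phi> x\<bar> \<le> \<bar>f x\<bar> * \<bar>B\<bar>" using B by (intro mult_left_mono) force+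
    then show "norm (f x * \<phi> x) \<le> norm (B * f x)" by (simp add: abs_mult mult.commute)
  qed
qed

text \<open>The converse of \<open>weak_derivative_representation\<close>: integrate by parts on each line in direction \<open>k\<close>,
  where the part \<open>m\<close> drops out because \<open>partial k \<phi>\<close> has mean zero on the line.\<close>

lemma primitive_weak_derivative:
  fixes u g :: "(nat \<Rightarrow> real) \<Rightarrow> real"
  assumes u: "integrable (Q n) u" and g: "integrable (Q n) g" and k: "k < n"
    and m: "\<And>x t. m (x(k := t)) = m x" and rep: "AE x in Q n. u x = m x + primitive k g x"
    and test: "test_fun I n \<phi>"
  shows "(\<integral>x. u x * partial k \<phi> x \<partial>Q n) = - (\<integral>x. g x * \<phi> x \<partial>Q n)"
proof -
  have J: "finite {..<n}" "k \<in> {..<n}" using k by auto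
  have mp [measurable]: "\<phi> \<in> borel_measurable (Q n)" "partial k \<phi> \<in> borel_measurable (Q n)"
    by (rule measurable_continuous_on_cube[OF test_fun_continuous[OF test k]],
        rule measurable_continuous_on_cube[OF test_fun_partial_continuous[OF test k]])
  have [measurable]: "u \<in> borel_measurable (Q n)" "g \<in> borel_measurable (Q n)" using u g by auto
  obtain B where B: "0 \<le> B" "\<And>x. x \<in> {..<n} \<rightarrow>\<^sub>E UNIV \<Longrightarrow> \<bar>\<phi> x\<bar> \<le> B \<and> \<bar>partial k \<phi> x\<bar> \<le> B"
    by (rule test_fun_bounded[OF test k]) (rule that)
  have Bs: "\<bar>\<phi> x\<bar> \<le> B" "\<bar>partial k \<phi> x\<bar> \<le> B" if "x \<in> space (Q n)" for x
    using B(2)[OF space_Q_subset[OF that]] by auto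
  have iu: "integrable (Q n) (\<lambda>x. u x * partial k \<phi> x)" by (rule integrable_mult_bounded[OF u mp(2) Bs(2)])
  have ig: "integrable (Q n) (\<lambda>x. g x * \<phi> x)" by (rule integrable_mult_bounded[OF g mp(1) Bs(1)])
  obtain a b where ab: "{a..b} \<subseteq> interior I"
    "\<And>x. x \<in> {..<n} \<rightarrow>\<^sub>E UNIV \<Longrightarrow> x \<notin> Pi\<^sub>E {..<n} (\<lambda>_. {a..b}) \<Longrightarrow> \<phi> x = 0 \<and> partial k \<phi> x = 0"
    by (rule test_fun_support[OF test k]) (rule that)
  have line: "(\<integral>t. u (x(k := t)) * partial k \<phi> (x(k := t)) \<partial>R) = - (\<integral>t. g (x(k := t)) * \<phi> (x(k := t)) \<partial>R)"
    if x: "x \<in> space (Q n)" and gx: "integrable R (\<lambda>t. g (x(k := t)))"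
      and ux: "AE t in R. u (x(k := t)) = m (x(k := t)) + primitive k g (x(k := t))" for x
  proof -
    note xU = space_Q_subset[OF x]
    define \<eta> \<gamma> where "\<eta> = (\<lambda>t. \<phi> (x(k := t)))" and "\<gamma> = (\<lambda>t. partial k \<phi> (x(k := t)))"
    have upd: "x(k := t) \<in> {..<n} \<rightarrow>\<^sub>E UNIV" for t using xU k by (auto simp: PiE_iff extensional_def)
    have deriv: "(\<eta> has_real_derivative \<gamma> t) (at t)" for t
      unfolding \<eta>_def \<gamma>_def by (rule test_fun_has_partial[OF test k xU])
    have cont: "continuous_on UNIV \<gamma>"
      unfolding \<gamma>_def by (rule test_fun_partial_line_continuous[OF test k xU])
    have [measurable]: "\<gamma> \<in> borel_measurable borel" by (rule borel_measurable_continuous_onI[OF cont])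
    have \<eta>0: "\<eta> t = 0" if "t \<notin> {lo<..<lo + 1}" for t
    proof -
      have "t \<notin> {a..b}" using that ab(1) unfolding interior_I by blast
      then have "(x(k := t)) k \<notin> {a..b}" by (simp del: atLeastAtMost_iff)
      then have "x(k := t) \<notin> Pi\<^sub>E {..<n} (\<lambda>_. {a..b})" using k by blast
      then show ?thesis using ab(2)[OF upd] by (simp add: \<eta>_def)
    qed
    have int\<gamma>: "(\<integral>s. indicator {..t} s * \<gamma> s \<partial>R) = \<eta> t" if "t \<in> {lo..lo + 1}" for t
      by (rule integral_deriv_R[OF deriv cont _ that]) (simp add: \<eta>0)
    have mean: "(\<integral>s. \<gamma> s \<partial>R) = 0"
    proof -
      have "(\<integral>s. \<gamma> s \<partial>R) = (\<integral>s. indicator {..lo + 1} s * \<gamma> s \<partial>R)"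
        by (rule Bochner_Integration.integral_cong) (use interval_upper in \<open>auto simp: indicator_def\<close>)
      also have "\<dots> = \<eta> (lo + 1)" by (rule int\<gamma>) simp
      finally show ?thesis by (simp add: \<eta>0)
    qed
    have \<gamma>B: "\<bar>\<gamma> t\<bar> \<le> B" for t unfolding \<gamma>_def using B(2)[OF upd] by simp
    have mR: "\<gamma> \<in> borel_measurable R" by (rule measurable_R) simp
    have i\<gamma>: "integrable R \<gamma>" by (rule R.integrable_const_bound[of _ B]) (use \<gamma>B mR in auto)
    define V where "V = (\<lambda>s. \<integral>t. indicator {..<s} t * g (x(k := t)) \<partial>R)"
    have mu: "(\<lambda>t. u (x(k := t))) \<in> borel_measurable R" by (rule measurable_section[OF _ k x]) simp
    have Vle: "\<bar>V s\<bar> \<le> (\<integral>t. \<bar>g (x(k := t))\<bar> \<partial>R)" for s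
    proof -
      have "\<bar>V s\<bar> \<le> (\<integral>t. \<bar>indicator {..<s} t * g (x(k := t))\<bar> \<partial>R)" unfolding V_def by (rule integral_abs_bound)
      also have "\<dots> \<le> (\<integral>t. \<bar>g (x(k := t))\<bar> \<partial>R)"
        by (rule integral_mono') (use gx in \<open>auto simp: indicator_def\<close>)
      finally show ?thesis .
    qed
    have V_AE: "AE t in R. V t = u (x(k := t)) - m x"
      using ux by eventually_elim (simp add: m primitive_update V_def)
    have "(\<integral>t. u (x(k := t)) * \<gamma> t \<partial>R) = (\<integral>t. m x * \<gamma> t + (u (x(k := t)) - m x) * \<gamma> t \<partial>R)"
      by (simp add: algebra_simps)
    also have "\<dots> = (\<integral>t. m x * \<gamma> t \<partial>R) + (\<integral>t. (u (x(k := t)) - m x) * \<gamma> t \<partial>R)"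
    proof (rule Bochner_Integration.integral_add)
      show "integrable R (\<lambda>t. (u (x(k := t)) - m x) * \<gamma> t)"
      proof (rule R.integrable_const_bound[of _ "(\<integral>t. \<bar>g (x(k := t))\<bar> \<partial>R) * B"])
        show "AE t in R. norm ((u (x(k := t)) - m x) * \<gamma> t) \<le> (\<integral>t. \<bar>g (x(k := t))\<bar> \<partial>R) * B"
          using V_AE
        proof eventually_elim
          case (elim t)
          have "\<bar>V t\<bar> * \<bar>\<gamma> t\<bar> \<le> (\<integral>t. \<bar>g (x(k := t))\<bar> \<partial>R) * B"
            using Vle[of t] \<gamma>B[of t] by (intro mult_mono) auto
          then show ?case using elim by (simp add: abs_mult)
        qed
        show "(\<lambda>t. (u (x(k := t)) - m x) * \<gamma> t) \<in> borel_measurable R" using mu mR by simp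
      qed
    qed (use i\<gamma> in simp)
    also have "(\<integral>t. m x * \<gamma> t \<partial>R) = 0" using mean by simp
    also have "(\<integral>t. (u (x(k := t)) - m x) * \<gamma> t \<partial>R) = (\<integral>t. V t * \<gamma> t \<partial>R)"
    proof -
      have "integral\<^sup>L R (\<lambda>t. (u (x(k := t)) - m x) * \<gamma> t) = integral\<^sup>L R (\<lambda>t. V t * \<gamma> t)"
      proof (rule integral_cong_AE)
        show "(\<lambda>t. (u (x(k := t)) - m x) * \<gamma> t) \<in> borel_measurable R" using mu mR by simp
        have "V \<in> borel_measurable R"
        proof -
          interpret RR: pair_sigma_finite R R by unfold_locales
          have m1: "(\<lambda>z. fst z) \<in> borel_measurable (R \<Otimes>\<^sub>M R)" "(\<lambda>z. snd z) \<in> borel_measurable (R \<Otimes>\<^sub>M R)"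
            using measurable_compose[OF measurable_fst measurable_R[of "\<lambda>t. t"]] measurable_compose[OF measurable_snd measurable_R[of "\<lambda>t. t"]]
            by auto
          have m2: "(\<lambda>z. g (x(k := snd z))) \<in> borel_measurable (R \<Otimes>\<^sub>M R)"
            by (rule measurable_compose[OF measurable_snd measurable_section[OF _ k x]]) simp
          have m3: "(\<lambda>z. indicator {..<fst z} (snd z) :: real) \<in> borel_measurable (R \<Otimes>\<^sub>M R)"
            unfolding indicator_def lessThan_iff using m1 by measurable
          have "(\<lambda>(s, t). indicator {..<s} t * g (x(k := t))) \<in> borel_measurable (R \<Otimes>\<^sub>M R)"
            unfolding split_beta' by (rule borel_measurable_times[OF m3 m2])
          then show ?thesis unfolding V_def by (rule R.borel_measurable_lebesgue_integral)
        qed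
        then show "(\<lambda>t. V t * \<gamma> t) \<in> borel_measurable R" using mR by simp
        show "AE t in R. (u (x(k := t)) - m x) * \<gamma> t = V t * \<gamma> t" using V_AE by eventually_elim simp
      qed
      then show ?thesis .
    qed
    also have "(\<integral>t. V t * \<gamma> t \<partial>R) = - (\<integral>t. g (x(k := t)) * \<eta> t \<partial>R)"
    proof -
      have "(\<integral>t. g (x(k := t)) * \<eta> t \<partial>R) = - (\<integral>t. V t * \<gamma> t \<partial>R)"
        unfolding V_def
        by (rule integral_by_parts_R[OF gx _ \<gamma>B mean]) (use int\<gamma> interval_upper in auto)
      then show ?thesis by simp
    qed
    finally show ?thesis by (simp add: \<eta>_def \<gamma>_def fun_upd_def)
  qed
  have "(\<integral>x. u x * partial k \<phi> x \<partial>Q n) = (\<integral>x. \<integral>t. u (x(k := t)) * partial k \<phi> (x(k := t)) \<partial>R \<partial>Q n)"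
    using R.integral_update[OF J iu] by simp
  also have "\<dots> = (\<integral>x. - (\<integral>t. g (x(k := t)) * \<phi> (x(k := t)) \<partial>R) \<partial>Q n)"
  proof (rule integral_cong_AE)
    show "(\<lambda>x. \<integral>t. u (x(k := t)) * partial k \<phi> (x(k := t)) \<partial>R) \<in> borel_measurable (Q n)"
      using R.integrable_integral_update[OF J iu] by simp
    show "(\<lambda>x. - (\<integral>t. g (x(k := t)) * \<phi> (x(k := t)) \<partial>R)) \<in> borel_measurable (Q n)"
      using R.integrable_integral_update[OF J ig] by simp
    show "AE x in Q n. (\<integral>t. u (x(k := t)) * partial k \<phi> (x(k := t)) \<partial>R) = - (\<integral>t. g (x(k := t)) * \<phi> (x(k := t)) \<partial>R)"
      using R.integrable_update[OF J g] R.AE_update[OF J rep] AE_space by eventually_elim (rule line)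
  qed
  also have "\<dots> = - (\<integral>x. g x * \<phi> x \<partial>Q n)" using R.integral_update[OF J ig] by simp
  finally show ?thesis .
qed

end

section \<open>Logarithmic averages of a decreasing profile\<close>

lemma integrable_const_Icc: "integrable lborel (\<lambda>s::real. indicator {a..b} s *\<^sub>R (c :: real))"
  by (intro integrable_scaleR_left integrable_real_indicator) (auto simp: emeasure_lborel_Icc_eq)

context
  fixes h :: "real \<Rightarrow> real"
  assumes h_nonneg: "\<And>s. 0 \<le> h s" and h_antimono: "\<And>s t. 0 < s \<Longrightarrow> s \<le> t \<Longrightarrow> h t \<le> h s"
    and h_meas: "h \<in> borel_measurable borel"
begin

lemma integrable_profile:
  assumes "0 < a"
  shows "integrable lborel (\<lambda>s. indicator {a..<b} s * (h s / s))"
proof (rule Bochner_Integration.integrable_bound)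
  show "integrable lborel (\<lambda>s. indicator {a..b} s *\<^sub>R (h a / a))" by (rule integrable_const_Icc)
  show "(\<lambda>s. indicator {a..<b} s * (h s / s)) \<in> borel_measurable lborel" using h_meas by measurable
  show "AE s in lborel. norm (indicator {a..<b} s * (h s / s)) \<le> norm (indicator {a..b} s *\<^sub>R (h a / a))"
  proof (rule AE_I2)
    fix s
    have "h s / s \<le> h a / a" if "a \<le> s" using that assms h_antimono[of a s] h_nonneg by (intro frac_le) auto
    then show "norm (indicator {a..<b} s * (h s / s)) \<le> norm (indicator {a..b} s *\<^sub>R (h a / a))"
      using assms h_nonneg[of s] h_nonneg[of a] by (auto simp: indicator_def)
  qed
qed

definition profile_int :: "real \<Rightarrow> real \<Rightarrow> real" where
  "profile_int a b = (\<integral>s. indicator {a..<b} s * (h s / s) \<partial>lborel)"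

text \<open>Averaging \<open>h\<close> over \<open>(\<rho>/2, \<rho>)\<close> against \<open>ds/s\<close> makes it absolutely continuous while keeping it between
  \<open>h(\<rho>)\<close> and \<open>h(\<rho>/2)\<close>. The derivative of the average is \<open>- log_slope\<close>, which is controlled by \<open>h(s/2)/s\<close>
  without any regularity of \<open>h\<close>.\<close>

definition log_avg :: "real \<Rightarrow> real" where
  "log_avg \<rho> = profile_int (\<rho> / 2) \<rho> / ln 2"

definition log_slope :: "real \<Rightarrow> real" where
  "log_slope s = (h (s / 2) - h s) / (s * ln 2)"

lemma profile_int_add:
  assumes "0 < a" "a \<le> b" "b \<le> c"
  shows "profile_int a c = profile_int a b + profile_int b c"
proof -
  have "profile_int a b + profile_int b c = (\<integral>s. indicator {a..<b} s * (h s / s) + indicator {b..<c} s * (h s / s) \<partial>lborel)"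
    unfolding profile_int_def using assms
    by (intro Bochner_Integration.integral_add[symmetric] integrable_profile) auto
  also have "\<dots> = profile_int a c" unfolding profile_int_def
    by (rule Bochner_Integration.integral_cong) (use assms in \<open>auto simp: indicator_def\<close>)
  finally show ?thesis by simp
qed

lemma integral_inverse:
  fixes a b c :: real
  assumes "0 < a" "a \<le> b"
  shows "(\<integral>s. indicator {a..<b} s * (c / s) \<partial>lborel) = c * (ln b - ln a)"
    "integrable lborel (\<lambda>s. indicator {a..<b} s * (c / s))"
proof -
  have "((\<lambda>s. c * ln s) has_real_derivative c / s) (at s)" if "a \<le> s" for s
    using that assms by (auto intro!: derivative_eq_intros)
  moreover have "isCont (\<lambda>s. c / s) s" if "a \<le> s" for s using that assms by (intro continuous_intros) auto
  ultimately have 1: "(\<integral>s. c / s * indicator {a..b} s \<partial>lborel) = c * ln b - c * ln a"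
    using assms by (intro integral_FTC_Icc_real) auto
  have "(\<integral>s. indicator {a..<b} s * (c / s) \<partial>lborel) = (\<integral>s. c / s * indicator {a..b} s \<partial>lborel)"
  proof (rule integral_cong_AE)
    show "AE s in lborel. indicator {a..<b} s * (c / s) = c / s * indicator {a..b} s"
      using AE_lborel_singleton[of b] by eventually_elim (auto simp: indicator_def)
  qed auto
  then show "(\<integral>s. indicator {a..<b} s * (c / s) \<partial>lborel) = c * (ln b - ln a)" using 1 by (simp add: right_diff_distrib)
  show "integrable lborel (\<lambda>s. indicator {a..<b} s * (c / s))"
  proof (rule Bochner_Integration.integrable_bound)
    show "integrable lborel (\<lambda>s. indicator {a..b} s *\<^sub>R (c / a))" by (rule integrable_const_Icc)
    show "AE s in lborel. norm (indicator {a..<b} s * (c / s)) \<le> norm (indicator {a..b} s *\<^sub>R (c / a))"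
      by (rule AE_I2) (use assms in \<open>auto simp: indicator_def intro!: divide_left_mono\<close>)
  qed auto
qed

lemma log_avg_bounds:
  assumes "0 < \<rho>"
  shows "h \<rho> \<le> log_avg \<rho>" "log_avg \<rho> \<le> h (\<rho> / 2)" "0 \<le> log_avg \<rho>"
proof -
  have ln: "ln \<rho> - ln (\<rho> / 2) = ln 2" using assms by (simp add: ln_div)
  have half: "0 < \<rho> / 2" "\<rho> / 2 \<le> \<rho>" using assms by auto
  have "(\<integral>s. indicator {\<rho> / 2..<\<rho>} s * (h \<rho> / s) \<partial>lborel) \<le> profile_int (\<rho> / 2) \<rho>"
    unfolding profile_int_def using assms h_antimono
    by (intro integral_mono integral_inverse(2) integrable_profile)
      (auto simp: indicator_def intro!: divide_right_mono)
  then have "h \<rho> * ln 2 \<le> profile_int (\<rho> / 2) \<rho>" by (simp only: integral_inverse(1)[OF half] ln)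
  then show 1: "h \<rho> \<le> log_avg \<rho>" by (simp add: log_avg_def field_simps)
  have "profile_int (\<rho> / 2) \<rho> \<le> (\<integral>s. indicator {\<rho> / 2..<\<rho>} s * (h (\<rho> / 2) / s) \<partial>lborel)"
    unfolding profile_int_def using assms h_antimono
    by (intro integral_mono integral_inverse(2) integrable_profile)
      (auto simp: indicator_def intro!: divide_right_mono)
  then have "profile_int (\<rho> / 2) \<rho> \<le> h (\<rho> / 2) * ln 2" by (simp only: integral_inverse(1)[OF half] ln)
  then show "log_avg \<rho> \<le> h (\<rho> / 2)" by (simp add: log_avg_def field_simps)
  show "0 \<le> log_avg \<rho>" using 1 h_nonneg[of \<rho>] by linarith
qed

lemma log_slope_bounds:
  assumes "0 < s"
  shows "0 \<le> log_slope s" "log_slope s \<le> h (s / 2) / (s * ln 2)"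
proof -
  have "h s \<le> h (s / 2)" using assms by (intro h_antimono) auto
  then show "0 \<le> log_slope s" using assms by (simp add: log_slope_def)
  show "log_slope s \<le> h (s / 2) / (s * ln 2)"
    unfolding log_slope_def using assms h_nonneg[of s] by (intro divide_right_mono) auto
qed

lemma measurable_log_slope: "log_slope \<in> borel_measurable borel"
  unfolding log_slope_def using h_meas by measurable

lemma measurable_log_avg: "log_avg \<in> borel_measurable borel"
proof -
  have "(\<lambda>(\<rho>, s). indicator {\<rho> / 2..<\<rho>} s * (h s / s)) = (\<lambda>z. of_bool (fst z / 2 \<le> snd z \<and> snd z < fst z) * (h (snd z) / snd z))"
    by (auto simp: fun_eq_iff indicator_def)
  also have "\<dots> \<in> borel_measurable (borel \<Otimes>\<^sub>M lborel)" using h_meas by measurable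
  finally have "(\<lambda>\<rho>. \<integral>s. indicator {\<rho> / 2..<\<rho>} s * (h s / s) \<partial>lborel) \<in> borel_measurable borel"
    by (rule lborel.borel_measurable_lebesgue_integral)
  then show ?thesis unfolding log_avg_def profile_int_def by (rule borel_measurable_divide) simp
qed

text \<open>Both sides compare \<open>\<integral>\<^bsub>\<rho>/2\<^esub>\<^sup>1 h(s) ds/s\<close> split at \<open>\<rho>\<close> and at \<open>1/2\<close>; the substitution \<open>s \<mapsto> s/2\<close> leaves
  \<open>ds/s\<close> invariant.\<close>

lemma log_avg_eq_integral_slope:
  assumes "0 < \<rho>" "\<rho> \<le> 1"
  shows "log_avg \<rho> = log_avg 1 + (\<integral>s. indicator {\<rho>..<1} s * log_slope s \<partial>lborel)"
proof -
  have shift: "(\<integral>s. indicator {\<rho>..<1} s * (h (s / 2) / s) \<partial>lborel) = profile_int (\<rho> / 2) (1 / 2)"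
  proof -
    have "(\<integral>s. indicator {\<rho>..<1} s * (h (s / 2) / s) \<partial>lborel)
        = \<bar>2\<bar> *\<^sub>R (\<integral>s. indicator {\<rho>..<1} (0 + 2 * s) * (h ((0 + 2 * s) / 2) / (0 + 2 * s)) \<partial>lborel)"
      by (rule lborel_integral_real_affine) simp
    also have "\<dots> = (\<integral>s. 2 * (indicator {\<rho>..<1} (0 + 2 * s) * (h ((0 + 2 * s) / 2) / (0 + 2 * s))) \<partial>lborel)"
      by (simp only: abs_numeral real_scaleR_def integral_mult_right_zero)
    also have "\<dots> = profile_int (\<rho> / 2) (1 / 2)" unfolding profile_int_def
      by (rule Bochner_Integration.integral_cong) (auto simp: indicator_def)
    finally show ?thesis .
  qed
  have int2: "integrable lborel (\<lambda>s. indicator {\<rho>..<1} s * (h (s / 2) / s))"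
  proof (rule Bochner_Integration.integrable_bound)
    show "integrable lborel (\<lambda>s. indicator {\<rho>..1} s *\<^sub>R (h (\<rho> / 2) / \<rho>))" by (rule integrable_const_Icc)
    show "(\<lambda>s. indicator {\<rho>..<1} s * (h (s / 2) / s)) \<in> borel_measurable lborel" using h_meas by measurable
    show "AE s in lborel. norm (indicator {\<rho>..<1} s * (h (s / 2) / s)) \<le> norm (indicator {\<rho>..1} s *\<^sub>R (h (\<rho> / 2) / \<rho>))"
    proof (rule AE_I2)
      fix s
      have "h (s / 2) / s \<le> h (\<rho> / 2) / \<rho>" if "\<rho> \<le> s"
        using that assms h_antimono[of "\<rho> / 2" "s / 2"] h_nonneg by (intro frac_le) auto
      then show "norm (indicator {\<rho>..<1} s * (h (s / 2) / s)) \<le> norm (indicator {\<rho>..1} s *\<^sub>R (h (\<rho> / 2) / \<rho>))"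
        using assms h_nonneg[of "s / 2"] h_nonneg[of "\<rho> / 2"] by (auto simp: indicator_def)
    qed
  qed
  have "(\<integral>s. indicator {\<rho>..<1} s * log_slope s \<partial>lborel)
      = (\<integral>s. (indicator {\<rho>..<1} s * (h (s / 2) / s) - indicator {\<rho>..<1} s * (h s / s)) / ln 2 \<partial>lborel)"
    by (rule Bochner_Integration.integral_cong) (auto simp: log_slope_def indicator_def diff_divide_distrib)
  also have "\<dots> = (profile_int (\<rho> / 2) (1 / 2) - profile_int \<rho> 1) / ln 2"
    using int2 integrable_profile[OF assms(1), of 1] shift by (simp add: profile_int_def)
  finally have "(\<integral>s. indicator {\<rho>..<1} s * log_slope s \<partial>lborel) = (profile_int (\<rho> / 2) (1 / 2) - profile_int \<rho> 1) / ln 2" .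
  moreover have "profile_int (\<rho> / 2) \<rho> + profile_int \<rho> 1 = profile_int (\<rho> / 2) (1 / 2) + profile_int (1 / 2) 1"
    using profile_int_add[of "\<rho> / 2" \<rho> 1] profile_int_add[of "\<rho> / 2" "1 / 2" 1] assms by simp
  ultimately show ?thesis by (simp add: log_avg_def add_divide_distrib[symmetric] diff_divide_distrib[symmetric])
qed

end

section \<open>Functions of the largest coordinate\<close>

context unit_interval begin

text \<open>The distance from the corner \<open>(lo, \<dots>, lo)\<close> of the cube in the maximum norm.\<close>

definition corner :: "nat \<Rightarrow> (nat \<Rightarrow> real) \<Rightarrow> real" where
  "corner n x = Max ((\<lambda>i. x i - lo) ` {..<n})"

definition on_top :: "nat \<Rightarrow> nat \<Rightarrow> (nat \<Rightarrow> real) \<Rightarrow> bool" where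
  "on_top n k x \<longleftrightarrow> (\<forall>i<n. x i \<le> x k)"

lemma corner_le_iff: "0 < n \<Longrightarrow> corner n x \<le> c \<longleftrightarrow> (\<forall>i<n. x i - lo \<le> c)"
  unfolding corner_def by (subst Max_le_iff) auto

lemma corner_less_iff: "0 < n \<Longrightarrow> corner n x < c \<longleftrightarrow> (\<forall>i<n. x i - lo < c)"
  unfolding corner_def by (subst Max_less_iff) auto

lemma corner_ge: "i < n \<Longrightarrow> x i - lo \<le> corner n x"
  unfolding corner_def by (rule Max_ge) auto

lemma corner_attained: "0 < n \<Longrightarrow> \<exists>k<n. on_top n k x \<and> corner n x = x k - lo"
proof -
  assume n: "0 < n"
  have "corner n x \<in> (\<lambda>i. x i - lo) ` {..<n}"
    unfolding corner_def by (rule Max_in) (use n in auto)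
  then obtain k where k: "k < n" "corner n x = x k - lo" by auto
  have "x i \<le> x k" if "i < n" for i using corner_ge[OF that, of x] k by simp
  then show ?thesis using k by (auto simp: on_top_def)
qed

lemma measurable_corner:
  assumes "0 < n" shows "corner n \<in> borel_measurable (Q n)"
  unfolding borel_measurable_iff_less
proof
  fix c
  have "{x \<in> space (Q n). corner n x < c} = {x \<in> space (Q n). \<forall>i\<in>{..<n}. x i - lo < c}"
    using corner_less_iff[OF assms] by auto
  also have "\<dots> \<in> sets (Q n)"
  proof (rule sets.sets_Collect_finite_All)
    fix i assume "i \<in> {..<n}"
    then have [measurable]: "(\<lambda>x. x i) \<in> borel_measurable (Q n)" using measurable_Q_component by auto
    show "{x \<in> space (Q n). x i - lo < c} \<in> sets (Q n)" by measurable
  qed simp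
  finally show "{x \<in> space (Q n). corner n x < c} \<in> sets (Q n)" .
qed

lemma emeasure_R_below: "0 \<le> \<rho> \<Longrightarrow> \<rho> \<le> 1 \<Longrightarrow> emeasure R (I \<inter> {..<lo + \<rho>}) = ennreal \<rho>"
  and emeasure_R_atMost: "0 \<le> \<rho> \<Longrightarrow> \<rho> \<le> 1 \<Longrightarrow> emeasure R (I \<inter> {..lo + \<rho>}) = ennreal \<rho>"
proof -
  assume r: "0 \<le> \<rho>" "\<rho> \<le> 1"
  have eq: "emeasure R (I \<inter> A) = emeasure lborel {lo<..<lo + \<rho>}"
    if A: "A \<in> sets borel" and cl: "\<And>t. t \<noteq> lo \<Longrightarrow> t \<noteq> lo + \<rho> \<Longrightarrow> t \<noteq> lo + 1 \<Longrightarrow> t \<in> I \<and> t \<in> A \<longleftrightarrow> t \<in> {lo<..<lo + \<rho>}" for A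
  proof -
    have "emeasure R (I \<inter> A) = emeasure lborel (I \<inter> A)" by (rule emeasure_restrict_space) auto
    also have "\<dots> = emeasure lborel {lo<..<lo + \<rho>}"
    proof (rule emeasure_eq_AE)
      show "AE t in lborel. (t \<in> I \<inter> A) = (t \<in> {lo<..<lo + \<rho>})"
        using AE_lborel_singleton[of lo] AE_lborel_singleton[of "lo + \<rho>"] AE_lborel_singleton[of "lo + 1"]
        by eventually_elim (use cl in auto)
    qed (use A in auto)
    finally show ?thesis .
  qed
  have mem: "t \<in> I \<longleftrightarrow> t \<in> {lo<..<lo + 1}" if "t \<noteq> lo" "t \<noteq> lo + 1" for t
  proof
    assume "t \<in> I"
    then have "t \<in> {lo..lo + 1}" using interval_upper by blast
    then show "t \<in> {lo<..<lo + 1}" using that by auto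
  qed (use interval_lower in blast)
  show "emeasure R (I \<inter> {..<lo + \<rho>}) = ennreal \<rho>"
    using r by (subst eq) (auto simp: mem)
  show "emeasure R (I \<inter> {..lo + \<rho>}) = ennreal \<rho>"
    using r by (subst eq) (auto simp: mem)
qed

lemma emeasure_corner_less:
  assumes "0 < n" "0 \<le> \<rho>" "\<rho> \<le> 1"
  shows "emeasure (Q n) {x \<in> space (Q n). corner n x < \<rho>} = ennreal (\<rho> ^ n)"
proof -
  have "{x \<in> space (Q n). corner n x < \<rho>} = Pi\<^sub>E {..<n} (\<lambda>_. I \<inter> {..<lo + \<rho>})"
  proof (rule set_eqI)
    fix x
    show "x \<in> {x \<in> space (Q n). corner n x < \<rho>} \<longleftrightarrow> x \<in> Pi\<^sub>E {..<n} (\<lambda>_. I \<inter> {..<lo + \<rho>})"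
      using corner_less_iff[OF assms(1), of x \<rho>] by (auto simp: space_PiM PiE_iff algebra_simps)
  qed
  also have "emeasure (Q n) \<dots> = (\<Prod>i<n. emeasure R (I \<inter> {..<lo + \<rho>}))"
    by (rule R.emeasure_PiM_box) (auto simp: sets_restrict_space_iff)
  also have "\<dots> = ennreal (\<rho> ^ n)" using assms by (simp add: emeasure_R_below ennreal_power)
  finally show ?thesis .
qed

lemma measurable_on_top: "k < n \<Longrightarrow> {x \<in> space (Q n). on_top n k x} \<in> sets (Q n)"
proof -
  assume k: "k < n"
  have [measurable]: "(\<lambda>x. x k) \<in> borel_measurable (Q n)" by (rule measurable_Q_component[OF k])
  have "{x \<in> space (Q n). \<forall>i\<in>{..<n}. x i \<le> x k} \<in> sets (Q n)"
  proof (rule sets.sets_Collect_finite_All)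
    fix i assume "i \<in> {..<n}"
    then have [measurable]: "(\<lambda>x. x i) \<in> borel_measurable (Q n)" using measurable_Q_component by auto
    show "{x \<in> space (Q n). x i \<le> x k} \<in> sets (Q n)" by measurable
  qed simp
  then show ?thesis unfolding on_top_def Ball_def lessThan_iff .
qed

lemma nn_integral_R_shift:
  assumes [measurable]: "\<psi> \<in> borel_measurable borel"
  shows "(\<integral>\<^sup>+t. \<psi> (t - lo) \<partial>R) = (\<integral>\<^sup>+s. \<psi> s * indicator {0<..<1} s \<partial>lborel)"
proof -
  have "(\<integral>\<^sup>+s. \<psi> s * indicator {0<..<1} s \<partial>lborel)
      = ennreal \<bar>1\<bar> * (\<integral>\<^sup>+t. \<psi> (- lo + 1 * t) * indicator {0<..<1} (- lo + 1 * t) \<partial>lborel)"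
    by (rule nn_integral_real_affine) auto
  also have "\<dots> = (\<integral>\<^sup>+t. \<psi> (t - lo) * indicator {0<..<1} (t - lo) \<partial>lborel)" by (simp add: algebra_simps)
  also have "\<dots> = (\<integral>\<^sup>+t. \<psi> (t - lo) * indicator I t \<partial>lborel)"
  proof (rule nn_integral_cong_AE)
    show "AE t in lborel. \<psi> (t - lo) * indicator {0<..<1} (t - lo) = \<psi> (t - lo) * indicator I t"
      using AE_lborel_interior by eventually_elim (auto simp: indicator_def)
  qed
  also have "\<dots> = (\<integral>\<^sup>+t. \<psi> (t - lo) \<partial>R)" by (subst nn_integral_restrict_space) auto
  finally show ?thesis by simp
qed

text \<open>Fix the \<open>k\<close>th coordinate at distance \<open>s\<close> from \<open>lo\<close>: the other \<open>n - 1\<close> coordinates then range over an interval of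
  length \<open>s\<close>.\<close>

lemma nn_integral_on_top:
  assumes \<psi> [measurable]: "\<psi> \<in> borel_measurable borel" and k: "k < n"
  shows "(\<integral>\<^sup>+x. \<psi> (x k - lo) * indicator {x. on_top n k x} x \<partial>Q n)
    = (\<integral>\<^sup>+s. \<psi> s * ennreal (s ^ (n - 1)) * indicator {0<..<1} s \<partial>lborel)"
proof -
  interpret Q: prob_space "Q n" by (rule prob_Q)
  interpret QR: pair_sigma_finite "Q n" R by unfold_locales
  have J: "finite {..<n}" "k \<in> {..<n}" using k by auto
  let ?F = "\<lambda>x. \<psi> (x k - lo) * indicator {x. on_top n k x} x"
  have mk: "(\<lambda>x. x k) \<in> borel_measurable (Q n)" by (rule measurable_Q_component[OF k])
  have mi: "(\<lambda>x. indicator {x. on_top n k x} x :: ennreal) \<in> borel_measurable (Q n)"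
  proof -
    have "(\<lambda>x. indicator {x. on_top n k x} x :: ennreal) \<in> borel_measurable (Q n)
        \<longleftrightarrow> (\<lambda>x. indicator {x \<in> space (Q n). on_top n k x} x :: ennreal) \<in> borel_measurable (Q n)"
      by (rule measurable_cong) (auto simp: indicator_def)
    then show ?thesis using measurable_on_top[OF k] by simp
  qed
  have mF: "?F \<in> borel_measurable (Q n)"
    using mk by (intro borel_measurable_times_ennreal mi measurable_compose[OF _ \<psi>]) simp
  have m2: "(\<lambda>(x, t). ?F (x(k := t))) \<in> borel_measurable (Q n \<Otimes>\<^sub>M R)"
    using measurable_compose[OF R.measurable_update[OF J(2)] mF] by (simp add: split_beta')
  have "(\<integral>\<^sup>+x. ?F x \<partial>Q n) = (\<integral>\<^sup>+x. \<integral>\<^sup>+t. ?F (x(k := t)) \<partial>R \<partial>Q n)"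
    by (rule R.nn_integral_update[OF J mF, symmetric])
  also have "\<dots> = (\<integral>\<^sup>+t. \<integral>\<^sup>+x. ?F (x(k := t)) \<partial>Q n \<partial>R)"
    by (rule QR.Fubini'[OF m2, symmetric])
  also have "\<dots> = (\<integral>\<^sup>+t. \<psi> (t - lo) * ennreal ((t - lo) ^ (n - 1)) \<partial>R)"
  proof (rule nn_integral_cong)
    fix t assume "t \<in> space R"
    then have t: "0 \<le> t - lo" "t - lo \<le> 1" "t \<in> I" using interval_upper by (auto simp: subset_eq)
    let ?B = "Pi\<^sub>E {..<n} ((\<lambda>_. I \<inter> {..lo + (t - lo)})(k := I))"
    have B: "?B \<in> sets (Q n)" by (intro sets_PiM_I_finite) (auto simp: sets_restrict_space_iff)
    have "(\<integral>\<^sup>+x. ?F (x(k := t)) \<partial>Q n) = (\<integral>\<^sup>+x. \<psi> (t - lo) * indicator ?B x \<partial>Q n)"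
    proof (rule nn_integral_cong)
      fix x assume x: "x \<in> space (Q n)"
      have "on_top n k (x(k := t)) \<longleftrightarrow> (\<forall>i<n. i \<noteq> k \<longrightarrow> x i \<le> t)" using k by (auto simp: on_top_def)
      also have "\<dots> \<longleftrightarrow> x \<in> ?B"
      proof
        assume a: "\<forall>i<n. i \<noteq> k \<longrightarrow> x i \<le> t"
        show "x \<in> ?B" unfolding PiE_iff
        proof (intro conjI ballI)
          fix i assume i: "i \<in> {..<n}"
          then have "x i \<in> I" using Q_component[OF x] by simp
          then show "x i \<in> ((\<lambda>_. I \<inter> {..lo + (t - lo)})(k := I)) i" using a i by auto
        qed (use x in \<open>simp add: space_PiM PiE_iff\<close>)
      next
        assume b: "x \<in> ?B"
        show "\<forall>i<n. i \<noteq> k \<longrightarrow> x i \<le> t"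
        proof (intro allI impI)
          fix i assume "i < n" "i \<noteq> k"
          then have "x i \<in> ((\<lambda>_. I \<inter> {..lo + (t - lo)})(k := I)) i" using b by (auto simp only: PiE_iff lessThan_iff)
          then show "x i \<le> t" using \<open>i \<noteq> k\<close> by simp
        qed
      qed
      finally show "?F (x(k := t)) = \<psi> (t - lo) * indicator ?B x" by (simp add: indicator_def)
    qed
    also have "\<dots> = \<psi> (t - lo) * emeasure (Q n) ?B" using B by (rule nn_integral_cmult_indicator)
    also have "emeasure (Q n) ?B = (\<Prod>i<n. emeasure R (((\<lambda>_. I \<inter> {..lo + (t - lo)})(k := I)) i))"
      by (rule R.emeasure_PiM_box) (auto simp: sets_restrict_space_iff)
    also have "\<dots> = (\<Prod>i\<in>{..<n} - {k}. emeasure R (I \<inter> {..lo + (t - lo)}))"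
      using k R.emeasure_space_1 by (subst prod.remove[of _ k]) auto
    also have "\<dots> = ennreal ((t - lo) ^ (n - 1))"
      unfolding emeasure_R_atMost[OF t(1,2)] using k t by (simp add: ennreal_power)
    finally show "(\<integral>\<^sup>+x. ?F (x(k := t)) \<partial>Q n) = \<psi> (t - lo) * ennreal ((t - lo) ^ (n - 1))" .
  qed
  also have "\<dots> = (\<integral>\<^sup>+s. \<psi> s * ennreal (s ^ (n - 1)) * indicator {0<..<1} s \<partial>lborel)"
    by (rule nn_integral_R_shift[of "\<lambda>s. \<psi> s * ennreal (s ^ (n - 1))"]) measurable
  finally show ?thesis .
qed

lemma nn_integral_corner_le:
  assumes \<psi> [measurable]: "\<psi> \<in> borel_measurable borel" and n: "0 < n"
  shows "(\<integral>\<^sup>+x. \<psi> (corner n x) \<partial>Q n) \<le> of_nat n * (\<integral>\<^sup>+s. \<psi> s * ennreal (s ^ (n - 1)) * indicator {0<..<1} s \<partial>lborel)"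
proof -
  have "(\<integral>\<^sup>+x. \<psi> (corner n x) \<partial>Q n) \<le> (\<integral>\<^sup>+x. (\<Sum>k<n. \<psi> (x k - lo) * indicator {x. on_top n k x} x) \<partial>Q n)"
  proof (rule nn_integral_mono)
    fix x
    obtain k where k: "k < n" "on_top n k x" "corner n x = x k - lo" using corner_attained[OF n] by blast
    then have "\<psi> (corner n x) = \<psi> (x k - lo) * indicator {x. on_top n k x} x" by simp
    also have "\<dots> \<le> (\<Sum>k<n. \<psi> (x k - lo) * indicator {x. on_top n k x} x)"
      by (rule member_le_sum) (use k in auto)
    finally show "\<psi> (corner n x) \<le> (\<Sum>k<n. \<psi> (x k - lo) * indicator {x. on_top n k x} x)" .
  qed
  also have "\<dots> = (\<Sum>k<n. \<integral>\<^sup>+x. \<psi> (x k - lo) * indicator {x. on_top n k x} x \<partial>Q n)"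
  proof (rule nn_integral_sum)
    fix k assume "k \<in> {..<n}"
    then have k: "k < n" by simp
    have mi: "(\<lambda>x. indicator {x. on_top n k x} x :: ennreal) \<in> borel_measurable (Q n)"
    proof -
      have "(\<lambda>x. indicator {x. on_top n k x} x :: ennreal) \<in> borel_measurable (Q n)
          \<longleftrightarrow> (\<lambda>x. indicator {x \<in> space (Q n). on_top n k x} x :: ennreal) \<in> borel_measurable (Q n)"
        by (rule measurable_cong) (auto simp: indicator_def)
      then show ?thesis using measurable_on_top[OF k] by simp
    qed
    show "(\<lambda>x. \<psi> (x k - lo) * indicator {x. on_top n k x} x) \<in> borel_measurable (Q n)"
      using measurable_Q_component[OF k] by (intro borel_measurable_times_ennreal mi measurable_compose[OF _ \<psi>]) simp
  qed
  also have "\<dots> = (\<Sum>k<n. \<integral>\<^sup>+s. \<psi> s * ennreal (s ^ (n - 1)) * indicator {0<..<1} s \<partial>lborel)"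
    by (rule sum.cong[OF refl]) (rule nn_integral_on_top[OF \<psi>], simp)
  also have "\<dots> = of_nat n * (\<integral>\<^sup>+s. \<psi> s * ennreal (s ^ (n - 1)) * indicator {0<..<1} s \<partial>lborel)" by simp
  finally show ?thesis .
qed

end

section \<open>A Sobolev function with a prescribed profile\<close>

context unit_interval begin

context
  \<comment> \<open>The last condition is finiteness of the norm of \<open>h(corner (n - 1) y)\<close> in \<open>L\<^bsup>r,p\<^esup>\<close>, in the variable
  \<open>s = t\<^bsup>1/(n-1)\<^esup>\<close>.\<close>
  fixes n :: nat and p :: real and h :: "real \<Rightarrow> real"
  assumes n: "2 \<le> n" and p: "1 \<le> p" "p < n"
    and h_nonneg: "\<And>s. 0 \<le> h s" and h_antimono: "\<And>s t. 0 < s \<Longrightarrow> s \<le> t \<Longrightarrow> h t \<le> h s"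
    and h_meas: "h \<in> borel_measurable borel"
    and fin: "(\<integral>\<^sup>+s. ennreal (h s powr p * s powr (n - 1 - p)) * indicator {0<..<1} s \<partial>lborel) < top"
begin

lemma avg_bounds:
  assumes "0 < \<rho>"
  shows "h \<rho> \<le> log_avg h \<rho>" "log_avg h \<rho> \<le> h (\<rho> / 2)" "0 \<le> log_avg h \<rho>"
  by (rule log_avg_bounds; simp add: h_nonneg h_antimono h_meas assms)+

lemma slope_bounds:
  assumes "0 < s"
  shows "0 \<le> log_slope h s" "log_slope h s \<le> h (s / 2) / (s * ln 2)"
  by (rule log_slope_bounds; simp add: h_nonneg h_antimono h_meas assms)+

lemma meas_avg [measurable]: "log_avg h \<in> borel_measurable borel"
  by (rule measurable_log_avg; simp add: h_nonneg h_antimono h_meas)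

lemma meas_slope [measurable]: "log_slope h \<in> borel_measurable borel"
  by (rule measurable_log_slope; simp add: h_nonneg h_antimono h_meas)

text \<open>A Sobolev function whose supremum on the line in direction \<open>k\<close> through \<open>y\<close> is at least
  \<open>h(corner (n - 1) y)\<close>. The profile \<open>h\<close> will be a rearrangement, hence not differentiable in general,
  which is why its logarithmic average is used.\<close>

definition corner_fun :: "(nat \<Rightarrow> real) \<Rightarrow> real" where
  "corner_fun x = log_avg h (corner n x)"

text \<open>The chain rule: the \<open>k\<close>th partial derivative of a maximum is the indicator of the set where the \<open>k\<close>th
  coordinate attains it. On the null set of ties several components are nonzero, which is harmless.\<close>

definition corner_grad :: "nat \<Rightarrow> (nat \<Rightarrow> real) \<Rightarrow> real" where
  "corner_grad k x = (if on_top n k x then - log_slope h (x k - lo) else 0)"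

lemma scaled_profile_integral:
  "(\<integral>\<^sup>+s. ennreal (h (s / 2) powr p * s powr (n - 1 - p)) * indicator {0<..<1} s \<partial>lborel)
    \<le> ennreal (2 powr (n - p)) * (\<integral>\<^sup>+s. ennreal (h s powr p * s powr (n - 1 - p)) * indicator {0<..<1} s \<partial>lborel)"
proof -
  note [measurable] = h_meas
  have "(\<integral>\<^sup>+s. ennreal (h (s / 2) powr p * s powr (n - 1 - p)) * indicator {0<..<1} s \<partial>lborel)
      = ennreal \<bar>2\<bar> * (\<integral>\<^sup>+s. ennreal (h ((0 + 2 * s) / 2) powr p * (0 + 2 * s) powr (n - 1 - p)) * indicator {0<..<1} (0 + 2 * s) \<partial>lborel)"
    by (rule nn_integral_real_affine) auto
  also have "\<dots> \<le> ennreal \<bar>2\<bar> * (\<integral>\<^sup>+s. ennreal (2 powr (n - 1 - p)) * (ennreal (h s powr p * s powr (n - 1 - p)) * indicator {0<..<1} s) \<partial>lborel)"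
  proof (intro mult_left_mono nn_integral_mono)
    fix s :: real
    show "ennreal (h ((0 + 2 * s) / 2) powr p * (0 + 2 * s) powr (n - 1 - p)) * indicator {0<..<1} (0 + 2 * s)
        \<le> ennreal (2 powr (n - 1 - p)) * (ennreal (h s powr p * s powr (n - 1 - p)) * indicator {0<..<1} s)"
      by (cases "0 < s") (auto simp: indicator_def ennreal_mult[symmetric] powr_mult mult_ac)
  qed simp
  also have "\<dots> = ennreal \<bar>2\<bar> * (ennreal (2 powr (n - 1 - p)) * (\<integral>\<^sup>+s. ennreal (h s powr p * s powr (n - 1 - p)) * indicator {0<..<1} s \<partial>lborel))"
    by (subst nn_integral_cmult) auto
  also have "\<dots> = ennreal (2 powr (n - p)) * (\<integral>\<^sup>+s. ennreal (h s powr p * s powr (n - 1 - p)) * indicator {0<..<1} s \<partial>lborel)"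
  proof -
    have "2 * 2 powr (n - 1 - p) = (2::real) powr (1 + (n - 1 - p))" by (simp only: powr_add) simp
    also have "1 + (n - 1 - p) = n - p" using n by (simp add: of_nat_diff)
    finally have "ennreal \<bar>2\<bar> * ennreal (2 powr (n - 1 - p)) = ennreal (2 powr (n - p))"
      by (subst ennreal_mult[symmetric]) auto
    then show ?thesis by (simp only: mult.assoc[symmetric])
  qed
  finally show ?thesis .
qed

lemma corner_fun_power:
  "(\<integral>\<^sup>+x. epowr (ennreal \<bar>corner_fun x\<bar>) p \<partial>Q n)
    \<le> ennreal (n * 2 powr (n - p)) * (\<integral>\<^sup>+s. ennreal (h s powr p * s powr (n - 1 - p)) * indicator {0<..<1} s \<partial>lborel)"
    (is "_ \<le> _ * ?T")
proof -
  have "(\<integral>\<^sup>+x. epowr (ennreal \<bar>corner_fun x\<bar>) p \<partial>Q n)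
      \<le> of_nat n * (\<integral>\<^sup>+s. epowr (ennreal \<bar>log_avg h s\<bar>) p * ennreal (s ^ (n - 1)) * indicator {0<..<1} s \<partial>lborel)"
    unfolding corner_fun_def by (rule nn_integral_corner_le) (use n in auto)
  also have "\<dots> \<le> of_nat n * (\<integral>\<^sup>+s. ennreal (h (s / 2) powr p * s powr (n - 1 - p)) * indicator {0<..<1} s \<partial>lborel)"
  proof (intro mult_left_mono nn_integral_mono)
    fix s :: real
    show "epowr (ennreal \<bar>log_avg h s\<bar>) p * ennreal (s ^ (n - 1)) * indicator {0<..<1} s
        \<le> ennreal (h (s / 2) powr p * s powr (n - 1 - p)) * indicator {0<..<1} s"
    proof (cases "s \<in> {0<..<1}")
      case True
      then have s: "0 < s" "s < 1" by auto
      have "\<bar>log_avg h s\<bar> powr p \<le> h (s / 2) powr p"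
        using avg_bounds[OF s(1)] p by (intro powr_mono2) auto
      moreover have "s ^ (n - 1) \<le> s powr (n - 1 - p)"
      proof -
        have "s ^ (n - 1) = s powr (n - 1)" using s by (simp add: powr_realpow)
        also have "\<dots> \<le> s powr (n - 1 - p)" using s p by (intro powr_mono') auto
        finally show ?thesis .
      qed
      ultimately have "\<bar>log_avg h s\<bar> powr p * s ^ (n - 1) \<le> h (s / 2) powr p * s powr (n - 1 - p)"
        using s by (intro mult_mono) auto
      then have "ennreal (\<bar>log_avg h s\<bar> powr p * s ^ (n - 1)) \<le> ennreal (h (s / 2) powr p * s powr (n - 1 - p))"
        by (rule ennreal_leI)
      moreover have "ennreal (\<bar>log_avg h s\<bar> powr p * s ^ (n - 1)) = ennreal (\<bar>log_avg h s\<bar> powr p) * ennreal (s ^ (n - 1))"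
        using s by (intro ennreal_mult) auto
      ultimately have "ennreal (\<bar>log_avg h s\<bar> powr p) * ennreal (s ^ (n - 1)) \<le> ennreal (h (s / 2) powr p * s powr (n - 1 - p))"
        by (simp only:)
      then show ?thesis using True by (simp add: epowr_ennreal)
    qed simp
  qed simp
  also have "\<dots> \<le> of_nat n * (ennreal (2 powr (n - p)) * ?T)"
    by (intro mult_left_mono scaled_profile_integral) simp
  also have "\<dots> = ennreal (n * 2 powr (n - p)) * ?T"
    by (simp add: ennreal_mult ennreal_of_nat_eq_real_of_nat mult.assoc)
  finally show ?thesis .
qed

lemma corner_grad_power:
  assumes k: "k < n"
  shows "(\<integral>\<^sup>+x. epowr (ennreal \<bar>corner_grad k x\<bar>) p \<partial>Q n)
    \<le> ennreal ((1 / ln 2) powr p * 2 powr (n - p)) * (\<integral>\<^sup>+s. ennreal (h s powr p * s powr (n - 1 - p)) * indicator {0<..<1} s \<partial>lborel)"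
    (is "_ \<le> _ * ?T")
proof -
  have "(\<integral>\<^sup>+x. epowr (ennreal \<bar>corner_grad k x\<bar>) p \<partial>Q n)
      = (\<integral>\<^sup>+x. epowr (ennreal \<bar>log_slope h (x k - lo)\<bar>) p * indicator {x. on_top n k x} x \<partial>Q n)"
    by (rule nn_integral_cong) (simp add: corner_grad_def indicator_def)
  also have "\<dots> = (\<integral>\<^sup>+s. epowr (ennreal \<bar>log_slope h s\<bar>) p * ennreal (s ^ (n - 1)) * indicator {0<..<1} s \<partial>lborel)"
    by (rule nn_integral_on_top[OF _ k]) measurable
  also have "\<dots> \<le> (\<integral>\<^sup>+s. ennreal ((1 / ln 2) powr p) * (ennreal (h (s / 2) powr p * s powr (n - 1 - p)) * indicator {0<..<1} s) \<partial>lborel)"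
  proof (rule nn_integral_mono)
    fix s :: real
    show "epowr (ennreal \<bar>log_slope h s\<bar>) p * ennreal (s ^ (n - 1)) * indicator {0<..<1} s
        \<le> ennreal ((1 / ln 2) powr p) * (ennreal (h (s / 2) powr p * s powr (n - 1 - p)) * indicator {0<..<1} s)"
    proof (cases "s \<in> {0<..<1}")
      case True
      then have s: "0 < s" "s < 1" by auto
      have "\<bar>log_slope h s\<bar> powr p \<le> (h (s / 2) / (s * ln 2)) powr p"
        using slope_bounds[OF s(1)] p by (intro powr_mono2) auto
      then have "\<bar>log_slope h s\<bar> powr p * s ^ (n - 1) \<le> (h (s / 2) / (s * ln 2)) powr p * s ^ (n - 1)"
        using s by (intro mult_right_mono) auto
      also have "\<dots> = (1 / ln 2) powr p * (h (s / 2) powr p * s powr (n - 1 - p))"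
      proof -
        have "s ^ (n - 1) = s powr (n - 1)" using s by (simp add: powr_realpow)
        moreover have "s powr (n - 1 - p) = s powr (n - 1) / s powr p" using s by (simp add: powr_diff)
        moreover have "(h (s / 2) / (s * ln 2)) powr p = (1 / ln 2) powr p * h (s / 2) powr p / s powr p"
          using s h_nonneg[of "s / 2"] by (simp add: powr_mult powr_divide)
        ultimately show ?thesis by simp
      qed
      finally have "ennreal (\<bar>log_slope h s\<bar> powr p * s ^ (n - 1)) \<le> ennreal ((1 / ln 2) powr p * (h (s / 2) powr p * s powr (n - 1 - p)))"
        by (rule ennreal_leI)
      moreover have "ennreal (\<bar>log_slope h s\<bar> powr p * s ^ (n - 1)) = ennreal (\<bar>log_slope h s\<bar> powr p) * ennreal (s ^ (n - 1))"
        using s by (intro ennreal_mult) auto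
      moreover have "ennreal ((1 / ln 2) powr p * (h (s / 2) powr p * s powr (n - 1 - p))) = ennreal ((1 / ln 2) powr p) * ennreal (h (s / 2) powr p * s powr (n - 1 - p))"
        by (intro ennreal_mult) auto
      ultimately have "ennreal (\<bar>log_slope h s\<bar> powr p) * ennreal (s ^ (n - 1))
          \<le> ennreal ((1 / ln 2) powr p) * ennreal (h (s / 2) powr p * s powr (n - 1 - p))"
        by (simp only:)
      then show ?thesis using True by (simp add: epowr_ennreal)
    qed simp
  qed
  also have "\<dots> = ennreal ((1 / ln 2) powr p) * (\<integral>\<^sup>+s. ennreal (h (s / 2) powr p * s powr (n - 1 - p)) * indicator {0<..<1} s \<partial>lborel)"
    proof (rule nn_integral_cmult)
    note [measurable] = h_meas
    show "(\<lambda>s. ennreal (h (s / 2) powr p * s powr (n - 1 - p)) * indicator {0<..<1} s) \<in> borel_measurable lborel"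
      by measurable
  qed
  also have "\<dots> \<le> ennreal ((1 / ln 2) powr p) * (ennreal (2 powr (n - p)) * ?T)"
    by (intro mult_left_mono scaled_profile_integral) simp
  also have "\<dots> = ennreal ((1 / ln 2) powr p * 2 powr (n - p)) * ?T"
    by (simp add: ennreal_mult mult.assoc)
  finally show ?thesis .
qed

lemma measurable_corner_fun: "corner_fun \<in> borel_measurable (Q n)"
  unfolding corner_fun_def using n by (intro measurable_compose[OF measurable_corner meas_avg]) auto

lemma measurable_corner_grad: "k < n \<Longrightarrow> corner_grad k \<in> borel_measurable (Q n)"
proof -
  assume k: "k < n"
  have [measurable]: "(\<lambda>x. x k) \<in> borel_measurable (Q n)" by (rule measurable_Q_component[OF k])
  have "(\<lambda>x. - log_slope h (x k - lo)) \<in> borel_measurable (Q n)" by measurable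
  then show ?thesis unfolding corner_grad_def using measurable_on_top[OF k] by (intro measurable_If) auto
qed

lemma integrable_corner_fun: "integrable (Q n) corner_fun"
  by (rule integrable_of_power[OF measurable_corner_fun p(1)])
    (rule le_less_trans[OF corner_fun_power], use fin in \<open>simp add: ennreal_mult_less_top\<close>)

lemma integrable_corner_grad: "k < n \<Longrightarrow> integrable (Q n) (corner_grad k)"
  by (rule integrable_of_power[OF measurable_corner_grad p(1)], assumption)
    (rule le_less_trans[OF corner_grad_power], use fin in \<open>simp_all add: ennreal_mult_less_top\<close>)

text \<open>Moving the \<open>k\<close>th coordinate to \<open>\<sigma>\<close> leaves the corner distance unchanged until \<open>\<sigma>\<close> exceeds all other
  coordinates, and makes it equal to \<open>\<sigma> - lo\<close> afterwards. The slope integrated over \<open>\<sigma> - lo \<ge> corner n x\<close> is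
  therefore the difference of two values of \<open>log_avg\<close>, by \<open>log_avg_eq_integral_slope\<close>.\<close>

lemma corner_fun_representation:
  assumes k: "k < n"
  shows "AE x in Q n. corner_fun x = (log_avg h 1 - (\<integral>\<sigma>. corner_grad k (x(k := \<sigma>)) \<partial>R)) + primitive k (corner_grad k) x"
proof -
  have J: "finite {..<n}" "k \<in> {..<n}" using k by auto
  show ?thesis using R.integrable_update[OF J integrable_corner_grad[OF k]] AE_Q_interior[of n] AE_space
  proof eventually_elim
    case (elim x)
    define \<rho> where "\<rho> = corner n x"
    have \<rho>: "0 < \<rho>" "\<rho> < 1"
    proof -
      have "x k - lo \<le> \<rho>" unfolding \<rho>_def by (rule corner_ge[OF k])
      moreover have "lo < x k" using elim(2) k by auto
      ultimately show "0 < \<rho>" by linarith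
      have "x i - lo < 1" if "i < n" for i
      proof -
        have "x i \<in> {lo<..<lo + 1}" using elim(2) that by blast
        then show ?thesis by simp
      qed
      then show "\<rho> < 1" unfolding \<rho>_def using corner_less_iff[of n x 1] n by simp
    qed
    have iG: "integrable R (\<lambda>\<sigma>. corner_grad k (x(k := \<sigma>)))" by (rule elim(1))
    have iGi: "integrable R (\<lambda>\<sigma>. indicator {..<x k} \<sigma> * corner_grad k (x(k := \<sigma>)))"
    proof (rule Bochner_Integration.integrable_bound[OF iG])
      have "(indicator {..<x k} :: real \<Rightarrow> real) \<in> borel_measurable R" by (rule measurable_R) simp
      then show "(\<lambda>\<sigma>. indicator {..<x k} \<sigma> * corner_grad k (x(k := \<sigma>))) \<in> borel_measurable R"
        using iG by (intro borel_measurable_times) auto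
    qed (auto simp: indicator_def)
    have top: "on_top n k (x(k := \<sigma>)) \<and> \<not> \<sigma> < x k \<longleftrightarrow> \<rho> \<le> \<sigma> - lo" for \<sigma>
    proof -
      have "\<rho> \<le> \<sigma> - lo \<longleftrightarrow> (\<forall>i<n. x i \<le> \<sigma>)"
        unfolding \<rho>_def using corner_le_iff[of n x "\<sigma> - lo"] n by auto
      also have "\<dots> \<longleftrightarrow> on_top n k (x(k := \<sigma>)) \<and> \<not> \<sigma> < x k"
      proof
        assume a: "\<forall>i<n. x i \<le> \<sigma>"
        then show "on_top n k (x(k := \<sigma>)) \<and> \<not> \<sigma> < x k" using k by (auto simp: on_top_def not_less)
      next
        assume b: "on_top n k (x(k := \<sigma>)) \<and> \<not> \<sigma> < x k"
        show "\<forall>i<n. x i \<le> \<sigma>"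
        proof (intro allI impI)
          fix i assume i: "i < n"
          show "x i \<le> \<sigma>"
          proof (cases "i = k")
            case True then show ?thesis using b by simp
          next
            case False
            have "(x(k := \<sigma>)) i \<le> (x(k := \<sigma>)) k" using b i unfolding on_top_def by blast
            then show ?thesis using False by simp
          qed
        qed
      qed
      finally show ?thesis by simp
    qed
    have "(\<integral>\<sigma>. indicator {..<x k} \<sigma> * corner_grad k (x(k := \<sigma>)) \<partial>R) - (\<integral>\<sigma>. corner_grad k (x(k := \<sigma>)) \<partial>R)
        = (\<integral>\<sigma>. indicator {..<x k} \<sigma> * corner_grad k (x(k := \<sigma>)) - corner_grad k (x(k := \<sigma>)) \<partial>R)"
      by (rule Bochner_Integration.integral_diff[OF iGi iG, symmetric])
    also have "\<dots> = (\<integral>\<sigma>. indicator {\<rho>..} (\<sigma> - lo) * log_slope h (\<sigma> - lo) \<partial>R)"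
    proof (rule Bochner_Integration.integral_cong[OF refl])
      fix \<sigma>
      show "indicator {..<x k} \<sigma> * corner_grad k (x(k := \<sigma>)) - corner_grad k (x(k := \<sigma>)) = indicator {\<rho>..} (\<sigma> - lo) * log_slope h (\<sigma> - lo)"
        using top[of \<sigma>] by (cases "\<sigma> < x k"; cases "on_top n k (x(k := \<sigma>))") (simp_all add: corner_grad_def)
    qed
    also have "\<dots> = (\<integral>\<sigma>. indicator I \<sigma> * (indicator {\<rho>..} (\<sigma> - lo) * log_slope h (\<sigma> - lo)) \<partial>lborel)" by (rule integral_R)
    also have "\<dots> = (\<integral>\<sigma>. indicator {\<rho>..<1} (- lo + 1 * \<sigma>) * log_slope h (- lo + 1 * \<sigma>) \<partial>lborel)"
    proof (rule integral_cong_AE)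
      show "AE \<sigma> in lborel. indicator I \<sigma> * (indicator {\<rho>..} (\<sigma> - lo) * log_slope h (\<sigma> - lo))
          = indicator {\<rho>..<1} (- lo + 1 * \<sigma>) * log_slope h (- lo + 1 * \<sigma>)"
        using AE_lborel_interior by eventually_elim (use \<rho> in \<open>auto simp: indicator_def\<close>)
    qed measurable
    also have "\<dots> = (\<integral>s. indicator {\<rho>..<1} s * log_slope h s \<partial>lborel)"
      using lborel_integral_real_affine[of 1 "\<lambda>s. indicator {\<rho>..<1} s * log_slope h s" "- lo"] by simp
    finally have eq: "primitive k (corner_grad k) x - (\<integral>\<sigma>. corner_grad k (x(k := \<sigma>)) \<partial>R)
        = (\<integral>s. indicator {\<rho>..<1} s * log_slope h s \<partial>lborel)" unfolding primitive_def .
    have "log_avg h \<rho> = log_avg h 1 + (\<integral>s. indicator {\<rho>..<1} s * log_slope h s \<partial>lborel)"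
      using \<rho> by (intro log_avg_eq_integral_slope; simp add: h_nonneg h_antimono h_meas)
    then show ?case using eq by (simp add: corner_fun_def \<rho>_def)
  qed
qed

lemma locally_integrable_of_integrable:
  assumes "integrable (Q n) f" shows "locally_integrable I n f"
  unfolding locally_integrable_def
proof (intro conjI allI impI)
  have f: "f \<in> borel_measurable (Q n)" using assms by simp
  then show "f \<in> borel_measurable (cube I n)" by (rule measurable_cube)
  fix a b :: real assume "{a..b} \<subseteq> interior I"
  then have "{a..b} \<subseteq> I" using interior_subset by blast
  then have "Pi\<^sub>E {..<n} (\<lambda>_. {a..b}) \<in> sets (Q n)"
    by (intro sets_PiM_I_finite) (auto simp: sets_restrict_space_iff)
  then have "Pi\<^sub>E {..<n} (\<lambda>_. {a..b}) \<in> sets (cube I n)" by (simp add: cube_def)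
  moreover have "integrable (cube I n) f" using assms integrable_cube[OF f] by simp
  ultimately show "set_integrable (cube I n) (Pi\<^sub>E {..<n} (\<lambda>_. {a..b})) f"
    unfolding set_integrable_def by (rule integrable_mult_indicator)
qed

lemma corner_weak_gradient: "is_weak_gradient I n corner_fun corner_grad"
  unfolding is_weak_gradient_def
proof (intro conjI allI impI)
  show "locally_integrable I n corner_fun" by (rule locally_integrable_of_integrable[OF integrable_corner_fun])
  fix i assume i: "i < n"
  show "locally_integrable I n (corner_grad i)" by (rule locally_integrable_of_integrable[OF integrable_corner_grad[OF i]])
  fix \<phi> assume test: "test_fun I n \<phi>"
  have mp: "\<phi> \<in> borel_measurable (Q n)" "partial i \<phi> \<in> borel_measurable (Q n)"
    by (rule measurable_continuous_on_cube[OF test_fun_continuous[OF test i]],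
        rule measurable_continuous_on_cube[OF test_fun_partial_continuous[OF test i]])
  have "(\<integral>x. corner_fun x * partial i \<phi> x \<partial>Q n) = - (\<integral>x. corner_grad i x * \<phi> x \<partial>Q n)"
    by (rule primitive_weak_derivative[OF integrable_corner_fun integrable_corner_grad[OF i] i _ corner_fun_representation[OF i] test]) simp
  moreover have "(LINT x|cube I n. corner_fun x * partial i \<phi> x) = (\<integral>x. corner_fun x * partial i \<phi> x \<partial>Q n)"
    using mp measurable_corner_fun by (intro integral_cube borel_measurable_times)
  moreover have "(LINT x|cube I n. corner_grad i x * \<phi> x) = (\<integral>x. corner_grad i x * \<phi> x \<partial>Q n)"
    using mp measurable_corner_grad[OF i] by (intro integral_cube borel_measurable_times)
  ultimately show "(LINT x|cube I n. corner_fun x * partial i \<phi> x) = - (LINT x|cube I n. corner_grad i x * \<phi> x)" by simp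
qed

lemma corner_grad_length_power:
  "(\<integral>\<^sup>+x. epowr (ennreal \<bar>grad_length I n corner_fun x\<bar>) p \<partial>Q n)
    \<le> ennreal (n powr p * n * ((1 / ln 2) powr p * 2 powr (n - p)))
      * (\<integral>\<^sup>+s. ennreal (h s powr p * s powr (n - 1 - p)) * indicator {0<..<1} s \<partial>lborel)"
    (is "_ \<le> _ * ?T")
proof -
  have W: "is_weak_gradient I n corner_fun (weak_gradient I n corner_fun)"
    using corner_weak_gradient by (intro weak_gradient_is_weak_gradient) blast
  have "AE x in Q n. \<forall>i\<in>{..<n}. weak_gradient I n corner_fun i x = corner_grad i x"
    by (intro AE_finite_allI weak_gradient_unique[OF W corner_weak_gradient]) auto
  then have "AE x in Q n. epowr (ennreal \<bar>grad_length I n corner_fun x\<bar>) p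
      \<le> ennreal (n powr p) * (\<Sum>i<n. epowr (ennreal \<bar>corner_grad i x\<bar>) p)"
  proof eventually_elim
    case (elim x)
    define m where "m = Max ((\<lambda>i. \<bar>corner_grad i x\<bar>) ` {..<n})"
    have "m \<in> (\<lambda>i. \<bar>corner_grad i x\<bar>) ` {..<n}" unfolding m_def by (rule Max_in) (use n in \<open>auto simp: lessThan_empty_iff\<close>)
    then obtain j where j: "j < n" "m = \<bar>corner_grad j x\<bar>" by auto
    have m: "\<bar>corner_grad i x\<bar> \<le> m" if "i < n" for i unfolding m_def by (rule Max_ge) (use that in auto)
    have "grad_length I n corner_fun x = sqrt (\<Sum>i<n. (corner_grad i x)\<^sup>2)"
      unfolding grad_length_def using elim by simp
    also have "\<dots> \<le> (\<Sum>i<n. \<bar>corner_grad i x\<bar>)" by (rule L2_set_le_sum_abs[unfolded L2_set_def])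
    also have "\<dots> \<le> n * m" using m sum_bounded_above[of "{..<n}" "\<lambda>i. \<bar>corner_grad i x\<bar>" m] by simp
    finally have "\<bar>grad_length I n corner_fun x\<bar> \<le> n * m" by (simp add: grad_length_def sum_nonneg)
    then have "epowr (ennreal \<bar>grad_length I n corner_fun x\<bar>) p \<le> epowr (ennreal (n * m)) p"
      using p by (intro epowr_mono ennreal_leI) auto
    also have "\<dots> = ennreal (n powr p) * epowr (ennreal \<bar>corner_grad j x\<bar>) p"
      unfolding j(2) by (simp add: epowr_ennreal powr_mult ennreal_mult[symmetric])
    also have "\<dots> \<le> ennreal (n powr p) * (\<Sum>i<n. epowr (ennreal \<bar>corner_grad i x\<bar>) p)"
      using j by (intro mult_left_mono member_le_sum) auto
    finally show ?case .
  qed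
  then have "(\<integral>\<^sup>+x. epowr (ennreal \<bar>grad_length I n corner_fun x\<bar>) p \<partial>Q n)
      \<le> (\<integral>\<^sup>+x. ennreal (n powr p) * (\<Sum>i<n. epowr (ennreal \<bar>corner_grad i x\<bar>) p) \<partial>Q n)"
    by (rule nn_integral_mono_AE)
  also have "\<dots> = ennreal (n powr p) * (\<Sum>i<n. \<integral>\<^sup>+x. epowr (ennreal \<bar>corner_grad i x\<bar>) p \<partial>Q n)"
  proof -
    have m: "(\<lambda>x. epowr (ennreal \<bar>corner_grad i x\<bar>) p) \<in> borel_measurable (Q n)" if "i \<in> {..<n}" for i
    proof -
      have [measurable]: "corner_grad i \<in> borel_measurable (Q n)" using that by (intro measurable_corner_grad) auto
      show ?thesis by measurable
    qed
    have "(\<lambda>x. \<Sum>i<n. epowr (ennreal \<bar>corner_grad i x\<bar>) p) \<in> borel_measurable (Q n)"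
      by (rule borel_measurable_sum) (rule m)
    then show ?thesis using nn_integral_sum[OF m, of "{..<n}"] by (simp only: nn_integral_cmult)
  qed
  also have "\<dots> \<le> ennreal (n powr p) * (\<Sum>i<n. ennreal ((1 / ln 2) powr p * 2 powr (n - p)) * ?T)"
    by (intro mult_left_mono sum_mono corner_grad_power) auto
  also have "\<dots> = ennreal (n powr p * n * ((1 / ln 2) powr p * 2 powr (n - p))) * ?T"
    using n by (simp add: ennreal_mult ennreal_of_nat_eq_real_of_nat mult.assoc of_nat_diff)
  finally show ?thesis .
qed

lemma corner_fun_sobolev:
  "corner_fun \<in> fst (sobolev_W1 I n (Lnorm (cube I n) (ennreal p)))"
  "snd (sobolev_W1 I n (Lnorm (cube I n) (ennreal p))) corner_fun
    \<le> ennreal ((n * 2 powr (n - p)) powr (1 / p) + (n powr p * n * ((1 / ln 2) powr p * 2 powr (n - p))) powr (1 / p))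
      * epowr (\<integral>\<^sup>+s. ennreal (h s powr p * s powr (n - 1 - p)) * indicator {0<..<1} s \<partial>lborel) (1 / p)"
    (is "_ \<le> ennreal (?A powr _ + ?B powr _) * epowr ?T _")
proof -
  have p0: "0 < p" using p by simp
  have 1: "fnorm (Lnorm (cube I n) (ennreal p)) f \<le> ennreal (c powr (1 / p)) * epowr ?T (1 / p)"
    if "(\<integral>\<^sup>+x. epowr (ennreal \<bar>f x\<bar>) p \<partial>Q n) \<le> ennreal c * ?T" "0 \<le> c" for f c
  proof -
    have "fnorm (Lnorm (cube I n) (ennreal p)) f \<le> epowr (ennreal c * ?T) (1 / p)"
      unfolding fnorm_def Lnorm_cube[OF p0] using that(1) p0 by (intro epowr_mono) auto
    also have "\<dots> = ennreal (c powr (1 / p)) * epowr ?T (1 / p)" using p0 that(2) by (simp add: epowr_mult epowr_ennreal)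
    finally show ?thesis .
  qed
  have a: "fnorm (Lnorm (cube I n) (ennreal p)) corner_fun \<le> ennreal (?A powr (1 / p)) * epowr ?T (1 / p)"
    by (rule 1[OF corner_fun_power]) simp
  have b: "fnorm (Lnorm (cube I n) (ennreal p)) (grad_length I n corner_fun) \<le> ennreal (?B powr (1 / p)) * epowr ?T (1 / p)"
    by (rule 1[OF corner_grad_length_power]) simp
  have T: "epowr ?T (1 / p) < top" using fin by (simp add: epowr_less_top_iff)
  have fina: "fnorm (Lnorm (cube I n) (ennreal p)) corner_fun < top"
    by (rule le_less_trans[OF a]) (use T in \<open>simp add: ennreal_mult_less_top\<close>)
  have finb: "fnorm (Lnorm (cube I n) (ennreal p)) (grad_length I n corner_fun) < top"
    by (rule le_less_trans[OF b]) (use T in \<open>simp add: ennreal_mult_less_top\<close>)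
  have W: "is_weak_gradient I n corner_fun (weak_gradient I n corner_fun)"
    using corner_weak_gradient by (intro weak_gradient_is_weak_gradient) blast
  have mg: "grad_length I n corner_fun \<in> borel_measurable (cube I n)"
  proof -
    have "weak_gradient I n corner_fun i \<in> borel_measurable (cube I n)" if "i < n" for i
      using W that by (auto simp: is_weak_gradient_def locally_integrable_def)
    then have "(\<lambda>x. \<Sum>i<n. (weak_gradient I n corner_fun i x)\<^sup>2) \<in> borel_measurable (cube I n)"
      by (intro borel_measurable_sum borel_measurable_power) auto
    then show ?thesis unfolding grad_length_def by (rule measurable_compose) measurable
  qed
  show "corner_fun \<in> fst (sobolev_W1 I n (Lnorm (cube I n) (ennreal p)))"
    using fina finb mg corner_weak_gradient measurable_cube[OF measurable_corner_fun]
    by (auto simp: sobolev_W1_def fspace_of_def)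
  have "snd (sobolev_W1 I n (Lnorm (cube I n) (ennreal p))) corner_fun
      \<le> ennreal (?A powr (1 / p)) * epowr ?T (1 / p) + ennreal (?B powr (1 / p)) * epowr ?T (1 / p)"
    unfolding sobolev_W1_def using add_mono[OF a b] by simp
  also have "\<dots> = ennreal (?A powr (1 / p) + ?B powr (1 / p)) * epowr ?T (1 / p)"
    by (simp add: ennreal_plus distrib_right)
  finally show "snd (sobolev_W1 I n (Lnorm (cube I n) (ennreal p))) corner_fun \<le> \<dots>" .
qed

text \<open>Inserting a coordinate that does not exceed the largest one present leaves the maximum unchanged.\<close>

lemma corner_insert_coord:
  assumes k: "k < n" and t: "t - lo \<le> corner (n - 1) y"
  shows "corner n (insert_coord n k y t) = corner (n - 1) y"
proof -
  have n1: "0 < n" "0 < n - 1" using n by auto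
  have "corner n (insert_coord n k y t) \<le> c \<longleftrightarrow> corner (n - 1) y \<le> c" for c
  proof
    assume c: "corner (n - 1) y \<le> c"
    show "corner n (insert_coord n k y t) \<le> c"
      unfolding corner_le_iff[OF n1(1)]
    proof (intro allI impI)
      fix i assume i: "i < n"
      have y: "y j - lo \<le> c" if "j < n - 1" for j using c that unfolding corner_le_iff[OF n1(2)] by blast
      show "insert_coord n k y t i - lo \<le> c"
        using i k y[of i] y[of "i - 1"] t c by (auto simp: insert_coord_def)
    qed
  next
    assume c: "corner n (insert_coord n k y t) \<le> c"
    show "corner (n - 1) y \<le> c"
      unfolding corner_le_iff[OF n1(2)]
    proof (intro allI impI)
      fix j assume j: "j < n - 1"
      have z: "insert_coord n k y t i - lo \<le> c" if "i < n" for i using c that unfolding corner_le_iff[OF n1(1)] by blast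
      show "y j - lo \<le> c"
        using j z[of j] z[of "Suc j"] by (cases "j < k") (auto simp: insert_coord_def)
    qed
  qed
  then show ?thesis by (meson eq_iff)
qed

text \<open>On the line in direction \<open>k\<close> over \<open>y\<close>, the function is constant with value \<open>log_avg h \<rho> \<ge> h \<rho>\<close> on a segment of
  length \<open>\<rho> = corner (n - 1) y > 0\<close>, so its essential supremum is at least that value.\<close>

lemma profile_le_mixed_psi:
  assumes k: "k < n"
  shows "AE y in Q (n - 1). ennreal (h (corner (n - 1) y)) \<le> mixed_psi n Linf k corner_fun y"
proof -
  have eq: "AE x in Q n. corner_fun x = corner_fun x" by simp
  show ?thesis using mixed_psi_AE_eq[OF k measurable_corner_fun eq] AE_Q_interior[of "n - 1"] AE_space
  proof eventually_elim
    case (elim y)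
    define \<rho> where "\<rho> = corner (n - 1) y"
    have \<rho>: "0 < \<rho>" "\<rho> < 1"
    proof -
      have n1: "0 < n - 1" using n by simp
      have "y 0 - lo \<le> \<rho>" unfolding \<rho>_def by (rule corner_ge[OF n1])
      moreover have "lo < y 0" using elim(2) n1 by auto
      ultimately show "0 < \<rho>" by linarith
      have "y i - lo < 1" if "i < n - 1" for i
      proof -
        have "y i \<in> {lo<..<lo + 1}" using elim(2) that by blast
        then show ?thesis by simp
      qed
      then show "\<rho> < 1" unfolding \<rho>_def using corner_less_iff[OF n1, of y 1] by simp
    qed
    have "ennreal (log_avg h \<rho>) \<le> line_sup n k corner_fun y"
    proof (rule dense_le)
      fix s assume s: "s < ennreal (log_avg h \<rho>)"
      have ms: "{t \<in> space R. s < ennreal \<bar>corner_fun (insert_coord n k y t)\<bar>} \<in> sets R"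
      proof -
        have [measurable]: "(\<lambda>t. corner_fun (insert_coord n k y t)) \<in> borel_measurable R"
          by (rule measurable_compose[OF measurable_insert_section[OF k elim(3)] measurable_corner_fun])
        show ?thesis by measurable
      qed
      have "I \<inter> {..lo + \<rho>} \<subseteq> {t \<in> space R. s < ennreal \<bar>corner_fun (insert_coord n k y t)\<bar>}"
      proof
        fix t assume t: "t \<in> I \<inter> {..lo + \<rho>}"
        then have "corner n (insert_coord n k y t) = \<rho>" unfolding \<rho>_def by (intro corner_insert_coord[OF k]) (auto simp: \<rho>_def)
        then show "t \<in> {t \<in> space R. s < ennreal \<bar>corner_fun (insert_coord n k y t)\<bar>}"
          using t s avg_bounds(3)[OF \<rho>(1)] by (simp add: corner_fun_def)
      qed
      then have "emeasure R (I \<inter> {..lo + \<rho>}) \<le> emeasure R {t \<in> space R. s < ennreal \<bar>corner_fun (insert_coord n k y t)\<bar>}"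
        by (rule emeasure_mono[OF _ ms])
      then have "emeasure R {t \<in> space R. s < ennreal \<bar>corner_fun (insert_coord n k y t)\<bar>} \<noteq> 0"
        using emeasure_R_atMost[of \<rho>] \<rho> by auto
      then show "s \<le> line_sup n k corner_fun y"
        using less_line_sup_iff[OF k measurable_corner_fun elim(3), of s] by simp
    qed
    moreover have "ennreal (h \<rho>) \<le> ennreal (log_avg h \<rho>)" using avg_bounds(1)[OF \<rho>(1)] by (rule ennreal_leI)
    ultimately show ?case unfolding elim(1) \<rho>_def[symmetric] by (rule order_trans[rotated])
  qed
qed

end

end

section \<open>Optimality of the Lorentz norm\<close>

context prob_space begin

text \<open>Markov's inequality: an infinite value at \<open>t\<close> would force \<open>h > k\<close> on a set of measure at least \<open>t\<close> for every
  \<open>k\<close>.\<close>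

lemma rearrangement_less_top:
  assumes h [measurable]: "h \<in> borel_measurable M" and fin: "(\<integral>\<^sup>+x. h x \<partial>M) < top" and t: "0 < t"
  shows "rearrangement M h t < top"
proof (rule ccontr)
  assume "\<not> ?thesis"
  then have top: "rearrangement M h t = top" by (metis top.not_eq_extremum)
  define c where "c = enn2real (\<integral>\<^sup>+x. h x \<partial>M)"
  have c: "(\<integral>\<^sup>+x. h x \<partial>M) = ennreal c" "0 \<le> c" using fin by (simp_all add: c_def)
  define k where "k = (c + 1) / t"
  have k: "0 < k" "k * t = c + 1" using c(2) t by (auto simp: k_def)
  have "ennreal t \<le> distr_fun M h (ennreal k)"
    using less_rearrangement_iff[OF h, of "ennreal k" t] top by simp
  then have "ennreal k * ennreal t \<le> ennreal k * distr_fun M h (ennreal k)" by (intro mult_left_mono) auto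
  also have "\<dots> = (\<integral>\<^sup>+x. ennreal k * indicator {x \<in> space M. ennreal k < h x} x \<partial>M)"
    unfolding distr_fun_def by (rule nn_integral_cmult_indicator[symmetric]) measurable
  also have "\<dots> \<le> (\<integral>\<^sup>+x. h x \<partial>M)"
    by (rule nn_integral_mono) (auto simp: indicator_def)
  finally have "ennreal (c + 1) \<le> ennreal c" using k t c by (simp add: ennreal_mult[symmetric])
  then show False using c by simp
qed

text \<open>The substitution \<open>t = s\<^bsup>n-1\<^esup>\<close>, with \<open>(n - 1) e = n - p\<close>; the factor \<open>n - 1\<close> of the Jacobian is dropped.\<close>

lemma power_substitution_lorentz_int:
  fixes n :: nat and p :: real
  assumes f [measurable]: "f \<in> borel_measurable M" and n: "2 \<le> n" and p: "1 \<le> p" "p < n"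
    and fin: "\<And>t. 0 < t \<Longrightarrow> rearrangement M f t < top"
  shows "(\<integral>\<^sup>+s. ennreal (enn2real (rearrangement M f (s ^ (n - 1))) powr p * s powr (n - 1 - p)) * indicator {0<..<1} s \<partial>lborel)
    \<le> lorentz_int M ((real n - p) / real (n - 1)) p f"
proof -
  define e where "e = (real n - p) / real (n - 1)"
  define m where "m = n - 1"
  have m: "0 < m" "real m = n - 1" using n by (auto simp: m_def of_nat_diff)
  have me: "m * e = n - p" using m n unfolding e_def m_def[symmetric] by (simp add: of_nat_diff)
  define F where "F = (\<lambda>t. t powr (e - 1) * enn2real (rearrangement M f t) powr p)"
  have [measurable]: "F \<in> borel_measurable borel" unfolding F_def by measurable
  have "(\<integral>\<^sup>+s. ennreal (enn2real (rearrangement M f (s ^ m)) powr p * s powr (n - 1 - p)) * indicator {0<..<1} s \<partial>lborel)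
      \<le> (\<integral>\<^sup>+s. ennreal (F (s ^ m) * (m * s ^ (m - 1)) * indicator {0..1} s) \<partial>lborel)"
  proof (rule nn_integral_mono)
    fix s :: real
    show "ennreal (enn2real (rearrangement M f (s ^ m)) powr p * s powr (n - 1 - p)) * indicator {0<..<1} s
        \<le> ennreal (F (s ^ m) * (m * s ^ (m - 1)) * indicator {0..1} s)"
    proof (cases "s \<in> {0<..<1}")
      case True
      then have s: "0 < s" "s < 1" by auto
      have "(s ^ m) powr (e - 1) * s ^ (m - 1) = s powr (m * (e - 1)) * s powr (real (m - 1))"
        using s by (simp add: powr_realpow[symmetric] powr_powr)
      also have "\<dots> = s powr (m * (e - 1) + real (m - 1))" by (simp add: powr_add)
      also have "m * (e - 1) + real (m - 1) = n - 1 - p"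
        using me m by (simp add: of_nat_diff algebra_simps Suc_leI)
      finally have pw: "(s ^ m) powr (e - 1) * s ^ (m - 1) = s powr (n - 1 - p)" .
      let ?y = "enn2real (rearrangement M f (s ^ m)) powr p"
      have "1 * (?y * s powr (n - 1 - p)) \<le> m * (?y * s powr (n - 1 - p))"
        using m(1) by (intro mult_right_mono) auto
      then have "?y * s powr (n - 1 - p) \<le> m * (?y * s powr (n - 1 - p))" by simp
      also have "\<dots> = F (s ^ m) * (m * s ^ (m - 1))" unfolding F_def pw[symmetric] by (simp only: mult_ac)
      finally show ?thesis using True by (simp add: ennreal_leI)
    qed simp
  qed
  also have "\<dots> = (\<integral>\<^sup>+t. ennreal (F t * indicator {0 ^ m..1 ^ m} t) \<partial>lborel)"
  proof (rule nn_integral_substitution[symmetric])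
    show "set_borel_measurable borel {0 ^ m..1 ^ m} F" unfolding set_borel_measurable_def by measurable
    show "((\<lambda>s. s ^ m) has_real_derivative real m * x ^ (m - 1)) (at x)" for x :: real
      by (auto intro!: derivative_eq_intros)
  qed (auto intro!: continuous_intros)
  also have "\<dots> = (\<integral>\<^sup>+t. ennreal (t powr (e - 1)) * epowr (rearrangement M f t) p * indicator {0<..<1} t \<partial>lborel)"
  proof (rule nn_integral_cong_AE)
    show "AE t in lborel. ennreal (F t * indicator {0 ^ m..1 ^ m} t)
        = ennreal (t powr (e - 1)) * epowr (rearrangement M f t) p * indicator {0<..<1} t"
      using AE_lborel_singleton[of 0] AE_lborel_singleton[of 1]
    proof eventually_elim
      case (elim t)
      have I: "0 ^ m = (0::real)" using m(1) by (simp add: zero_power)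
      show ?case
      proof (cases "t \<in> {0<..<1}")
        case True
        then have "rearrangement M f t = ennreal (enn2real (rearrangement M f t))" using fin[of t] by simp
        then have "epowr (rearrangement M f t) p = ennreal (enn2real (rearrangement M f t) powr p)"
          by (metis epowr_ennreal enn2real_nonneg)
        then show ?thesis using True by (simp add: F_def ennreal_mult I)
      next
        case False
        then have "t \<notin> {0..1}" using elim by auto
        then show ?thesis using False by (simp add: I)
      qed
    qed
  qed
  also have "\<dots> = lorentz_int M e p f" by (simp only: lorentz_int_def nn_integral_U)
  finally show ?thesis unfolding e_def m_def .
qed

end

context unit_interval begin

text \<open>The sublevel set of \<open>corner m\<close> at height \<open>\<rho>\<close> has measure \<open>\<rho>\<^sup>m\<close>, so the \<open>m\<close>-th power of \<open>corner m\<close> is uniformly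
  distributed on \<open>(0,1)\<close>. Composing it with \<open>f\<^sup>*\<close> gives a function equimeasurable with \<open>f\<close>.\<close>

lemma distr_fun_corner:
  assumes m: "0 < m" and f: "f \<in> borel_measurable (cube I m)"
    and h: "h \<in> borel_measurable borel" "\<And>s. 0 < s \<Longrightarrow> ennreal (h s) = rearrangement (cube I m) f (s ^ m)"
  shows "distr_fun (cube I m) (\<lambda>y. ennreal (h (corner m y))) = distr_fun (cube I m) f"
proof
  fix s
  interpret C: prob_space "cube I m" by (rule prob_cube)
  define c where "c = enn2real (distr_fun (cube I m) f s)"
  have c: "distr_fun (cube I m) f s = ennreal c" "0 \<le> c" "c \<le> 1"
  proof -
    have le: "distr_fun (cube I m) f s \<le> 1" by (rule C.distr_fun_le_1)
    then have "distr_fun (cube I m) f s < top" by (rule le_less_trans) simp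
    then show eq: "distr_fun (cube I m) f s = ennreal c" by (simp add: c_def)
    show "0 \<le> c" by (simp add: c_def)
    show "c \<le> 1" using le unfolding eq by (simp add: ennreal_le_1)
  qed
  define q where "q = root m c"
  have q: "0 \<le> q" "q \<le> 1" "q ^ m = c" using c m by (auto simp: q_def)
  have mQ: "{y \<in> space (Q m). corner m y < q} \<in> sets (Q m)"
    using measurable_corner[OF m] by measurable
  have corner_pos: "AE y in Q m. 0 < corner m y"
    using AE_Q_interior[of m]
  proof eventually_elim
    case (elim y)
    have "lo < y 0" using elim m by auto
    then show ?case using corner_ge[OF m, of y] by simp
  qed
  have "distr_fun (cube I m) (\<lambda>y. ennreal (h (corner m y))) s
      = emeasure (cube I m) {y \<in> space (Q m). corner m y < q}"
    unfolding distr_fun_def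
  proof (rule emeasure_eq_AE)
    show "AE y in cube I m. (y \<in> {y \<in> space (cube I m). s < ennreal (h (corner m y))})
        = (y \<in> {y \<in> space (Q m). corner m y < q})"
      unfolding AE_cube using corner_pos AE_space
    proof eventually_elim
      case (elim y)
      have "s < ennreal (h (corner m y)) \<longleftrightarrow> s < rearrangement (cube I m) f (corner m y ^ m)"
        using h(2)[OF elim(1)] by simp
      also have "\<dots> \<longleftrightarrow> ennreal (corner m y ^ m) < ennreal c"
        using C.less_rearrangement_iff[OF f, of s "corner m y ^ m"] c(1) by simp
      also have "\<dots> \<longleftrightarrow> corner m y ^ m < c" using elim(1) by (intro ennreal_less_iff) simp
      also have "\<dots> \<longleftrightarrow> root m (corner m y ^ m) < q" unfolding q_def using m by simp
      also have "root m (corner m y ^ m) = corner m y" using m elim(1) by (simp add: real_root_power_cancel)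
      finally show ?case using elim(2) by (simp add: cube_def)
    qed
    have [measurable]: "corner m \<in> borel_measurable (cube I m)" by (rule measurable_cube[OF measurable_corner[OF m]])
    note [measurable] = h(1)
    show "{y \<in> space (cube I m). s < ennreal (h (corner m y))} \<in> sets (cube I m)" by measurable
    show "{y \<in> space (Q m). corner m y < q} \<in> sets (cube I m)" using mQ by (simp add: cube_def)
  qed
  also have "\<dots> = emeasure (Q m) {y \<in> space (Q m). corner m y < q}"
    using mQ by (simp add: cube_def)
  also have "\<dots> = ennreal c" using emeasure_corner_less[OF m q(1,2)] q(3) by simp
  finally show "distr_fun (cube I m) (\<lambda>y. ennreal (h (corner m y))) s = distr_fun (cube I m) f s"
    using c(1) by simp
qed

definition corner_const :: "nat \<Rightarrow> real \<Rightarrow> real" where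
  "corner_const n p = (n * 2 powr (n - p)) powr (1 / p) + (n powr p * n * ((1 / ln 2) powr p * 2 powr (n - p))) powr (1 / p)"

text \<open>Test the assumed embedding on the corner function whose profile is the rearrangement of \<open>f\<close>. Its
  Sobolev norm is bounded by the Lorentz norm of \<open>f\<close>, while \<open>\<psi>\<^sub>0\<close> of it dominates a function
  equimeasurable with \<open>f\<close>, so that rearrangement invariance bounds \<open>X f\<close>.\<close>

lemma ri_norm_le_lorentz:
  fixes n :: nat and p :: real
  assumes n: "2 \<le> n" and p: "1 \<le> p" "p < n" and X: "ri_norm (cube I (n - 1)) X"
    and emb: "\<And>u. u \<in> fst (sobolev_W1 I n (Lnorm (cube I n) (ennreal p))) \<Longrightarrow>
      snd (mixed_space I n X Linf) u \<le> ennreal C * snd (sobolev_W1 I n (Lnorm (cube I n) (ennreal p))) u"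
    and f: "f \<in> borel_measurable (cube I (n - 1))"
    and fin: "lorentz_int (cube I (n - 1)) (crit n p) p f < top"
  shows "X f \<le> ennreal C * (ennreal (corner_const n p) * epowr (lorentz_int (cube I (n - 1)) (crit n p) p f) (1 / p))"
proof -
  let ?M = "cube I (n - 1)" let ?L = "lorentz_int (cube I (n - 1)) (crit n p) p f"
  let ?W = "sobolev_W1 I n (Lnorm (cube I n) (ennreal p))"
  interpret C: prob_space ?M by (rule prob_cube)
  have e: "crit n p \<le> 1" and m: "0 < n - 1" and p0: "0 < p" using n p by (auto simp: crit_def of_nat_diff)
  have "(\<integral>\<^sup>+y. f y \<partial>?M) \<le> ennreal 2 * epowr ?L (1 / p)"
    by (rule C.nn_integral_le_lorentz[OF f e p(1)])
  also have "\<dots> < top" using fin by (simp add: ennreal_mult_less_top epowr_less_top_iff)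
  finally have int: "(\<integral>\<^sup>+y. f y \<partial>?M) < top" .
  have rfin: "rearrangement ?M f t < top" if "0 < t" for t
    by (rule C.rearrangement_less_top[OF f int that])
  define h where "h = (\<lambda>s. enn2real (rearrangement ?M f (s ^ (n - 1))))"
  have h_nonneg: "0 \<le> h s" for s by (simp add: h_def)
  have h_antimono: "h t \<le> h s" if st: "0 < s" "s \<le> t" for s t
    unfolding h_def using st by (intro enn2real_mono C.rearrangement_antimono power_mono rfin) auto
  have h_meas: "h \<in> borel_measurable borel"
    unfolding h_def using C.measurable_rearrangement[OF f] by measurable
  have h_eq: "ennreal (h s) = rearrangement ?M f (s ^ (n - 1))" if "0 < s" for s
    using rfin[of "s ^ (n - 1)"] that by (simp add: h_def)
  let ?T = "\<integral>\<^sup>+s. ennreal (h s powr p * s powr (n - 1 - p)) * indicator {0<..<1} s \<partial>lborel"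
  have T: "?T \<le> ?L" unfolding h_def crit_def by (rule C.power_substitution_lorentz_int[OF f n p rfin])
  then have T_fin: "?T < top" using fin by (rule le_less_trans)
  note ctx = n p h_nonneg h_antimono h_meas T_fin
  let ?u = "corner_fun n h"
  have u_meas: "?u \<in> borel_measurable (cube I n)"
    by (rule measurable_cube[OF measurable_corner_fun]) (use ctx in auto)
  have u_W: "?u \<in> fst ?W" by (rule corner_fun_sobolev) (use ctx in auto)
  have u_norm: "snd ?W ?u \<le> ennreal (corner_const n p) * epowr ?T (1 / p)"
    unfolding corner_const_def by (rule corner_fun_sobolev) (use ctx in auto)
  have u_psi: "AE y in ?M. ennreal (h (corner (n - 1) y)) \<le> mixed_psi n Linf 0 ?u y"
    unfolding AE_cube by (rule profile_le_mixed_psi) (use ctx in auto)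
  have bfn: "banach_function_norm ?M X" using X by (simp add: ri_norm_def)
  have X_mono: "X g \<le> X g'" if "g \<in> borel_measurable ?M" "g' \<in> borel_measurable ?M" "AE y in ?M. g y \<le> g' y" for g g'
    using bfn that unfolding banach_function_norm_def by blast
  \<comment> \<open>Rearrangement invariance is formulated for real functions; \<open>f\<close> is finite almost everywhere.\<close>
  define fr where "fr = (\<lambda>y. enn2real (f y))"
  define hr where "hr = (\<lambda>y. h (corner (n - 1) y))"
  have fr_meas: "fr \<in> borel_measurable ?M" unfolding fr_def using f by measurable
  have hr_meas: "hr \<in> borel_measurable ?M" unfolding hr_def
    by (rule measurable_compose[OF measurable_cube[OF measurable_corner[OF m]] h_meas])
  have fr_eq: "AE y in ?M. ennreal \<bar>fr y\<bar> = f y"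
    using nn_integral_PInf_AE[OF f] int by (auto simp: fr_def less_top elim: eventually_mono)
  have "distr_fun ?M (\<lambda>y. ennreal \<bar>fr y\<bar>) = distr_fun ?M f"
  proof
    fix s
    show "distr_fun ?M (\<lambda>y. ennreal \<bar>fr y\<bar>) s = distr_fun ?M f s"
      unfolding distr_fun_def
    proof (rule emeasure_eq_AE)
      show "AE y in ?M. (y \<in> {y \<in> space ?M. s < ennreal \<bar>fr y\<bar>}) = (y \<in> {y \<in> space ?M. s < f y})"
        using fr_eq by eventually_elim simp
    qed (use f fr_meas in measurable)
  qed
  also have "\<dots> = distr_fun ?M (\<lambda>y. ennreal (h (corner (n - 1) y)))"
    by (rule distr_fun_corner[OF m f h_meas h_eq, symmetric])
  also have "\<dots> = distr_fun ?M (\<lambda>y. ennreal \<bar>hr y\<bar>)" using h_nonneg by (simp add: hr_def)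
  finally have same: "fnorm X fr = fnorm X hr"
    using X fr_meas hr_meas unfolding ri_norm_def by blast
  have "X f \<le> fnorm X fr"
    unfolding fnorm_def
  proof (rule X_mono[OF f])
    show "(\<lambda>y. ennreal \<bar>fr y\<bar>) \<in> borel_measurable ?M" using fr_meas by measurable
    show "AE y in ?M. f y \<le> ennreal \<bar>fr y\<bar>" using fr_eq by eventually_elim simp
  qed
  also have "\<dots> = fnorm X hr" by (rule same)
  also have "\<dots> \<le> X (mixed_psi n Linf 0 ?u)"
    unfolding fnorm_def
  proof (rule X_mono)
    show "(\<lambda>y. ennreal \<bar>hr y\<bar>) \<in> borel_measurable ?M" using hr_meas by measurable
    show "mixed_psi n Linf 0 ?u \<in> borel_measurable ?M" by (rule measurable_mixed_psi[OF _ u_meas]) (use n in simp)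
    show "AE y in ?M. ennreal \<bar>hr y\<bar> \<le> mixed_psi n Linf 0 ?u y"
      using u_psi by eventually_elim (simp add: hr_def h_nonneg)
  qed
  also have "\<dots> \<le> (\<Sum>k<n. X (mixed_psi n Linf k ?u))"
    using n by (intro member_le_sum) auto
  also have "\<dots> = snd (mixed_space I n X Linf) ?u" by (simp add: mixed_space_def mixed_space_k_def)
  also have "\<dots> \<le> ennreal C * snd ?W ?u" by (rule emb[OF u_W])
  also have "\<dots> \<le> ennreal C * (ennreal (corner_const n p) * epowr ?T (1 / p))"
    by (intro mult_left_mono u_norm) simp
  also have "\<dots> \<le> ennreal C * (ennreal (corner_const n p) * epowr ?L (1 / p))"
    using T p0 by (intro mult_left_mono epowr_mono) auto
  finally show ?thesis .
qed

text \<open>The preceding bound \<open>X f \<le> K \<parallel>f\<parallel>\<close> with the Lorentz norm on the right, for all \<open>f\<close> on \<open>I\<^bsup>n-1\<^esup>\<close>, is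
  applied to each \<open>\<psi>\<^sub>k(f, L\<^sup>\<infinity>)\<close>.\<close>

lemma lorentz_optimal:
  fixes n :: nat and p :: real
  assumes n: "2 \<le> n" and p: "1 \<le> p" "p < n" and X: "ri_norm (cube I (n - 1)) X"
    and emb: "sobolev_W1 I n (Lnorm (cube I n) (ennreal p)) \<hookrightarrow> mixed_space I n X Linf"
  shows "mixed_space I n (lorentz_norm (cube I (n - 1)) (ennreal (p * (real n - 1) / (real n - p))) (ennreal p)) Linf
    \<hookrightarrow> mixed_space I n X Linf"
proof -
  let ?L = "lorentz_norm (cube I (n - 1)) (ennreal (p * (real n - 1) / (real n - p))) (ennreal p)"
  let ?N = "\<lambda>f. epowr (lorentz_int (cube I (n - 1)) (crit n p) p f) (1 / p)"
  have L: "?L f = ?N f" for f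
    using lorentz_norm_eq[OF lorentz_exponent(3)[OF n p] p(1)] lorentz_exponent(1)[OF n p] by simp
  obtain C where C: "0 \<le> C" and CW: "\<And>u. u \<in> fst (sobolev_W1 I n (Lnorm (cube I n) (ennreal p))) \<Longrightarrow>
      snd (mixed_space I n X Linf) u \<le> ennreal C * snd (sobolev_W1 I n (Lnorm (cube I n) (ennreal p))) u"
    using emb unfolding embeds_def by blast
  define K where "K = C * corner_const n p"
  have K0: "0 \<le> corner_const n p" by (simp add: corner_const_def)
  have bound: "X f \<le> ennreal K * ?L f" if "f \<in> borel_measurable (cube I (n - 1))" "?L f < top" for f
  proof -
    have "lorentz_int (cube I (n - 1)) (crit n p) p f < top" using that(2) by (simp only: L epowr_less_top_iff)
    from ri_norm_le_lorentz[OF n p X CW that(1) this] show ?thesis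
      using C K0 by (simp only: L K_def ennreal_mult mult.assoc)
  qed
  have psi: "X (mixed_psi n Linf k f) \<le> ennreal K * ?L (mixed_psi n Linf k f)" "X (mixed_psi n Linf k f) < top"
    if f: "f \<in> fst (mixed_space I n ?L Linf)" and k: "k < n" for f k
  proof -
    have "f \<in> fst (mixed_space_k I n ?L Linf k)" using f k by (simp add: mixed_space_def)
    then have fm: "f \<in> borel_measurable (cube I n)" and fin: "?L (mixed_psi n Linf k f) < top"
      by (simp_all add: mixed_space_k_def)
    show b: "X (mixed_psi n Linf k f) \<le> ennreal K * ?L (mixed_psi n Linf k f)"
      by (rule bound[OF measurable_mixed_psi[OF k fm] fin])
    show "X (mixed_psi n Linf k f) < top"
      by (rule le_less_trans[OF b]) (use fin in \<open>simp add: ennreal_mult_less_top\<close>)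
  qed
  show ?thesis unfolding embeds_def
  proof (intro conjI exI[of _ K] ballI subsetI)
    show "0 \<le> K" using C K0 by (simp add: K_def)
  next
    fix f assume f: "f \<in> fst (mixed_space I n ?L Linf)"
    have "f \<in> fst (mixed_space_k I n X Linf k)" if k: "k < n" for k
    proof -
      have "f \<in> fst (mixed_space_k I n ?L Linf k)" using f k by (simp add: mixed_space_def)
      then show ?thesis using psi(2)[OF f k] by (simp add: mixed_space_k_def)
    qed
    then show "f \<in> fst (mixed_space I n X Linf)" by (simp add: mixed_space_def)
  next
    fix f assume f: "f \<in> fst (mixed_space I n ?L Linf)"
    have "(\<Sum>k<n. X (mixed_psi n Linf k f)) \<le> (\<Sum>k<n. ennreal K * ?L (mixed_psi n Linf k f))"
      using psi(1)[OF f] by (intro sum_mono) simp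
    then show "snd (mixed_space I n X Linf) f \<le> ennreal K * snd (mixed_space I n ?L Linf) f"
      by (simp add: mixed_space_def mixed_space_k_def sum_distrib_left)
  qed
qed

end

theorem corollary4p5:
  fixes n :: nat and I :: "real set" and p :: real
  assumes "n \<ge> 2"
    and "is_interval I" and "emeasure lborel I = 1"
    and "1 \<le> p" and "p < real n"
  shows
    "let W = sobolev_W1 I n (Lnorm (cube I n) (ennreal p));
         Linf = Lnorm (lebesgue_on I) \<infinity>;
         L = lorentz_norm (cube I (n - 1)) (ennreal (p * (real n - 1) / (real n - p))) (ennreal p)
     in ri_norm (cube I (n - 1)) L \<and>
        W \<hookrightarrow> mixed_space I n L Linf \<and>
        (\<forall>X. ri_norm (cube I (n - 1)) X \<longrightarrow> W \<hookrightarrow> mixed_space I n X Linf \<longrightarrow>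
             mixed_space I n L Linf \<hookrightarrow> mixed_space I n X Linf)"
proof -
  interpret unit_interval I by unfold_locales (use assms in auto)
  note np = assms(1,4,5)
  show ?thesis unfolding Let_def
  proof (intro conjI allI impI)
    show "ri_norm (cube I (n - 1)) (lorentz_norm (cube I (n - 1)) (ennreal (p * (real n - 1) / (real n - p))) (ennreal p))"
      by (rule prob_space.ri_norm_lorentz[OF prob_cube assms(4) lorentz_exponent(2)[OF np]])
    show "sobolev_W1 I n (Lnorm (cube I n) (ennreal p)) \<hookrightarrow>
        mixed_space I n (lorentz_norm (cube I (n - 1)) (ennreal (p * (real n - 1) / (real n - p))) (ennreal p)) Linf"
      by (rule sobolev_embedding[OF np])
    fix X
    assume "ri_norm (cube I (n - 1)) X" "sobolev_W1 I n (Lnorm (cube I n) (ennreal p)) \<hookrightarrow> mixed_space I n X Linf"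
    then show "mixed_space I n (lorentz_norm (cube I (n - 1)) (ennreal (p * (real n - 1) / (real n - p))) (ennreal p)) Linf
        \<hookrightarrow> mixed_space I n X Linf"
      by (rule lorentz_optimal[OF np])
  qed
qed

end
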